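(* Let $p$ be an odd prime and let $G$ be any group of order $p^5$ belonging to one of the isoclinism families $\Phi_1,\Phi_2,\Phi_3,\Phi_4,\Phi_8,\Phi_9$ (in the numbering of James). Let $p^e$ be the exponent of $G$. Let $K$ be a field such that either (i) $\operatorname{char} K=p>0$, or (ii) $\operatorname{char} K\ne p$ and $K$ contains a primitive $p^e$-th root of unity. Then $K(G)$ is rational over $K$.
   Context: For a field $K$ and a finite group $G$, let $G$ act on the rational function field $K(x(g):g\in G)$ (in $|G|$ independent variables indexed by $G$) by $K$-automorphisms defined by $g\cdot x(h)=x(gh)$ for all $g,h\in G$. $K(G)$ denotes the fixed field $K(x(g):g\in G)^G$. A field extension of $K$ is called rational over $K$ if it is purely transcendental over $K$. Isoclinism: two groups $G_1,G_2$ are isoclinic if there are isomorphisms $\theta:G_1/Z(G_1)\to G_2/Z(G_2)$ and $\phi:[G_1,G_1]\to[G_2,G_2]$ such that $\phi([g,h])=[g',h']$ whenever $g,h\in G_1$, $g',h'\in G_2$ satisfy $\theta(gZ(G_1))=g'Z(G_2)$ and $\theta(hZ(G_1))=h'Z(G_2)$. An isoclinism family is an equivalence class for this relation. James (The groups of order $p^6$, Math. Comp. 34 (1980)) numbers the families; the relevant ones are the classes of the following groups. In the presentations, $[a,b]=a^{-1}b^{-1}ab$, and all commutators between generators that are not listed are trivial. The symbol $\alpha_i^{(p)}$ denotes $\alpha_i^{p}\alpha_{i+1}^{\binom p2}\cdots\alpha_{i+k-1}^{\binom pk}\cdots\alpha_{i+p-1}$, where generators $\alpha_m$ with index $m$ beyond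 those in the presentation are read as $1$. $\Phi_1$: the abelian groups. $\Phi_2$: the groups isoclinic to $\langle \alpha,\alpha_1,\alpha_2 : [\alpha_1,\alpha]=\alpha_2,\ \alpha^p=\alpha_1^p=\alpha_2^p=1\rangle$ (order $p^3$). $\Phi_3$: the groups isoclinic to $\langle \alpha,\alpha_1,\alpha_2,\alpha_3 : [\alpha_1,\alpha]=\alpha_2,\ [\alpha_2,\alpha]=\alpha_3,\ \alpha^p=\alpha_1^{(p)}=\alpha_2^p=\alpha_3^p=1\rangle$ (order $p^4$). $\Phi_4$: the groups isoclinic to $\langle \alpha,\alpha_1,\alpha_2,\beta_1,\beta_2 : [\alpha_i,\alpha]=\beta_i,\ \alpha^p=\alpha_i^p=\beta_i^p=1\ (i=1,2)\rangle$ (order $p^5$). $\Phi_8$: the groups isoclinic to $\langle \alpha_1,\alpha_2,\beta : [\alpha_1,\alpha_2]=\beta=\alpha_1^p,\ \beta^{p^2}=\alpha_2^{p^2}=1\rangle$ (order $p^5$). $\Phi_9$: the groups isoclinic to $\langle \alpha,\alpha_1,\alpha_2,\alpha_3,\alpha_4 : [\alpha_i,\alpha]=\alpha_{i+1}\ (i=1,2,3),\ \alpha^p=\alpha_1^{(p)}=\alpha_2^{(p)}=\alpha_3^{(p)}=\alpha_4^{(p)}=1\rangle$ (order $p^5$).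
   Formalization: In the presentation for Φ_8 the convention that unlisted commutators are trivial is not applied to β=α_1^p: imposing [α_2,β]=1 would force β^p=1 and give order p^4 instead of the stated p^5 (a group in Φ_2, which is covered anyway). *)

theory Defs
  imports
    "HOL-Algebra.Algebra"
    "HOL-Algebra.Algebraic_Closure_Type"
    "HOL-Computational_Algebra.Primes"
    "HOL-Computational_Algebra.Fraction_Field"
    "HOL-Library.Poly_Mapping"
begin

section \<open>Rational function fields\<close>

text \<open>
  Variables are indexed by an arbitrary type. The wrapper type carries some linear order, whose
  only purpose is to activate the library's \<open>idom\<close> instance for polynomials.
\<close>

datatype 'v var = Var 'v

instantiation var :: (type) linorder
begin

definition less_eq_var :: "'a var \<Rightarrow> 'a var \<Rightarrow> bool" where
  "(x :: 'a var) \<le> y \<longleftrightarrow> (x, y) \<in> (SOME r. well_order_on UNIV r)"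

definition less_var :: "'a var \<Rightarrow> 'a var \<Rightarrow> bool" where
  "x < y \<longleftrightarrow> x \<le> y \<and> \<not> y \<le> (x :: 'a var)"

instance
proof -
  define r where "r = (SOME r. well_order_on (UNIV :: 'a var set) r)"
  have "well_order_on UNIV r"
    unfolding r_def by (rule someI_ex) (rule well_order_on)
  then have *: "refl r" "trans r" "antisym r" "total r"
    by (simp_all add: order_on_defs)
  have le: "x \<le> y \<longleftrightarrow> (x, y) \<in> r" for x y :: "'a var"
    by (simp add: less_eq_var_def r_def)
  show "OFCLASS('a var, linorder_class)"
  proof
    fix x y z :: "'a var"
    show "x < y \<longleftrightarrow> x \<le> y \<and> \<not> y \<le> x" by (rule less_var_def)
    show "x \<le> x" using *(1) by (auto simp: le refl_on_def)
    show "x \<le> y \<Longrightarrow> y \<le> z \<Longrightarrow> x \<le> z" using *(2) unfolding le by (rule transD)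
    show "x \<le> y \<Longrightarrow> y \<le> x \<Longrightarrow> x = y" using *(3) unfolding le by (rule antisymD)
    show "x \<le> y \<or> y \<le> x" using *(1,4) unfolding le refl_on_def total_on_def by (cases "x = y") auto
  qed
qed

end

type_synonym 'v monom = "'v \<Rightarrow>\<^sub>0 nat"
type_synonym ('v, 'k) mpoly = "'v monom \<Rightarrow>\<^sub>0 'k"
type_synonym ('v, 'k) ratfun = "('v var, 'k) mpoly fract"

definition ratfun_const :: "'k::field \<Rightarrow> ('v, 'k) ratfun" where
  "ratfun_const c = Fract (Poly_Mapping.single 0 c) 1"

definition ratfun_var :: "'v \<Rightarrow> ('v, 'k::field) ratfun" where
  "ratfun_var v = Fract (Poly_Mapping.single (Poly_Mapping.single (Var v) 1) 1) 1"

text \<open>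
  For a bijection \<open>\<pi>\<close> the monomial \<open>m \<circ> \<pi>\<inverse>\<close> arises from \<open>m\<close> by replacing every variable \<open>v\<close>
  by \<open>\<pi> v\<close>; hence the coefficient of \<open>m\<close> in the substituted polynomial is the coefficient of
  \<open>m \<circ> \<pi>\<close> in the original one.
\<close>

definition permute_mpoly :: "('v \<Rightarrow> 'v) \<Rightarrow> ('v, 'k::zero) mpoly \<Rightarrow> ('v, 'k) mpoly" where
  "permute_mpoly \<pi> P = Poly_Mapping.map_key (Poly_Mapping.map_key \<pi>) P"

context
  fixes \<pi> :: "'v \<Rightarrow> 'v"
  assumes bij: "bij \<pi>"
begin

lemma map_key_perm_inverse:
  "Poly_Mapping.map_key \<pi> (Poly_Mapping.map_key (inv_into UNIV \<pi>) m) = (m :: 'v \<Rightarrow>\<^sub>0 'n::zero)"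
  "Poly_Mapping.map_key (inv_into UNIV \<pi>) (Poly_Mapping.map_key \<pi> m) = (m :: 'v \<Rightarrow>\<^sub>0 'n::zero)"
  using bij
  by (auto intro!: poly_mapping_eqI
      simp: map_key.rep_eq bij_is_inj bij_imp_bij_inv inv_f_f surj_f_inv_f bij_is_surj)

lemma bij_map_key_perm: "bij (Poly_Mapping.map_key \<pi> :: ('v \<Rightarrow>\<^sub>0 'n::zero) \<Rightarrow> _)"
  by (rule o_bij[of "Poly_Mapping.map_key (inv_into UNIV \<pi>)"]) (auto simp: map_key_perm_inverse)

lemma lookup_permute_mpoly:
  "Poly_Mapping.lookup (permute_mpoly \<pi> P) m = Poly_Mapping.lookup P (Poly_Mapping.map_key \<pi> m)"
  unfolding permute_mpoly_def
  by (simp add: map_key.rep_eq[OF bij_is_inj[OF bij_map_key_perm]])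

lemma permute_mpoly_0 [simp]: "permute_mpoly \<pi> 0 = 0"
  by (rule poly_mapping_eqI) (simp add: lookup_permute_mpoly)

lemma permute_mpoly_eq_0_iff [simp]: "permute_mpoly \<pi> P = 0 \<longleftrightarrow> P = 0"
  by (metis (no_types, lifting) lookup_permute_mpoly lookup_zero map_key_perm_inverse(1)
      poly_mapping_eqI)

lemma permute_mpoly_add: "permute_mpoly \<pi> (P + Q) = permute_mpoly \<pi> P + permute_mpoly \<pi> Q"
  for P Q :: "('v, 'k::comm_monoid_add) mpoly"
  by (rule poly_mapping_eqI) (simp add: lookup_permute_mpoly lookup_add)

lemma permute_mpoly_single:
  "permute_mpoly \<pi> (Poly_Mapping.single m c) =
     Poly_Mapping.single (Poly_Mapping.map_key (inv_into UNIV \<pi>) m) c"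
  by (rule poly_mapping_eqI)
    (auto simp: lookup_permute_mpoly lookup_single when_def map_key_perm_inverse)

lemma permute_mpoly_one [simp]: "permute_mpoly \<pi> 1 = (1 :: ('v, 'k::zero_neq_one) mpoly)"
  using permute_mpoly_single[of 0 "1 :: 'k"] bij
  by (simp add: bij_is_inj bij_imp_bij_inv del: single_one flip: single_one)

lemma permute_mpoly_mult: "permute_mpoly \<pi> (P * Q) = permute_mpoly \<pi> P * permute_mpoly \<pi> Q"
  for P Q :: "('v, 'k::comm_semiring_0) mpoly"
proof -
  have upd: "Poly_Mapping.update m c P = P + Poly_Mapping.single m c" if "m \<notin> Poly_Mapping.keys P"
    for m c and P :: "('v, 'k) mpoly"
    using that by (intro poly_mapping_eqI)
      (auto simp: lookup_update lookup_add lookup_single when_def in_keys_iff)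
  have single: "permute_mpoly \<pi> (Poly_Mapping.single m c * Q) =
      permute_mpoly \<pi> (Poly_Mapping.single m c) * permute_mpoly \<pi> Q"
    for m :: "'v monom" and c and Q :: "('v, 'k) mpoly"
  proof (induction Q rule: update_induct)
    case const
    then show ?case by simp
  next
    case (update Q m' c')
    then show ?case
      using bij by (simp add: upd permute_mpoly_add permute_mpoly_single mult_single
          distrib_left map_key_plus bij_is_inj bij_imp_bij_inv)
  qed
  show ?thesis
    by (induction P rule: update_induct)
      (simp_all add: upd permute_mpoly_add distrib_right single)
qed

end

lemma bij_map_var [simp]: "bij \<pi> \<Longrightarrow> bij (map_var \<pi>)"
  by (rule o_bij[of "map_var (inv_into UNIV \<pi>)"])
    (auto simp: fun_eq_iff var.map_comp o_def bij_is_inj bij_is_surj surj_f_inv_f var.map_ident)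

text \<open>Meaningful for multiplicative \<open>\<sigma>\<close> with trivial kernel; see the lemma below.\<close>

definition map_fract_hom :: "('r::idom \<Rightarrow> 'r) \<Rightarrow> 'r fract \<Rightarrow> 'r fract" where
  "map_fract_hom \<sigma> f =
     (THE y. \<forall>a b. b \<noteq> 0 \<and> f = Fract a b \<longrightarrow> y = Fract (\<sigma> a) (\<sigma> b))"

lemma map_fract_hom_Fract:
  assumes "\<And>a b. \<sigma> (a * b) = \<sigma> a * \<sigma> b" "\<And>a. \<sigma> a = 0 \<longleftrightarrow> a = 0" "b \<noteq> 0"
  shows "map_fract_hom \<sigma> (Fract a b) = Fract (\<sigma> a) (\<sigma> b)"
  unfolding map_fract_hom_def
proof (rule the_equality)
  show "\<forall>c d. d \<noteq> 0 \<and> Fract a b = Fract c d \<longrightarrow> Fract (\<sigma> a) (\<sigma> b) = Fract (\<sigma> c) (\<sigma> d)"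
  proof (intro allI impI)
    fix c d assume *: "d \<noteq> 0 \<and> Fract a b = Fract c d"
    then have "a * d = c * b"
      using iffD1[OF Fraction_Field.eq_fract(1)[of b d a c]] assms(3) by blast
    then have "\<sigma> a * \<sigma> d = \<sigma> c * \<sigma> b"
      by (simp only: assms(1)[symmetric])
    then show "Fract (\<sigma> a) (\<sigma> b) = Fract (\<sigma> c) (\<sigma> d)"
      using * assms(2,3) by (simp add: Fraction_Field.eq_fract(1))
  qed
next
  fix y assume "\<forall>c d. d \<noteq> 0 \<and> Fract a b = Fract c d \<longrightarrow> y = Fract (\<sigma> c) (\<sigma> d)"
  then show "y = Fract (\<sigma> a) (\<sigma> b)"
    using assms(3) by blast
qed

definition permute_ratfun :: "('v \<Rightarrow> 'v) \<Rightarrow> ('v, 'k::field) ratfun \<Rightarrow> ('v, 'k) ratfun" where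
  "permute_ratfun \<pi> = map_fract_hom (permute_mpoly (map_var \<pi>))"

lemma permute_ratfun_Fract:
  "bij \<pi> \<Longrightarrow> b \<noteq> 0 \<Longrightarrow> permute_ratfun \<pi> (Fract a b) =
     Fract (permute_mpoly (map_var \<pi>) a) (permute_mpoly (map_var \<pi>) b)"
  by (simp add: permute_ratfun_def map_fract_hom_Fract permute_mpoly_mult)

lemma permute_ratfun_add:
  "bij \<pi> \<Longrightarrow> permute_ratfun \<pi> (f + g) = permute_ratfun \<pi> f + permute_ratfun \<pi> g"
  by (cases f; cases g)
    (simp add: permute_ratfun_Fract permute_mpoly_add permute_mpoly_mult)

lemma permute_ratfun_mult:
  "bij \<pi> \<Longrightarrow> permute_ratfun \<pi> (f * g) = permute_ratfun \<pi> f * permute_ratfun \<pi> g"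
  by (cases f; cases g) (simp add: permute_ratfun_Fract permute_mpoly_mult)

lemma permute_ratfun_const:
  "bij \<pi> \<Longrightarrow> permute_ratfun \<pi> (ratfun_const c) = ratfun_const c"
  by (simp add: ratfun_const_def permute_ratfun_Fract permute_mpoly_single
      bij_is_inj bij_imp_bij_inv)

lemma permute_ratfun_var:
  assumes "bij \<pi>"
  shows "permute_ratfun \<pi> (ratfun_var v) = (ratfun_var (\<pi> v) :: ('v, 'k::field) ratfun)"
proof -
  have inj: "inj (inv_into UNIV (map_var \<pi>))"
    using assms by (simp add: bij_is_inj bij_imp_bij_inv)
  have "inv_into UNIV (map_var \<pi>) (Var (\<pi> v)) = Var v"
    using assms by (metis bij_is_inj bij_map_var inv_f_f var.map)
  then have "Poly_Mapping.map_key (inv_into UNIV (map_var \<pi>)) (Poly_Mapping.single (Var v) (1 :: nat)) =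
      Poly_Mapping.single (Var (\<pi> v)) 1"
    using map_key_single[OF inj, of "Var (\<pi> v)" "1 :: nat"] by simp
  then show ?thesis
    using assms by (simp add: ratfun_var_def permute_ratfun_Fract permute_mpoly_single)
qed


section \<open>Purely transcendental extensions\<close>

definition eval_mpoly :: "('l, 'l) mpoly \<Rightarrow> 'l::field" where
  "eval_mpoly P = (\<Sum>m\<in>Poly_Mapping.keys P.
     Poly_Mapping.lookup P m * (\<Prod>v\<in>Poly_Mapping.keys m. v ^ Poly_Mapping.lookup m v))"

definition algebraically_independent :: "'l::field set \<Rightarrow> 'l set \<Rightarrow> bool" where
  "algebraically_independent K B \<longleftrightarrow>
     (\<forall>P :: ('l, 'l) mpoly.
        (\<forall>m\<in>Poly_Mapping.keys P. Poly_Mapping.lookup P m \<in> K \<and> Poly_Mapping.keys m \<subseteq> B) \<and>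
        eval_mpoly P = 0 \<longrightarrow> P = 0)"

definition adjoin :: "'l::field set \<Rightarrow> 'l set \<Rightarrow> 'l set" where
  "adjoin K S = generate_field ring_of_type_algebra (K \<union> S)"

definition rational_over :: "'l::field set \<Rightarrow> 'l set \<Rightarrow> bool" where
  "rational_over K F \<longleftrightarrow> (\<exists>B. algebraically_independent K B \<and> F = adjoin K B)"


section \<open>The Noether field\<close>

abbreviation base_field :: "('v, 'k::field) ratfun set" where
  "base_field \<equiv> range ratfun_const"

text \<open>
  Left translation by \<open>g\<close>, extended by the identity outside the carrier so as to be a
  permutation of the whole index type.
\<close>

definition left_mult :: "('a, 'b) monoid_scheme \<Rightarrow> 'a \<Rightarrow> 'a \<Rightarrow> 'a" where
  "left_mult G g h = (if h \<in> carrier G then g \<otimes>\<^bsub>G\<^esub> h else h)"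

definition noether_act ::
    "('a, 'b) monoid_scheme \<Rightarrow> 'a \<Rightarrow> ('a, 'k::field) ratfun \<Rightarrow> ('a, 'k) ratfun" where
  "noether_act G g = permute_ratfun (left_mult G g)"

lemma (in group) bij_left_mult:
  assumes "g \<in> carrier G"
  shows "bij (left_mult G g)"
  by (rule o_bij[of "left_mult G (inv g)"])
    (use assms in \<open>auto simp: left_mult_def fun_eq_iff simp flip: m_assoc\<close>)

lemma (in group) noether_act_var:
  "g \<in> carrier G \<Longrightarrow> h \<in> carrier G \<Longrightarrow>
     noether_act G g (ratfun_var h) = ratfun_var (g \<otimes> h)"
  by (simp add: noether_act_def permute_ratfun_var bij_left_mult left_mult_def)

definition noether_field :: "('a, 'b) monoid_scheme \<Rightarrow> ('a, 'k::field) ratfun set" where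
  "noether_field G =
     {f \<in> adjoin base_field (ratfun_var ` carrier G). \<forall>g\<in>carrier G. noether_act G g f = f}"


section \<open>Roots of unity and exponents\<close>

definition primitive_root_of_unity :: "nat \<Rightarrow> 'k::field \<Rightarrow> bool" where
  "primitive_root_of_unity n \<zeta> \<longleftrightarrow> 0 < n \<and> \<zeta> ^ n = 1 \<and> (\<forall>m. 0 < m \<and> m < n \<longrightarrow> \<zeta> ^ m \<noteq> 1)"

definition group_exponent :: "('a, 'b) monoid_scheme \<Rightarrow> nat" where
  "group_exponent G = (LEAST n. 0 < n \<and> (\<forall>x\<in>carrier G. x [^]\<^bsub>G\<^esub> n = \<one>\<^bsub>G\<^esub>))"


section \<open>Isoclinism\<close>

definition group_center :: "('a, 'b) monoid_scheme \<Rightarrow> 'a set" where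
  "group_center G = {z \<in> carrier G. \<forall>g\<in>carrier G. z \<otimes>\<^bsub>G\<^esub> g = g \<otimes>\<^bsub>G\<^esub> z}"

definition commutator :: "('a, 'b) monoid_scheme \<Rightarrow> 'a \<Rightarrow> 'a \<Rightarrow> 'a" where
  "commutator G g h = inv\<^bsub>G\<^esub> g \<otimes>\<^bsub>G\<^esub> inv\<^bsub>G\<^esub> h \<otimes>\<^bsub>G\<^esub> g \<otimes>\<^bsub>G\<^esub> h"

text \<open>
  The library forms \<open>G Mod N\<close> from right cosets and generates \<open>derived\<close> by the commutators
  \<open>g h g\<inverse> h\<inverse>\<close>; neither convention affects the resulting groups.
\<close>

definition isoclinic :: "('a, 'b) monoid_scheme \<Rightarrow> ('c, 'd) monoid_scheme \<Rightarrow> bool" where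
  "isoclinic G H \<longleftrightarrow>
     (\<exists>\<theta> \<in> iso (G Mod group_center G) (H Mod group_center H).
      \<exists>\<phi> \<in> iso (G\<lparr>carrier := derived G (carrier G)\<rparr>) (H\<lparr>carrier := derived H (carrier H)\<rparr>).
        \<forall>g\<in>carrier G. \<forall>h\<in>carrier G. \<forall>g'\<in>carrier H. \<forall>h'\<in>carrier H.
          \<theta> (group_center G #>\<^bsub>G\<^esub> g) = group_center H #>\<^bsub>H\<^esub> g' \<and>
          \<theta> (group_center G #>\<^bsub>G\<^esub> h) = group_center H #>\<^bsub>H\<^esub> h' \<longrightarrow>
          \<phi> (commutator G g h) = commutator H g' h')"


section \<open>Group presentations\<close>

text \<open>
  A word is a list of letters \<open>(x, True)\<close>, standing for the generator \<open>x\<close>, and \<open>(x, False)\<close>,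
  standing for its inverse. A relation is a pair of words.
\<close>

type_synonym 'x gword = "('x \<times> bool) list"

definition words :: "'x set \<Rightarrow> 'x gword set" where
  "words S = {w. fst ` set w \<subseteq> S}"

definition letter :: "'x \<Rightarrow> 'x gword" where
  "letter x = [(x, True)]"

definition word_inv :: "'x gword \<Rightarrow> 'x gword" where
  "word_inv w = rev (map (\<lambda>(x, b). (x, \<not> b)) w)"

definition word_pow :: "'x gword \<Rightarrow> nat \<Rightarrow> 'x gword" where
  "word_pow w n = concat (replicate n w)"

definition word_commutator :: "'x gword \<Rightarrow> 'x gword \<Rightarrow> 'x gword" where
  "word_commutator u v = word_inv u @ word_inv v @ u @ v"

inductive word_cong :: "'x set \<Rightarrow> ('x gword \<times> 'x gword) set \<Rightarrow> 'x gword \<Rightarrow> 'x gword \<Rightarrow> bool"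
  for S R where
    rel: "(u, v) \<in> R \<Longrightarrow> u \<in> words S \<Longrightarrow> v \<in> words S \<Longrightarrow> word_cong S R u v"
  | cancel: "x \<in> S \<Longrightarrow> word_cong S R [(x, b), (x, \<not> b)] []"
  | refl: "u \<in> words S \<Longrightarrow> word_cong S R u u"
  | sym: "word_cong S R u v \<Longrightarrow> word_cong S R v u"
  | trans: "word_cong S R u v \<Longrightarrow> word_cong S R v w \<Longrightarrow> word_cong S R u w"
  | append: "word_cong S R u v \<Longrightarrow> word_cong S R u' v' \<Longrightarrow> word_cong S R (u @ u') (v @ v')"

definition word_rel :: "'x set \<Rightarrow> ('x gword \<times> 'x gword) set \<Rightarrow> 'x gword rel" where
  "word_rel S R = {(u, v). word_cong S R u v}"

definition presented_group ::
    "'x set \<Rightarrow> ('x gword \<times> 'x gword) set \<Rightarrow> 'x gword set monoid" where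
  "presented_group S R =
     \<lparr>carrier = words S // word_rel S R,
      monoid.mult = (\<lambda>A B. word_rel S R `` {u @ v | u v. u \<in> A \<and> v \<in> B}),
      one = word_rel S R `` {[]}\<rparr>"

lemma word_cong_words: "word_cong S R u v \<Longrightarrow> u \<in> words S \<and> v \<in> words S"
  by (induction rule: word_cong.induct) (auto simp: words_def)

lemma equiv_word_rel: "equiv (words S) (word_rel S R)"
  by (rule equivI)
    (auto simp: word_rel_def refl_on_def sym_def trans_def
      dest: word_cong_words intro: word_cong.refl word_cong.sym word_cong.trans)

lemma presented_group_mult:
  assumes "u \<in> words S" "v \<in> words S"
  shows "word_rel S R `` {u} \<otimes>\<^bsub>presented_group S R\<^esub> word_rel S R `` {v} =
    word_rel S R `` {u @ v}"
  using assms unfolding presented_group_def word_rel_def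
  by (auto intro: word_cong.append word_cong.sym word_cong.trans word_cong.refl)

lemma word_cong_inv:
  assumes "w \<in> words S"
  shows "word_cong S R (word_inv w @ w) []"
proof -
  have "w \<in> words S \<and> word_inv w \<in> words S \<and> word_cong S R (word_inv w @ w) []"
    using assms
  proof (induction w)
    case Nil
    then show ?case by (auto simp: word_inv_def words_def intro: word_cong.refl)
  next
    case (Cons a w)
    obtain x b where a: "a = (x, b)" by force
    have x: "x \<in> S" and w: "w \<in> words S"
      using Cons.prems by (auto simp: a words_def)
    note Cons = w Cons.IH[OF w]
    have "word_cong S R (word_inv w @ [(x, \<not> b), (x, b)] @ w) (word_inv w @ [] @ w)"
      using word_cong.cancel[OF x, of R "\<not> b"] Cons
      by (intro word_cong.append) (auto intro: word_cong.refl)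
    then have "word_cong S R (word_inv (a # w) @ (a # w)) []"
      using Cons by (auto simp: a word_inv_def intro: word_cong.trans)
    moreover have "a # w \<in> words S" "word_inv (a # w) \<in> words S"
      using Cons x by (auto simp: a word_inv_def words_def)
    ultimately show ?case by blast
  qed
  then show ?thesis by blast
qed

lemma group_presented_group: "group (presented_group S R)"
proof -
  let ?G = "presented_group S R" and ?c = "\<lambda>w. word_rel S R `` {w}"
  have carr: "A \<in> carrier ?G \<longleftrightarrow> (\<exists>w\<in>words S. A = ?c w)" for A
    by (auto simp: presented_group_def quotient_def)
  have one: "\<one>\<^bsub>?G\<^esub> = ?c []" by (simp add: presented_group_def)
  have [simp]: "[] \<in> words S" "u \<in> words S \<Longrightarrow> v \<in> words S \<Longrightarrow> u @ v \<in> words S"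
    "u \<in> words S \<Longrightarrow> word_inv u \<in> words S" for u v
    by (auto simp: words_def word_inv_def image_image case_prod_beta)
  show ?thesis
  proof (rule groupI)
    fix A assume "A \<in> carrier ?G"
    then obtain w where w: "w \<in> words S" "A = ?c w" by (auto simp: carr)
    have "?c (word_inv w @ w) = ?c []"
      using word_cong_inv[OF w(1)] by (intro equiv_class_eq[OF equiv_word_rel])
        (simp add: word_rel_def)
    then show "\<exists>B\<in>carrier ?G. B \<otimes>\<^bsub>?G\<^esub> A = \<one>\<^bsub>?G\<^esub>"
      using w by (intro bexI[of _ "?c (word_inv w)"]) (auto simp: one presented_group_mult carr)
  next
    fix A B assume "A \<in> carrier ?G" "B \<in> carrier ?G"
    then obtain u v where "u \<in> words S" "A = ?c u" "v \<in> words S" "B = ?c v"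
      by (auto simp: carr)
    then have "A \<otimes>\<^bsub>?G\<^esub> B = ?c (u @ v)" "u @ v \<in> words S"
      by (simp_all add: presented_group_mult)
    then show "A \<otimes>\<^bsub>?G\<^esub> B \<in> carrier ?G" unfolding carr by blast
  next
    show "\<one>\<^bsub>?G\<^esub> \<in> carrier ?G" unfolding carr one by (rule bexI[of _ "[]"]) simp_all
  qed (auto simp: carr one presented_group_mult)
qed


section \<open>The isoclinism families\<close>

text \<open>
  \<open>Alpha i\<close> and \<open>Beta i\<close> are the generators $\alpha_i$ and $\beta_i$; the generators $\alpha$
  and $\beta$ without index are \<open>Alpha 0\<close> and \<open>Beta 0\<close>.
\<close>

datatype gen = Alpha nat | Beta nat

definition gcomm :: "gen \<Rightarrow> gen \<Rightarrow> gen gword" where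
  "gcomm x y = word_commutator (letter x) (letter y)"

definition gpow :: "gen \<Rightarrow> nat \<Rightarrow> gen gword" where
  "gpow x n = word_pow (letter x) n"

text \<open>
  The word $\alpha_i^{(p)}$ for a presentation whose generators $\alpha_m$ have indices $m \le N$.
\<close>

definition alpha_paren :: "nat \<Rightarrow> nat \<Rightarrow> nat \<Rightarrow> gen gword" where
  "alpha_paren N p i =
     concat (map (\<lambda>k. if i + k - 1 \<le> N then gpow (Alpha (i + k - 1)) (p choose k) else [])
       [1..<p + 1])"

text \<open>
  \<open>C\<close> lists the commutator relations \<open>[x, y] = w\<close> as \<open>((x, y), w)\<close>; generators whose commutator
  does not occur in \<open>C\<close> in either order commute.
\<close>

definition commutator_presentation ::
    "gen set \<Rightarrow> ((gen \<times> gen) \<times> gen gword) set \<Rightarrow> (gen gword \<times> gen gword) set \<Rightarrow>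
       gen gword set monoid" where
  "commutator_presentation S C R =
     presented_group S
       ({(gcomm x y, w) | x y w. ((x, y), w) \<in> C} \<union>
        {(gcomm x y, []) | x y. x \<in> S \<and> y \<in> S \<and> (x, y) \<notin> fst ` C \<and> (y, x) \<notin> fst ` C} \<union> R)"

definition phi2_group :: "nat \<Rightarrow> gen gword set monoid" where
  "phi2_group p = commutator_presentation {Alpha 0, Alpha 1, Alpha 2}
     {((Alpha 1, Alpha 0), letter (Alpha 2))}
     {(gpow (Alpha 0) p, []), (gpow (Alpha 1) p, []), (gpow (Alpha 2) p, [])}"

definition phi3_group :: "nat \<Rightarrow> gen gword set monoid" where
  "phi3_group p = commutator_presentation {Alpha 0, Alpha 1, Alpha 2, Alpha 3}
     {((Alpha 1, Alpha 0), letter (Alpha 2)), ((Alpha 2, Alpha 0), letter (Alpha 3))}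
     {(gpow (Alpha 0) p, []), (alpha_paren 3 p 1, []), (gpow (Alpha 2) p, []),
      (gpow (Alpha 3) p, [])}"

definition phi4_group :: "nat \<Rightarrow> gen gword set monoid" where
  "phi4_group p = commutator_presentation {Alpha 0, Alpha 1, Alpha 2, Beta 1, Beta 2}
     {((Alpha 1, Alpha 0), letter (Beta 1)), ((Alpha 2, Alpha 0), letter (Beta 2))}
     {(gpow (Alpha 0) p, []), (gpow (Alpha 1) p, []), (gpow (Alpha 2) p, []),
      (gpow (Beta 1) p, []), (gpow (Beta 2) p, [])}"

text \<open>
  Here $\beta$ only abbreviates $\alpha_1^p$, and the commutator $[\beta, \alpha_2] = \beta^p$ is
  determined by the other relations. Requiring $\beta$ to commute with $\alpha_2$ would force
  $\beta^p = 1$ and shrink the group from order $p^5$ to $p^4$; so the convention on unlisted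
  commutators is not applied to $\beta$.
\<close>

definition phi8_group :: "nat \<Rightarrow> gen gword set monoid" where
  "phi8_group p = presented_group {Alpha 1, Alpha 2, Beta 0}
     {(gcomm (Alpha 1) (Alpha 2), letter (Beta 0)), (letter (Beta 0), gpow (Alpha 1) p),
      (gpow (Beta 0) (p ^ 2), []), (gpow (Alpha 2) (p ^ 2), [])}"

definition phi9_group :: "nat \<Rightarrow> gen gword set monoid" where
  "phi9_group p = commutator_presentation {Alpha 0, Alpha 1, Alpha 2, Alpha 3, Alpha 4}
     {((Alpha 1, Alpha 0), letter (Alpha 2)), ((Alpha 2, Alpha 0), letter (Alpha 3)),
      ((Alpha 3, Alpha 0), letter (Alpha 4))}
     {(gpow (Alpha 0) p, []), (alpha_paren 4 p 1, []), (alpha_paren 4 p 2, []),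
      (alpha_paren 4 p 3, []), (alpha_paren 4 p 4, [])}"

definition in_Phi1 :: "('a, 'b) monoid_scheme \<Rightarrow> bool" where
  "in_Phi1 G \<longleftrightarrow> comm_group G"

definition in_Phi2 :: "nat \<Rightarrow> ('a, 'b) monoid_scheme \<Rightarrow> bool" where
  "in_Phi2 p G \<longleftrightarrow> group G \<and> isoclinic G (phi2_group p)"

definition in_Phi3 :: "nat \<Rightarrow> ('a, 'b) monoid_scheme \<Rightarrow> bool" where
  "in_Phi3 p G \<longleftrightarrow> group G \<and> isoclinic G (phi3_group p)"

definition in_Phi4 :: "nat \<Rightarrow> ('a, 'b) monoid_scheme \<Rightarrow> bool" where
  "in_Phi4 p G \<longleftrightarrow> group G \<and> isoclinic G (phi4_group p)"

definition in_Phi8 :: "nat \<Rightarrow> ('a, 'b) monoid_scheme \<Rightarrow> bool" where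
  "in_Phi8 p G \<longleftrightarrow> group G \<and> isoclinic G (phi8_group p)"

definition in_Phi9 :: "nat \<Rightarrow> ('a, 'b) monoid_scheme \<Rightarrow> bool" where
  "in_Phi9 p G \<longleftrightarrow> group G \<and> isoclinic G (phi9_group p)"

end

theory Submission
  imports Defs
begin

text \<open>
  The variables \<open>x(g)\<close> are algebraic over the fixed field. Hence any set of at most \<open>|G|\<close> generators
  of the fixed field is algebraically independent by counting transcendence degrees, and it is
  enough to find that few generators. A stepwise affine action \<open>x \<mapsto> a x + b\<close> needs only one
  generator of the invariants per step.

  In characteristic \<open>p\<close> a \<open>p\<close>-group acts unipotently, so such a triangular system exists. Otherwise
  the variables of an abelian subgroup \<open>H\<close> can be replaced by eigenvectors of \<open>H\<close>, which settles the
  abelian case. Groups in \<open>\<Phi>\<^sub>2\<close>, \<open>\<Phi>\<^sub>3\<close>, \<open>\<Phi>\<^sub>4\<close> and \<open>\<Phi>\<^sub>9\<close> have an abelian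
  normal subgroup \<open>H\<close> and a \<open>t\<close> with \<open>t\<^sup>p \<in> H\<close> and \<open>G = \<langle>t\<rangle> H\<close>. The normalized quotients of consecutive
  elements of the \<open>t\<close>-orbit of an eigenvector form a system of \<open>p\<close> elements with product \<open>1\<close> which \<open>t\<close>
  permutes cyclically, while \<open>H\<close> acts on it by constants. Taking invariants under one element of \<open>H\<close> at
  a time, chosen central modulo those that act trivially, gives systems of the same kind, so the
  \<open>H\<close>-invariants are again generated by such systems; these are linearized by a discrete Fourier
  transform. For \<open>\<Phi>\<^sub>8\<close> the group is either of the previous type or a product \<open>\<langle>t\<rangle> \<langle>g\<rangle>\<close> with
  \<open>\<langle>g\<rangle>\<close> normal of order \<open>p\<^sup>3\<close> and \<open>t\<close> of order \<open>p\<^sup>2\<close> modulo \<open>\<langle>g\<rangle>\<close>; then the invariants of \<open>g\<close> on the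
  systems are written down explicitly.
\<close>

text \<open>The generator count closes with nothing to spare. An eigenvector \<open>w\<close>
  contributes itself and a system of length \<open>m\<close> with product \<open>1\<close>, which
  linearizes to \<open>m - 1\<close> elements; at most \<open>card H\<close> eigenvectors thus give
  at most \<open>card H * m = |G|\<close> generators. To reach product \<open>1\<close>, the
  eigenvalue \<open>c\<close> of \<open>t [^] m\<close> on \<open>w\<close> needs an
  \<open>m\<close>-th root in \<open>K\<close>. This is where the exponent enters:
  \<open>t [^] (p ^ e) = \<one>\<close> bounds the order of \<open>c\<close>, so a power of the
  given root of unity serves.

  In the cyclic case of \<open>\<Phi>\<^sub>8\<close>, \<open>g\<close> scales the entries of one
  system by different constants, and quotients of neighbouring entries are not yet invariant. The
  remedy costs no generator: the orbit of the \<open>H\<close>-invariant vector is traded for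
  \<open>p\<close> partial sums and \<open>p\<^sup>2 - p\<close> Fourier coefficients, and quotients
  of the partial sums form one more system, of length \<open>p\<close> and fixed by
  \<open>g\<close>, against which the weights are balanced.

  Isoclinism matches elements only up to the centre, so the order of \<open>g\<close> in
  \<open>G\<close> has to be recovered from commutators and from \<open>|G| = p ^ 5\<close>.\<close>

section \<open>Subrings, subfields and adjunction\<close>

definition is_subfield :: "'l::field set \<Rightarrow> bool" where
  "is_subfield F \<longleftrightarrow> 1 \<in> F \<and> (\<forall>x\<in>F. \<forall>y\<in>F. x - y \<in> F \<and> x * y \<in> F) \<and> (\<forall>x\<in>F. inverse x \<in> F)"

definition is_subring :: "'l::field set \<Rightarrow> bool" where
  "is_subring R \<longleftrightarrow> 1 \<in> R \<and> (\<forall>x\<in>R. \<forall>y\<in>R. x - y \<in> R \<and> x * y \<in> R)"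

lemma is_subfield_imp_subring: "is_subfield F \<Longrightarrow> is_subring F"
  by (auto simp: is_subfield_def is_subring_def)

context
  fixes R :: "'l::field set"
  assumes R: "is_subring R"
begin

lemma subring_1: "1 \<in> R" and subring_diff: "x \<in> R \<Longrightarrow> y \<in> R \<Longrightarrow> x - y \<in> R"
  and subring_mult: "x \<in> R \<Longrightarrow> y \<in> R \<Longrightarrow> x * y \<in> R"
  using R by (auto simp: is_subring_def)

lemma subring_0: "0 \<in> R"
  using subring_diff[OF subring_1 subring_1] by simp

lemma subring_uminus: "x \<in> R \<Longrightarrow> - x \<in> R"
  using subring_diff[OF subring_0, of x] by simp

lemma subring_add: "x \<in> R \<Longrightarrow> y \<in> R \<Longrightarrow> x + y \<in> R"
  using subring_diff[of x "- y"] subring_uminus[of y] by simp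

lemma subring_power: "x \<in> R \<Longrightarrow> x ^ n \<in> R"
  by (induction n) (auto intro: subring_1 subring_mult)

lemma subring_sum: "(\<And>i. i \<in> I \<Longrightarrow> f i \<in> R) \<Longrightarrow> sum f I \<in> R"
  by (induction I rule: infinite_finite_induct) (auto intro: subring_0 subring_add)

lemma subring_prod: "(\<And>i. i \<in> I \<Longrightarrow> f i \<in> R) \<Longrightarrow> prod f I \<in> R"
  by (induction I rule: infinite_finite_induct) (auto intro: subring_1 subring_mult)

lemma subring_of_nat: "of_nat n \<in> R"
  by (induction n) (auto intro: subring_0 subring_1 subring_add)

lemmas subring_closed = subring_0 subring_1 subring_add subring_diff subring_mult subring_uminus
  subring_power subring_sum subring_prod subring_of_nat

end

lemma is_subfieldI:
  assumes "is_subring F" "\<And>x. x \<in> F \<Longrightarrow> x \<noteq> 0 \<Longrightarrow> inverse x \<in> F"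
  shows "is_subfield F"
  using assms subring_0[OF assms(1)] unfolding is_subfield_def is_subring_def
  by (metis inverse_zero)

context
  fixes F :: "'l::field set"
  assumes F: "is_subfield F"
begin

lemma subfield_inverse: "x \<in> F \<Longrightarrow> inverse x \<in> F"
  using F by (auto simp: is_subfield_def)

lemma subfield_divide: "x \<in> F \<Longrightarrow> y \<in> F \<Longrightarrow> x / y \<in> F"
  using F by (auto simp: is_subfield_def divide_inverse)

lemmas subfield_closed = subring_closed[OF is_subfield_imp_subring[OF F]]
  subfield_inverse subfield_divide

end

text \<open>\<open>adjoin\<close> is defined by the record-based \<open>generate_field\<close>. This
  lemma and \<open>adjoin_least\<close> translate its negation and inverse into the type-class
  operations, so that from here on fields are plain sets.\<close>

lemma is_subfield_adjoin: "is_subfield (adjoin K S)"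
proof -
  let ?R = "ring_of_type_algebra :: 'a ring"
  interpret R: field ?R by (rule field_from_type_algebra)
  have [simp]: "carrier ?R = UNIV" "\<one>\<^bsub>?R\<^esub> = 1" "\<zero>\<^bsub>?R\<^esub> = 0" "x \<oplus>\<^bsub>?R\<^esub> y = x + y"
    "x \<otimes>\<^bsub>?R\<^esub> y = x * y" for x y by (simp_all add: ring_of_type_algebra_def)
  have neg: "\<ominus>\<^bsub>?R\<^esub> x = - x" for x
    using R.r_neg[of x] by (simp add: R.minus_equality)
  have inv: "inv\<^bsub>?R\<^esub> x = inverse x" if "x \<noteq> 0" for x
    using that by (intro R.inv_char) auto
  have g: "adjoin K S = generate_field ?R (K \<union> S)" by (simp add: adjoin_def)
  show ?thesis
  proof (rule is_subfieldI)
    show "is_subring (adjoin K S)"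
      unfolding g is_subring_def
    proof (intro conjI ballI)
      show "1 \<in> generate_field ?R (K \<union> S)" using generate_field.one[of ?R] by simp
      fix x y assume *: "x \<in> generate_field ?R (K \<union> S)" "y \<in> generate_field ?R (K \<union> S)"
      then have "x + - y \<in> generate_field ?R (K \<union> S)"
        using generate_field.eng_add[of x ?R _ "- y"] generate_field.a_inv[of y ?R] by (simp add: neg)
      then show "x - y \<in> generate_field ?R (K \<union> S)" by simp
      show "x * y \<in> generate_field ?R (K \<union> S)" using * generate_field.eng_mult[of x ?R _ y] by simp
    qed
  next
    fix x assume "x \<in> adjoin K S" "x \<noteq> 0"
    then show "inverse x \<in> adjoin K S"
      using generate_field.m_inv[of x ?R] by (simp add: g inv)
  qed
qed

lemma adjoin_base: "K \<subseteq> adjoin K S" and adjoin_gens: "S \<subseteq> adjoin K S"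
  unfolding adjoin_def by (auto intro: generate_field.incl)

lemma adjoin_least:
  assumes "is_subfield F" "K \<subseteq> F" "S \<subseteq> F"
  shows "adjoin K S \<subseteq> F"
proof
  let ?R = "ring_of_type_algebra :: 'a ring"
  interpret R: field ?R by (rule field_from_type_algebra)
  have [simp]: "carrier ?R = UNIV" "\<one>\<^bsub>?R\<^esub> = 1" "\<zero>\<^bsub>?R\<^esub> = 0" "x \<oplus>\<^bsub>?R\<^esub> y = x + y"
    "x \<otimes>\<^bsub>?R\<^esub> y = x * y" for x y by (simp_all add: ring_of_type_algebra_def)
  have neg: "\<ominus>\<^bsub>?R\<^esub> x = - x" for x
    using R.r_neg[of x] by (simp add: R.minus_equality)
  have inv: "inv\<^bsub>?R\<^esub> x = inverse x" if "x \<noteq> 0" for x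
    using that by (intro R.inv_char) auto
  fix x assume "x \<in> adjoin K S"
  then have "x \<in> generate_field ?R (K \<union> S)" by (simp add: adjoin_def)
  then show "x \<in> F"
    by (induction rule: generate_field.induct)
      (use assms in \<open>auto simp: neg inv intro: subfield_closed[OF assms(1)]\<close>)
qed

lemma adjoin_mono: "K \<subseteq> K' \<Longrightarrow> S \<subseteq> S' \<Longrightarrow> adjoin K S \<subseteq> adjoin K' S'"
  by (rule adjoin_least[OF is_subfield_adjoin]) (meson adjoin_base adjoin_gens order_trans)+

lemma adjoin_subset: "S \<subseteq> adjoin K T \<Longrightarrow> adjoin K S \<subseteq> adjoin K T"
  by (rule adjoin_least[OF is_subfield_adjoin adjoin_base])

lemma adjoin_adjoin: "adjoin (adjoin K S) T = adjoin K (S \<union> T)"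
proof
  have "S \<union> T \<subseteq> adjoin K (S \<union> T)" by (rule adjoin_gens)
  then show "adjoin (adjoin K S) T \<subseteq> adjoin K (S \<union> T)"
    by (intro adjoin_least is_subfield_adjoin adjoin_base) auto
  have "K \<subseteq> adjoin (adjoin K S) T" "S \<subseteq> adjoin (adjoin K S) T" "T \<subseteq> adjoin (adjoin K S) T"
    by (meson adjoin_base adjoin_gens order_trans)+
  then show "adjoin K (S \<union> T) \<subseteq> adjoin (adjoin K S) T"
    by (intro adjoin_least is_subfield_adjoin) auto
qed

lemma adjoin_empty: "is_subfield F \<Longrightarrow> adjoin F {} = F"
  by (simp add: adjoin_base adjoin_least subset_antisym)

lemmas adjoin_closed = subfield_closed[OF is_subfield_adjoin]

section \<open>Fractions\<close>

text \<open>Zero denominators are harmless: \<open>a / 0 = 0\<close> already lies in every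
  subring.\<close>

definition fracs :: "'l::field set \<Rightarrow> 'l set" where
  "fracs R = {a / b | a b. a \<in> R \<and> b \<in> R}"

lemma fracs_subset: "is_subfield F \<Longrightarrow> R \<subseteq> F \<Longrightarrow> fracs R \<subseteq> F"
  by (auto simp: fracs_def intro: subfield_closed)

lemma subset_fracs: "is_subring R \<Longrightarrow> R \<subseteq> fracs R"
  unfolding fracs_def using subring_1[of R] by force

lemma is_subfield_fracs:
  assumes R: "is_subring R" shows "is_subfield (fracs R)"
proof -
  note cl = subring_closed[OF R]
  have d: "x - y \<in> fracs R" "x * y \<in> fracs R" if xy: "x \<in> fracs R" "y \<in> fracs R" for x y
  proof -
    from xy obtain a b c d where *: "x = a / b" "a \<in> R" "b \<in> R" "y = c / d" "c \<in> R" "d \<in> R"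
      by (auto simp: fracs_def)
    show "x * y \<in> fracs R"
    proof -
      have "x * y = (a * c) / (b * d)" using * by simp
      then show ?thesis unfolding fracs_def using * by (blast intro: cl)
    qed
    consider "b = 0" | "d = 0" | "b \<noteq> 0" "d \<noteq> 0" by blast
    then show "x - y \<in> fracs R"
    proof cases
      case 1
      then have "x - y = (- c) / d" using * by simp
      then show ?thesis unfolding fracs_def using * by (blast intro: cl)
    next
      case 2
      then have "x - y = a / b" using * by simp
      then show ?thesis unfolding fracs_def using * by (blast intro: cl)
    next
      case 3
      then have "x - y = (a * d - c * b) / (b * d)" using * by (simp add: diff_frac_eq)
      then show ?thesis unfolding fracs_def using * by (blast intro: cl)
    qed
  qed
  have i: "inverse x \<in> fracs R" if x: "x \<in> fracs R" for x
  proof -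
    obtain a b where "x = a / b" "a \<in> R" "b \<in> R" using x by (auto simp: fracs_def)
    moreover from this have "inverse x = b / a" by simp
    ultimately show ?thesis unfolding fracs_def by blast
  qed
  have "1 \<in> fracs R" using subset_fracs[OF R] cl by blast
  then show ?thesis using d i unfolding is_subfield_def by blast
qed

lemma adjoin_eq_fracs:
  assumes "is_subring R" "K \<union> S \<subseteq> R" "R \<subseteq> adjoin K S"
  shows "adjoin K S = fracs R"
  using assms by (intro subset_antisym adjoin_least fracs_subset is_subfield_fracs is_subfield_adjoin)
    (use subset_fracs in blast)+

text \<open>The product of the nonzero denominators works. It turns a polynomial over the fraction
  field into one over the ring without changing its roots.\<close>

lemma common_denominator:
  assumes R: "is_subring R" and "finite I" "\<And>i. i \<in> I \<Longrightarrow> c i \<in> fracs R"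
  shows "\<exists>d\<in>R. d \<noteq> 0 \<and> (\<forall>i\<in>I. d * c i \<in> R)"
  using assms(2,3)
proof (induction I rule: finite_induct)
  case empty
  show ?case by (rule bexI[of _ 1]) (use subring_1[OF R] in auto)
next
  case (insert i I)
  then obtain d where d: "d \<in> R" "d \<noteq> 0" "\<And>j. j \<in> I \<Longrightarrow> d * c j \<in> R" by auto
  have "c i \<in> fracs R" using insert by simp
  then obtain a b where ab: "c i = a / b" "a \<in> R" "b \<in> R" by (auto simp: fracs_def)
  show ?case
  proof (cases "b = 0")
    case True
    then show ?thesis using d ab subring_0[OF R] by (intro bexI[of _ d]) auto
  next
    case False
    have "d * b * c j \<in> R" if "j \<in> I" for j
      using subring_mult[OF R ab(3) d(3)[OF that]] by (simp add: ac_simps)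
    moreover have "d * b * c i \<in> R" using False ab d(1) by (auto intro: subring_mult[OF R])
    ultimately show ?thesis using d ab False by (intro bexI[of _ "d * b"]) (auto intro: subring_mult[OF R])
  qed
qed

section \<open>Algebraic dependence\<close>

definition poly_over :: "'l::field set \<Rightarrow> 'l poly set" where
  "poly_over F = {P. \<forall>i. coeff P i \<in> F}"

definition alg_over :: "'l::field set \<Rightarrow> 'l \<Rightarrow> bool" where
  "alg_over F x \<longleftrightarrow> (\<exists>P\<in>poly_over F. P \<noteq> 0 \<and> poly P x = 0)"

lemma poly_over_coeff: "P \<in> poly_over F \<Longrightarrow> coeff P i \<in> F"
  by (simp add: poly_over_def)

lemma poly_over_mono: "F \<subseteq> E \<Longrightarrow> poly_over F \<subseteq> poly_over E"
  by (auto simp: poly_over_def)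

lemma alg_over_mono: "F \<subseteq> E \<Longrightarrow> alg_over F x \<Longrightarrow> alg_over E x"
  using poly_over_mono unfolding alg_over_def by blast

context
  fixes R :: "'l::field set"
  assumes R: "is_subring R"
begin

lemma poly_over_add: "P \<in> poly_over R \<Longrightarrow> Q \<in> poly_over R \<Longrightarrow> P + Q \<in> poly_over R"
  and poly_over_diff: "P \<in> poly_over R \<Longrightarrow> Q \<in> poly_over R \<Longrightarrow> P - Q \<in> poly_over R"
  and poly_over_mult: "P \<in> poly_over R \<Longrightarrow> Q \<in> poly_over R \<Longrightarrow> P * Q \<in> poly_over R"
  and poly_over_const: "a \<in> R \<Longrightarrow> [:a:] \<in> poly_over R"
  and poly_over_0: "0 \<in> poly_over R"
  and poly_over_1: "1 \<in> poly_over R"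
  and poly_over_pCons: "a \<in> R \<Longrightarrow> P \<in> poly_over R \<Longrightarrow> pCons a P \<in> poly_over R"
  and poly_over_monom: "a \<in> R \<Longrightarrow> monom a n \<in> poly_over R"
  by (auto simp: poly_over_def coeff_mult coeff_pCons split: nat.splits
      intro!: subring_closed[OF R])

lemma poly_over_sum: "(\<And>i. i \<in> I \<Longrightarrow> P i \<in> poly_over R) \<Longrightarrow> sum P I \<in> poly_over R"
  by (induction I rule: infinite_finite_induct) (auto intro: poly_over_0 poly_over_add)

lemma poly_over_prod: "(\<And>i. i \<in> I \<Longrightarrow> P i \<in> poly_over R) \<Longrightarrow> prod P I \<in> poly_over R"
  by (induction I rule: infinite_finite_induct) (auto intro: poly_over_1 poly_over_mult)

lemma poly_over_poly: "P \<in> poly_over R \<Longrightarrow> x \<in> R \<Longrightarrow> poly P x \<in> R"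
  by (auto simp: poly_over_def poly_altdef intro!: subring_closed[OF R])

lemma poly_over_pcompose:
  "P \<in> poly_over R \<Longrightarrow> Q \<in> poly_over R \<Longrightarrow> pcompose P Q \<in> poly_over R"
proof (induction P)
  case (pCons a P)
  have "a \<in> R" "P \<in> poly_over R"
    using poly_over_coeff[OF pCons.prems(1), of 0] poly_over_coeff[OF pCons.prems(1), of "Suc _"]
    by (auto simp: poly_over_def)
  then show ?case using pCons
    by (auto simp: pcompose_pCons intro!: poly_over_add poly_over_mult poly_over_const)
qed (auto simp: poly_over_0)

end

definition ring_adjoin :: "'l::field set \<Rightarrow> 'l \<Rightarrow> 'l set" where
  "ring_adjoin F x = (\<lambda>P. poly P x) ` poly_over F"

lemma is_subring_ring_adjoin:
  assumes R: "is_subring R" shows "is_subring (ring_adjoin R x)"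
  unfolding is_subring_def ring_adjoin_def
proof (intro conjI ballI)
  show "1 \<in> (\<lambda>P. poly P x) ` poly_over R"
    by (rule image_eqI[of _ _ 1]) (auto intro: poly_over_1[OF R])
next
  fix a b assume "a \<in> (\<lambda>P. poly P x) ` poly_over R" "b \<in> (\<lambda>P. poly P x) ` poly_over R"
  then obtain P Q where *: "a = poly P x" "b = poly Q x" "P \<in> poly_over R" "Q \<in> poly_over R" by auto
  show "a - b \<in> (\<lambda>P. poly P x) ` poly_over R"
    using * by (intro image_eqI[of _ _ "P - Q"]) (auto intro: poly_over_diff[OF R])
  show "a * b \<in> (\<lambda>P. poly P x) ` poly_over R"
    using * by (intro image_eqI[of _ _ "P * Q"]) (auto intro: poly_over_mult[OF R])
qed

lemma adjoin_insert_eq_fracs: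
  assumes F: "is_subfield F" shows "adjoin F {x} = fracs (ring_adjoin F x)"
proof (rule adjoin_eq_fracs)
  note R = is_subfield_imp_subring[OF F]
  show "is_subring (ring_adjoin F x)" by (rule is_subring_ring_adjoin[OF R])
  have "a \<in> ring_adjoin F x" if "a \<in> F" for a
    unfolding ring_adjoin_def using that
    by (intro image_eqI[of _ _ "[:a:]"]) (auto intro: poly_over_const[OF R])
  moreover have "x \<in> ring_adjoin F x"
    unfolding ring_adjoin_def
    by (intro image_eqI[of _ _ "[:0,1:]"])
      (auto intro!: poly_over_pCons[OF R] poly_over_0[OF R] subring_closed[OF R])
  ultimately show "F \<union> {x} \<subseteq> ring_adjoin F x" by blast
  show "ring_adjoin F x \<subseteq> adjoin F {x}"
    unfolding ring_adjoin_def
    using poly_over_poly[OF is_subfield_imp_subring[OF is_subfield_adjoin], of _ F "{x}" x]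
      poly_over_mono[OF adjoin_base, of F "{x}"] adjoin_gens[of "{x}" F] by blast
qed

section \<open>Linear spans and finite-dimensional algebras\<close>

definition lin_span :: "'l::field set \<Rightarrow> 'l set \<Rightarrow> 'l set" where
  "lin_span F W = {\<Sum>w\<in>W. c w * w | c. \<forall>w\<in>W. c w \<in> F}"

lemma lin_span_add:
  assumes F: "is_subfield F" and "x \<in> lin_span F W" "y \<in> lin_span F W"
  shows "x + y \<in> lin_span F W"
proof -
  obtain c d where *: "\<forall>w\<in>W. c w \<in> F" "x = (\<Sum>w\<in>W. c w * w)" "\<forall>w\<in>W. d w \<in> F" "y = (\<Sum>w\<in>W. d w * w)"
    using assms(2,3) unfolding lin_span_def by blast
  then show ?thesis unfolding lin_span_def
    by (auto intro!: exI[of _ "\<lambda>w. c w + d w"] subfield_closed[OF F] simp: sum.distrib distrib_right)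
qed

lemma lin_span_scale:
  assumes F: "is_subfield F" and "a \<in> F" "x \<in> lin_span F W"
  shows "a * x \<in> lin_span F W"
proof -
  obtain c where *: "\<forall>w\<in>W. c w \<in> F" "x = (\<Sum>w\<in>W. c w * w)"
    using assms(3) unfolding lin_span_def by blast
  then show ?thesis unfolding lin_span_def using assms(2)
    by (auto intro!: exI[of _ "\<lambda>w. a * c w"] subfield_closed[OF F] simp: sum_distrib_left mult.assoc)
qed

lemma lin_span_base:
  assumes F: "is_subfield F" and "finite W" "w \<in> W"
  shows "w \<in> lin_span F W"
proof -
  have "(\<Sum>v\<in>W. (if v = w then 1 else 0) * v) = w"
    using assms by (subst sum.remove[of _ w]) auto
  then show ?thesis unfolding lin_span_def
    by (auto intro!: exI[of _ "\<lambda>v. if v = w then 1 else 0"] subfield_closed[OF F])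
qed

lemma lin_span_0: "is_subfield F \<Longrightarrow> 0 \<in> lin_span F W"
  unfolding lin_span_def by (auto intro!: exI[of _ "\<lambda>_. 0"] subfield_closed)

lemma lin_span_sum:
  "is_subfield F \<Longrightarrow> (\<And>i. i \<in> I \<Longrightarrow> f i \<in> lin_span F W) \<Longrightarrow> sum f I \<in> lin_span F W"
  by (induction I rule: infinite_finite_induct) (auto intro: lin_span_0 lin_span_add)

text \<open>Gaussian elimination: the vector \<open>w\<close> is eliminated with one pivot
  \<open>x j0\<close>. The \<open>x j\<close> form a family rather than a set, because in the
  application to powers of one element they may coincide.\<close>

lemma lin_span_dependent:
  assumes F: "is_subfield F" and "finite W" "finite J" "card W < card J"
    "\<And>j. j \<in> J \<Longrightarrow> x j \<in> lin_span F W"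
  shows "\<exists>c. (\<forall>j\<in>J. c j \<in> F) \<and> (\<exists>j\<in>J. c j \<noteq> 0) \<and> (\<Sum>j\<in>J. c j * x j) = 0"
  using assms(2-5)
proof (induction W arbitrary: J x rule: finite_induct)
  case empty
  then have "x j = 0" if "j \<in> J" for j using that by (auto simp: lin_span_def)
  moreover have "J \<noteq> {}" using empty by auto
  ultimately show ?case by (intro exI[of _ "\<lambda>_. 1"]) (auto intro: subfield_closed[OF F])
next
  case (insert w W)
  have "\<exists>a y. a \<in> F \<and> y \<in> lin_span F W \<and> x j = a * w + y" if j: "j \<in> J" for j
  proof -
    obtain c where c: "\<forall>v\<in>insert w W. c v \<in> F" "x j = (\<Sum>v\<in>insert w W. c v * v)"
      using insert.prems(3)[OF j] unfolding lin_span_def by blast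
    then show ?thesis using insert.hyps
      by (intro exI[of _ "c w"] exI[of _ "\<Sum>v\<in>W. c v * v"]) (auto simp: lin_span_def)
  qed
  then obtain a y where ay: "\<And>j. j \<in> J \<Longrightarrow> a j \<in> F" "\<And>j. j \<in> J \<Longrightarrow> y j \<in> lin_span F W"
    "\<And>j. j \<in> J \<Longrightarrow> x j = a j * w + y j" by metis
  show ?case
  proof (cases "\<forall>j\<in>J. a j = 0")
    case True
    then show ?thesis using insert ay by (intro insert.IH) auto
  next
    case False
    then obtain j0 where j0: "j0 \<in> J" "a j0 \<noteq> 0" by blast
    let ?J = "J - {j0}"
    define x' where "x' j = x j + (- (a j / a j0)) * x j0" for j
    have "x' j \<in> lin_span F W" if "j \<in> ?J" for j
    proof -
      have "x' j = y j + (- (a j / a j0)) * y j0"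
        using that j0 ay(3) by (simp add: x'_def field_simps)
      also have "\<dots> \<in> lin_span F W"
        using that j0 ay(1,2) by (intro lin_span_add lin_span_scale F subfield_closed[OF F]) auto
      finally show ?thesis .
    qed
    moreover have "card W < card ?J" "finite ?J" using insert j0 by auto
    ultimately obtain c where c: "\<forall>j\<in>?J. c j \<in> F" "\<exists>j\<in>?J. c j \<noteq> 0" "(\<Sum>j\<in>?J. c j * x' j) = 0"
      using insert.IH[of ?J x'] by blast
    \<comment> \<open>The coefficient of the pivot compensates for the multiples of
      \<open>x j0\<close> that were subtracted in forming \<open>x'\<close>.\<close>
    define c' where "c' j = (if j = j0 then - (\<Sum>j\<in>?J. c j * (a j / a j0)) else c j)" for j
    have "(\<Sum>j\<in>J. c' j * x j) = c' j0 * x j0 + (\<Sum>j\<in>?J. c' j * x j)"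
      using j0 insert by (subst sum.remove[of _ j0]) auto
    also have "(\<Sum>j\<in>?J. c' j * x j) = (\<Sum>j\<in>?J. c j * x j)" by (rule sum.cong) (auto simp: c'_def)
    also have "c' j0 * x j0 = - (\<Sum>j\<in>?J. c j * (a j / a j0) * x j0)"
      by (simp add: c'_def sum_distrib_right)
    also have "\<dots> + (\<Sum>j\<in>?J. c j * x j) = (\<Sum>j\<in>?J. c j * x' j)"
      by (simp add: x'_def sum_negf[symmetric] sum.distrib[symmetric] algebra_simps)
    finally have "(\<Sum>j\<in>J. c' j * x j) = 0" using c by simp
    moreover have "\<forall>j\<in>J. c' j \<in> F" using c(1) ay(1) j0
      by (auto simp: c'_def intro!: subfield_closed[OF F])
    moreover have "\<exists>j\<in>J. c' j \<noteq> 0" using c(2) by (auto simp: c'_def)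
    ultimately show ?thesis by blast
  qed
qed

text \<open>Finite dimension is expressed by a finite spanning set \<open>W\<close>, whose
  cardinality bounds how many elements can avoid a linear relation.\<close>

definition fin_algebra :: "'l::field set \<Rightarrow> 'l set \<Rightarrow> bool" where
  "fin_algebra F V \<longleftrightarrow> (\<exists>W. finite W \<and> V = lin_span F W) \<and> is_subring V \<and> F \<subseteq> V"

lemma fin_algebra_self:
  assumes F: "is_subfield F" shows "fin_algebra F F"
proof -
  have "F = lin_span F {1}"
    unfolding lin_span_def by (auto intro: exI[of _ "\<lambda>_. _"])
  then show ?thesis unfolding fin_algebra_def
    using is_subfield_imp_subring[OF F] by blast
qed

text \<open>The powers of \<open>x\<close> with exponents up to \<open>card W\<close> are
  \<open>card W + 1\<close> members of a span of \<open>card W\<close> elements; a linear relation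
  between them is the wanted polynomial.\<close>

lemma fin_algebra_alg:
  assumes F: "is_subfield F" and V: "fin_algebra F V" "x \<in> V"
  shows "alg_over F x"
proof -
  obtain W where W: "finite W" "V = lin_span F W" and R: "is_subring V" using V by (auto simp: fin_algebra_def)
  have "\<exists>c. (\<forall>j\<in>{..card W}. c j \<in> F) \<and> (\<exists>j\<in>{..card W}. c j \<noteq> 0) \<and> (\<Sum>j\<in>{..card W}. c j * x ^ j) = 0"
    using W V(2) subring_power[OF R V(2)] by (intro lin_span_dependent[OF F W(1)]) auto
  then obtain c where c: "\<forall>j\<le>card W. c j \<in> F" "\<exists>j\<le>card W. c j \<noteq> 0" "(\<Sum>j\<le>card W. c j * x ^ j) = 0"
    by auto
  define P where "P = (\<Sum>j\<le>card W. monom (c j) j)"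
  have cf: "coeff P i = (if i \<le> card W then c i else 0)" for i
    by (simp add: P_def coeff_sum)
  have "P \<in> poly_over F" using c(1) by (auto simp: poly_over_def cf intro: subfield_closed[OF F])
  moreover have "P \<noteq> 0" using c(2) cf by (metis coeff_0)
  moreover have "poly P x = 0" using c(3) by (simp add: P_def poly_sum poly_monom)
  ultimately show ?thesis unfolding alg_over_def by blast
qed

text \<open>Polynomials in \<open>x\<close> of degree below \<open>d\<close> with coefficients in
  \<open>V\<close> are closed under multiplication, since the relation rewrites
  \<open>x ^ d\<close>. Its coefficients may lie in \<open>V\<close> and not only in
  \<open>F\<close>; this is what transitivity of algebraicity uses.\<close>

lemma fin_algebra_extend:
  assumes F: "is_subfield F" and V: "fin_algebra F V"
    and x: "x ^ d = (\<Sum>k<d. v k * x ^ k)" "\<And>k. k < d \<Longrightarrow> v k \<in> V"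
  shows "\<exists>V'. fin_algebra F V' \<and> V \<subseteq> V' \<and> x \<in> V'"
proof -
  obtain W where W: "finite W" "V = lin_span F W" and R: "is_subring V" and FV: "F \<subseteq> V"
    using V by (auto simp: fin_algebra_def)
  note cl = subring_closed[OF R]
  \<comment> \<open>For \<open>d = 0\<close> the relation would read \<open>1 = 0\<close>.\<close>
  have d: "d > 0" using x(1) by (cases d) auto
  define V' where "V' = {\<Sum>k<d. u k * x ^ k | u. \<forall>k<d. u k \<in> V}"
  have V'I: "(\<Sum>k<d. u k * x ^ k) \<in> V'" if "\<And>k. k < d \<Longrightarrow> u k \<in> V" for u
    using that by (auto simp: V'_def)
  have diff: "a - b \<in> V'" if ab: "a \<in> V'" "b \<in> V'" for a b
  proof -
    obtain u where "a = (\<Sum>k<d. u k * x ^ k)" "\<forall>k<d. u k \<in> V"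
      using ab(1) by (auto simp: V'_def)
    moreover obtain u' where "b = (\<Sum>k<d. u' k * x ^ k)" "\<forall>k<d. u' k \<in> V"
      using ab(2) by (auto simp: V'_def)
    ultimately show ?thesis using V'I[of "\<lambda>k. u k - u' k"]
      by (auto simp: left_diff_distrib sum_subtractf intro: cl)
  qed
  have sub: "a \<in> V'" if "a \<in> V" for a
  proof -
    have "(\<Sum>k<d. (if k = 0 then a else 0) * x ^ k) = a"
      using d by (subst sum.remove[of _ 0]) auto
    moreover have "(if k = 0 then a else 0) \<in> V" for k :: nat using that cl(1) by simp
    ultimately show ?thesis using V'I[of "\<lambda>k. if k = 0 then a else 0"] by simp
  qed
  have zero: "0 \<in> V'" using sub cl by blast
  have add: "a + b \<in> V'" if "a \<in> V'" "b \<in> V'" for a b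
    using diff[OF that(1) diff[OF zero that(2)]] by simp
  have sum: "sum f I \<in> V'" if "\<And>i. i \<in> I \<Longrightarrow> f i \<in> V'" for f and I :: "nat set"
    using that by (induction I rule: infinite_finite_induct) (auto intro: zero add)
  have scale: "a * b \<in> V'" if ab: "a \<in> V" "b \<in> V'" for a b
  proof -
    obtain u where "b = (\<Sum>k<d. u k * x ^ k)" "\<forall>k<d. u k \<in> V" using ab by (auto simp: V'_def)
    then show ?thesis using V'I[of "\<lambda>k. a * u k"] ab by (auto simp: sum_distrib_left mult.assoc intro: cl)
  qed
  have pow_small: "x ^ k \<in> V'" if "k < d" for k
  proof -
    have "(\<Sum>j<d. (if j = k then 1 else 0) * x ^ j) = x ^ k"
      using that by (subst sum.remove[of _ k]) auto
    moreover have "(if j = k then 1 else 0) \<in> V" for j using cl(1,2) by simp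
    ultimately show ?thesis using V'I[of "\<lambda>j. if j = k then 1 else 0"] by simp
  qed
  have xd: "x ^ d \<in> V'" unfolding x(1) by (rule V'I) (rule x(2))
  have times_x: "x * b \<in> V'" if b: "b \<in> V'" for b
  proof -
    obtain u where u: "b = (\<Sum>k<d. u k * x ^ k)" "\<forall>k<d. u k \<in> V" using b by (auto simp: V'_def)
    have "x * b = (\<Sum>k<d. u k * x ^ Suc k)" by (simp add: u sum_distrib_left ac_simps)
    moreover have "x ^ Suc k \<in> V'" if "k < d" for k
      using that pow_small[of "Suc k"] xd by (cases "Suc k = d") auto
    ultimately show ?thesis using u(2) by (auto intro!: sum scale simp del: power_Suc)
  qed
  have times_pow: "x ^ k * b \<in> V'" if "b \<in> V'" for b k
    using that by (induction k) (auto simp: mult.assoc intro: times_x)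
  have mult: "a * b \<in> V'" if ab: "a \<in> V'" "b \<in> V'" for a b
  proof -
    obtain u where u: "a = (\<Sum>k<d. u k * x ^ k)" "\<forall>k<d. u k \<in> V" using ab by (auto simp: V'_def)
    show ?thesis unfolding u(1) sum_distrib_right mult.assoc
      using u(2) ab(2) by (intro sum scale times_pow) auto
  qed
  have ring: "is_subring V'" unfolding is_subring_def using diff mult sub cl by blast
  define W' where "W' = (\<lambda>(w, k). w * x ^ k) ` (W \<times> {..<d})"
  have W': "finite W'" using W by (simp add: W'_def)
  have "V' = lin_span F W'"
  proof
    show "V' \<subseteq> lin_span F W'"
    proof
      fix a assume "a \<in> V'"
      then obtain u where u: "a = (\<Sum>k<d. u k * x ^ k)" "\<forall>k<d. u k \<in> V" by (auto simp: V'_def)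
      have "u k * x ^ k \<in> lin_span F W'" if k: "k < d" for k
      proof -
        obtain c where c: "\<forall>w\<in>W. c w \<in> F" "u k = (\<Sum>w\<in>W. c w * w)"
          using u(2) k unfolding W lin_span_def by blast
        have "u k * x ^ k = (\<Sum>w\<in>W. c w * (w * x ^ k))" by (simp add: c sum_distrib_right mult.assoc)
        also have "\<dots> \<in> lin_span F W'"
        proof (rule lin_span_sum[OF F])
          fix w assume "w \<in> W"
          then show "c w * (w * x ^ k) \<in> lin_span F W'"
            using c(1) k by (intro lin_span_scale[OF F] lin_span_base[OF F W']) (auto simp: W'_def)
        qed
        finally show ?thesis .
      qed
      then show "a \<in> lin_span F W'" unfolding u(1) by (auto intro!: lin_span_sum F)
    qed
    have W'V: "w \<in> V'" if "w \<in> W'" for w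
      using that W lin_span_base[OF F, of W] pow_small unfolding W'_def
      by (auto intro!: scale)
    show "lin_span F W' \<subseteq> V'"
      unfolding lin_span_def using W'V FV
      by (auto intro!: subring_sum[OF ring] scale)
  qed
  moreover have "x \<in> V'" using times_x[OF pow_small[of 0]] d by simp
  ultimately show ?thesis using W' ring FV sub unfolding fin_algebra_def by blast
qed

lemma alg_over_monic:
  assumes F: "is_subfield F" and "alg_over F x"
  obtains d v where "x ^ d = (\<Sum>k<d. v k * x ^ k)" "\<And>k. v k \<in> F"
proof -
  obtain P where P: "P \<in> poly_over F" "P \<noteq> 0" "poly P x = 0" using assms by (auto simp: alg_over_def)
  let ?d = "degree P"
  define v where "v k = - (coeff P k / lead_coeff P)" for k
  have "v k \<in> F" for k using P(1) by (auto simp: v_def poly_over_def intro!: subfield_closed[OF F])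
  moreover have "x ^ ?d = (\<Sum>k<?d. v k * x ^ k)"
  proof -
    have "(\<Sum>k\<le>?d. coeff P k * x ^ k) = 0" using P(3) by (simp add: poly_altdef)
    then have "(\<Sum>k<?d. coeff P k * x ^ k) + lead_coeff P * x ^ ?d = 0"
      by (simp add: lessThan_Suc_atMost[symmetric])
    then have "x ^ ?d = - (\<Sum>k<?d. coeff P k * x ^ k) / lead_coeff P"
      using P(2) by (simp add: field_simps eq_neg_iff_add_eq_0)
    also have "\<dots> = (\<Sum>k<?d. v k * x ^ k)"
      by (simp add: v_def sum_negf sum_divide_distrib)
    finally show ?thesis .
  qed
  ultimately show ?thesis using that by blast
qed

lemma fin_algebra_adjoin_alg:
  assumes F: "is_subfield F" and V: "fin_algebra F V" and "alg_over F x"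
  shows "\<exists>V'. fin_algebra F V' \<and> V \<subseteq> V' \<and> x \<in> V'"
proof -
  have FV: "F \<subseteq> V" using V by (auto simp: fin_algebra_def)
  obtain d v where "x ^ d = (\<Sum>k<d. v k * x ^ k)" "\<And>k. v k \<in> F"
    using alg_over_monic[OF F assms(3)] by blast
  then show ?thesis using FV by (intro fin_algebra_extend[OF F V]) auto
qed

lemma alg_over_base: assumes F: "is_subfield F" "x \<in> F" shows "alg_over F x"
  unfolding alg_over_def using F
  by (intro bexI[of _ "[:- x, 1:]"])
    (auto intro!: poly_over_pCons poly_over_0 is_subfield_imp_subring subfield_closed[OF F(1)])

section \<open>The relative algebraic closure and exchange\<close>

definition alg_closure_in :: "'l::field set \<Rightarrow> 'l set" where
  "alg_closure_in F = {x. alg_over F x}"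

text \<open>Two algebraic elements lie in a common finite algebra, hence so do their difference and
  product. For an inverse the reversed polynomial is used.\<close>

lemma is_subfield_alg_closure_in:
  assumes F: "is_subfield F" shows "is_subfield (alg_closure_in F)"
proof (rule is_subfieldI)
  have *: "x - y \<in> alg_closure_in F \<and> x * y \<in> alg_closure_in F" if xy: "alg_over F x" "alg_over F y" for x y
  proof -
    obtain V where V: "fin_algebra F V" "x \<in> V"
      using fin_algebra_adjoin_alg[OF F fin_algebra_self[OF F] xy(1)] by blast
    obtain V' where V': "fin_algebra F V'" "V \<subseteq> V'" "y \<in> V'"
      using fin_algebra_adjoin_alg[OF F V(1) xy(2)] by blast
    have R: "is_subring V'" using V' by (simp add: fin_algebra_def)
    have "x \<in> V'" using V V' by blast
    then show ?thesis using fin_algebra_alg[OF F V'(1)] subring_diff[OF R] subring_mult[OF R] V'(3)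
      by (simp add: alg_closure_in_def)
  qed
  show "is_subring (alg_closure_in F)"
    unfolding is_subring_def
  proof (intro conjI)
    show "1 \<in> alg_closure_in F"
      using alg_over_base[OF F subring_1[OF is_subfield_imp_subring[OF F]]] by (simp add: alg_closure_in_def)
    show "\<forall>x\<in>alg_closure_in F. \<forall>y\<in>alg_closure_in F. x - y \<in> alg_closure_in F \<and> x * y \<in> alg_closure_in F"
      using * by (simp add: alg_closure_in_def)
  qed
  fix x assume x: "x \<in> alg_closure_in F" "x \<noteq> 0"
  then obtain P where P: "P \<in> poly_over F" "P \<noteq> 0" "poly P x = 0"
    by (auto simp: alg_closure_in_def alg_over_def)
  have "reflect_poly P \<in> poly_over F" using P(1)
    by (auto simp: poly_over_def coeff_reflect_poly intro: subfield_closed[OF F])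
  moreover have "poly (reflect_poly P) (inverse x) = 0"
    using P(3) x(2) by (simp add: poly_reflect_poly_nz)
  moreover have "reflect_poly P \<noteq> 0" using P(2) by simp
  ultimately show "inverse x \<in> alg_closure_in F"
    unfolding alg_closure_in_def alg_over_def mem_Collect_eq by (intro bexI conjI)
qed

text \<open>The finitely many coefficients of a monic relation for \<open>x\<close> are adjoined one
  by one. This gives a finite algebra over \<open>F\<close>, to which \<open>x\<close> is then
  adjoined.\<close>

lemma alg_over_trans:
  assumes F: "is_subfield F" and x: "alg_over (alg_closure_in F) x"
  shows "alg_over F x"
proof -
  obtain d v where v: "x ^ d = (\<Sum>k<d. v k * x ^ k)" "\<And>k. v k \<in> alg_closure_in F"
    using alg_over_monic[OF is_subfield_alg_closure_in[OF F] x] by metis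
  have "\<exists>V. fin_algebra F V \<and> (\<forall>k<n. v k \<in> V)" for n
  proof (induction n)
    case 0
    show ?case using fin_algebra_self[OF F] by auto
  next
    case (Suc n)
    then obtain V where V: "fin_algebra F V" "\<forall>k<n. v k \<in> V" by blast
    have "alg_over F (v n)" using v(2) by (simp add: alg_closure_in_def)
    then obtain V' where "fin_algebra F V'" "V \<subseteq> V'" "v n \<in> V'"
      using fin_algebra_adjoin_alg[OF F V(1)] by blast
    then show ?case using V(2) less_Suc_eq by (intro exI[of _ V']) auto
  qed
  then obtain V where V: "fin_algebra F V" "\<forall>k<d. v k \<in> V" by blast
  then obtain V' where V': "fin_algebra F V'" "x \<in> V'"
    using fin_algebra_extend[OF F V(1) v(1)] by auto
  then show ?thesis using fin_algebra_alg[OF F] by blast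
qed

text \<open>After clearing denominators, a relation for \<open>x\<close> over \<open>F(y)\<close> is
  a polynomial relation between \<open>x\<close> and \<open>y\<close> over \<open>F\<close>, which
  is reread as a relation for \<open>y\<close> over \<open>F(x)\<close>. It does not degenerate: as
  \<open>x\<close> is transcendental over \<open>F\<close>, a coefficient that vanishes at
  \<open>x\<close> vanishes identically.\<close>

lemma alg_over_exchange:
  assumes F: "is_subfield F" and x: "alg_over (adjoin F {y}) x" "\<not> alg_over F x"
  shows "alg_over (adjoin F {x}) y"
proof -
  note R = is_subfield_imp_subring[OF F]
  obtain P where P: "P \<in> poly_over (adjoin F {y})" "P \<noteq> 0" "poly P x = 0"
    using x(1) by (auto simp: alg_over_def)
  obtain d where d: "d \<in> ring_adjoin F y" "d \<noteq> 0" "\<forall>i\<le>degree P. d * coeff P i \<in> ring_adjoin F y"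
    using common_denominator[OF is_subring_ring_adjoin[OF R], of "{..degree P}" "coeff P" y] P(1)
    unfolding adjoin_insert_eq_fracs[OF F] poly_over_def by auto
  then have "\<forall>i\<in>{..degree P}. \<exists>Q. Q \<in> poly_over F \<and> d * coeff P i = poly Q y"
    by (auto simp: ring_adjoin_def)
  then obtain Q where Q: "\<And>i. i \<le> degree P \<Longrightarrow> Q i \<in> poly_over F"
    "\<And>i. i \<le> degree P \<Longrightarrow> d * coeff P i = poly (Q i) y" by (metis atMost_iff)
  define S where "S = (\<Sum>i\<le>degree P. smult (x ^ i) (Q i))"
  have "poly S y = (\<Sum>i\<le>degree P. d * coeff P i * x ^ i)"
    by (simp add: S_def poly_sum Q(2) ac_simps)
  also have "\<dots> = d * poly P x" by (simp add: poly_altdef sum_distrib_left mult.assoc)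
  finally have Sy: "poly S y = 0" using P by simp
  have cS: "coeff S j = poly (\<Sum>i\<le>degree P. monom (coeff (Q i) j) i) x" for j
    by (simp add: S_def coeff_sum poly_sum poly_monom ac_simps)
  have "S \<in> poly_over (adjoin F {x})"
  proof -
    have xin: "x \<in> adjoin F {x}" using adjoin_gens[of "{x}" F] by simp
    have "coeff (Q i) j \<in> adjoin F {x}" if "i \<le> degree P" for i j
      using Q(1)[OF that] adjoin_base[of F "{x}"] by (auto simp: poly_over_def)
    then have "coeff S j \<in> adjoin F {x}" for j
      unfolding S_def coeff_sum coeff_smult using xin by (intro adjoin_closed) auto
    then show ?thesis by (simp add: poly_over_def)
  qed
  moreover have "S \<noteq> 0"
  proof
    assume S: "S = 0"
    define T where "T j = (\<Sum>i\<le>degree P. monom (coeff (Q i) j) i)" for j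
    have "T j \<in> poly_over F" for j
      unfolding T_def using Q(1) by (intro poly_over_sum poly_over_monom R) (auto simp: poly_over_def)
    moreover have "poly (T j) x = 0" for j using cS[of j] S by (simp add: T_def)
    ultimately have "T j = 0" for j using x(2) unfolding alg_over_def by blast
    moreover have "coeff (T j) i = (if i \<le> degree P then coeff (Q i) j else 0)" for i j
      by (simp add: T_def coeff_sum)
    ultimately have "coeff (Q i) j = 0" if "i \<le> degree P" for i j using that by (metis coeff_0)
    then have "Q (degree P) = 0" by (simp add: poly_eq_iff)
    then show False using Q(2)[of "degree P"] d(2) P(2) by simp
  qed
  ultimately show ?thesis using Sy unfolding alg_over_def by blast
qed

section \<open>Transcendence bases\<close>

text \<open>The closure operator of algebraic dependence over \<open>K\<close>. With
  \<open>acl_exchange\<close> as its exchange property, finite bases can be compared by cardinality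
  as in linear algebra.\<close>

definition acl :: "'l::field set \<Rightarrow> 'l set \<Rightarrow> 'l set" where
  "acl K S = alg_closure_in (adjoin K S)"

definition independent_over :: "'l::field set \<Rightarrow> 'l set \<Rightarrow> bool" where
  "independent_over K B \<longleftrightarrow> (\<forall>b\<in>B. b \<notin> acl K (B - {b}))"

lemma is_subfield_acl: "is_subfield (acl K S)"
  by (simp add: acl_def is_subfield_alg_closure_in is_subfield_adjoin)

lemma adjoin_subset_acl: "adjoin K S \<subseteq> acl K S"
  by (auto simp: acl_def alg_closure_in_def intro: alg_over_base is_subfield_adjoin)

lemma acl_gens: "S \<subseteq> acl K S"
  using adjoin_subset_acl adjoin_gens by blast

lemma acl_least: "S \<subseteq> acl K T \<Longrightarrow> acl K S \<subseteq> acl K T"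
proof
  fix x assume S: "S \<subseteq> acl K T" and x: "x \<in> acl K S"
  have "adjoin K S \<subseteq> acl K T"
    using S adjoin_subset_acl[of K T] adjoin_base[of K T] by (intro adjoin_least is_subfield_acl) auto
  then have "alg_over (acl K T) x" using x alg_over_mono by (auto simp: acl_def alg_closure_in_def)
  then show "x \<in> acl K T"
    using alg_over_trans[OF is_subfield_adjoin] by (auto simp: acl_def alg_closure_in_def)
qed

lemma acl_mono: "S \<subseteq> T \<Longrightarrow> acl K S \<subseteq> acl K T"
  by (rule acl_least) (use acl_gens in blast)

lemma acl_exchange:
  assumes "x \<in> acl K (insert y S)" "x \<notin> acl K S"
  shows "y \<in> acl K (insert x S)"
  using alg_over_exchange[OF is_subfield_adjoin, of K S y x] assms
  by (simp add: acl_def alg_closure_in_def adjoin_adjoin)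

text \<open>Steinitz exchange, by induction on the number of elements of \<open>Y\<close> outside
  \<open>B\<close>: each step replaces some \<open>b\<close> in \<open>B\<close> that is not in
  \<open>Y\<close> by an element of \<open>Y\<close>.\<close>

lemma independent_card_le:
  assumes "finite B" "finite Y" "independent_over K Y" "Y \<subseteq> acl K B"
  shows "card Y \<le> card B"
  using assms
proof (induction "card (Y - B)" arbitrary: B)
  case 0
  then show ?case by (simp add: card_mono)
next
  case (Suc n)
  then obtain x where x: "x \<in> Y" "x \<notin> B" by (metis DiffE card.empty ex_in_conv nat.distinct(1))
  \<comment> \<open>A minimal \<open>B0\<close> is chosen on which \<open>x\<close> depends together
    with \<open>Y \<inter> B\<close>. It is nonempty as \<open>Y\<close> is independent; by
    minimality it avoids \<open>Y\<close>, and each of its elements can be exchanged for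
    \<open>x\<close>.\<close>
  let ?A = "{B0. B0 \<subseteq> B \<and> x \<in> acl K ((Y \<inter> B) \<union> B0)}"
  have "x \<in> acl K B" using Suc.prems(4) x by blast
  then have "B \<in> ?A" by (simp add: Un_absorb1)
  moreover have "finite ?A" using Suc.prems(1) by simp
  ultimately obtain B0 where "B0 \<in> ?A" and min': "\<forall>B1\<in>?A. B1 \<subseteq> B0 \<longrightarrow> B0 = B1"
    using finite_has_minimal[of ?A] by blast
  then have B0: "B0 \<subseteq> B" "x \<in> acl K ((Y \<inter> B) \<union> B0)" by auto
  have min: "x \<notin> acl K ((Y \<inter> B) \<union> B1)" if "B1 \<subseteq> B0" "B1 \<noteq> B0" for B1
    using that B0(1) min' by blast
  have "x \<notin> acl K (Y \<inter> B)"
    using Suc.prems(3) x acl_mono[of "Y \<inter> B" "Y - {x}" K] by (auto simp: independent_over_def)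
  then have "B0 \<noteq> {}" using B0(2) by auto
  then obtain b where b: "b \<in> B0" by blast
  have "b \<notin> Y"
  proof
    assume "b \<in> Y"
    then have "(Y \<inter> B) \<union> (B0 - {b}) = (Y \<inter> B) \<union> B0" using b B0 by auto
    then show False using min[of "B0 - {b}"] B0(2) b by auto
  qed
  let ?S = "(Y \<inter> B) \<union> (B0 - {b})"
  have "x \<notin> acl K ?S" using min[of "B0 - {b}"] b by blast
  moreover have "insert b ?S = (Y \<inter> B) \<union> B0" using b by auto
  ultimately have bx: "b \<in> acl K (insert x ?S)" using B0(2) acl_exchange[of x K b ?S] by simp
  let ?B = "insert x (B - {b})"
  have "insert x ?S \<subseteq> ?B" using B0 \<open>b \<notin> Y\<close> by auto
  then have "b \<in> acl K ?B" using bx acl_mono by blast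
  then have "B \<subseteq> acl K ?B" using acl_gens[of ?B K] by blast
  then have "Y \<subseteq> acl K ?B" using Suc.prems(4) acl_least by blast
  moreover have "Y - ?B = Y - B - {x}" using \<open>b \<notin> Y\<close> by auto
  then have "card (Y - ?B) = n" using Suc x by simp
  moreover have "card ?B = card B" using x b B0 Suc.prems(1)
    by (metis Diff_iff card.insert card_Suc_Diff1 finite_Diff subsetD)
  ultimately show ?case using Suc by (metis finite_Diff finite_insert)
qed

text \<open>A redundant element of \<open>B\<close> could be removed without shrinking the closure,
  which would leave fewer than \<open>card Y\<close> elements whose closure contains
  \<open>Y\<close>.\<close>

lemma independent_if_card_le:
  assumes "finite B" "finite Y" "independent_over K Y" "Y \<subseteq> acl K B" "card B \<le> card Y"
  shows "independent_over K B"
  unfolding independent_over_def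
proof (intro ballI notI)
  fix b assume b: "b \<in> B" "b \<in> acl K (B - {b})"
  then have "B \<subseteq> acl K (B - {b})" using acl_gens[of "B - {b}" K] by blast
  then have "Y \<subseteq> acl K (B - {b})" using assms(4) acl_least by blast
  then have "card Y \<le> card (B - {b})" using assms independent_card_le by blast
  then show False using b assms by (meson card_Diff1_less leD le_trans)
qed

section \<open>Polynomial relations\<close>

definition eval_monom :: "'l monom \<Rightarrow> 'l::field" where
  "eval_monom m = (\<Prod>v\<in>Poly_Mapping.keys m. v ^ Poly_Mapping.lookup m v)"

lemma eval_monom_superset:
  assumes "finite A" "Poly_Mapping.keys m \<subseteq> A"
  shows "eval_monom m = (\<Prod>v\<in>A. v ^ Poly_Mapping.lookup m v)"
  unfolding eval_monom_def using assms by (intro prod.mono_neutral_left) (auto simp: in_keys_iff)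

lemma eval_monom_add: "eval_monom (m + m') = eval_monom m * eval_monom m'"
proof -
  let ?A = "Poly_Mapping.keys m \<union> Poly_Mapping.keys m'"
  have "Poly_Mapping.keys (m + m') \<subseteq> ?A" by (rule keys_add)
  then have "eval_monom (m + m') = (\<Prod>v\<in>?A. v ^ Poly_Mapping.lookup (m + m') v)"
    by (intro eval_monom_superset) auto
  also have "\<dots> = eval_monom m * eval_monom m'"
    by (subst (1 2) eval_monom_superset[of ?A]) (auto simp: lookup_add power_add prod.distrib)
  finally show ?thesis .
qed

lemma eval_monom_0 [simp]: "eval_monom 0 = 1"
  by (simp add: eval_monom_def)

lemma eval_monom_single [simp]: "eval_monom (Poly_Mapping.single v n) = v ^ n"
  by (cases "n = 0") (auto simp: eval_monom_def)

lemma eval_mpoly_superset: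
  assumes "finite A" "Poly_Mapping.keys P \<subseteq> A"
  shows "eval_mpoly P = (\<Sum>m\<in>A. Poly_Mapping.lookup P m * eval_monom m)"
  unfolding eval_mpoly_def eval_monom_def[symmetric]
  using assms by (intro sum.mono_neutral_left) (auto simp: in_keys_iff)

lemma eval_mpoly_add: "eval_mpoly (P + Q) = eval_mpoly P + eval_mpoly Q"
proof -
  let ?A = "Poly_Mapping.keys P \<union> Poly_Mapping.keys Q"
  have "Poly_Mapping.keys (P + Q) \<subseteq> ?A" by (rule keys_add)
  then have "eval_mpoly (P + Q) = (\<Sum>m\<in>?A. Poly_Mapping.lookup (P + Q) m * eval_monom m)"
    by (intro eval_mpoly_superset) auto
  also have "\<dots> = eval_mpoly P + eval_mpoly Q"
    by (subst (1 2) eval_mpoly_superset[of ?A]) (auto simp: lookup_add distrib_right sum.distrib)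
  finally show ?thesis .
qed

lemma eval_mpoly_0 [simp]: "eval_mpoly 0 = 0"
  by (simp add: eval_mpoly_def)

lemma eval_mpoly_single: "eval_mpoly (Poly_Mapping.single m c) = c * eval_monom m"
  by (cases "c = 0") (auto simp: eval_mpoly_def eval_monom_def)

lemma eval_mpoly_sum: "eval_mpoly (sum f I) = (\<Sum>i\<in>I. eval_mpoly (f i))"
  by (induction I rule: infinite_finite_induct) (auto simp: eval_mpoly_add)

lemma mpoly_sum_monomials:
  "P = (\<Sum>m\<in>Poly_Mapping.keys P. Poly_Mapping.single m (Poly_Mapping.lookup P m))"
  by (rule poly_mapping_eqI) (auto simp: lookup_sum lookup_single when_def in_keys_iff sum.delta)

lemma eval_mpoly_mult: "eval_mpoly (P * Q) = eval_mpoly P * eval_mpoly Q"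
proof -
  have "P * Q = (\<Sum>m\<in>Poly_Mapping.keys P. \<Sum>m'\<in>Poly_Mapping.keys Q.
      Poly_Mapping.single (m + m') (Poly_Mapping.lookup P m * Poly_Mapping.lookup Q m'))"
    by (subst mpoly_sum_monomials[of P], subst mpoly_sum_monomials[of Q])
      (simp add: sum_product mult_single)
  then have "eval_mpoly (P * Q) = (\<Sum>m\<in>Poly_Mapping.keys P. \<Sum>m'\<in>Poly_Mapping.keys Q.
      (Poly_Mapping.lookup P m * eval_monom m) * (Poly_Mapping.lookup Q m' * eval_monom m'))"
    by (simp add: eval_mpoly_sum eval_mpoly_single eval_monom_add ac_simps)
  also have "\<dots> = eval_mpoly P * eval_mpoly Q"
    unfolding eval_mpoly_def eval_monom_def[symmetric] by (simp add: sum_product)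
  finally show ?thesis .
qed

text \<open>Injectivity of \<open>f\<close> keeps summands from merging, so coefficients can be read
  off.\<close>

lemma lookup_sum_single:
  assumes "finite A" "inj_on f A" "a \<in> A"
  shows "Poly_Mapping.lookup (\<Sum>a\<in>A. Poly_Mapping.single (f a) (c a)) (f a) = c a"
proof -
  have "Poly_Mapping.lookup (\<Sum>a\<in>A. Poly_Mapping.single (f a) (c a)) (f a) = (\<Sum>b\<in>A. if b = a then c b else 0)"
    unfolding lookup_sum using assms by (intro sum.cong) (auto simp: lookup_single when_def dest: inj_onD)
  then show ?thesis using assms by simp
qed

definition mpoly_over :: "'l::field set \<Rightarrow> 'l set \<Rightarrow> ('l, 'l) mpoly set" where
  "mpoly_over K S = {P. \<forall>m\<in>Poly_Mapping.keys P. Poly_Mapping.lookup P m \<in> K \<and> Poly_Mapping.keys m \<subseteq> S}"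

lemma algebraically_independent_alt:
  "algebraically_independent K B \<longleftrightarrow> (\<forall>P\<in>mpoly_over K B. eval_mpoly P = 0 \<longrightarrow> P = 0)"
  unfolding algebraically_independent_def mpoly_over_def by blast

context
  fixes K :: "'l::field set"
  assumes K: "is_subfield K"
begin

lemma mpoly_over_lookup: "P \<in> mpoly_over K S \<Longrightarrow> Poly_Mapping.lookup P m \<in> K"
  unfolding mpoly_over_def using subfield_closed(1)[OF K]
  by (cases "m \<in> Poly_Mapping.keys P") (auto simp: in_keys_iff)

lemma mpoly_over_add:
  assumes "P \<in> mpoly_over K S" "Q \<in> mpoly_over K S"
  shows "P + Q \<in> mpoly_over K S"
proof -
  have "Poly_Mapping.lookup (P + Q) m \<in> K" for m
    using assms by (auto simp: lookup_add intro!: subfield_closed[OF K] mpoly_over_lookup)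
  moreover have "Poly_Mapping.keys m \<subseteq> S" if "m \<in> Poly_Mapping.keys (P + Q)" for m
    using that keys_add[of P Q] assms unfolding mpoly_over_def by blast
  ultimately show ?thesis unfolding mpoly_over_def by blast
qed

lemma mpoly_over_0: "0 \<in> mpoly_over K S"
  by (simp add: mpoly_over_def)

lemma mpoly_over_sum: "(\<And>i. i \<in> I \<Longrightarrow> f i \<in> mpoly_over K S) \<Longrightarrow> sum f I \<in> mpoly_over K S"
  by (induction I rule: infinite_finite_induct) (auto intro: mpoly_over_0 mpoly_over_add)

lemma mpoly_over_single:
  "c \<in> K \<Longrightarrow> Poly_Mapping.keys m \<subseteq> S \<Longrightarrow> Poly_Mapping.single m c \<in> mpoly_over K S"
  by (auto simp: mpoly_over_def)

lemma mpoly_over_uminus: "P \<in> mpoly_over K S \<Longrightarrow> - P \<in> mpoly_over K S"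
  by (auto simp: mpoly_over_def keys_minus lookup_uminus intro: subfield_closed[OF K])

lemma mpoly_over_mult:
  assumes "P \<in> mpoly_over K S" "Q \<in> mpoly_over K S"
  shows "P * Q \<in> mpoly_over K S"
proof -
  have eq: "P * Q = (\<Sum>m\<in>Poly_Mapping.keys P. \<Sum>m'\<in>Poly_Mapping.keys Q.
      Poly_Mapping.single (m + m') (Poly_Mapping.lookup P m * Poly_Mapping.lookup Q m'))"
    by (subst mpoly_sum_monomials[of P], subst mpoly_sum_monomials[of Q])
      (simp add: sum_product mult_single)
  have "Poly_Mapping.keys (m + m') \<subseteq> S" if "m \<in> Poly_Mapping.keys P" "m' \<in> Poly_Mapping.keys Q" for m m'
    using that keys_add[of m m'] assms unfolding mpoly_over_def by blast
  then show ?thesis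
    unfolding eq using assms
    by (intro mpoly_over_sum mpoly_over_single subfield_closed[OF K] mpoly_over_lookup) auto
qed

lemma eval_mpoly_uminus: "eval_mpoly (- P) = - eval_mpoly P"
  using eval_mpoly_add[of P "- P"] by (simp add: eq_neg_iff_add_eq_0 add.commute)

lemma is_subring_eval: "is_subring (eval_mpoly ` mpoly_over K S)"
  unfolding is_subring_def
proof (intro conjI ballI)
  show "1 \<in> eval_mpoly ` mpoly_over K S"
    by (rule image_eqI[of _ _ "Poly_Mapping.single 0 1"])
      (auto simp: eval_mpoly_single simp del: single_one intro!: mpoly_over_single subfield_closed[OF K])
  fix x y assume "x \<in> eval_mpoly ` mpoly_over K S" "y \<in> eval_mpoly ` mpoly_over K S"
  then obtain P Q where *: "x = eval_mpoly P" "y = eval_mpoly Q" "P \<in> mpoly_over K S" "Q \<in> mpoly_over K S"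
    by auto
  show "x - y \<in> eval_mpoly ` mpoly_over K S"
    using * by (intro image_eqI[of _ _ "P + - Q"])
      (auto simp: eval_mpoly_add eval_mpoly_uminus simp del: add_uminus_conv_diff
        intro!: mpoly_over_add mpoly_over_uminus)
  show "x * y \<in> eval_mpoly ` mpoly_over K S"
    using * by (intro image_eqI[of _ _ "P * Q"]) (auto simp: eval_mpoly_mult intro!: mpoly_over_mult)
qed

lemma adjoin_eq_fracs_eval: "adjoin K S = fracs (eval_mpoly ` mpoly_over K S)"
proof (rule adjoin_eq_fracs)
  show "is_subring (eval_mpoly ` mpoly_over K S)" by (rule is_subring_eval)
  show "K \<union> S \<subseteq> eval_mpoly ` mpoly_over K S"
  proof
    fix x assume "x \<in> K \<union> S"
    then show "x \<in> eval_mpoly ` mpoly_over K S"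
    proof
      assume "x \<in> K"
      then show ?thesis by (intro image_eqI[of _ _ "Poly_Mapping.single 0 x"])
        (auto simp: eval_mpoly_single intro!: mpoly_over_single)
    next
      assume "x \<in> S"
      then show ?thesis by (intro image_eqI[of _ _ "Poly_Mapping.single (Poly_Mapping.single x 1) 1"])
        (auto simp: eval_mpoly_single intro!: mpoly_over_single subfield_closed[OF K])
    qed
  qed
  have "eval_mpoly P \<in> adjoin K S" if P: "P \<in> mpoly_over K S" for P
  proof -
    have "v \<in> adjoin K S" if "m \<in> Poly_Mapping.keys P" "v \<in> Poly_Mapping.keys m" for m v
      using that P adjoin_gens[of S K] unfolding mpoly_over_def by blast
    moreover have "Poly_Mapping.lookup P m \<in> adjoin K S" for m
      using mpoly_over_lookup[OF P] adjoin_base by blast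
    ultimately show ?thesis unfolding eval_mpoly_def by (auto intro!: adjoin_closed)
  qed
  then show "eval_mpoly ` mpoly_over K S \<subseteq> adjoin K S" by blast
qed

text \<open>Clearing denominators in a relation for \<open>b\<close> over the remaining elements
  gives polynomials \<open>Q i\<close> in those elements. They are reassembled into one polynomial
  \<open>M\<close> as the coefficients of \<open>b ^ i\<close>; no two terms merge because
  \<open>b\<close> occurs in none of the \<open>Q i\<close>.\<close>

lemma independent_over_if_algebraically_independent:
  assumes ai: "algebraically_independent K S"
  shows "independent_over K S"
  unfolding independent_over_def
proof (intro ballI notI)
  fix b assume b: "b \<in> S" and "b \<in> acl K (S - {b})"
  then obtain P where P: "P \<in> poly_over (adjoin K (S - {b}))" "P \<noteq> 0" "poly P b = 0"
    by (auto simp: acl_def alg_closure_in_def alg_over_def)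
  let ?M = "mpoly_over K (S - {b})"
  have ring: "is_subring (eval_mpoly ` ?M)" by (rule is_subring_eval)
  obtain d where d: "d \<noteq> 0" "\<forall>i\<le>degree P. d * coeff P i \<in> eval_mpoly ` ?M"
    using common_denominator[OF ring, of "{..degree P}" "coeff P"] P(1)
    unfolding adjoin_eq_fracs_eval poly_over_def by auto
  then have "\<forall>i\<in>{..degree P}. \<exists>Q. Q \<in> ?M \<and> d * coeff P i = eval_mpoly Q" by auto
  then obtain Q where Q: "\<And>i. i \<le> degree P \<Longrightarrow> Q i \<in> ?M"
    "\<And>i. i \<le> degree P \<Longrightarrow> d * coeff P i = eval_mpoly (Q i)" by (metis atMost_iff)
  define A where "A = (SIGMA i:{..degree P}. Poly_Mapping.keys (Q i))"
  define f where "f = (\<lambda>(i, m). m + Poly_Mapping.single b i :: 'l monom)"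
  define c where "c = (\<lambda>(i, m). Poly_Mapping.lookup (Q i) m)"
  have bm: "Poly_Mapping.lookup m b = 0" "Poly_Mapping.keys m \<subseteq> S" if "(i, m) \<in> A" for i m
  proof -
    have "Poly_Mapping.keys m \<subseteq> S - {b}" using that Q(1)[of i] unfolding A_def mpoly_over_def by auto
    then have "b \<notin> Poly_Mapping.keys m" "Poly_Mapping.keys m \<subseteq> S" by auto
    then show "Poly_Mapping.lookup m b = 0" "Poly_Mapping.keys m \<subseteq> S"
      unfolding in_keys_iff by auto
  qed
  have "inj_on f A"
  proof (rule inj_onI, clarify)
    fix i m j m' assume *: "(i, m) \<in> A" "(j, m') \<in> A" "f (i, m) = f (j, m')"
    then have "Poly_Mapping.lookup (m + Poly_Mapping.single b i) b = Poly_Mapping.lookup (m' + Poly_Mapping.single b j) b"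
      by (simp add: f_def)
    then have "i = j" using bm * by (simp add: lookup_add)
    then show "i = j \<and> m = m'" using * by (simp add: f_def)
  qed
  have fin: "finite A" by (simp add: A_def)
  define M where "M = (\<Sum>a\<in>A. Poly_Mapping.single (f a) (c a))"
  have keys_f: "Poly_Mapping.keys (f a) \<subseteq> S" if a: "a \<in> A" for a
  proof -
    obtain i m where im: "a = (i, m)" by force
    have "Poly_Mapping.keys (f a) \<subseteq> Poly_Mapping.keys m \<union> Poly_Mapping.keys (Poly_Mapping.single b i)"
      unfolding im f_def using keys_add[of m "Poly_Mapping.single b i"] by simp
    then show ?thesis using bm(2)[of i m] a b unfolding im by (auto split: if_splits)
  qed
  have "M \<in> mpoly_over K S"
    unfolding M_def using Q(1) keys_f
    by (intro mpoly_over_sum mpoly_over_single) (auto simp: c_def A_def intro: mpoly_over_lookup)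
  moreover have "eval_mpoly M = 0"
  proof -
    have "eval_mpoly M = (\<Sum>a\<in>A. c a * eval_monom (f a))"
      by (simp add: M_def eval_mpoly_sum eval_mpoly_single)
    also have "\<dots> = (\<Sum>i\<le>degree P. \<Sum>m\<in>Poly_Mapping.keys (Q i). Poly_Mapping.lookup (Q i) m * (eval_monom m * b ^ i))"
      unfolding A_def by (subst sum.Sigma) (auto simp: c_def f_def eval_monom_add intro!: sum.cong)
    also have "\<dots> = (\<Sum>i\<le>degree P. eval_mpoly (Q i) * b ^ i)"
      by (simp add: eval_mpoly_def eval_monom_def sum_distrib_right mult.assoc)
    also have "\<dots> = d * poly P b" using Q(2)
      by (simp add: poly_altdef sum_distrib_left mult.assoc[symmetric])
    finally show ?thesis using P(3) by simp
  qed
  ultimately have "M = 0" using ai unfolding algebraically_independent_alt by blast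
  then have c0: "c a = 0" if "a \<in> A" for a
    using lookup_sum_single[OF fin \<open>inj_on f A\<close> that, of c] by (simp add: M_def)
  have "m \<notin> Poly_Mapping.keys (Q (degree P))" for m
  proof
    assume m: "m \<in> Poly_Mapping.keys (Q (degree P))"
    then have "(degree P, m) \<in> A" by (simp add: A_def)
    then have "c (degree P, m) = 0" by (rule c0)
    then show False using m by (simp add: c_def in_keys_iff)
  qed
  then have "Q (degree P) = 0" by (metis all_not_in_conv keys_eq_empty)
  then show False using Q(2)[of "degree P"] d(1) P(2) by simp
qed

text \<open>A polynomial relation is sorted by powers of \<open>b\<close>. As \<open>b\<close> is
  transcendental over the rest, every coefficient evaluates to zero, and the induction hypothesis
  makes it the zero polynomial.\<close>

lemma algebraically_independent_if_independent_over:
  assumes "finite B" "independent_over K B"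
  shows "algebraically_independent K B"
  using assms
proof (induction B rule: finite_induct)
  case empty
  show ?case unfolding algebraically_independent_alt
  proof (intro ballI impI)
    fix P :: "('l, 'l) mpoly" assume P: "P \<in> mpoly_over K {}" "eval_mpoly P = 0"
    have "Poly_Mapping.keys P \<subseteq> {0}" using P(1) by (auto simp: mpoly_over_def)
    then have "Poly_Mapping.lookup P 0 = 0"
      using P(2) eval_mpoly_superset[of "{0}" P] by simp
    moreover have "Poly_Mapping.lookup P m = 0" if "m \<noteq> 0" for m
      using that \<open>Poly_Mapping.keys P \<subseteq> {0}\<close> by (auto simp: in_keys_iff)
    ultimately show "P = 0" by (intro poly_mapping_eqI) (metis lookup_zero)
  qed
next
  case (insert b B)
  have bB: "b \<notin> acl K B" using insert by (auto simp: independent_over_def)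
  have "independent_over K B"
    unfolding independent_over_def
  proof (intro ballI notI)
    fix x assume x: "x \<in> B" "x \<in> acl K (B - {x})"
    then have "x \<in> acl K (insert b B - {x})" using acl_mono[of "B - {x}" "insert b B - {x}" K] by blast
    then show False using insert.prems x by (auto simp: independent_over_def)
  qed
  then have ai: "algebraically_independent K B" by (rule insert.IH)
  show ?case unfolding algebraically_independent_alt
  proof (intro ballI impI)
    fix P :: "('l, 'l) mpoly" assume P: "P \<in> mpoly_over K (insert b B)" "eval_mpoly P = 0"
    \<comment> \<open>\<open>r\<close> strips the variable \<open>b\<close> from a monomial,
      \<open>A i\<close> collects the terms of degree \<open>i\<close> in \<open>b\<close>, and
      \<open>Q i\<close> is the coefficient of \<open>b ^ i\<close>. The \<open>0\<close> inserted
      into the maximum covers the zero polynomial.\<close>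
    define r where "r m = Poly_Mapping.update b 0 m" for m :: "'l monom"
    define A where "A i = {m \<in> Poly_Mapping.keys P. Poly_Mapping.lookup m b = i}" for i
    define Q where "Q i = (\<Sum>m\<in>A i. Poly_Mapping.single (r m) (Poly_Mapping.lookup P m))" for i
    define n where "n = Max (insert 0 ((\<lambda>m. Poly_Mapping.lookup m b) ` Poly_Mapping.keys P))"
    have fin: "finite (A i)" for i by (simp add: A_def)
    have mr: "m = r m + Poly_Mapping.single b (Poly_Mapping.lookup m b)" for m
      by (rule poly_mapping_eqI) (auto simp: r_def lookup_add lookup_update lookup_single when_def)
    have keys_r: "Poly_Mapping.keys (r m) = Poly_Mapping.keys m - {b}" for m
      by (simp add: r_def keys_update)
    have Qin: "Q i \<in> mpoly_over K B" for i
    proof -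
      have "Poly_Mapping.keys (r m) \<subseteq> B" if "m \<in> A i" for m
        using that P(1) unfolding keys_r A_def mpoly_over_def by auto
      then show ?thesis unfolding Q_def
        by (intro mpoly_over_sum mpoly_over_single mpoly_over_lookup[OF P(1)])
    qed
    have keysP: "Poly_Mapping.keys P = (\<Union>i\<in>{..n}. A i)"
      by (auto simp: A_def n_def intro!: Max_ge)
    have "eval_mpoly P = (\<Sum>m\<in>(\<Union>i\<in>{..n}. A i). Poly_Mapping.lookup P m * eval_monom m)"
      unfolding keysP[symmetric] by (simp add: eval_mpoly_def eval_monom_def)
    also have "\<dots> = (\<Sum>i\<le>n. \<Sum>m\<in>A i. Poly_Mapping.lookup P m * eval_monom m)"
      by (rule sum.UNION_disjoint) (auto simp: A_def)
    also have "\<dots> = (\<Sum>i\<le>n. eval_mpoly (Q i) * b ^ i)"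
    proof (rule sum.cong[OF HOL.refl])
      fix i
      have "eval_monom m = eval_monom (r m) * b ^ i" if "m \<in> A i" for m
        by (subst mr[of m]) (use that in \<open>simp add: eval_monom_add A_def\<close>)
      then show "(\<Sum>m\<in>A i. Poly_Mapping.lookup P m * eval_monom m) = eval_mpoly (Q i) * b ^ i"
        by (simp add: Q_def eval_mpoly_sum eval_mpoly_single sum_distrib_right mult.assoc)
    qed
    finally have eq: "(\<Sum>i\<le>n. eval_mpoly (Q i) * b ^ i) = 0" using P(2) by simp
    define p where "p = (\<Sum>i\<le>n. monom (eval_mpoly (Q i)) i)"
    have cp: "coeff p i = (if i \<le> n then eval_mpoly (Q i) else 0)" for i
      by (simp add: p_def coeff_sum)
    have "eval_mpoly (Q i) \<in> adjoin K B" for i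
      using Qin[of i] adjoin_eq_fracs_eval[of B] subset_fracs adjoin_closed(1)
    proof -
      have "v \<in> adjoin K B" if "m \<in> Poly_Mapping.keys (Q i)" "v \<in> Poly_Mapping.keys m" for m v
        using that Qin[of i] adjoin_gens[of B K] unfolding mpoly_over_def by blast
      moreover have "Poly_Mapping.lookup (Q i) m \<in> adjoin K B" for m
        using mpoly_over_lookup[OF Qin[of i]] adjoin_base by blast
      ultimately show ?thesis unfolding eval_mpoly_def by (auto intro!: adjoin_closed)
    qed
    then have "p \<in> poly_over (adjoin K B)" by (auto simp: poly_over_def cp intro: adjoin_closed)
    moreover have "poly p b = 0" using eq by (simp add: p_def poly_sum poly_monom)
    ultimately have "p = 0" using bB by (auto simp: acl_def alg_closure_in_def alg_over_def)
    then have "eval_mpoly (Q i) = 0" if "i \<le> n" for i using cp[of i] that by simp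
    then have Q0: "Q i = 0" if "i \<le> n" for i
      using ai Qin that unfolding algebraically_independent_alt by blast
    have "Poly_Mapping.lookup P m = 0" if "m \<in> Poly_Mapping.keys P" for m
    proof -
      let ?i = "Poly_Mapping.lookup m b"
      have "?i \<le> n" using that by (auto simp: n_def)
      moreover have "inj_on r (A ?i)"
      proof (rule inj_onI)
        fix x y assume "x \<in> A ?i" "y \<in> A ?i" "r x = r y"
        then show "x = y" using mr[of x] mr[of y] by (simp add: A_def)
      qed
      moreover have "m \<in> A ?i" using that by (simp add: A_def)
      ultimately show ?thesis
        using lookup_sum_single[OF fin, of r ?i m "Poly_Mapping.lookup P"] Q0[of ?i] by (simp add: Q_def)
    qed
    then have "Poly_Mapping.lookup P m = 0" for m by (metis in_keys_iff)
    then show "P = 0" by (simp add: poly_mapping_eqI)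
  qed
qed

end

section \<open>Rational functions\<close>

lemma ratfun_const_hom:
  "ratfun_const (a + b) = ratfun_const a + (ratfun_const b :: ('v, 'k::field) ratfun)"
  "ratfun_const (a * b) = ratfun_const a * (ratfun_const b :: ('v, 'k::field) ratfun)"
  "ratfun_const 0 = (0 :: ('v, 'k::field) ratfun)"
  "ratfun_const 1 = (1 :: ('v, 'k::field) ratfun)"
  by (simp_all add: ratfun_const_def single_add mult_single fract_collapse)

lemma ratfun_const_diff: "ratfun_const (a - b) = ratfun_const a - (ratfun_const b :: ('v, 'k::field) ratfun)"
  unfolding eq_diff_eq ratfun_const_hom(1)[symmetric] by simp

lemma ratfun_const_inverse: "ratfun_const (inverse a) = inverse (ratfun_const a :: ('v, 'k::field) ratfun)"
proof (cases "a = 0")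
  case False
  then have "ratfun_const a * ratfun_const (inverse a) = (1 :: ('v, 'k) ratfun)"
    by (simp add: ratfun_const_hom[symmetric])
  then show ?thesis by (metis inverse_unique)
qed (simp add: ratfun_const_hom)

lemma is_subfield_base_field: "is_subfield (base_field :: ('v, 'k::field) ratfun set)"
  unfolding is_subfield_def
proof (intro conjI ballI)
  show "1 \<in> base_field" by (rule range_eqI[of _ _ 1]) (simp add: ratfun_const_hom)
qed (auto simp: ratfun_const_diff[symmetric] ratfun_const_hom(2)[symmetric] ratfun_const_inverse[symmetric])

lemma ratfun_const_eq_0: "ratfun_const c = (0 :: ('v, 'k::field) ratfun) \<longleftrightarrow> c = 0"
proof
  assume "ratfun_const c = (0 :: ('v, 'k) ratfun)"
  then have "ratfun_const (c * inverse c) = (0 :: ('v, 'k) ratfun)" by (simp only: ratfun_const_hom mult_zero_left)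
  then show "c = 0" by (metis ratfun_const_hom(4) right_inverse zero_neq_one)
qed (simp add: ratfun_const_hom)

lemma ratfun_const_power: "ratfun_const (a ^ n) = (ratfun_const a :: ('v, 'k::field) ratfun) ^ n"
  by (induction n) (simp_all add: ratfun_const_hom)

lemma ratfun_const_of_nat: "ratfun_const (of_nat n) = (of_nat n :: ('v, 'k::field) ratfun)"
  by (induction n) (simp_all add: ratfun_const_hom)

lemma inj_ratfun_var: "inj (ratfun_var :: 'v \<Rightarrow> ('v, 'k::field) ratfun)"
proof (rule injI)
  fix v w :: 'v assume "(ratfun_var v :: ('v, 'k) ratfun) = ratfun_var w"
  then have "Poly_Mapping.single (Poly_Mapping.single (Var v) (1::nat)) (1::'k) =
      Poly_Mapping.single (Poly_Mapping.single (Var w) 1) 1"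
    by (simp add: ratfun_var_def eq_fract)
  then have "Poly_Mapping.keys (Poly_Mapping.single (Poly_Mapping.single (Var v) (1::nat)) (1::'k)) =
      Poly_Mapping.keys (Poly_Mapping.single (Poly_Mapping.single (Var w) 1) (1::'k))" by simp
  then have "Poly_Mapping.single (Var v) (1::nat) = Poly_Mapping.single (Var w) 1" by simp
  then have "Poly_Mapping.keys (Poly_Mapping.single (Var v) (1::nat)) =
      Poly_Mapping.keys (Poly_Mapping.single (Var w) (1::nat))" by simp
  then show "v = w" by simp
qed

text \<open>A polynomial whose variables are the field elements \<open>ratfun_var v\<close> is
  pulled back along the injection \<open>g\<close> to a polynomial in the formal variables. Its
  value is the image of that polynomial in the fraction field, and this embedding is
  injective.\<close>

lemma algebraically_independent_ratfun_var:
  "algebraically_independent base_field (ratfun_var ` A :: ('v, 'k::field) ratfun set)"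
  unfolding algebraically_independent_alt
proof (intro ballI impI)
  fix P :: "(('v, 'k) ratfun, ('v, 'k) ratfun) mpoly"
  assume P: "P \<in> mpoly_over base_field (ratfun_var ` A)" "eval_mpoly P = 0"
  define emb where "emb Q = Fract Q 1" for Q :: "('v var, 'k) mpoly"
  have emb: "emb (a + b) = emb a + emb b" "emb (a * b) = emb a * emb b" "emb 0 = 0" "emb 1 = 1" for a b
    by (simp_all add: emb_def fract_collapse)
  have emb_eq_0: "emb a = 0 \<longleftrightarrow> a = 0" for a by (simp add: emb_def Zero_fract_def eq_fract)
  have emb_sum: "emb (sum f I) = (\<Sum>i\<in>I. emb (f i))" for f and I :: "(('v, 'k) ratfun monom) set"
    by (induction I rule: infinite_finite_induct) (auto simp: emb)
  have emb_prod: "emb (prod f I) = (\<Prod>i\<in>I. emb (f i))" for f and I :: "('v var) set"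
    by (induction I rule: infinite_finite_induct) (auto simp: emb)
  have emb_power: "emb (a ^ n) = emb a ^ n" for a n by (induction n) (auto simp: emb)
  define g :: "'v var \<Rightarrow> ('v, 'k) ratfun" where "g = (\<lambda>v. case v of Var w \<Rightarrow> ratfun_var w)"
  have inj_g: "inj g" using inj_ratfun_var by (auto simp: inj_def g_def split: var.splits)
  have g_emb: "g v = emb (Poly_Mapping.single (Poly_Mapping.single v 1) 1)" for v
    by (simp add: g_def emb_def ratfun_var_def split: var.splits)
  have range_g: "range g = range ratfun_var"
  proof -
    have "ratfun_var w = g (Var w)" for w by (simp add: g_def)
    moreover have "\<exists>w. g v = ratfun_var w" for v by (cases v) (auto simp: g_def)
    ultimately show ?thesis by (auto simp: image_iff)
  qed
  define f where "f m = Poly_Mapping.map_key g m" for m :: "('v, 'k) ratfun monom"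
  have lookup_f: "Poly_Mapping.lookup (f m) v = Poly_Mapping.lookup m (g v)" for m v
    by (simp add: f_def map_key.rep_eq[OF inj_g])
  have single_power: "Poly_Mapping.single (Poly_Mapping.single v 1) (1::'k) ^ n = Poly_Mapping.single (Poly_Mapping.single v n) 1"
    for v :: "'v var" and n :: nat
    by (induction n) (simp_all add: mult_single single_add[symmetric])
  have single_prod: "(\<Prod>v\<in>I. Poly_Mapping.single (h v) (1::'k)) = Poly_Mapping.single (\<Sum>v\<in>I. h v) 1"
    for I :: "'v var set" and h :: "_ \<Rightarrow> 'v var monom"
    by (induction I rule: infinite_finite_induct) (auto simp: mult_single)
  have mono: "eval_monom m = emb (Poly_Mapping.single (f m) 1)" if "Poly_Mapping.keys m \<subseteq> range g" for m
  proof -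
    have k: "Poly_Mapping.keys m = g ` Poly_Mapping.keys (f m)"
      using that by (auto simp: in_keys_iff lookup_f)
    have "eval_monom m = (\<Prod>v\<in>Poly_Mapping.keys (f m). g v ^ Poly_Mapping.lookup (f m) v)"
      unfolding eval_monom_def k using inj_g by (subst prod.reindex) (auto simp: lookup_f inj_on_def)
    also have "\<dots> = emb (\<Prod>v\<in>Poly_Mapping.keys (f m). Poly_Mapping.single (Poly_Mapping.single v (Poly_Mapping.lookup (f m) v)) 1)"
      by (simp only: g_emb emb_prod emb_power[symmetric] single_power)
    also have "\<dots> = emb (Poly_Mapping.single (f m) 1)"
      by (simp add: single_prod mpoly_sum_monomials[symmetric])
    finally show ?thesis .
  qed
  have keysm: "Poly_Mapping.keys m \<subseteq> range g" if "m \<in> Poly_Mapping.keys P" for m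
    using that P(1) unfolding range_g mpoly_over_def by blast
  have inj_f: "inj_on f (Poly_Mapping.keys P)"
  proof (rule inj_onI)
    fix x y assume xy: "x \<in> Poly_Mapping.keys P" "y \<in> Poly_Mapping.keys P" "f x = f y"
    have "Poly_Mapping.lookup x w = Poly_Mapping.lookup y w" for w
    proof (cases "w \<in> range g")
      case True
      then show ?thesis using xy(3) lookup_f by (metis imageE)
    next
      case False
      then have "w \<notin> Poly_Mapping.keys x" "w \<notin> Poly_Mapping.keys y" using xy keysm by blast+
      then show ?thesis by (simp add: in_keys_iff)
    qed
    then show "x = y" by (rule poly_mapping_eqI)
  qed
  have "\<forall>m\<in>Poly_Mapping.keys P. \<exists>c. Poly_Mapping.lookup P m = ratfun_const c"
    using P(1) unfolding mpoly_over_def by blast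
  then obtain c where c: "\<And>m. m \<in> Poly_Mapping.keys P \<Longrightarrow> Poly_Mapping.lookup P m = ratfun_const (c m)"
    by metis
  have "eval_mpoly P = (\<Sum>m\<in>Poly_Mapping.keys P. emb (Poly_Mapping.single (f m) (c m)))"
    unfolding eval_mpoly_def eval_monom_def[symmetric]
  proof (intro sum.cong HOL.refl)
    fix m assume m: "m \<in> Poly_Mapping.keys P"
    then show "Poly_Mapping.lookup P m * eval_monom m = emb (Poly_Mapping.single (f m) (c m))"
      using mono[OF keysm[OF m]]
      by (simp add: c ratfun_const_def emb_def mult_single)
  qed
  then have "(\<Sum>m\<in>Poly_Mapping.keys P. Poly_Mapping.single (f m) (c m)) = 0"
    using P(2) by (simp add: emb_sum[symmetric] emb_eq_0)
  then have "c m = 0" if "m \<in> Poly_Mapping.keys P" for m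
    using lookup_sum_single[OF finite_keys inj_f that, of c] by simp
  then have "Poly_Mapping.lookup P m = 0" for m
    using c[of m] by (metis in_keys_iff ratfun_const_hom(3))
  then show "P = 0" by (simp add: poly_mapping_eqI)
qed

section \<open>Finite groups acting on a field\<close>

text \<open>The action is on the whole field type. Intermediate fields are subsets, and
  \<open>stable\<close> marks those that the group maps into themselves, so that no restricted
  action has to be formed.\<close>

locale field_action = group G for G :: "('a, 'b) monoid_scheme" (structure) +
  fixes \<rho> :: "'a \<Rightarrow> 'l::field \<Rightarrow> 'l" and K :: "'l set"
  assumes finite_carrier: "finite (carrier G)" and K: "is_subfield K"
    and rho_add: "g \<in> carrier G \<Longrightarrow> \<rho> g (x + y) = \<rho> g x + \<rho> g y"
    and rho_mult: "g \<in> carrier G \<Longrightarrow> \<rho> g (x * y) = \<rho> g x * \<rho> g y"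
    and rho_comp: "g \<in> carrier G \<Longrightarrow> h \<in> carrier G \<Longrightarrow> \<rho> (g \<otimes> h) x = \<rho> g (\<rho> h x)"
    and rho_one: "\<rho> \<one> x = x"
    and rho_K: "g \<in> carrier G \<Longrightarrow> k \<in> K \<Longrightarrow> \<rho> g k = k"
begin

lemma rho_inv:
  assumes "g \<in> carrier G"
  shows "\<rho> (inv g) (\<rho> g x) = x" "\<rho> g (\<rho> (inv g) x) = x"
  using assms by (simp_all add: rho_comp[symmetric] rho_one)

context
  fixes g assumes g: "g \<in> carrier G"
begin

lemma rho_0: "\<rho> g 0 = 0"
  using rho_K[OF g] subfield_closed(1)[OF K] by blast

lemma rho_1: "\<rho> g 1 = 1"
  using rho_K[OF g] subfield_closed(2)[OF K] by blast

lemma rho_uminus: "\<rho> g (- x) = - \<rho> g x"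
  using rho_add[OF g, of x "- x"] rho_0 by (simp add: eq_neg_iff_add_eq_0 add.commute)

lemma rho_diff: "\<rho> g (x - y) = \<rho> g x - \<rho> g y"
  using rho_add[OF g, of x "- y"] rho_uminus by simp

lemma rho_eq_0: "\<rho> g x = 0 \<longleftrightarrow> x = 0"
  using rho_inv(1)[OF g, of x] rho_inv(1)[OF g, of 0] rho_0 by metis

lemma rho_inverse: "\<rho> g (inverse x) = inverse (\<rho> g x)"
proof (cases "x = 0")
  case False
  then have "\<rho> g x * \<rho> g (inverse x) = 1" by (simp add: rho_mult[OF g, symmetric] rho_1)
  then show ?thesis by (metis inverse_unique)
qed (simp add: rho_0)

lemma rho_divide: "\<rho> g (x / y) = \<rho> g x / \<rho> g y"
  by (simp add: divide_inverse rho_mult[OF g] rho_inverse)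

lemma rho_power: "\<rho> g (x ^ n) = \<rho> g x ^ n"
  by (induction n) (auto simp: rho_1 rho_mult[OF g])

lemma rho_sum: "\<rho> g (sum f I) = (\<Sum>i\<in>I. \<rho> g (f i))"
  by (induction I rule: infinite_finite_induct) (auto simp: rho_0 rho_add[OF g])

lemma rho_prod: "\<rho> g (prod f I) = (\<Prod>i\<in>I. \<rho> g (f i))"
  by (induction I rule: infinite_finite_induct) (auto simp: rho_1 rho_mult[OF g])

lemmas rho_hom = rho_0 rho_1 rho_add[OF g] rho_uminus rho_diff rho_mult[OF g] rho_inverse rho_divide
  rho_power rho_sum rho_prod

lemma map_poly_rho_mult: "map_poly (\<rho> g) (P * Q) = map_poly (\<rho> g) P * map_poly (\<rho> g) Q"
  by (rule poly_eqI) (simp add: coeff_map_poly rho_hom coeff_mult)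

lemma map_poly_rho_prod: "map_poly (\<rho> g) (prod f I) = (\<Prod>i\<in>I. map_poly (\<rho> g) (f i))"
  by (induction I rule: infinite_finite_induct) (auto simp: rho_hom map_poly_rho_mult map_poly_1)

lemma rho_poly: "\<rho> g (poly P x) = poly (map_poly (\<rho> g) P) (\<rho> g x)"
  by (induction P) (auto simp: rho_hom map_poly_pCons)

text \<open>The preimage of a subfield under an automorphism is a subfield, so it is enough to check
  generators.\<close>

lemma rho_adjoin_subset:
  assumes "\<And>x. x \<in> F \<Longrightarrow> \<rho> g x \<in> E" "\<And>x. x \<in> S \<Longrightarrow> \<rho> g x \<in> E" "is_subfield E" "x \<in> adjoin F S"
  shows "\<rho> g x \<in> E"
proof -
  have "is_subfield {x. \<rho> g x \<in> E}"
    unfolding is_subfield_def by (auto simp: rho_hom intro!: subfield_closed[OF assms(3)])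
  then have "adjoin F S \<subseteq> {x. \<rho> g x \<in> E}"
    using assms by (intro adjoin_least) auto
  then show ?thesis using assms(4) by blast
qed

lemma rho_adjoin_fixed:
  assumes "\<And>x. x \<in> F \<Longrightarrow> \<rho> g x = x" "\<And>x. x \<in> S \<Longrightarrow> \<rho> g x = x" "x \<in> adjoin F S"
  shows "\<rho> g x = x"
proof -
  have "is_subfield {x. \<rho> g x = x}"
    unfolding is_subfield_def by (auto simp: rho_hom)
  then have "adjoin F S \<subseteq> {x. \<rho> g x = x}"
    using assms by (intro adjoin_least) auto
  then show ?thesis using assms(3) by blast
qed

end

lemma rho_pow_Suc:
  assumes "s \<in> carrier G" shows "\<rho> (s [^] Suc n) x = \<rho> s (\<rho> (s [^] n) x)"
proof -
  have "s [^] Suc n = s \<otimes> s [^] n" using assms by (metis nat_pow_Suc2)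
  then show ?thesis using assms by (simp add: rho_comp)
qed

definition fixed_by :: "'a set \<Rightarrow> 'l set \<Rightarrow> 'l set" where
  "fixed_by H F = {x \<in> F. \<forall>h\<in>H. \<rho> h x = x}"

definition stable :: "'l set \<Rightarrow> bool" where
  "stable F \<longleftrightarrow> (\<forall>g\<in>carrier G. \<forall>x\<in>F. \<rho> g x \<in> F)"

lemma is_subfield_fixed_by:
  assumes "is_subfield F" "H \<subseteq> carrier G" shows "is_subfield (fixed_by H F)"
  using assms(2) unfolding is_subfield_def fixed_by_def
  by (auto simp: rho_hom subset_iff intro: subfield_closed[OF assms(1)])

lemma fixed_by_subset: "fixed_by H F \<subseteq> F"
  by (auto simp: fixed_by_def)

lemma stable_adjoin:
  assumes "stable F" "\<And>g x. g \<in> carrier G \<Longrightarrow> x \<in> S \<Longrightarrow> \<rho> g x \<in> adjoin F S"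
  shows "stable (adjoin F S)"
  unfolding stable_def
proof (intro ballI)
  fix g x assume g: "g \<in> carrier G" and x: "x \<in> adjoin F S"
  have "\<rho> g y \<in> adjoin F S" if "y \<in> F" for y
    using assms(1) that g adjoin_base[of F S] by (auto simp: stable_def)
  then show "\<rho> g x \<in> adjoin F S"
    using rho_adjoin_subset[OF g _ _ is_subfield_adjoin x] assms(2)[OF g] by blast
qed

lemma stable_K: "stable K"
  by (simp add: stable_def rho_K)

lemma fixed_by_K: "fixed_by (carrier G) K = K"
  by (auto simp: fixed_by_def rho_K)

lemma bij_betw_mult_left:
  assumes "g \<in> carrier G" shows "bij_betw (\<lambda>h. g \<otimes> h) (carrier G) (carrier G)"
  by (rule bij_betwI[of _ _ _ "\<lambda>h. inv g \<otimes> h"]) (use assms in \<open>auto simp: m_assoc[symmetric]\<close>)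

lemma rho_norm_fixed:
  assumes g: "g \<in> carrier G" shows "\<rho> g (\<Prod>h\<in>carrier G. \<rho> h x) = (\<Prod>h\<in>carrier G. \<rho> h x)"
proof -
  have "\<rho> g (\<Prod>h\<in>carrier G. \<rho> h x) = (\<Prod>h\<in>carrier G. \<rho> (g \<otimes> h) x)"
    using g by (simp add: rho_prod rho_comp)
  also have "\<dots> = (\<Prod>h\<in>carrier G. \<rho> h x)"
    by (rule prod.reindex_bij_betw[OF bij_betw_mult_left[OF g]])
  finally show ?thesis .
qed

text \<open>Multiplying numerator and denominator by the remaining conjugates of the denominator
  turns the latter into its norm, which is invariant; the new numerator is then invariant as
  well.\<close>

lemma fixed_by_fracs:
  assumes R: "is_subring R" "stable R" and f: "f \<in> fixed_by (carrier G) (fracs R)"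
  shows "f \<in> fracs (fixed_by (carrier G) R)"
proof -
  obtain a b where ab: "f = a / b" "a \<in> R" "b \<in> R" using f by (auto simp: fixed_by_def fracs_def)
  show ?thesis
  proof (cases "b = 0")
    case True
    have "0 \<in> fixed_by (carrier G) R" using subring_0[OF R(1)] by (auto simp: fixed_by_def rho_0)
    then show ?thesis using True ab unfolding fracs_def by auto
  next
    case False
    define d where "d = (\<Prod>h\<in>carrier G. \<rho> h b)"
    have d0: "d \<noteq> 0" using False finite_carrier by (auto simp: d_def rho_eq_0)
    have dR: "d \<in> R" using R(2) ab(3) by (auto simp: d_def stable_def intro!: subring_prod[OF R(1)])
    have dfix: "\<rho> g d = d" if "g \<in> carrier G" for g using rho_norm_fixed[OF that] by (simp add: d_def)
    have "d = b * (\<Prod>h\<in>carrier G - {\<one>}. \<rho> h b)"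
      unfolding d_def using finite_carrier by (subst prod.remove[of _ \<one>]) (auto simp: rho_one)
    then have "f * d = a * (\<Prod>h\<in>carrier G - {\<one>}. \<rho> h b)" using False ab(1) by simp
    also have "\<dots> \<in> R" using R(2) ab
      by (auto simp: stable_def intro!: subring_mult[OF R(1)] subring_prod[OF R(1)])
    finally have cR: "f * d \<in> R" .
    have ffix: "\<rho> g f = f" if "g \<in> carrier G" for g using f that by (auto simp: fixed_by_def)
    have "f * d \<in> fixed_by (carrier G) R" "d \<in> fixed_by (carrier G) R"
      using cR dR by (auto simp: fixed_by_def rho_mult dfix ffix)
    moreover have "f = (f * d) / d" using d0 by simp
    ultimately show ?thesis unfolding fracs_def by blast
  qed
qed

text \<open>\<open>x\<close> is a root of the product of the factors \<open>X - \<rho> h x\<close>,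
  and the group permutes these factors.\<close>

lemma alg_over_fixed:
  assumes F: "is_subfield F" "stable F" and x: "x \<in> F"
  shows "alg_over (fixed_by (carrier G) F) x"
proof -
  define P where "P = (\<Prod>h\<in>carrier G. [:- \<rho> h x, 1:])"
  have 1: "P \<in> poly_over F"
    unfolding P_def using F x is_subfield_imp_subring[OF F(1)]
    by (intro poly_over_prod poly_over_pCons poly_over_0)
      (auto simp: stable_def intro!: subfield_closed[OF F(1)])
  have "map_poly (\<rho> g) P = P" if g: "g \<in> carrier G" for g
  proof -
    have "map_poly (\<rho> g) P = (\<Prod>h\<in>carrier G. [:- \<rho> (g \<otimes> h) x, 1:])"
      unfolding P_def map_poly_rho_prod[OF g] using g
      by (intro prod.cong HOL.refl) (simp add: map_poly_pCons rho_hom rho_comp)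
    also have "\<dots> = P"
      unfolding P_def by (rule prod.reindex_bij_betw[OF bij_betw_mult_left[OF g]])
    finally show ?thesis .
  qed
  then have "\<rho> g (coeff P i) = coeff P i" if "g \<in> carrier G" for g i
    using that by (metis coeff_map_poly rho_0)
  then have "P \<in> poly_over (fixed_by (carrier G) F)"
    using 1 by (auto simp: poly_over_def fixed_by_def)
  moreover have "P \<noteq> 0" using finite_carrier by (simp add: P_def)
  moreover have "poly P x = 0"
    unfolding P_def poly_prod using finite_carrier by (auto simp: rho_one intro!: bexI[of _ \<one>])
  ultimately show ?thesis unfolding alg_over_def by blast
qed

end

section \<open>Invariants of triangular actions\<close>

text \<open>Long division inverts only the leading coefficient of \<open>D\<close>, so quotient and
  remainder keep their coefficients in \<open>F\<close>.\<close>

lemma poly_over_division: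
  assumes F: "is_subfield F" and D: "D \<in> poly_over F" "D \<noteq> 0" and "P \<in> poly_over F"
  shows "\<exists>Q\<in>poly_over F. \<exists>R\<in>poly_over F. P = Q * D + R \<and> (R = 0 \<or> degree R < degree D)"
  using assms(4)
proof (induction "degree P" arbitrary: P rule: less_induct)
  case less
  note R = is_subfield_imp_subring[OF F]
  show ?case
  proof (cases "P = 0 \<or> degree P < degree D")
    case True
    then show ?thesis using less.prems by (intro bexI[of _ 0] bexI[of _ P]) (auto intro: poly_over_0[OF R])
  next
    case False
    define m where "m = monom (lead_coeff P / lead_coeff D) (degree P - degree D)"
    have m: "m \<in> poly_over F" unfolding m_def using D less.prems
      by (intro poly_over_monom R subfield_closed[OF F] poly_over_coeff)
    have "m \<noteq> 0" "degree m = degree P - degree D" "lead_coeff m = lead_coeff P / lead_coeff D"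
      using False D(2) by (auto simp: m_def degree_monom_eq lead_coeff_monom)
    moreover from this have "degree (m * D) = degree m + degree D" using D(2) by (intro degree_mult_eq)
    ultimately have deg: "degree (m * D) = degree P" "lead_coeff (m * D) = lead_coeff P"
      using False D(2) lead_coeff_mult[of m D] by simp_all
    have P': "P - m * D \<in> poly_over F" by (intro poly_over_diff poly_over_mult R m less.prems D)
    show ?thesis
    proof (cases "P - m * D = 0")
      case True
      then show ?thesis using m by (intro bexI[of _ m] bexI[of _ 0]) (auto intro: poly_over_0[OF R])
    next
      case nz: False
      have "degree (P - m * D) \<le> degree P" using deg by (intro degree_diff_le) auto
      moreover have "coeff (P - m * D) (degree P) = 0" using deg by simp
      ultimately have "degree (P - m * D) < degree P"
        using nz by (metis eq_zero_or_degree_less)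
      then obtain Q R' where "Q \<in> poly_over F" "R' \<in> poly_over F" "P - m * D = Q * D + R'"
        "R' = 0 \<or> degree R' < degree D" using less.hyps[OF _ P'] by blast
      then show ?thesis using m
        by (intro bexI[of _ "Q + m"] bexI[of _ R']) (auto simp: algebra_simps intro!: poly_over_add R)
    qed
  qed
qed

context field_action
begin

text \<open>
  An invariant polynomial \<open>\<theta>\<close> in \<open>x\<close> of minimal positive degree generates: quotient and remainder
  of a division by \<open>\<theta>\<close> are unique, hence again invariant.
\<close>

lemma fixed_by_affine_extension:
  assumes F: "is_subfield F" "stable F" and x: "\<not> alg_over F x"
    and act: "\<And>g. g \<in> carrier G \<Longrightarrow> \<exists>a\<in>F. \<exists>b\<in>F. \<rho> g x = a * x + b"
  shows "\<exists>\<theta>. fixed_by (carrier G) (adjoin F {x}) = adjoin (fixed_by (carrier G) F) {\<theta>}"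
proof -
  note R = is_subfield_imp_subring[OF F(1)]
  obtain a b where ab: "\<And>g. g \<in> carrier G \<Longrightarrow> a g \<in> F" "\<And>g. g \<in> carrier G \<Longrightarrow> b g \<in> F"
    "\<And>g. g \<in> carrier G \<Longrightarrow> \<rho> g x = a g * x + b g" using act by metis
  have a0: "a g \<noteq> 0" if g: "g \<in> carrier G" for g
  proof
    assume "a g = 0"
    then have "\<rho> g x \<in> F" using ab[OF g] by simp
    then have "\<rho> (inv g) (\<rho> g x) \<in> F" using F(2) g by (simp add: stable_def)
    then show False using x rho_inv(1)[OF g] alg_over_base[OF F(1)] by simp
  qed
  \<comment> \<open>The action transported to polynomials in \<open>x\<close>: coefficients are
    mapped by \<open>\<rho> g\<close>, and the image \<open>a g * x + b g\<close> is substituted for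
    \<open>x\<close>. As \<open>x\<close> is transcendental, invariance of the value
    \<open>poly P x\<close> amounts to \<open>act' g P = P\<close> for all \<open>g\<close>.\<close>
  define act' where "act' g P = pcompose (map_poly (\<rho> g) P) [:b g, a g:]" for g P
  have act'_in: "act' g P \<in> poly_over F" if "g \<in> carrier G" "P \<in> poly_over F" for g P
  proof -
    have "map_poly (\<rho> g) P \<in> poly_over F"
      using that F(2) by (auto simp: poly_over_def coeff_map_poly rho_0 stable_def)
    then show ?thesis unfolding act'_def using ab[OF that(1)]
      by (intro poly_over_pcompose poly_over_pCons poly_over_0 R) auto
  qed
  have act'_poly: "poly (act' g P) x = \<rho> g (poly P x)" if "g \<in> carrier G" for g P
    using ab(3)[OF that] by (simp add: act'_def poly_pcompose rho_poly[OF that] algebra_simps)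
  have deg_map: "degree (map_poly (\<rho> g) P) = degree P" if "g \<in> carrier G" for g P
    using that by (intro degree_map_poly) (simp add: rho_eq_0)
  have deg_act': "degree (act' g P) = degree P" if "g \<in> carrier G" for g P
    using a0[OF that] deg_map[OF that] by (simp add: act'_def degree_pcompose)
  have inj: "P = Q" if "P \<in> poly_over F" "Q \<in> poly_over F" "poly P x = poly Q x" for P Q
  proof -
    have "P - Q \<in> poly_over F" "poly (P - Q) x = 0" using that by (auto intro: poly_over_diff[OF R])
    then show ?thesis using x unfolding alg_over_def by (metis eq_iff_diff_eq_0)
  qed
  let ?FG = "fixed_by (carrier G) F"
  have FG: "is_subfield ?FG" by (rule is_subfield_fixed_by[OF F(1) order_refl])
  define I where "I = {P \<in> poly_over F. \<forall>g\<in>carrier G. \<rho> g (poly P x) = poly P x}"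
  have I_act': "act' g P = P" if "P \<in> I" "g \<in> carrier G" for P g
    using that by (intro inj) (auto simp: I_def act'_in act'_poly)
  have I_if: "P \<in> I" if "P \<in> poly_over F" "\<And>g. g \<in> carrier G \<Longrightarrow> act' g P = P" for P
    using that act'_poly by (auto simp: I_def) metis
  have const: "poly P x \<in> ?FG" if P: "P \<in> I" "degree P = 0" for P
  proof -
    obtain c where c: "P = [:c:]" using P(2) by (metis degree_eq_zeroE)
    have "coeff P 0 \<in> F" using P(1) by (auto simp: I_def poly_over_def)
    then show ?thesis using P(1) c by (auto simp: I_def fixed_by_def)
  qed
  have fix_ring: "fixed_by (carrier G) (ring_adjoin F x) = (\<lambda>P. poly P x) ` I"
    by (auto simp: fixed_by_def ring_adjoin_def I_def)
  have stab: "stable (ring_adjoin F x)"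
    unfolding stable_def ring_adjoin_def
  proof (intro ballI)
    fix g y assume g: "g \<in> carrier G" and "y \<in> (\<lambda>P. poly P x) ` poly_over F"
    then obtain P where P: "P \<in> poly_over F" "y = poly P x" by blast
    show "\<rho> g y \<in> (\<lambda>P. poly P x) ` poly_over F"
      using act'_poly[OF g, of P] act'_in[OF g P(1)] P(2) by (intro image_eqI[of _ _ "act' g P"]) auto
  qed
  have fix_eq: "fixed_by (carrier G) (adjoin F {x}) \<subseteq> fracs ((\<lambda>P. poly P x) ` I)"
    using fixed_by_fracs[OF is_subring_ring_adjoin[OF R] stab]
    unfolding adjoin_insert_eq_fracs[OF F(1)] fix_ring by blast
  have I_sub: "poly P x \<in> fixed_by (carrier G) (adjoin F {x})" if "P \<in> I" for P
  proof -
    have "poly P x \<in> ring_adjoin F x" using that by (auto simp: I_def ring_adjoin_def)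
    then have "poly P x \<in> adjoin F {x}"
      using subset_fracs[OF is_subring_ring_adjoin[OF R]] unfolding adjoin_insert_eq_fracs[OF F(1)] by blast
    then show ?thesis using that by (auto simp: I_def fixed_by_def)
  qed
  have FG_sub: "?FG \<subseteq> fixed_by (carrier G) (adjoin F {x})"
    using adjoin_base[of F "{x}"] by (auto simp: fixed_by_def)
  have fixsub: "is_subfield (fixed_by (carrier G) (adjoin F {x}))"
    by (rule is_subfield_fixed_by[OF is_subfield_adjoin order_refl])
  obtain \<theta> where \<theta>: "\<theta> \<in> (\<lambda>P. poly P x) ` I" "(\<lambda>P. poly P x) ` I \<subseteq> adjoin ?FG {\<theta>}"
  proof (cases "\<exists>P\<in>I. degree P > 0")
    \<comment> \<open>Without an invariant polynomial of positive degree all invariants lie in the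
      fixed field of \<open>F\<close>, and \<open>1\<close> can serve as the additional
      generator.\<close>
    case False
    have "1 \<in> I" using poly_over_1[OF R] by (auto simp: I_def rho_1)
    then have "1 \<in> (\<lambda>P. poly P x) ` I" by (intro image_eqI[of _ _ 1]) auto
    moreover have "(\<lambda>P. poly P x) ` I \<subseteq> adjoin ?FG {1}"
      using False const adjoin_base[of ?FG "{1}"] by auto
    ultimately show ?thesis using that by blast
  next
    case True
    then have "\<exists>D. (D \<in> I \<and> degree D > 0) \<and> (\<forall>P. (P \<in> I \<and> degree P > 0) \<longrightarrow> degree D \<le> degree P)"
      using ex_has_least_nat[of "\<lambda>P. P \<in> I \<and> degree P > 0" _ degree] by blast
    then obtain D where D: "D \<in> I" "degree D > 0" "\<And>P. P \<in> I \<Longrightarrow> degree P > 0 \<Longrightarrow> degree D \<le> degree P"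
      by blast
    have DF: "D \<in> poly_over F" "D \<noteq> 0" using D by (auto simp: I_def)
    have "poly P x \<in> adjoin ?FG {poly D x}" if "P \<in> I" for P
      using that
    proof (induction "degree P" arbitrary: P rule: less_induct)
      case less
      show ?case
      proof (cases "degree P = 0")
        case True
        then show ?thesis using const[OF less.prems] adjoin_base[of ?FG "{poly D x}"] by blast
      next
        case False
        have PF: "P \<in> poly_over F" using less.prems by (simp add: I_def)
        obtain Q S where QS: "Q \<in> poly_over F" "S \<in> poly_over F" "P = Q * D + S" "S = 0 \<or> degree S < degree D"
          using poly_over_division[OF F(1) DF PF] by blast
        have inv: "act' g Q = Q \<and> act' g S = S" if g: "g \<in> carrier G" for g
        proof -
          have "map_poly (\<rho> g) (Q * D + S) = map_poly (\<rho> g) Q * map_poly (\<rho> g) D + map_poly (\<rho> g) S"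
            unfolding map_poly_rho_mult[OF g, symmetric]
            by (rule poly_eqI) (simp add: coeff_map_poly rho_0[OF g] rho_add[OF g])
          then have "act' g P = act' g Q * act' g D + act' g S"
            by (simp add: QS(3) act'_def pcompose_add pcompose_mult)
          \<comment> \<open>This compares \<open>P = Q * D + S\<close> with its image under
            \<open>g\<close>. The right side is zero or of degree below that of \<open>D\<close>, so
            both sides vanish.\<close>
          then have eq: "(act' g Q - Q) * D = S - act' g S"
            using I_act'[OF less.prems g] I_act'[OF D(1) g] QS(3) by (simp add: algebra_simps)
          have "act' g Q - Q = 0"
          proof (rule ccontr)
            assume nz: "act' g Q - Q \<noteq> 0"
            then have "degree D \<le> degree (S - act' g S)"
              using DF(2) by (simp add: eq[symmetric] degree_mult_eq)
            moreover have "S \<noteq> 0" using nz eq DF(2) by (auto simp: act'_def)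
            then have "degree (S - act' g S) < degree D"
              using QS(4) deg_act'[OF g, of S] by (intro degree_diff_less) auto
            ultimately show False by simp
          qed
          then show ?thesis using eq by simp
        qed
        have QI: "Q \<in> I" and SI: "S \<in> I" using inv QS by (auto intro: I_if)
        have "degree S = 0" using QS(4) D(3)[OF SI] by (metis degree_0 leD gr0I)
        then have "poly S x \<in> adjoin ?FG {poly D x}"
          using const[OF SI] adjoin_base[of ?FG "{poly D x}"] by blast
        moreover have "poly Q x \<in> adjoin ?FG {poly D x}"
        proof (rule less.hyps[OF _ QI])
          have "Q \<noteq> 0" using False QS(3) \<open>degree S = 0\<close> by auto
          then have "degree (Q * D) = degree Q + degree D" using DF(2) by (simp add: degree_mult_eq)
          moreover have "degree (Q * D + S) = degree (Q * D)"
            using calculation D(2) \<open>degree S = 0\<close> by (intro degree_add_eq_left) simp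
          ultimately show "degree Q < degree P" using D(2) QS(3) by simp
        qed
        moreover have "poly D x \<in> adjoin ?FG {poly D x}" using adjoin_gens[of "{poly D x}" ?FG] by simp
        ultimately show ?thesis unfolding QS(3) poly_add poly_mult by (intro adjoin_closed)
      qed
    qed
    then show ?thesis using that[of "poly D x"] D(1) by blast
  qed
  have "adjoin ?FG {\<theta>} \<subseteq> fixed_by (carrier G) (adjoin F {x})"
    using \<theta>(1) I_sub FG_sub by (intro adjoin_least fixsub) auto
  moreover have "fixed_by (carrier G) (adjoin F {x}) \<subseteq> adjoin ?FG {\<theta>}"
    using fix_eq fracs_subset[OF is_subfield_adjoin \<theta>(2)] by blast
  ultimately show ?thesis by blast
qed

text \<open>Each step of the tower adds at most one generator of the invariants. Coincidences among
  them only lower the cardinality of \<open>T\<close>.\<close>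

lemma fixed_by_triangular:
  assumes F: "is_subfield F" "stable F"
    and tr: "\<And>i. i < r \<Longrightarrow> \<not> alg_over (adjoin F (xs ` {..<i})) (xs i)"
    and act: "\<And>i g. i < r \<Longrightarrow> g \<in> carrier G \<Longrightarrow>
      \<exists>a\<in>adjoin F (xs ` {..<i}). \<exists>b\<in>adjoin F (xs ` {..<i}). \<rho> g (xs i) = a * xs i + b"
  shows "\<exists>T. finite T \<and> card T \<le> r \<and>
    fixed_by (carrier G) (adjoin F (xs ` {..<r})) = adjoin (fixed_by (carrier G) F) T"
proof -
  have "stable (adjoin F (xs ` {..<n})) \<and> (\<exists>T. finite T \<and> card T \<le> n \<and>
    fixed_by (carrier G) (adjoin F (xs ` {..<n})) = adjoin (fixed_by (carrier G) F) T)" if "n \<le> r" for n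
    using that
  proof (induction n)
    case 0
    show ?case using F adjoin_empty[OF F(1)]
      by (auto intro!: exI[of _ "{}"] simp: adjoin_empty is_subfield_fixed_by)
  next
    case (Suc n)
    let ?E = "adjoin F (xs ` {..<n})"
    have eq: "adjoin F (xs ` {..<Suc n}) = adjoin ?E {xs n}"
      by (simp add: adjoin_adjoin lessThan_Suc)
    have st: "stable ?E" using Suc by simp
    obtain T where T: "finite T" "card T \<le> n" "fixed_by (carrier G) ?E = adjoin (fixed_by (carrier G) F) T"
      using Suc by auto
    obtain \<theta> where \<theta>: "fixed_by (carrier G) (adjoin ?E {xs n}) = adjoin (fixed_by (carrier G) ?E) {\<theta>}"
      using fixed_by_affine_extension[OF is_subfield_adjoin st tr act] Suc.prems by (meson Suc_le_eq)
    have "stable (adjoin ?E {xs n})"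
    proof (rule stable_adjoin[OF st])
      fix g x assume g: "g \<in> carrier G" and "x \<in> {xs n}"
      then have x: "x = xs n" by simp
      obtain a b where "a \<in> ?E" "b \<in> ?E" "\<rho> g (xs n) = a * xs n + b"
        using act[OF _ g, of n] Suc.prems by auto
      then show "\<rho> g x \<in> adjoin ?E {xs n}"
        using adjoin_base[of ?E "{xs n}"] adjoin_gens[of "{xs n}" ?E] unfolding x
        by (auto intro!: adjoin_closed)
    qed
    moreover have "fixed_by (carrier G) (adjoin ?E {xs n}) = adjoin (fixed_by (carrier G) F) (insert \<theta> T)"
    proof -
      have "adjoin (adjoin (fixed_by (carrier G) F) T) {\<theta>} = adjoin (fixed_by (carrier G) F) (insert \<theta> T)"
        by (simp add: adjoin_adjoin)
      then show ?thesis by (simp only: \<theta> T(3))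
    qed
    moreover have "card (insert \<theta> T) \<le> Suc n" using T by (simp add: card_insert_if)
    ultimately show ?case unfolding eq using T(1) by blast
  qed
  then show ?thesis by blast
qed

end

section \<open>Kummer extensions\<close>

lemma sum_powers_root_of_unity:
  assumes \<omega>: "primitive_root_of_unity m (\<omega>::'l::field)"
  shows "(\<Sum>k<m. (\<omega> ^ i) ^ k) = (if m dvd i then of_nat m else 0)"
proof (cases "m dvd i")
  case True
  then have "\<omega> ^ i = 1" using \<omega> by (auto simp: primitive_root_of_unity_def power_mult)
  then show ?thesis using True by simp
next
  case False
  have m: "0 < m" "\<omega> ^ m = 1" using \<omega> by (auto simp: primitive_root_of_unity_def)
  have "\<omega> ^ i = \<omega> ^ (m * (i div m) + i mod m)" by simp
  also have "\<dots> = \<omega> ^ (i mod m)" unfolding power_add power_mult by (simp add: m)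
  finally have "\<omega> ^ i = \<omega> ^ (i mod m)" .
  moreover have "0 < i mod m" "i mod m < m" using False m by (simp_all add: mod_greater_zero_iff_not_dvd)
  ultimately have "\<omega> ^ i \<noteq> 1" using \<omega> by (auto simp: primitive_root_of_unity_def)
  moreover have "(\<omega> ^ i) ^ m = 1" using m by (metis mult.commute power_mult power_one)
  ultimately show ?thesis using False by (simp add: sum_gp_strict)
qed

context field_action
begin

text \<open>\<open>s\<close> multiplies \<open>u ^ i\<close> by \<open>\<omega> ^ i\<close>.
  Averaging over \<open>m\<close> powers of \<open>s\<close> annihilates the exponents that
  \<open>m\<close> does not divide, and the remaining powers of \<open>u\<close> lie in
  \<open>E\<close>. The argument applies to any expression in \<open>u\<close>, whatever the degree
  of \<open>u\<close> over \<open>E\<close>.\<close>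

lemma fixed_by_kummer:
  assumes s: "s \<in> carrier G" and E: "is_subfield E" "\<And>x. x \<in> E \<Longrightarrow> \<rho> s x = x"
    and u: "\<rho> s u = \<omega> * u" "u ^ m \<in> E" and \<omega>: "primitive_root_of_unity m \<omega>" "\<omega> \<in> E"
    and m: "of_nat m \<noteq> (0::'l)" and f: "f \<in> adjoin E {u}" "\<rho> s f = f"
  shows "f \<in> E"
proof -
  note R = is_subfield_imp_subring[OF E(1)]
  let ?R = "ring_adjoin E u"
  note ring = is_subring_ring_adjoin[OF R, of u]
  have step: "\<rho> s (poly P u) = poly P (\<omega> * u)" if "P \<in> poly_over E" for P
    using that E(2) by (simp add: poly_altdef rho_hom[OF s] u(1) poly_over_def)
  have stab: "\<rho> s r \<in> ?R" if r: "r \<in> ?R" for r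
  proof -
    obtain P where P: "P \<in> poly_over E" "r = poly P u" using r by (auto simp: ring_adjoin_def)
    then have "\<rho> s r = poly (pcompose P [:0, \<omega>:]) u" by (simp add: step poly_pcompose ac_simps)
    moreover have "pcompose P [:0, \<omega>:] \<in> poly_over E"
      using P \<omega> by (intro poly_over_pcompose poly_over_pCons poly_over_0 R) (auto intro: subfield_closed[OF E(1)])
    ultimately show ?thesis by (auto simp: ring_adjoin_def)
  qed
  have pow: "s [^] k \<in> carrier G" for k :: nat using s by simp
  have stab_pow: "\<rho> (s [^] k) r \<in> ?R" if "r \<in> ?R" for r and k :: nat
    by (induction k) (simp_all only: rho_pow_Suc[OF s] nat_pow_0 rho_one that stab)
  have fix_pow: "\<rho> (s [^] k) r = r" if "\<rho> s r = r" for r and k :: nat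
    by (induction k) (simp_all only: rho_pow_Suc[OF s] nat_pow_0 rho_one that)
  have fixR: "r \<in> E" if r: "r \<in> ?R" "\<rho> s r = r" for r
  proof -
    obtain P where P: "P \<in> poly_over E" "r = poly P u" using r by (auto simp: ring_adjoin_def)
    have Pc: "coeff P i \<in> E" for i using P by (simp add: poly_over_def)
    have upow: "\<rho> (s [^] k) (u ^ i) = (\<omega> ^ i) ^ k * u ^ i" for i and k :: nat
    proof (induction k)
      case (Suc k)
      have "\<rho> s ((\<omega> ^ i) ^ k) = (\<omega> ^ i) ^ k" using \<omega>(2) E(2) by (simp add: rho_hom[OF s])
      have "\<rho> (s [^] Suc k) (u ^ i) = \<rho> s ((\<omega> ^ i) ^ k * u ^ i)"
        by (simp only: rho_pow_Suc[OF s] Suc)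
      also have "\<dots> = (\<omega> ^ i) ^ k * (\<omega> * u) ^ i"
        using \<open>\<rho> s ((\<omega> ^ i) ^ k) = (\<omega> ^ i) ^ k\<close> by (simp only: rho_mult[OF s] rho_power[OF s, of u] u(1))
      finally show ?case by (simp add: power_mult_distrib ac_simps)
    qed (simp add: rho_one)
    have "of_nat m * r = (\<Sum>k<m. \<rho> (s [^] k) r)" using fix_pow[OF r(2)] by simp
    also have "\<dots> = (\<Sum>k<m. \<Sum>i\<le>degree P. coeff P i * ((\<omega> ^ i) ^ k * u ^ i))"
    proof (rule sum.cong[OF HOL.refl])
      fix k :: nat
      have "\<rho> (s [^] k) (coeff P i) = coeff P i" for i by (rule fix_pow[OF E(2)[OF Pc]])
      then show "\<rho> (s [^] k) r = (\<Sum>i\<le>degree P. coeff P i * ((\<omega> ^ i) ^ k * u ^ i))"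
        by (simp add: P(2) poly_altdef rho_sum[OF pow] rho_mult[OF pow] upow)
    qed
    also have "\<dots> = (\<Sum>i\<le>degree P. coeff P i * (\<Sum>k<m. (\<omega> ^ i) ^ k) * u ^ i)"
      by (subst sum.swap) (simp add: sum_distrib_left sum_distrib_right mult.assoc)
    also have "\<dots> = (\<Sum>i\<le>degree P. coeff P i * (if m dvd i then of_nat m else 0) * u ^ i)"
      by (simp add: sum_powers_root_of_unity[OF \<omega>(1)])
    also have "\<dots> = of_nat m * (\<Sum>i\<le>degree P. coeff P i * (if m dvd i then u ^ i else 0))"
      unfolding sum_distrib_left by (rule sum.cong) auto
    finally have req: "r = (\<Sum>i\<le>degree P. coeff P i * (if m dvd i then u ^ i else 0))" using m by simp
    have "(if m dvd i then u ^ i else 0) \<in> E" for i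
      using u(2) by (auto simp: power_mult elim!: dvdE intro: subfield_closed[OF E(1)])
    then show "r \<in> E" unfolding req using Pc by (intro subfield_closed[OF E(1)]) auto
  qed
  obtain a b where ab: "f = a / b" "a \<in> ?R" "b \<in> ?R"
    using f(1) unfolding adjoin_insert_eq_fracs[OF E(1)] fracs_def by blast
  show ?thesis
  proof (cases "b = 0")
    case True
    then show ?thesis using ab subfield_closed(1)[OF E(1)] by simp
  next
    case False
    \<comment> \<open>The norm runs over as many powers of \<open>s\<close> as the group has
      elements, rather than over \<open>m\<close> of them: \<open>s [^] n = \<one>\<close> is what
      makes the product \<open>d\<close> invariant.\<close>
    define n where "n = Coset.order G"
    have n: "n > 0" "s [^] n = \<one>"
      using finite_carrier s by (auto simp: n_def order_gt_0_iff_finite pow_order_eq_1)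
    define d where "d = (\<Prod>k<n. \<rho> (s [^] k) b)"
    have "d \<noteq> 0" using False by (auto simp: d_def rho_eq_0[OF pow])
    have "\<rho> s d = (\<Prod>k<n. \<rho> (s [^] Suc k) b)"
      by (simp only: d_def rho_prod[OF s] rho_pow_Suc[OF s])
    also have "\<dots> = d"
    proof -
      obtain n' where n': "n = Suc n'" using n(1) by (cases n) auto
      have "(\<Prod>k<n. \<rho> (s [^] Suc k) b) = (\<Prod>k<n'. \<rho> (s [^] Suc k) b) * \<rho> (s [^] n) b"
        by (simp only: n' prod.lessThan_Suc)
      also have "\<rho> (s [^] n) b = \<rho> (s [^] (0::nat)) b" by (simp only: n(2) nat_pow_0)
      also have "(\<Prod>k<n'. \<rho> (s [^] Suc k) b) * \<rho> (s [^] (0::nat)) b = d"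
        by (simp only: d_def n' prod.lessThan_Suc_shift mult.commute)
      finally show ?thesis .
    qed
    finally have dfix: "\<rho> s d = d" .
    have "d = b * (\<Prod>k\<in>{..<n} - {0}. \<rho> (s [^] k) b)"
      unfolding d_def using n(1) by (subst prod.remove[of _ 0]) (auto simp: rho_one)
    then have "f * d = a * (\<Prod>k\<in>{..<n} - {0}. \<rho> (s [^] k) b)" using ab(1) False by simp
    also have "\<dots> \<in> ?R" using ab stab_pow by (intro subring_closed[OF ring]) auto
    finally have "f * d \<in> ?R" .
    moreover have "\<rho> s (f * d) = f * d" by (simp add: rho_mult[OF s] dfix f(2))
    ultimately have "f * d \<in> E" by (rule fixR)
    moreover have "d \<in> E" using dfix ab stab_pow unfolding d_def by (intro fixR subring_closed[OF ring]) auto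
    ultimately have "f * d / d \<in> E" by (rule subfield_divide[OF E(1)])
    then show ?thesis using \<open>d \<noteq> 0\<close> by simp
  qed
qed

end

section \<open>Fixed points of \<open>p\<close>-groups\<close>

text \<open>Every orbit has \<open>p\<close>-power size, so the number of orbits of size one is
  divisible by \<open>p\<close>. Since \<open>x0\<close> gives one of them, there is
  another.\<close>

lemma (in group) p_group_second_fixed_point:
  assumes p: "Factorial_Ring.prime p" and ord: "Coset.order G = p ^ n"
    and fin: "finite \<Omega>" and dv: "p dvd card \<Omega>"
    and closed: "\<And>g x. g \<in> carrier G \<Longrightarrow> x \<in> \<Omega> \<Longrightarrow> act g x \<in> \<Omega>"
    and comp: "\<And>g h x. g \<in> carrier G \<Longrightarrow> h \<in> carrier G \<Longrightarrow> x \<in> \<Omega> \<Longrightarrow> act (g \<otimes> h) x = act g (act h x)"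
    and one: "\<And>x. x \<in> \<Omega> \<Longrightarrow> act \<one> x = x"
    and x0: "x0 \<in> \<Omega>" "\<And>g. g \<in> carrier G \<Longrightarrow> act g x0 = x0"
  shows "\<exists>x\<in>\<Omega>. x \<noteq> x0 \<and> (\<forall>g\<in>carrier G. act g x = x)"
proof (rule ccontr)
  assume no: "\<not> ?thesis"
  \<comment> \<open>\<open>BijGroup\<close> consists of extensional functions, hence the restriction
    to \<open>\<Omega>\<close>.\<close>
  define \<phi> where "\<phi> g = restrict (act g) \<Omega>" for g
  have inv: "act (inv g) (act g x) = x" "act g (act (inv g) x) = x" if "g \<in> carrier G" "x \<in> \<Omega>" for g x
    using that by (simp_all add: comp[symmetric] one)
  have bij: "bij_betw (act g) \<Omega> \<Omega>" if "g \<in> carrier G" for g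
    by (rule bij_betwI[of _ _ _ "act (inv g)"]) (use that inv closed in auto)
  have "bij_betw (\<phi> g) \<Omega> \<Omega>" if "g \<in> carrier G" for g
    using bij[OF that] by (simp add: \<phi>_def cong: bij_betw_cong)
  then have carr: "\<phi> g \<in> carrier (BijGroup \<Omega>)" if "g \<in> carrier G" for g
    using that by (simp add: BijGroup_def Bij_def \<phi>_def)
  have "\<phi> \<in> hom G (BijGroup \<Omega>)"
  proof (rule homI)
    show "\<phi> g \<in> carrier (BijGroup \<Omega>)" if "g \<in> carrier G" for g using carr[OF that] .
    fix g h assume gh: "g \<in> carrier G" "h \<in> carrier G"
    have "\<phi> g \<otimes>\<^bsub>BijGroup \<Omega>\<^esub> \<phi> h = compose \<Omega> (\<phi> g) (\<phi> h)"
      using carr gh by (simp add: BijGroup_def)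
    then show "\<phi> (g \<otimes> h) = \<phi> g \<otimes>\<^bsub>BijGroup \<Omega>\<^esub> \<phi> h"
      using gh by (auto simp: \<phi>_def compose_def fun_eq_iff comp closed)
  qed
  then interpret A: group_action G \<Omega> \<phi>
    by (simp add: group_action_def group_hom_def group_hom_axioms_def group_BijGroup is_group)
  let ?O = "orbits G \<Omega> \<phi>"
  have orbx0: "orbit G \<phi> x0 = {x0}"
    using x0 by (auto simp: orbit_def \<phi>_def intro!: exI[of _ \<one>])
  have fO: "finite ?O" using fin by (simp add: orbits_def)
  have x0O: "{x0} \<in> ?O" using orbx0 x0(1) unfolding orbits_def by blast
  have other: "p dvd card B" if B: "B \<in> ?O" "B \<noteq> {x0}" for B
  proof -
    obtain x where x: "x \<in> \<Omega>" "B = orbit G \<phi> x" using B by (auto simp: orbits_def)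
    have "card B dvd p ^ n" using A.orbit_stabilizer_theorem[OF x(1)] unfolding ord x(2)[symmetric] by (metis dvd_triv_left)
    then obtain i where i: "card B = p ^ i" using p by (auto simp: divides_primepow_nat)
    have "i \<noteq> 0"
    proof
      assume "i = 0"
      then have "card B = 1" using i by simp
      then obtain y where "B = {y}" by (auto simp: card_1_singleton_iff)
      then have "B = {x}" using A.orbit_refl[OF x(1)] x(2) by simp
      have fx: "act g x = x" if g: "g \<in> carrier G" for g
      proof -
        have "\<phi> g x \<in> orbit G \<phi> x" unfolding orbit_def using g by blast
        then have "\<phi> g x \<in> {x}" by (simp only: x(2)[symmetric] \<open>B = {x}\<close>)
        then have "\<phi> g x = x" by simp
        then show ?thesis using x(1) by (simp add: \<phi>_def)
      qed
      have "x \<noteq> x0" using B(2) \<open>B = {x}\<close> by auto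
      then show False using no x(1) fx by blast
    qed
    then show ?thesis using i by simp
  qed
  have "card \<Omega> = (\<Sum>B\<in>?O. card B)"
    using A.disjoint_sum[OF fin, of "\<lambda>_. 1 :: nat"] by simp
  also have "\<dots> = 1 + (\<Sum>B\<in>?O - {{x0}}. card B)"
    using fO x0O by (subst sum.remove[of _ "{x0}"]) auto
  finally have "card \<Omega> = 1 + (\<Sum>B\<in>?O - {{x0}}. card B)" .
  moreover have "p dvd (\<Sum>B\<in>?O - {{x0}}. card B)" using other by (intro dvd_sum) auto
  ultimately have "p dvd 1" using dv by (metis dvd_add_left_iff)
  then show False using p by simp
qed

section \<open>The regular action\<close>

locale regular_action = field_action G \<rho> K
  for G :: "('a, 'b) monoid_scheme" (structure) and \<rho> :: "'a \<Rightarrow> 'l::field \<Rightarrow> 'l" and K :: "'l set" +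
  fixes var :: "'a \<Rightarrow> 'l"
  assumes rho_var: "g \<in> carrier G \<Longrightarrow> h \<in> carrier G \<Longrightarrow> \<rho> g (var h) = var (g \<otimes> h)"
    and inj_var: "inj_on var (carrier G)"
    and independent_var: "independent_over K (var ` carrier G)"
begin

definition L where "L = adjoin K (var ` carrier G)"

definition few_generators :: bool where
  "few_generators \<longleftrightarrow> (\<exists>B. finite B \<and> card B \<le> Coset.order G \<and> fixed_by (carrier G) L = adjoin K B)"

lemma is_subfield_L: "is_subfield L"
  by (simp add: L_def is_subfield_adjoin)

lemma K_subset_L: "K \<subseteq> L"
  by (simp add: L_def adjoin_base)

lemma var_in_L: "g \<in> carrier G \<Longrightarrow> var g \<in> L"
  using adjoin_gens[of "var ` carrier G" K] by (auto simp: L_def)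

lemma stable_L: "stable L"
  unfolding L_def using adjoin_gens[of "var ` carrier G" K]
  by (intro stable_adjoin stable_K) (auto simp: rho_var)

lemma card_var: "finite (var ` carrier G)" "card (var ` carrier G) = Coset.order G"
  using finite_carrier inj_var by (simp_all add: card_image Coset.order_def)

text \<open>If \<open>xs i\<close> depended on its predecessors, fewer than \<open>|G|\<close>
  elements would span the \<open>|G|\<close> independent variables. A generating set of the right
  size thus certifies the transcendence of each of its members over the earlier ones.\<close>

lemma generators_transcendental:
  assumes "finite Y" "L \<subseteq> acl K (Y \<union> xs ` {..<r})" "card Y + r \<le> Coset.order G" "i < r"
  shows "\<not> alg_over (adjoin (adjoin K Y) (xs ` {..<i})) (xs i)"
proof
  assume "alg_over (adjoin (adjoin K Y) (xs ` {..<i})) (xs i)"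
  then have i: "xs i \<in> acl K (Y \<union> xs ` {..<i})" by (simp add: adjoin_adjoin acl_def alg_closure_in_def)
  let ?S = "Y \<union> xs ` ({..<r} - {i})"
  have "Y \<union> xs ` {..<i} \<subseteq> ?S" using assms(4) by auto
  then have "xs i \<in> acl K ?S" using i acl_mono by blast
  moreover have "Y \<union> xs ` {..<r} \<subseteq> insert (xs i) ?S" using assms(4) by auto
  ultimately have "Y \<union> xs ` {..<r} \<subseteq> acl K ?S" using acl_gens[of ?S K] by auto
  then have "L \<subseteq> acl K ?S" using assms(2) acl_least by blast
  then have sub: "var ` carrier G \<subseteq> acl K ?S" using var_in_L by blast
  have "finite ?S" using assms(1) by simp
  then have "card (var ` carrier G) \<le> card ?S"
    by (rule independent_card_le[OF _ card_var(1) independent_var sub])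
  also have "\<dots> \<le> card Y + card (xs ` ({..<r} - {i}))" by (rule card_Un_le)
  also have "card (xs ` ({..<r} - {i})) \<le> card ({..<r} - {i})" by (rule card_image_le) simp
  also have "card ({..<r} - {i}) = r - 1" using assms(4) by simp
  finally show False using assms(3,4) card_var(2) by linarith
qed

lemma few_generators_if_triangular:
  assumes L: "L = adjoin K (xs ` {..<r})" and r: "r \<le> Coset.order G"
    and act: "\<And>i g. i < r \<Longrightarrow> g \<in> carrier G \<Longrightarrow>
      \<exists>a\<in>adjoin K (xs ` {..<i}). \<exists>b\<in>adjoin K (xs ` {..<i}). \<rho> g (xs i) = a * xs i + b"
  shows few_generators
proof -
  have "\<exists>T. finite T \<and> card T \<le> r \<and>
    fixed_by (carrier G) (adjoin K (xs ` {..<r})) = adjoin (fixed_by (carrier G) K) T"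
  proof (rule fixed_by_triangular[OF K stable_K _ act])
    fix i assume "i < r"
    then show "\<not> alg_over (adjoin K (xs ` {..<i})) (xs i)"
      using generators_transcendental[of "{}" xs r i] adjoin_subset_acl[of K "xs ` {..<r}"] L r
      by (simp add: adjoin_empty[OF K])
  qed
  then show ?thesis using r unfolding few_generators_def L fixed_by_K by (meson le_trans)
qed

end

section \<open>Characteristic \<open>p\<close>\<close>

text \<open>In characteristic \<open>p\<close> these sets are the vector spaces over the prime
  field, whose scalars are written \<open>of_nat j\<close>.\<close>

definition additive_set :: "'l::field set \<Rightarrow> bool" where
  "additive_set A \<longleftrightarrow> 0 \<in> A \<and> (\<forall>x\<in>A. \<forall>y\<in>A. x - y \<in> A)"

lemma additive_setD:
  assumes "additive_set A"
  shows "0 \<in> A" "x \<in> A \<Longrightarrow> y \<in> A \<Longrightarrow> x - y \<in> A" "x \<in> A \<Longrightarrow> - x \<in> A"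
    "x \<in> A \<Longrightarrow> y \<in> A \<Longrightarrow> x + y \<in> A" "x \<in> A \<Longrightarrow> of_nat n * x \<in> A"
proof -
  have 0: "0 \<in> A" and d: "\<And>x y. x \<in> A \<Longrightarrow> y \<in> A \<Longrightarrow> x - y \<in> A"
    using assms by (auto simp: additive_set_def)
  have n: "- x \<in> A" if "x \<in> A" for x using d[OF 0 that] by simp
  have a: "x + y \<in> A" if "x \<in> A" "y \<in> A" for x y using d[OF that(1) n[OF that(2)]] by simp
  have "of_nat n * x \<in> A" if "x \<in> A" by (induction n) (auto simp: distrib_right 0 a that)
  then show "0 \<in> A" "x \<in> A \<Longrightarrow> y \<in> A \<Longrightarrow> x - y \<in> A" "x \<in> A \<Longrightarrow> - x \<in> A"
    "x \<in> A \<Longrightarrow> y \<in> A \<Longrightarrow> x + y \<in> A" "x \<in> A \<Longrightarrow> of_nat n * x \<in> A"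
    using 0 d n a by auto
qed

lemma additive_set_sum:
  "additive_set A \<Longrightarrow> (\<And>i. i \<in> I \<Longrightarrow> f i \<in> A) \<Longrightarrow> sum f I \<in> A"
  by (induction I rule: infinite_finite_induct) (auto intro: additive_setD)

text \<open>In characteristic \<open>p\<close> this is the span of \<open>A\<close> and
  \<open>v\<close> over the prime field. The coefficients run over \<open>j < p\<close>, so that the
  cardinality can be read off.\<close>

definition extend_set :: "nat \<Rightarrow> 'l::field set \<Rightarrow> 'l \<Rightarrow> 'l set" where
  "extend_set p A v = (\<lambda>(a, j). a + of_nat j * v) ` (A \<times> {..<p})"

context
  fixes p :: nat and A :: "'l::field set"
  assumes p: "Factorial_Ring.prime p" and p0: "of_nat p = (0::'l)"
    and A: "additive_set A" "finite A"
begin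

lemma of_nat_mod_p: "of_nat (n mod p) = (of_nat n :: 'l)"
proof -
  have "of_nat n = (of_nat (p * (n div p) + n mod p) :: 'l)" by simp
  then show ?thesis unfolding of_nat_add of_nat_mult by (simp add: p0)
qed

lemma in_extend_setI: "a \<in> A \<Longrightarrow> a + of_nat j * v \<in> extend_set p A v"
  unfolding extend_set_def using p
  by (intro image_eqI[of _ _ "(a, j mod p)"]) (auto simp: of_nat_mod_p prime_gt_0_nat)

lemma subset_extend_set: "A \<subseteq> extend_set p A v" "v \<in> extend_set p A v"
  using in_extend_setI[of _ 0 v] in_extend_setI[of 0 1 v] additive_setD(1)[OF A(1)] by auto

lemma additive_extend_set: "additive_set (extend_set p A v)"
  unfolding additive_set_def
proof (intro conjI ballI)
  show "0 \<in> extend_set p A v" using subset_extend_set(1) additive_setD(1)[OF A(1)] by blast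
  fix x y assume "x \<in> extend_set p A v" "y \<in> extend_set p A v"
  then obtain a i b j where *: "x = a + of_nat i * v" "y = b + of_nat j * v" "a \<in> A" "b \<in> A" "j < p"
    by (auto simp: extend_set_def)
  have "of_nat (p - j) = (- of_nat j :: 'l)" using *(5) p0 by (simp add: of_nat_diff)
  then have "x - y = (a - b) + of_nat (i + (p - j)) * v" using * by (simp add: algebra_simps)
  then show "x - y \<in> extend_set p A v"
    using in_extend_setI additive_setD(2)[OF A(1)] * by metis
qed

lemma finite_extend_set: "finite (extend_set p A v)"
  using A by (simp add: extend_set_def)

text \<open>\<open>k\<close> is invertible modulo \<open>p\<close>, so \<open>v\<close> is itself a
  multiple of \<open>of_nat k * v\<close>.\<close>

lemma multiple_notin:
  assumes "v \<notin> A" "0 < k" "k < p" shows "of_nat k * v \<notin> A"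
proof
  assume *: "of_nat k * v \<in> A"
  have "\<not> p dvd k" using assms by (meson dvd_imp_le not_le)
  then have "gcd k p = 1" using p by (metis coprime_iff_gcd_eq_1 gcd.commute prime_imp_coprime)
  then obtain x y where "k * x = p * y + 1" using bezout_nat[of k p] assms(2) by auto
  then have "of_nat (k * x) = (of_nat (p * y + 1) :: 'l)" by (simp only:)
  then have "of_nat x * of_nat k = (1 :: 'l)" by (simp add: p0 mult.commute)
  then have "of_nat x * (of_nat k * v) = v" by (metis mult.assoc mult_1_left)
  then show False using additive_setD(5)[OF A(1) *, of x] assms(1) by metis
qed

lemma card_extend_set:
  assumes v: "v \<notin> A" shows "card (extend_set p A v) = p * card A"
proof -
  have aux: "i = j" if "i \<le> j" "j < p" "a \<in> A" "b \<in> A" "a + of_nat i * v = b + of_nat j * v" for a b i j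
  proof (rule ccontr)
    assume "i \<noteq> j"
    have "of_nat (j - i) * v = a - b" using that by (simp add: of_nat_diff algebra_simps)
    then have "of_nat (j - i) * v \<in> A" using additive_setD(2)[OF A(1) that(3,4)] by metis
    moreover have "of_nat (j - i) * v \<notin> A" by (rule multiple_notin[OF v]) (use that \<open>i \<noteq> j\<close> in auto)
    ultimately show False by blast
  qed
  have "inj_on (\<lambda>(a, j). a + of_nat j * v) (A \<times> {..<p})"
  proof (rule inj_onI)
    fix x y assume xy: "x \<in> A \<times> {..<p}" "y \<in> A \<times> {..<p}"
      "(case x of (a, j) \<Rightarrow> a + of_nat j * v) = (case y of (a, j) \<Rightarrow> a + of_nat j * v)"
    obtain a i b j where *: "x = (a, i)" "y = (b, j)" by (metis surj_pair)
    have "i = j"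
      using aux[of i j a b] aux[of j i b a] xy unfolding * by (metis lessThan_iff mem_Sigma_iff nat_le_linear prod.case)
    then show "x = y" using xy * by simp
  qed
  then show ?thesis by (simp add: extend_set_def card_image card_cartesian_product)
qed

lemma extend_set_mem: "v \<in> A \<Longrightarrow> extend_set p A v = A"
  using subset_extend_set(1) additive_setD[OF A(1)] by (auto simp: extend_set_def)

end

context field_action
begin

text \<open>The group permutes the cosets of \<open>A\<close> in \<open>B\<close>, whose number
  \<open>p ^ (j - i)\<close> is divisible by \<open>p\<close>, and it fixes the coset
  \<open>A\<close>. A second fixed coset is represented by the required \<open>v\<close>.\<close>

lemma additive_quotient_fixed_point:
  assumes p: "Factorial_Ring.prime p" "of_nat p = (0::'l)" "Coset.order G = p ^ n"
    and A: "additive_set A" "stable A" and B: "additive_set B" "stable B" "finite B"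
    and AB: "A \<subseteq> B" "card A = p ^ i" "card B = p ^ j" "i < j"
  shows "\<exists>v\<in>B - A. \<forall>g\<in>carrier G. \<rho> g v - v \<in> A"
proof -
  note dA = additive_setD[OF A(1)] and dB = additive_setD[OF B(1)]
  have finA: "finite A" using AB B finite_subset by blast
  define Q where "Q = (\<lambda>v. (\<lambda>a. v + a) ` A) ` B"
  have coset_eq: "(\<lambda>a. v + a) ` A = (\<lambda>a. w + a) ` A \<longleftrightarrow> v - w \<in> A" for v w
  proof
    assume "(\<lambda>a. v + a) ` A = (\<lambda>a. w + a) ` A"
    then have "v \<in> (\<lambda>a. w + a) ` A" using dA(1) by force
    then show "v - w \<in> A" by auto
  next
    assume *: "v - w \<in> A"
    have "v + a = w + (v - w + a)" "w + a = v + (- (v - w) + a)" for a by simp_all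
    then show "(\<lambda>a. v + a) ` A = (\<lambda>a. w + a) ` A"
      using dA(4)[OF *] dA(4)[OF dA(3)[OF *]] by (auto simp only: image_iff; blast)
  qed
  have finQ: "finite Q" using B by (simp add: Q_def)
  have "card A * card Q = card (\<Union>Q)"
  proof (rule card_partition)
    show "finite Q" by (rule finQ)
    show "finite (\<Union>Q)" using finQ finA by (auto simp: Q_def)
    show "card c = card A" if "c \<in> Q" for c using that by (auto simp: Q_def card_image)
    show "c \<inter> c' = {}" if c: "c \<in> Q" "c' \<in> Q" "c \<noteq> c'" for c c'
    proof (rule ccontr)
      assume "c \<inter> c' \<noteq> {}"
      moreover obtain v w where vw: "c = (\<lambda>a. v + a) ` A" "c' = (\<lambda>a. w + a) ` A" using c by (auto simp: Q_def)
      ultimately obtain a b where "a \<in> A" "b \<in> A" "v + a = w + b" by auto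
      then have "v - w = b - a" by (simp add: algebra_simps)
      then have "v - w \<in> A" using dA \<open>a \<in> A\<close> \<open>b \<in> A\<close> by simp
      then show False using c(3) coset_eq vw by blast
    qed
  qed
  also have "\<Union>Q = B"
  proof
    show "\<Union>Q \<subseteq> B" using AB(1) dB(4) by (auto simp: Q_def)
    show "B \<subseteq> \<Union>Q" using dA(1) by (force simp: Q_def)
  qed
  finally have "p ^ i * card Q = p ^ i * p ^ (j - i)" using AB by (simp add: power_add[symmetric])
  then have cardQ: "card Q = p ^ (j - i)" using p(1) by (simp add: prime_gt_0_nat)
  have im: "\<rho> g ` (\<lambda>a. v + a) ` A = (\<lambda>a. \<rho> g v + a) ` A" if g: "g \<in> carrier G" for g v
  proof -
    have "a \<in> \<rho> g ` A" if "a \<in> A" for a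
      using that A(2) g rho_inv(2)[OF g, of a] by (intro image_eqI[of _ _ "\<rho> (inv g) a"]) (auto simp: stable_def)
    then have "\<rho> g ` A = A" using A(2) g by (auto simp: stable_def)
    moreover have "\<rho> g ` (\<lambda>a. v + a) ` A = (\<lambda>a. \<rho> g v + a) ` \<rho> g ` A"
      by (auto simp: rho_add[OF g] image_iff)
    ultimately show ?thesis by simp
  qed
  have A0: "(\<lambda>a. 0 + a) ` A = A" by simp
  have "\<exists>x\<in>Q. x \<noteq> A \<and> (\<forall>g\<in>carrier G. \<rho> g ` x = x)"
  proof (rule p_group_second_fixed_point[OF p(1,3) finQ])
    show "p dvd card Q" using cardQ AB(4) by simp
    show "\<rho> g ` x \<in> Q" if "g \<in> carrier G" "x \<in> Q" for g x
      using that B(2) im by (auto simp: Q_def stable_def)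
    show "A \<in> Q" using dB(1) A0 unfolding Q_def by blast
    show "\<rho> g ` A = A" if "g \<in> carrier G" for g using im[OF that, of 0] by (simp add: rho_0[OF that])
  qed (auto simp: rho_comp rho_one image_image)
  then obtain v where v: "v \<in> B" "(\<lambda>a. v + a) ` A \<noteq> A"
    "\<forall>g\<in>carrier G. \<rho> g ` (\<lambda>a. v + a) ` A = (\<lambda>a. v + a) ` A" by (auto simp: Q_def)
  have "\<rho> g v - v \<in> A" if "g \<in> carrier G" for g using v(3) that im coset_eq by metis
  moreover have "v \<notin> A" using v(2) coset_eq[of v 0] by auto
  ultimately show ?thesis using v(1) by blast
qed

end

context regular_action
begin

text \<open>The variables span a finite stable additive set \<open>B\<close>. A chain of stable
  subsets, each of index \<open>p\<close> in the next, provides elements \<open>xs i\<close> that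
  the group moves by translations with combinations of earlier ones: a triangular system with
  leading coefficient \<open>1\<close>.\<close>

theorem few_generators_char_p:
  assumes p: "Factorial_Ring.prime p" "of_nat p = (0::'l)" "Coset.order G = p ^ n"
  shows few_generators
proof -
  obtain hs where hs: "set hs = carrier G" "distinct hs" using finite_distinct_list[OF finite_carrier] by blast
  have len: "length hs = Coset.order G" using hs by (simp add: Coset.order_def distinct_card[symmetric])
  \<comment> \<open>The variables are added one at a time. The exponent \<open>k\<close> will bound
    the length of the triangular system, and the last inclusion will yield stability of
    \<open>B\<close>.\<close>
  have "\<exists>B k. additive_set B \<and> finite B \<and> B \<subseteq> L \<and> card B = p ^ k \<and> k \<le> m \<and> var ` set (take m hs) \<subseteq> B \<and>
      B \<subseteq> range (\<lambda>c. \<Sum>h\<in>carrier G. of_nat (c h) * var h)" if "m \<le> length hs" for m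
    using that
  proof (induction m)
    case 0
    show ?case by (rule exI[of _ "{0}"], rule exI[of _ 0])
        (auto simp: additive_set_def L_def adjoin_closed intro: range_eqI[of _ _ "\<lambda>_. 0"])
  next
    case (Suc m)
    then obtain B k where B: "additive_set B" "finite B" "B \<subseteq> L" "card B = p ^ k" "k \<le> m" "var ` set (take m hs) \<subseteq> B"
      "B \<subseteq> range (\<lambda>c. \<Sum>h\<in>carrier G. of_nat (c h) * var h)" by auto
    let ?v = "var (hs ! m)" and ?B = "extend_set p B (var (hs ! m))"
    have hm: "hs ! m \<in> carrier G" using Suc.prems hs by (metis Suc_le_eq nth_mem)
    have "?B \<subseteq> L" using B(3) var_in_L[OF hm] unfolding extend_set_def
      by (auto intro!: subfield_closed[OF is_subfield_L])
    moreover have "?B \<subseteq> range (\<lambda>c. \<Sum>h\<in>carrier G. of_nat (c h) * var h)"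
    proof
      fix x assume "x \<in> ?B"
      then obtain a j where a: "a \<in> B" "x = a + of_nat j * ?v" by (auto simp: extend_set_def)
      then obtain c where c: "a = (\<Sum>h\<in>carrier G. of_nat (c h) * var h)" using B(7) by auto
      have "(\<Sum>h\<in>carrier G. of_nat (if h = hs ! m then j else 0) * var h) = of_nat j * ?v"
        using hm finite_carrier by (subst sum.remove[of _ "hs ! m"]) auto
      then have "x = (\<Sum>h\<in>carrier G. of_nat (c h + (if h = hs ! m then j else 0)) * var h)"
        by (simp add: a c distrib_right sum.distrib)
      then show "x \<in> range (\<lambda>c. \<Sum>h\<in>carrier G. of_nat (c h) * var h)"
        by (intro range_eqI[of _ _ "\<lambda>h. c h + (if h = hs ! m then j else 0)"]) simp
    qed
    moreover have "\<exists>k'. card ?B = p ^ k' \<and> k' \<le> Suc m"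
    proof (cases "?v \<in> B")
      case True
      then show ?thesis using extend_set_mem[OF p(1,2) B(1,2)] B by (intro exI[of _ k]) auto
    next
      case False
      then show ?thesis using card_extend_set[OF p(1,2) B(1,2)] B by (intro exI[of _ "Suc k"]) auto
    qed
    moreover have "var ` set (take (Suc m) hs) \<subseteq> ?B"
      using B(6) subset_extend_set[OF p(1,2) B(1,2), of ?v] Suc.prems
      by (auto simp: take_Suc_conv_app_nth)
    ultimately show ?case
      using additive_extend_set[OF p(1,2) B(1,2), of ?v] finite_extend_set[OF p(1,2) B(1,2), of ?v] by blast
  qed
  from this[of "length hs"] obtain B k where B: "additive_set B" "finite B" "B \<subseteq> L" "card B = p ^ k"
    "k \<le> Coset.order G" "var ` carrier G \<subseteq> B" "B \<subseteq> range (\<lambda>c. \<Sum>h\<in>carrier G. of_nat (c h) * var h)"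
    using hs len by auto
  have B_sum: "(\<Sum>h\<in>carrier G. of_nat (c h) * var (g \<otimes> h)) \<in> B" if "g \<in> carrier G" for c g
  proof -
    have "of_nat (c h) * var (g \<otimes> h) \<in> B" if h: "h \<in> carrier G" for h
    proof -
      have "var (g \<otimes> h) \<in> B" using B(6) h \<open>g \<in> carrier G\<close> by blast
      then show ?thesis by (rule additive_setD(5)[OF B(1)])
    qed
    then show ?thesis by (rule additive_set_sum[OF B(1)])
  qed
  have stB: "stable B"
    unfolding stable_def
  proof (intro ballI)
    fix g x assume g: "g \<in> carrier G" and "x \<in> B"
    then obtain c where "x = (\<Sum>h\<in>carrier G. of_nat (c h) * var h)" using B(7) by auto
    then have "\<rho> g x = (\<Sum>h\<in>carrier G. of_nat (c h) * var (g \<otimes> h))"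
      using g rho_K[OF g] subfield_closed(10)[OF K] by (simp add: rho_sum rho_mult rho_var)
    then show "\<rho> g x \<in> B" using B_sum[OF g] by simp
  qed
  \<comment> \<open>Each step picks a fixed vector of the quotient of \<open>B\<close> by
    \<open>A\<close>; the translations by which the group moves a representative then lie in
    \<open>A\<close>.\<close>
  have "\<exists>A xs. additive_set A \<and> stable A \<and> A \<subseteq> B \<and> card A = p ^ j \<and> A \<subseteq> adjoin K (xs ` {..<j}) \<and> xs ` {..<j} \<subseteq> B \<and>
      (\<forall>i<j. \<forall>g\<in>carrier G. \<rho> g (xs i) - xs i \<in> adjoin K (xs ` {..<i}))" if "j \<le> k" for j
    using that
  proof (induction j)
    case 0
    show ?case by (rule exI[of _ "{0}"])
        (auto simp: additive_set_def stable_def rho_0 adjoin_closed additive_setD[OF B(1)])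
  next
    case (Suc j)
    then obtain A xs where A: "additive_set A" "stable A" "A \<subseteq> B" "card A = p ^ j" "A \<subseteq> adjoin K (xs ` {..<j})"
      "xs ` {..<j} \<subseteq> B" "\<forall>i<j. \<forall>g\<in>carrier G. \<rho> g (xs i) - xs i \<in> adjoin K (xs ` {..<i})" by auto
    obtain v where v: "v \<in> B" "v \<notin> A" "\<forall>g\<in>carrier G. \<rho> g v - v \<in> A"
      using additive_quotient_fixed_point[OF p A(1,2) B(1) stB B(2) A(3,4) B(4)] Suc.prems by auto
    have finA: "finite A" using A(3) B(2) finite_subset by blast
    let ?A = "extend_set p A v" and ?xs = "xs(j := v)"
    have im: "?xs ` {..<i} = xs ` {..<i}" if "i \<le> j" for i using that by (auto simp: image_iff)
    have imS: "?xs ` {..<Suc j} = insert v (xs ` {..<j})" by (auto simp: lessThan_Suc image_iff)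
    have sub: "adjoin K (xs ` {..<j}) \<subseteq> adjoin K (insert v (xs ` {..<j}))" by (rule adjoin_mono) auto
    have "stable ?A"
      unfolding stable_def
    proof (intro ballI)
      fix g x assume g: "g \<in> carrier G" and "x \<in> ?A"
      then obtain a m where a: "a \<in> A" "x = a + of_nat m * v" by (auto simp: extend_set_def)
      have "\<rho> g x = (\<rho> g a + of_nat m * (\<rho> g v - v)) + of_nat m * v"
        using rho_K[OF g] subfield_closed(10)[OF K] by (simp add: a(2) rho_hom[OF g] algebra_simps)
      moreover have "\<rho> g a + of_nat m * (\<rho> g v - v) \<in> A"
        using A(2) g a(1) v(3) by (intro additive_setD(4,5)[OF A(1)]) (auto simp: stable_def)
      ultimately show "\<rho> g x \<in> ?A" using in_extend_setI[OF p(1,2) A(1) finA] by metis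
    qed
    moreover have "?A \<subseteq> B" using A(3) v(1) unfolding extend_set_def by (auto intro!: additive_setD[OF B(1)])
    moreover have "?A \<subseteq> adjoin K (?xs ` {..<Suc j})"
    proof -
      have "v \<in> adjoin K (insert v (xs ` {..<j}))" using adjoin_gens[of "insert v (xs ` {..<j})" K] by simp
      then show ?thesis unfolding imS extend_set_def using A(5) sub by (auto intro!: adjoin_closed)
    qed
    moreover have "\<forall>i<Suc j. \<forall>g\<in>carrier G. \<rho> g (?xs i) - ?xs i \<in> adjoin K (?xs ` {..<i})"
    proof (intro allI impI ballI)
      fix i g assume i: "i < Suc j" and g: "g \<in> carrier G"
      show "\<rho> g (?xs i) - ?xs i \<in> adjoin K (?xs ` {..<i})"
      proof (cases "i = j")
        case True
        then show ?thesis using A(5) v(3) g im[of j] by auto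
      next
        case False
        then show ?thesis using A(7) i g im[of i] by simp
      qed
    qed
    moreover have "card ?A = p ^ Suc j" using card_extend_set[OF p(1,2) A(1) finA v(2)] A(4) by simp
    moreover have "?xs ` {..<Suc j} \<subseteq> B" unfolding imS using A(6) v(1) by simp
    ultimately show ?case using additive_extend_set[OF p(1,2) A(1) finA] by blast
  qed
  from this[of k] obtain A xs where A: "A \<subseteq> B" "card A = p ^ k" "A \<subseteq> adjoin K (xs ` {..<k})" "xs ` {..<k} \<subseteq> B"
    "\<forall>i<k. \<forall>g\<in>carrier G. \<rho> g (xs i) - xs i \<in> adjoin K (xs ` {..<i})" by auto
  have "A = B" using A(1,2) B(2,4) by (simp add: card_subset_eq)
  have "L = adjoin K (xs ` {..<k})"
  proof
    show "L \<subseteq> adjoin K (xs ` {..<k})" unfolding L_def using A(3) B(6) \<open>A = B\<close> by (intro adjoin_subset) blast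
    show "adjoin K (xs ` {..<k}) \<subseteq> L" using A(4) B(3) by (intro adjoin_least is_subfield_L K_subset_L) auto
  qed
  then show ?thesis
  proof (rule few_generators_if_triangular[OF _ B(5)])
    fix i g assume "i < k" "g \<in> carrier G"
    then have "\<rho> g (xs i) - xs i \<in> adjoin K (xs ` {..<i})" using A(5) by blast
    then show "\<exists>a\<in>adjoin K (xs ` {..<i}). \<exists>b\<in>adjoin K (xs ` {..<i}). \<rho> g (xs i) = a * xs i + b"
      using adjoin_closed(2) by (intro bexI[of _ 1] bexI[of _ "\<rho> g (xs i) - xs i"]) auto
  qed
qed

end

section \<open>Roots of unity\<close>

lemma primitive_root_power_eq_1:
  assumes "primitive_root_of_unity m (\<omega>::'l::field)"
  shows "\<omega> ^ i = 1 \<longleftrightarrow> m dvd i"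
proof
  assume "m dvd i"
  then show "\<omega> ^ i = 1" using assms by (auto simp: primitive_root_of_unity_def power_mult)
next
  assume i: "\<omega> ^ i = 1"
  have m: "0 < m" "\<omega> ^ m = 1" using assms by (auto simp: primitive_root_of_unity_def)
  have "\<omega> ^ i = \<omega> ^ (m * (i div m) + i mod m)" by simp
  also have "\<dots> = \<omega> ^ (i mod m)" unfolding power_add power_mult by (simp add: m)
  finally have "\<omega> ^ (i mod m) = 1" using i by simp
  moreover have "i mod m < m" using m by simp
  moreover have "\<forall>k. 0 < k \<and> k < m \<longrightarrow> \<omega> ^ k \<noteq> 1" using assms by (simp add: primitive_root_of_unity_def)
  ultimately have "\<not> 0 < i mod m" by metis
  then show "m dvd i" by (simp add: mod_greater_zero_iff_not_dvd)
qed

lemma primitive_root_nonzero: "primitive_root_of_unity m (\<omega>::'l::field) \<Longrightarrow> \<omega> \<noteq> 0"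
  by (auto simp: primitive_root_of_unity_def power_0_left)

lemma primitive_root_power:
  assumes "primitive_root_of_unity (a * b) (\<omega>::'l::field)" "a > 0"
  shows "primitive_root_of_unity b (\<omega> ^ a)"
proof -
  have "b > 0" using assms by (auto simp: primitive_root_of_unity_def)
  moreover have "(\<omega> ^ a) ^ i = 1 \<longleftrightarrow> b dvd i" for i
    using primitive_root_power_eq_1[OF assms(1), of "a * i"] assms(2) by (simp add: power_mult)
  ultimately show ?thesis unfolding primitive_root_of_unity_def
    by (auto dest: dvd_imp_le)
qed

text \<open>The powers of \<open>\<omega>\<close> are already \<open>m\<close> distinct roots of
  \<open>X ^ m - 1\<close>.\<close>

lemma root_of_unity_is_power:
  assumes \<omega>: "primitive_root_of_unity m (\<omega>::'l::field)" and x: "x ^ m = 1"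
  shows "\<exists>i<m. x = \<omega> ^ i"
proof -
  have m: "m > 0" using \<omega> by (auto simp: primitive_root_of_unity_def)
  have inj: "inj_on (\<lambda>i. \<omega> ^ i) {..<m}"
  proof (rule linorder_inj_onI)
    fix i j :: nat assume ij: "i < j" "j \<in> {..<m}"
    have "\<omega> ^ j = \<omega> ^ i * \<omega> ^ (j - i)" using ij by (simp add: power_add[symmetric])
    moreover have "\<omega> ^ (j - i) \<noteq> 1"
      unfolding primitive_root_power_eq_1[OF \<omega>] using ij by (auto dest!: dvd_imp_le)
    ultimately show "\<omega> ^ i \<noteq> \<omega> ^ j" using primitive_root_nonzero[OF \<omega>] by simp
  qed auto
  define P where "P = monom (1::'l) m - 1"
  have deg: "degree P = m" unfolding P_def using m
    by (subst diff_conv_add_uminus, subst degree_add_eq_left) (auto simp: degree_monom_eq)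
  have P0: "P \<noteq> 0" using deg m by auto
  have roots: "{y. poly P y = 0} = {y. y ^ m = 1}" by (auto simp: P_def poly_monom)
  have fin: "finite {y::'l. y ^ m = 1}" using poly_roots_finite[OF P0] roots by simp
  have "card {y::'l. y ^ m = 1} \<le> m" using card_poly_roots_bound[OF P0] deg roots by simp
  moreover have sub: "(\<lambda>i. \<omega> ^ i) ` {..<m} \<subseteq> {y. y ^ m = 1}"
    using \<omega> by (auto simp: primitive_root_of_unity_def power_mult[symmetric] mult.commute[of _ m])
      (simp add: power_mult)
  moreover have "card ((\<lambda>i. \<omega> ^ i) ` {..<m}) = m" using inj by (simp add: card_image)
  ultimately have "(\<lambda>i. \<omega> ^ i) ` {..<m} = {y. y ^ m = 1}"
    using fin by (intro card_seteq) auto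
  then have "x \<in> (\<lambda>i. \<omega> ^ i) ` {..<m}" using x by simp
  then show ?thesis by auto
qed

text \<open>A \<open>b\<close>-th root of unity is a power of \<open>\<zeta> ^ a\<close>, hence an
  \<open>a\<close>-th power. This supplies the roots of eigenvalues by which orbits are
  normalized.\<close>

lemma root_of_root_of_unity:
  assumes \<zeta>: "primitive_root_of_unity (a * b) (\<zeta>::'l::field)" and "a > 0" and c: "c ^ b = 1"
  shows "\<exists>i. c = (\<zeta> ^ i) ^ a"
proof -
  obtain i where "c = (\<zeta> ^ a) ^ i"
    using root_of_unity_is_power[OF primitive_root_power[OF assms(1,2)] c] by blast
  then show ?thesis by (auto intro!: exI[of _ i] simp: power_mult[symmetric] mult.commute)
qed

text \<open>The exponent \<open>m - i\<close> plays the role of \<open>- i\<close>; the inner sum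
  over \<open>k\<close> is orthogonality of characters.\<close>

lemma fourier_inversion:
  assumes \<omega>: "primitive_root_of_unity m (\<omega>::'l::field)" and i: "i < m"
  shows "of_nat m * s i = (\<Sum>k<m. (\<omega> ^ k) ^ (m - i) * (\<Sum>j<m. (\<omega> ^ k) ^ j * s j))"
proof -
  have "(\<Sum>k<m. (\<omega> ^ k) ^ (m - i) * (\<Sum>j<m. (\<omega> ^ k) ^ j * s j)) = (\<Sum>k<m. \<Sum>j<m. (\<omega> ^ (j + m - i)) ^ k * s j)"
    unfolding sum_distrib_left using i
    by (intro sum.cong HOL.refl) (simp add: power_mult[symmetric] power_add[symmetric] mult.assoc[symmetric] algebra_simps)
  also have "\<dots> = (\<Sum>j<m. (\<Sum>k<m. (\<omega> ^ (j + m - i)) ^ k) * s j)"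
    by (subst sum.swap) (simp add: sum_distrib_right)
  also have "\<dots> = (\<Sum>j<m. if j = i then of_nat m * s i else 0)"
  proof (rule sum.cong[OF HOL.refl])
    fix j assume "j \<in> {..<m}"
    then have "j + m - i < 2 * m" "0 < j + m - i" using i by auto
    moreover have "m dvd x \<longleftrightarrow> x = m" if "0 < x" "x < 2 * m" for x
      using that by (auto elim!: dvdE)
    ultimately have "m dvd j + m - i \<longleftrightarrow> j = i" using i by auto
    then show "(\<Sum>k<m. (\<omega> ^ (j + m - i)) ^ k) * s j = (if j = i then of_nat m * s i else 0)"
      by (simp add: sum_powers_root_of_unity[OF \<omega>])
  qed
  finally show ?thesis using i by simp
qed

lemma sum_lessThan_shift_cyclic:
  fixes f :: "nat \<Rightarrow> 'c::comm_monoid_add"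
  assumes "f q = f 0" shows "(\<Sum>j<q. f (Suc j)) = (\<Sum>j<q. f j)"
proof (cases q)
  case (Suc n)
  have "(\<Sum>j<q. f (Suc j)) = (\<Sum>j<n. f (Suc j)) + f 0" using assms Suc by simp
  also have "\<dots> = (\<Sum>j<q. f j)" unfolding Suc sum.lessThan_Suc_shift by (simp add: add.commute)
  finally show ?thesis .
qed simp

lemma prod_lessThan_shift_cyclic:
  fixes f :: "nat \<Rightarrow> 'c::comm_monoid_mult"
  assumes "f q = f 0" shows "(\<Prod>j<q. f (Suc j)) = (\<Prod>j<q. f j)"
proof (cases q)
  case (Suc n)
  have "(\<Prod>j<q. f (Suc j)) = (\<Prod>j<n. f (Suc j)) * f 0" using assms Suc by simp
  also have "\<dots> = (\<Prod>j<q. f j)" unfolding Suc prod.lessThan_Suc_shift by (simp add: mult.commute)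
  finally show ?thesis .
qed simp

lemma (in group) subgroup_nat_pow_closed:
  assumes "subgroup H G" "h \<in> H" shows "h [^] (k :: nat) \<in> H"
  using assms by (induction k) (auto intro: subgroup.one_closed subgroup.m_closed)

section \<open>Eigenvectors of abelian subgroups\<close>

text \<open>A smallest subset \<open>W'\<close> that still generates all of \<open>W\<close> as a
  field is linearly independent, since a relation would express one member by the others. Being
  contained in the span of \<open>S\<close>, it is no larger than \<open>S\<close>.\<close>

lemma adjoin_spanning_subset:
  assumes K: "is_subfield K" and "finite W" "finite S" "W \<subseteq> lin_span K S"
  shows "\<exists>W'\<subseteq>W. card W' \<le> card S \<and> W \<subseteq> adjoin K W'"
proof -
  have "\<exists>W'. (W' \<subseteq> W \<and> W \<subseteq> adjoin K W') \<and>
      (\<forall>W''. W'' \<subseteq> W \<and> W \<subseteq> adjoin K W'' \<longrightarrow> card W' \<le> card W'')"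
    by (rule ex_has_least_nat[of _ W]) (simp add: adjoin_gens)
  then obtain W' where "W' \<subseteq> W \<and> W \<subseteq> adjoin K W'"
    and min: "\<forall>W''. W'' \<subseteq> W \<and> W \<subseteq> adjoin K W'' \<longrightarrow> card W' \<le> card W''" by (elim exE conjE) (rule that, simp_all)
  then have W': "W' \<subseteq> W" "W \<subseteq> adjoin K W'" by auto
  have fin: "finite W'" using W'(1) assms(2) finite_subset by blast
  have "card W' \<le> card S"
  proof (rule ccontr)
    assume "\<not> card W' \<le> card S"
    then have "\<exists>c. (\<forall>w\<in>W'. c w \<in> K) \<and> (\<exists>w\<in>W'. c w \<noteq> 0) \<and> (\<Sum>w\<in>W'. c w * w) = 0"
      using W'(1) assms(4) by (intro lin_span_dependent[OF K assms(3) fin]) auto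
    then obtain c w where c: "\<And>v. v \<in> W' \<Longrightarrow> c v \<in> K" "w \<in> W'" "c w \<noteq> 0" "(\<Sum>v\<in>W'. c v * v) = 0" by blast
    let ?E = "adjoin K (W' - {w})"
    have "c w * w + (\<Sum>v\<in>W' - {w}. c v * v) = 0" using c(2,4) fin by (simp add: sum.remove)
    then have "w = - (\<Sum>v\<in>W' - {w}. c v * v) / c w"
      using c(3) by (simp add: field_simps eq_neg_iff_add_eq_0)
    also have "\<dots> \<in> ?E" using c(1,2) adjoin_base[of K "W' - {w}"] adjoin_gens[of "W' - {w}" K]
      by (intro adjoin_closed(12) adjoin_closed(6) adjoin_closed(8) adjoin_closed(5)) auto
    finally have "w \<in> ?E" .
    then have "W' \<subseteq> ?E" using adjoin_gens[of "W' - {w}" K] by auto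
    then have "W \<subseteq> ?E" using W'(2) adjoin_subset by blast
    then have "card W' \<le> card (W' - {w})" using W'(1) min[rule_format, of "W' - {w}"] by auto
    then show False using c(2) fin by (metis card_Diff1_less leD)
  qed
  then show ?thesis using W' by blast
qed

context regular_action
begin

text \<open>The elements of \<open>H\<close> are diagonalized one after the other. Since
  \<open>H\<close> is commutative, projecting to the eigenspaces of a new \<open>h\<close> preserves
  the eigenvectors of the earlier elements. The resulting generators are finally thinned out to at
  most \<open>card H\<close>.\<close>

lemma eigenbasis:
  assumes H: "subgroup H G" "\<And>g h. g \<in> H \<Longrightarrow> h \<in> H \<Longrightarrow> g \<otimes> h = h \<otimes> g"
    and q: "\<And>h. h \<in> H \<Longrightarrow> h [^] q = \<one>" "of_nat q \<noteq> (0::'l)"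
    and \<zeta>: "primitive_root_of_unity q \<zeta>" "\<zeta> \<in> K"
  shows "\<exists>W. finite W \<and> card W \<le> card H \<and> 0 \<notin> W \<and> W \<subseteq> L \<and> var ` H \<subseteq> adjoin K W \<and>
    (\<forall>w\<in>W. \<forall>h\<in>H. \<exists>c\<in>K. \<rho> h w = c * w)"
proof -
  have HG: "H \<subseteq> carrier G" using H(1) by (rule subgroup.subset)
  have finH: "finite H" using HG finite_carrier finite_subset by blast
  let ?S = "var ` H"
  have span_stable: "\<rho> h x \<in> lin_span K ?S" if h: "h \<in> H" and x: "x \<in> lin_span K ?S" for h x
  proof -
    obtain c where c: "\<forall>w\<in>?S. c w \<in> K" "x = (\<Sum>w\<in>?S. c w * w)" using x unfolding lin_span_def by blast
    have hG: "h \<in> carrier G" using h HG by blast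
    have "\<rho> h x = (\<Sum>w\<in>?S. c w * \<rho> h w)"
      unfolding c(2) rho_sum[OF hG] rho_mult[OF hG] using rho_K[OF hG] c(1) by (intro sum.cong) auto
    also have "\<dots> \<in> lin_span K ?S"
    proof (rule lin_span_sum[OF K])
      fix w assume w: "w \<in> ?S"
      then obtain g where g: "g \<in> H" "w = var g" by blast
      have "\<rho> h w = var (h \<otimes> g)" using g h HG by (simp add: rho_var subset_iff)
      then have "\<rho> h w \<in> ?S" using subgroup.m_closed[OF H(1) h g(1)] by blast
      then show "c w * \<rho> h w \<in> lin_span K ?S"
        using c(1) w finH by (intro lin_span_scale K lin_span_base) auto
    qed
    finally show ?thesis .
  qed
  have q0: "q > 0" using \<zeta> by (auto simp: primitive_root_of_unity_def)
  have ex: "\<exists>W. finite W \<and> W \<subseteq> lin_span K ?S \<and> ?S \<subseteq> adjoin K W \<and> (\<forall>w\<in>W. \<forall>h\<in>set hs. \<exists>c\<in>K. \<rho> h w = c * w)"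
    if "set hs \<subseteq> H" for hs
    using that
  proof (induction hs)
    case Nil
    show ?case using finH lin_span_base[OF K, of ?S] adjoin_gens[of ?S K] by (intro exI[of _ ?S]) auto
  next
    case (Cons h hs)
    then obtain W where W: "finite W" "W \<subseteq> lin_span K ?S" "?S \<subseteq> adjoin K W"
      "\<forall>w\<in>W. \<forall>h\<in>set hs. \<exists>c\<in>K. \<rho> h w = c * w" by auto
    have h: "h \<in> H" "h \<in> carrier G" using Cons.prems HG by auto
    have hj: "h [^] j \<in> H" "h [^] j \<in> carrier G" for j :: nat
      using subgroup_nat_pow_closed[OF H(1) h(1)] h(2) by auto
    \<comment> \<open>Up to the factor \<open>q\<close> this is the projection of \<open>w\<close>
      to the eigenspace of \<open>h\<close> with eigenvalue
      \<open>inverse (\<zeta> ^ k)\<close>.\<close>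
    define E where "E k w = (\<Sum>j<q. (\<zeta> ^ k) ^ j * \<rho> (h [^] j) w)" for k and w :: 'l
    define W' where "W' = (\<lambda>(w, k). E k w) ` (W \<times> {..<q})"
    have Kpow: "(\<zeta> ^ k) ^ j \<in> K" for k j using \<zeta>(2) by (intro subfield_closed[OF K])
    have eig: "\<rho> h (E k w) = inverse (\<zeta> ^ k) * E k w" for k w
    proof -
      have z0: "\<zeta> ^ k \<noteq> 0" using primitive_root_nonzero[OF \<zeta>(1)] by simp
      have "\<rho> h (E k w) = (\<Sum>j<q. (\<zeta> ^ k) ^ j * \<rho> (h [^] Suc j) w)"
        by (simp only: E_def rho_sum[OF h(2)] rho_mult[OF h(2)] rho_K[OF h(2) Kpow] rho_pow_Suc[OF h(2)])
      then have "\<zeta> ^ k * \<rho> h (E k w) = (\<Sum>j<q. (\<zeta> ^ k) ^ Suc j * \<rho> (h [^] Suc j) w)"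
        by (simp only: sum_distrib_left power_Suc mult.assoc)
      also have "\<dots> = E k w"
        unfolding E_def
      proof (rule sum_lessThan_shift_cyclic)
        have "(\<zeta> ^ k) ^ q = 1" using \<zeta>(1) by (metis power_mult mult.commute power_one primitive_root_of_unity_def)
        then show "(\<zeta> ^ k) ^ q * \<rho> (h [^] q) w = (\<zeta> ^ k) ^ 0 * \<rho> (h [^] (0::nat)) w"
          using q(1)[OF h(1)] by simp
      qed
      finally have "\<zeta> ^ k * \<rho> h (E k w) = E k w" .
      then have "inverse (\<zeta> ^ k) * (\<zeta> ^ k * \<rho> h (E k w)) = inverse (\<zeta> ^ k) * E k w" by (rule arg_cong)
      moreover have "inverse (\<zeta> ^ k) * (\<zeta> ^ k * y) = y" for y using z0 by (simp add: mult.assoc[symmetric])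
      ultimately show ?thesis by simp
    qed
    have eig': "\<exists>c\<in>K. \<rho> g (E k w) = c * E k w" if w: "w \<in> W" and g: "g \<in> set hs" for g k w
    proof -
      obtain c where c: "c \<in> K" "\<rho> g w = c * w" using W(4) w g by blast
      have gH: "g \<in> H" "g \<in> carrier G" using g Cons.prems HG by auto
      have "\<rho> g (\<rho> (h [^] j) w) = c * \<rho> (h [^] j) w" for j :: nat
      proof -
        have "\<rho> g (\<rho> (h [^] j) w) = \<rho> (h [^] j) (\<rho> g w)"
          using gH hj H(2)[OF gH(1) hj(1)] by (simp add: rho_comp[symmetric])
        then show ?thesis using c hj by (simp add: rho_mult rho_K)
      qed
      then have "\<rho> g (E k w) = c * E k w"
        by (simp add: E_def rho_sum[OF gH(2)] rho_mult[OF gH(2)] rho_K[OF gH(2) Kpow] sum_distrib_left ac_simps)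
      then show ?thesis using c(1) by blast
    qed
    have in_span: "E k w \<in> lin_span K ?S" if "w \<in> W" for k w
      unfolding E_def using W(2) that hj span_stable Kpow by (intro lin_span_sum lin_span_scale K) auto
    \<comment> \<open>The projections add up to \<open>q\<close> times the vector, so nothing is
      lost by passing to them.\<close>
    have recover: "of_nat q * w = (\<Sum>k<q. E k w)" for w
    proof -
      have "(\<Sum>k<q. E k w) = (\<Sum>j<q. \<Sum>k<q. (\<zeta> ^ k) ^ j * \<rho> (h [^] j) w)"
        unfolding E_def by (rule sum.swap)
      also have "\<dots> = (\<Sum>j<q. (\<Sum>k<q. (\<zeta> ^ j) ^ k) * \<rho> (h [^] j) w)"
        unfolding sum_distrib_right
        by (intro sum.cong HOL.refl) (simp add: power_mult[symmetric] mult.commute)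
      also have "\<dots> = (\<Sum>j<q. if j = 0 then of_nat q * w else 0)"
        unfolding sum_powers_root_of_unity[OF \<zeta>(1)]
        by (intro sum.cong HOL.refl) (auto simp: rho_one dest!: dvd_imp_le)
      finally show ?thesis using q0 by simp
    qed
    have "W \<subseteq> adjoin K W'"
    proof
      fix w assume "w \<in> W"
      then have "E k w \<in> adjoin K W'" if "k < q" for k
        using that adjoin_gens[of W' K] by (auto simp: W'_def)
      then have "of_nat q * w \<in> adjoin K W'" unfolding recover by (intro adjoin_closed) auto
      then have "of_nat q * w / of_nat q \<in> adjoin K W'" by (rule adjoin_closed(12)[OF _ adjoin_closed(10)])
      moreover have "of_nat q * w / of_nat q = w" using q(2) by simp
      ultimately show "w \<in> adjoin K W'" by simp
    qed
    then have "?S \<subseteq> adjoin K W'" using W(3) adjoin_subset by blast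
    moreover have "inverse (\<zeta> ^ k) \<in> K" for k using \<zeta>(2) by (intro subfield_closed[OF K])
    ultimately show ?case using W(1) in_span eig eig'
      by (intro exI[of _ W']) (auto simp: W'_def)
  qed
  obtain hs where hs: "set hs = H" using finite_list[OF finH] by blast
  obtain W where W: "finite W" "W \<subseteq> lin_span K ?S" "?S \<subseteq> adjoin K W"
    "\<forall>w\<in>W. \<forall>h\<in>H. \<exists>c\<in>K. \<rho> h w = c * w" using ex[of hs] unfolding hs by blast
  have "\<exists>W'\<subseteq>W - {0}. card W' \<le> card ?S \<and> W - {0} \<subseteq> adjoin K W'"
    using W finH by (intro adjoin_spanning_subset K) auto
  then obtain W' where W': "W' \<subseteq> W - {0}" "card W' \<le> card ?S" "W - {0} \<subseteq> adjoin K W'" by blast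
  have "W \<subseteq> adjoin K W'" using W'(3) adjoin_closed(1) by auto
  then have 1: "?S \<subseteq> adjoin K W'" using W(3) adjoin_subset by blast
  have "lin_span K ?S \<subseteq> L"
  proof
    fix x assume "x \<in> lin_span K ?S"
    then obtain c where c: "\<forall>w\<in>?S. c w \<in> K" "x = (\<Sum>w\<in>?S. c w * w)" unfolding lin_span_def by blast
    then show "x \<in> L" using var_in_L HG K_subset_L by (auto intro!: subfield_closed[OF is_subfield_L])
  qed
  then have 2: "W' \<subseteq> L" using W(2) W'(1) by auto
  have 3: "card W' \<le> card H" using W'(2) card_image_le[OF finH] by (rule order_trans)
  have 4: "finite W'" using finite_subset[OF W'(1)] W(1) by simp
  have 5: "0 \<notin> W'" using W'(1) by auto
  have 6: "\<forall>w\<in>W'. \<forall>h\<in>H. \<exists>c\<in>K. \<rho> h w = c * w" using W(4) W'(1) by auto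
  show ?thesis by (rule exI[of _ W'], intro conjI) (fact 4, fact 3, fact 5, fact 2, fact 1, fact 6)
qed

theorem few_generators_abelian:
  assumes "\<And>g h. g \<in> carrier G \<Longrightarrow> h \<in> carrier G \<Longrightarrow> g \<otimes> h = h \<otimes> g"
    and q: "\<And>h. h \<in> carrier G \<Longrightarrow> h [^] q = \<one>" "of_nat q \<noteq> (0::'l)"
    and \<zeta>: "primitive_root_of_unity q \<zeta>" "\<zeta> \<in> K"
  shows few_generators
proof -
  obtain W where W: "finite W" "card W \<le> card (carrier G)" "W \<subseteq> L" "var ` carrier G \<subseteq> adjoin K W"
    "\<forall>w\<in>W. \<forall>h\<in>carrier G. \<exists>c\<in>K. \<rho> h w = c * w"
    using eigenbasis[OF subgroup_self assms] by blast
  obtain xs where xs: "W = xs ` {..<card W}"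
    using ex_bij_betw_nat_finite[OF W(1)] by (auto simp: bij_betw_def atLeast0LessThan)
  have "L \<subseteq> adjoin K W" unfolding L_def using W(4) adjoin_subset by blast
  moreover have "adjoin K W \<subseteq> L" by (rule adjoin_least[OF is_subfield_L K_subset_L W(3)])
  ultimately have "L = adjoin K (xs ` {..<card W})" using xs by simp
  then show ?thesis
  proof (rule few_generators_if_triangular)
    show "card W \<le> Coset.order G" using W(2) by (simp add: Coset.order_def)
    fix i g assume i: "i < card W" and g: "g \<in> carrier G"
    then have "xs i \<in> W" using xs by blast
    then obtain c where "c \<in> K" "\<rho> g (xs i) = c * xs i" using W(5) g by blast
    then show "\<exists>a\<in>adjoin K (xs ` {..<i}). \<exists>b\<in>adjoin K (xs ` {..<i}). \<rho> g (xs i) = a * xs i + b"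
      using adjoin_base[of K "xs ` {..<i}"] adjoin_closed(1) by (intro bexI[of _ c] bexI[of _ 0]) auto
  qed
qed

end

section \<open>Cyclic systems\<close>

context field_action
begin

text \<open>The index runs through all natural numbers with period \<open>m\<close>, so that shifts
  need no reduction. By the condition on the product, the entries generate a multiplicative group
  that is a quotient of \<open>\<int>[C_m]\<close> modulo its norm element.\<close>

definition cyclic_system :: "nat \<Rightarrow> 'a \<Rightarrow> (nat \<Rightarrow> 'l) \<Rightarrow> bool" where
  "cyclic_system m t z \<longleftrightarrow> (\<forall>i. z (i + m) = z i) \<and> (\<Prod>i<m. z i) = 1 \<and> (\<forall>i. \<rho> t (z i) = z (Suc i))"

definition system_field :: "nat \<Rightarrow> (nat \<Rightarrow> nat \<Rightarrow> 'l) \<Rightarrow> 'l set" where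
  "system_field r z = adjoin K (\<Union>j<r. range (z j))"

lemma is_subfield_system_field: "is_subfield (system_field r z)"
  by (simp add: system_field_def is_subfield_adjoin)

lemma system_field_base: "K \<subseteq> system_field r z"
  by (simp add: system_field_def adjoin_base)

lemma system_field_mem: "j < r \<Longrightarrow> z j i \<in> system_field r z"
  unfolding system_field_def by (rule subsetD[OF adjoin_gens]) blast

lemma system_field_least:
  "is_subfield F \<Longrightarrow> K \<subseteq> F \<Longrightarrow> (\<And>j i. j < r \<Longrightarrow> z j i \<in> F) \<Longrightarrow> system_field r z \<subseteq> F"
  unfolding system_field_def by (intro adjoin_least) auto

context
  fixes m t z
  assumes z: "cyclic_system m t z" and m: "m > 0"
begin

lemma cyclic_system_period: "z (i + m) = z i"
  and cyclic_system_prod: "(\<Prod>i<m. z i) = 1"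
  and cyclic_system_shift: "\<rho> t (z i) = z (Suc i)"
  using z by (auto simp: cyclic_system_def)

lemma cyclic_system_mod: "z (i mod m) = z i"
proof -
  have "z (a + m * k) = z a" for a k
    by (induction k) (use cyclic_system_period[of "a + m * _"] in \<open>auto simp: algebra_simps\<close>)
  from this[of "i mod m" "i div m"] show ?thesis by simp
qed

lemma cyclic_system_nonzero: "z i \<noteq> 0"
proof
  assume "z i = 0"
  then have "z (i mod m) = 0" by (simp add: cyclic_system_mod)
  then have "(\<Prod>i<m. z i) = 0" using m by (intro prod_zero) auto
  then show False using cyclic_system_prod by simp
qed

lemma cyclic_system_prod_shift: "(\<Prod>k<m. z (i + k)) = 1"
proof (induction i)
  case (Suc i)
  have "(\<Prod>k<m. z (i + Suc k)) = (\<Prod>k<m. z (i + k))"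
    by (rule prod_lessThan_shift_cyclic) (simp add: cyclic_system_period)
  then show ?case using Suc by simp
qed (simp add: cyclic_system_prod)

text \<open>
  The partial products \<open>s i\<close> are the affine coordinates of a point of projective space whose
  homogeneous coordinates are permuted cyclically, so discrete Fourier transform diagonalizes.
\<close>

lemma cyclic_system_linearize:
  assumes t: "t \<in> carrier G" and \<omega>: "primitive_root_of_unity m \<omega>" "\<omega> \<in> K" and m0: "of_nat m \<noteq> (0::'l)"
  shows "\<exists>U. finite U \<and> card U \<le> m - 1 \<and> adjoin K (range z) = adjoin K U \<and>
    (\<forall>u\<in>U. \<exists>c\<in>K. \<rho> t u = c * u)"
proof -
  define s where "s i = (\<Prod>j<i. z j)" for i
  have s0: "s 0 = 1" and sm: "s m = 1" by (simp_all add: s_def cyclic_system_prod)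
  have s_nz: "s i \<noteq> 0" for i by (simp add: s_def cyclic_system_nonzero)
  have s_t: "\<rho> t (s i) = s (Suc i) / z 0" for i
  proof -
    have "\<rho> t (s i) = (\<Prod>j<i. z (Suc j))" using t by (simp add: s_def rho_prod cyclic_system_shift)
    moreover have "s (Suc i) = z 0 * (\<Prod>j<i. z (Suc j))" unfolding s_def by (rule prod.lessThan_Suc_shift)
    ultimately show ?thesis by (simp add: cyclic_system_nonzero)
  qed
  define V where "V k = (\<Sum>i<m. (\<omega> ^ k) ^ i * s i)" for k
  have \<omega>0: "\<omega> ^ k \<noteq> 0" for k using primitive_root_nonzero[OF \<omega>(1)] by simp
  have \<omega>m: "(\<omega> ^ k) ^ m = 1" for k
    using primitive_root_power_eq_1[OF \<omega>(1), of "k * m"] by (simp add: power_mult)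
  have \<omega>K: "\<omega> ^ k \<in> K" "(\<omega> ^ k) ^ i \<in> K" for k i using \<omega>(2) by (auto intro!: subfield_closed[OF K])
  have V_t: "\<omega> ^ k * \<rho> t (V k) = V k / z 0" for k
  proof -
    have "\<rho> t (V k) = (\<Sum>i<m. (\<omega> ^ k) ^ i * (s (Suc i) / z 0))"
      using t by (simp only: V_def rho_sum rho_mult rho_K[OF t \<omega>K(2)] s_t)
    then have "\<omega> ^ k * \<rho> t (V k) = (\<Sum>i<m. (\<omega> ^ k) ^ Suc i * s (Suc i)) / z 0"
      by (simp add: sum_distrib_left sum_divide_distrib mult.assoc)
    also have "(\<Sum>i<m. (\<omega> ^ k) ^ Suc i * s (Suc i)) = V k"
      unfolding V_def by (rule sum_lessThan_shift_cyclic) (simp only: \<omega>m s0 sm power_0)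
    finally show ?thesis .
  qed
  have recover: "of_nat m * s i = (\<Sum>k<m. (\<omega> ^ k) ^ (m - i) * V k)" if "i < m" for i
    unfolding V_def by (rule fourier_inversion[OF \<omega>(1) that])
  \<comment> \<open>Some Fourier coefficient is nonzero, because together they recover
    \<open>s 0 = 1\<close>. It is the one by which the homogeneous coordinates are divided.\<close>
  have "\<exists>k0<m. V k0 \<noteq> 0"
  proof (rule ccontr)
    assume "\<not> ?thesis"
    then have "of_nat m * s 0 = 0" unfolding recover[OF m] by auto
    then show False using m0 s0 by simp
  qed
  then obtain k0 where k0: "k0 < m" "V k0 \<noteq> 0" by blast
  define u where "u k = V k / V k0" for k
  define U where "U = u ` ({..<m} - {k0})"
  have u_t: "\<exists>c\<in>K. \<rho> t (u k) = c * u k" for k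
  proof -
    have V': "\<rho> t (V k) = V k / (\<omega> ^ k * z 0)" for k
      using V_t[of k] \<omega>0[of k] cyclic_system_nonzero[of 0] by (simp add: field_simps)
    then have "\<rho> t (u k) = (\<omega> ^ k0 / \<omega> ^ k) * u k"
      unfolding u_def rho_divide[OF t] V' using cyclic_system_nonzero[of 0] by simp
    moreover have "\<omega> ^ k0 / \<omega> ^ k \<in> K" using \<omega>K(1) by (intro subfield_divide[OF K])
    ultimately show ?thesis by blast
  qed
  have cU: "card U \<le> m - 1"
  proof -
    have "card U \<le> card ({..<m} - {k0})" unfolding U_def by (rule card_image_le) simp
    then show ?thesis using k0 by simp
  qed
  let ?E = "adjoin K U" and ?Z = "adjoin K (range z)"
  have zZ: "z i \<in> ?Z" for i using adjoin_gens[of "range z" K] by blast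
  have KZ: "c \<in> ?Z" if "c \<in> K" for c using adjoin_base that by blast
  have KE: "c \<in> ?E" if "c \<in> K" for c using adjoin_base that by blast
  have "V k \<in> ?Z" for k unfolding V_def s_def using zZ KZ[OF \<omega>K(2)]
    by (intro adjoin_closed(8) adjoin_closed(5) adjoin_closed(9)) auto
  then have "U \<subseteq> ?Z" unfolding U_def u_def by (auto intro!: adjoin_closed)
  then have sub1: "?E \<subseteq> ?Z" by (rule adjoin_subset)
  have uE: "u k \<in> ?E" if "k < m" for k
  proof (cases "k = k0")
    case True
    then show ?thesis using k0 adjoin_closed(2) by (simp add: u_def)
  next
    case False
    then show ?thesis using that adjoin_gens[of U K] by (auto simp: U_def)
  qed
  have sE': "s i / V k0 \<in> ?E" if "i < m" for i
  proof -
    have "of_nat m * s i / V k0 = (\<Sum>k<m. (\<omega> ^ k) ^ (m - i) * u k)"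
      unfolding recover[OF that] by (simp add: u_def sum_divide_distrib)
    also have "\<dots> \<in> ?E" using uE KE[OF \<omega>K(2)] by (intro adjoin_closed(8) adjoin_closed(5)) auto
    finally have "of_nat m * s i / V k0 / of_nat m \<in> ?E" by (rule adjoin_closed(12)[OF _ adjoin_closed(10)])
    then show ?thesis using m0 by simp
  qed
  have sE: "s i \<in> ?E" if "i \<le> m" for i
  proof (cases "i = m")
    case True
    then show ?thesis using sm adjoin_closed(2) by simp
  next
    case False
    \<comment> \<open>Dividing by the expression for \<open>s 0 = 1\<close> removes the common
      factor \<open>V k0\<close>.\<close>
    then have "(s i / V k0) / (s 0 / V k0) \<in> ?E" using that m by (intro adjoin_closed(12) sE') auto
    then show ?thesis using k0(2) s0 by simp
  qed
  have "z i \<in> ?E" for i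
  proof -
    have i: "i mod m < m" using m by simp
    have "z i = s (Suc (i mod m)) / s (i mod m)"
      using s_nz[of "i mod m"] by (simp add: s_def cyclic_system_mod)
    also have "\<dots> \<in> ?E" using i by (intro adjoin_closed(12) sE) auto
    finally show ?thesis .
  qed
  then have "?Z \<subseteq> ?E" by (intro adjoin_subset) auto
  then show ?thesis using sub1 cU u_t by (intro exI[of _ U]) (auto simp: U_def)
qed

end

text \<open>
  Since \<open>h\<close> scales each system by one \<open>p\<close>-th root of unity, dividing by suitable powers of one
  system on which it is nontrivial gives \<open>h\<close>-invariant systems.
\<close>

lemma cyclic_systems_kummer_step:
  fixes z :: "nat \<Rightarrow> nat \<Rightarrow> 'l" and r :: nat
  assumes p: "Factorial_Ring.prime p" "of_nat p \<noteq> (0::'l)"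
    and z: "\<And>j. j < r \<Longrightarrow> cyclic_system p t (z j)" and t: "t \<in> carrier G" and h: "h \<in> carrier G"
    and c: "\<And>j. j < r \<Longrightarrow> c j \<in> K" "\<And>j. j < r \<Longrightarrow> c j ^ p = 1"
      "\<And>j i. j < r \<Longrightarrow> \<rho> h (z j i) = c j * z j i"
    and j0: "j0 < r" "c j0 \<noteq> 1"
  shows "\<exists>z'. (\<forall>j<r. cyclic_system p t (z' j)) \<and> system_field r z' \<subseteq> system_field r z \<and>
    (\<forall>j<r. \<forall>i. \<rho> h (z' j i) = z' j i) \<and>
    (\<forall>x\<in>system_field r z. \<rho> h x = x \<longrightarrow> x \<in> system_field r z') \<and>
    (\<forall>g\<in>carrier G. (\<forall>j<r. \<forall>i. \<exists>c\<in>K. \<rho> g (z j i) = c * z j i) \<longrightarrow>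
      (\<forall>j<r. \<forall>i. \<exists>c\<in>K. \<rho> g (z' j i) = c * z' j i))"
proof -
  have p0: "p > 0" using p(1) prime_gt_0_nat by blast
  \<comment> \<open>An element other than \<open>1\<close> whose order divides the prime
    \<open>p\<close> has order \<open>p\<close>.\<close>
  have root: "primitive_root_of_unity p (c j0)"
  proof -
    have "c j0 ^ k \<noteq> 1" if kp: "0 < k" "k < p" for k
    proof
      assume k: "c j0 ^ k = 1"
      have "\<not> p dvd k" using kp by (meson dvd_imp_le not_le)
      then have "gcd k p = 1" using p(1) by (metis coprime_iff_gcd_eq_1 gcd.commute prime_imp_coprime)
      then obtain x y where "k * x = p * y + 1" using bezout_nat[of k p] kp(1) by auto
      then have "(c j0 ^ k) ^ x = (c j0 ^ p) ^ y * c j0" by (simp add: power_mult[symmetric])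
      then show False using k c(2)[OF j0(1)] j0(2) by simp
    qed
    then show ?thesis using c(2)[OF j0(1)] p0 by (simp add: primitive_root_of_unity_def)
  qed
  have "\<exists>a. c j = c j0 ^ a" if "j < r" for j using root_of_unity_is_power[OF root c(2)[OF that]] by blast
  then obtain a where a: "\<And>j. j < r \<Longrightarrow> c j = c j0 ^ a j" by metis
  \<comment> \<open>System \<open>j0\<close> itself is replaced by the quotients of its neighbouring
    entries, all of which \<open>h\<close> scales alike. Periodicity keeps their product equal to
    \<open>1\<close>.\<close>
  define z' where "z' j i = (if j = j0 then z j0 (Suc i) / z j0 i else z j i / z j0 i ^ a j)" for j i
  note per = cyclic_system_period[OF z p0] and prd = cyclic_system_prod[OF z p0]
    and sh = cyclic_system_shift[OF z p0] and nz = cyclic_system_nonzero[OF z p0]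
  have sys: "cyclic_system p t (z' j)" if j: "j < r" for j
    unfolding cyclic_system_def
  proof (intro conjI allI)
    show "z' j (i + p) = z' j i" for i
      using per[OF j, of i] per[OF j0(1), of i] per[OF j0(1), of "Suc i"] by (simp add: z'_def)
    show "\<rho> t (z' j i) = z' j (Suc i)" for i
      using j0(1) j t by (simp add: z'_def rho_divide rho_power sh)
    have "(\<Prod>i<p. z j0 (Suc i)) = (\<Prod>i<p. z j0 i)"
      by (rule prod_lessThan_shift_cyclic) (use per[OF j0(1), of 0] in simp)
    then show "(\<Prod>i<p. z' j i) = 1"
      using prd[OF j] prd[OF j0(1)]
      by (cases "j = j0") (simp_all add: z'_def prod_dividef prod_power_distrib[symmetric])
  qed
  let ?E = "system_field r z'"
  have z'E: "z' j i \<in> ?E" if "j < r" for j i using system_field_mem[OF that] .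
  have sub: "?E \<subseteq> system_field r z"
    by (intro system_field_least is_subfield_system_field system_field_base)
      (auto simp: z'_def j0(1) intro!: subfield_closed[OF is_subfield_system_field] system_field_mem)
  have inv: "\<rho> h (z' j i) = z' j i" if "j < r" for j i
  proof -
    have c0: "c j0 \<noteq> 0" using primitive_root_nonzero[OF root] .
    show ?thesis
    proof (cases "j = j0")
      case True
      then show ?thesis using c0 c(3)[OF j0(1)] by (simp add: z'_def rho_divide[OF h])
    next
      case False
      have "\<rho> h (z j i) = c j0 ^ a j * z j i" using c(3)[OF that] a[OF that] by simp
      then show ?thesis using False c0 c(3)[OF j0(1)]
        by (simp add: z'_def rho_divide[OF h] rho_power[OF h] power_mult_distrib)
    qed
  qed
  have fixE: "\<rho> h x = x" if "x \<in> ?E" for x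
    using rho_adjoin_fixed[OF h, of K "\<Union>j<r. range (z' j)" x] inv rho_K[OF h] that
    by (auto simp: system_field_def)
  \<comment> \<open>The single entry \<open>u\<close> generates the old field over the new one, and
    the product relation of system \<open>j0\<close> puts \<open>u ^ p\<close> into the new field.
    This is the situation of \<open>fixed_by_kummer\<close>.\<close>
  define u where "u = z j0 0"
  define e where "e i = (\<Prod>k<i. z' j0 k)" for i
  have eE: "e i \<in> ?E" for i
    unfolding e_def using z'E[OF j0(1)] by (intro subfield_closed[OF is_subfield_system_field])
  have zu: "z j0 i = u * e i" for i
  proof (induction i)
    case (Suc i)
    have "z j0 (Suc i) = z j0 i * z' j0 i" using nz[OF j0(1)] by (simp add: z'_def)
    then show ?case using Suc by (simp add: e_def mult.assoc)
  qed (simp add: u_def e_def)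
  have e_nz: "e i \<noteq> 0" for i using zu[of i] nz[OF j0(1), of i] by auto
  have "u ^ p * (\<Prod>i<p. e i) = 1" using prd[OF j0(1)] by (simp add: zu prod.distrib)
  then have up: "u ^ p = 1 / (\<Prod>i<p. e i)" using e_nz by (simp add: field_simps)
  have upE: "u ^ p \<in> ?E" unfolding up using eE by (intro subfield_closed[OF is_subfield_system_field])
  have gen: "system_field r z \<subseteq> adjoin ?E {u}"
  proof (intro system_field_least is_subfield_adjoin)
    have E: "?E \<subseteq> adjoin ?E {u}" and uE: "u \<in> adjoin ?E {u}" using adjoin_base adjoin_gens[of "{u}" ?E] by auto
    show "K \<subseteq> adjoin ?E {u}" using E system_field_base by blast
    have zj0: "z j0 i \<in> adjoin ?E {u}" for i using E uE eE[of i] by (auto simp: zu intro: adjoin_closed)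
    fix j i assume j: "j < r"
    show "z j i \<in> adjoin ?E {u}"
    proof (cases "j = j0")
      case False
      then have "z j i = z' j i * z j0 i ^ a j" using nz[OF j0(1)] by (simp add: z'_def)
      then show ?thesis using zj0[of i] z'E[OF j, of i] E by (auto intro!: adjoin_closed)
    qed (simp add: zj0)
  qed
  have "c j0 \<in> ?E" using c(1)[OF j0(1)] system_field_base by blast
  then have "x \<in> ?E" if "x \<in> system_field r z" "\<rho> h x = x" for x
    using fixed_by_kummer[OF h is_subfield_system_field fixE _ upE root _ p(2)] that gen c(3)[OF j0(1)]
    by (auto simp: u_def)
  moreover have "\<exists>c\<in>K. \<rho> g (z' j i) = c * z' j i"
    if g: "g \<in> carrier G" "\<forall>j<r. \<forall>i. \<exists>c\<in>K. \<rho> g (z j i) = c * z j i" and j: "j < r" for g j i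
  proof -
    obtain d where d: "\<And>j i. j < r \<Longrightarrow> d j i \<in> K" "\<And>j i. j < r \<Longrightarrow> \<rho> g (z j i) = d j i * z j i"
      using g(2) by metis
    show ?thesis
    proof (cases "j = j0")
      case True
      then show ?thesis using d(2)[OF j0(1)] g(1) d(1)[OF j0(1)]
        by (intro bexI[of _ "d j0 (Suc i) / d j0 i"]) (auto simp: z'_def rho_divide intro!: subfield_closed[OF K])
    next
      case False
      then show ?thesis using d(2)[OF j0(1)] d(2)[OF j] g(1) d(1)[OF j0(1)] d(1)[OF j]
        by (intro bexI[of _ "d j i / d j0 i ^ a j"])
          (auto simp: z'_def rho_divide rho_power power_mult_distrib intro!: subfield_closed[OF K])
    qed
  qed
  ultimately show ?thesis using sys sub inv by (intro exI[of _ z']) blast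
qed

end

section \<open>Abelian normal subgroups with cyclic quotient\<close>

text \<open>\<open>m\<close> is the index of \<open>H\<close>. It is \<open>p\<close> for the
  abelian-by-cyclic families and \<open>p\<^sup>2\<close> for the case of
  \<open>\<Phi>\<^sub>8\<close> with a cyclic \<open>H\<close>.\<close>

locale abelian_extension = regular_action G \<rho> K var
  for G :: "('a, 'b) monoid_scheme" (structure) and \<rho> :: "'a \<Rightarrow> 'l::field \<Rightarrow> 'l" and K :: "'l set"
    and var :: "'a \<Rightarrow> 'l" +
  fixes H :: "'a set" and t :: 'a and m :: nat
  assumes H: "subgroup H G" and H_comm: "g \<in> H \<Longrightarrow> h \<in> H \<Longrightarrow> g \<otimes> h = h \<otimes> g"
    and H_normal: "g \<in> carrier G \<Longrightarrow> h \<in> H \<Longrightarrow> g \<otimes> h \<otimes> inv g \<in> H"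
    and t: "t \<in> carrier G" and t_pow: "t [^] m \<in> H"
    and cover: "g \<in> carrier G \<Longrightarrow> \<exists>i<m. \<exists>h\<in>H. g = t [^] i \<otimes> h"
    and card_H: "card H * m = Coset.order G"
begin

lemma H_carrier: "h \<in> H \<Longrightarrow> h \<in> carrier G"
  using H by (auto dest: subgroup.subset)

lemma m_pos: "m > 0"
  using cover[OF one_closed] by auto

lemma t_power: "t [^] (i::nat) \<in> carrier G"
  using t by simp

lemma H_conj: "h \<in> H \<Longrightarrow> inv (t [^] (i::nat)) \<otimes> h \<otimes> t [^] i \<in> H"
  using H_normal[of "inv (t [^] i)" h] t_power[of i] by simp

lemma rho_H_t_power:
  assumes "h \<in> H"
  shows "\<rho> h (\<rho> (t [^] (i::nat)) x) = \<rho> (t [^] i) (\<rho> (inv (t [^] i) \<otimes> h \<otimes> t [^] i) x)"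
proof -
  have "h \<otimes> t [^] i = t [^] i \<otimes> (inv (t [^] i) \<otimes> h \<otimes> t [^] i)"
    using H_carrier[OF assms] t_power[of i] by (simp add: m_assoc[symmetric])
  then show ?thesis
    using H_carrier[OF assms] t_power[of i] H_carrier[OF H_conj[OF assms, of i]]
    by (simp add: rho_comp[symmetric])
qed

lemma rho_t_power_system:
  assumes "cyclic_system k t z" shows "\<rho> (t [^] (i::nat)) (z j) = z (j + i)"
proof (induction i)
  case (Suc i)
  have "\<rho> (t [^] Suc i) (z j) = \<rho> t (z (j + i))" by (simp only: rho_pow_Suc[OF t] Suc)
  then show ?case using assms by (simp add: cyclic_system_def)
qed (simp add: rho_one)

text \<open>Every group element is a power of \<open>t\<close>, which shifts the systems, times an
  element of \<open>H\<close>, which scales their entries by constants.\<close>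

lemma stable_system_field:
  fixes z :: "nat \<Rightarrow> nat \<Rightarrow> 'l" and r :: nat
  assumes "\<And>j. j < r \<Longrightarrow> cyclic_system (ms j) t (z j)"
    and "\<And>h j i. h \<in> H \<Longrightarrow> j < r \<Longrightarrow> \<exists>c\<in>K. \<rho> h (z j i) = c * z j i"
  shows "stable (system_field r z)"
  unfolding system_field_def
proof (rule stable_adjoin[OF stable_K])
  fix g x assume g: "g \<in> carrier G" and "x \<in> (\<Union>j<r. range (z j))"
  then obtain j k where x: "j < r" "x = z j k" by auto
  obtain i :: nat and h where h: "h \<in> H" "g = t [^] i \<otimes> h" using cover[OF g] by blast
  obtain c where c: "c \<in> K" "\<rho> h (z j k) = c * z j k" using assms(2)[OF h(1) x(1)] by blast
  have "\<rho> g x = c * z j (k + i)"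
    using h c t_power[of i] rho_t_power_system[OF assms(1)[OF x(1)]] H_carrier[OF h(1)]
    by (simp add: x rho_comp rho_mult rho_K)
  then show "\<rho> g x \<in> adjoin K (\<Union>j<r. range (z j))"
    using c(1) system_field_base[of r z] system_field_mem[OF x(1), of z "k + i"]
    by (auto simp: system_field_def intro!: adjoin_closed)
qed

text \<open>
  The \<open>p\<close>-group \<open>G\<close> fixes a nontrivial element of \<open>H\<close> modulo the kernel of the action on the systems,
  which therefore scales every system by a single constant.
\<close>

lemma cyclic_systems_central_scaling:
  fixes z :: "nat \<Rightarrow> nat \<Rightarrow> 'l" and r :: nat
  assumes p: "Factorial_Ring.prime p" "Coset.order G = p ^ n"
    and z: "\<And>j. j < r \<Longrightarrow> cyclic_system p t (z j)"
    and sc: "\<And>h j i. h \<in> H \<Longrightarrow> j < r \<Longrightarrow> \<exists>c\<in>K. \<rho> h (z j i) = c * z j i"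
    and nontriv: "h0 \<in> H" "j1 < r" "\<rho> h0 (z j1 i1) \<noteq> z j1 i1"
  shows "\<exists>h\<in>H. \<exists>c. (\<forall>j<r. c j \<in> K \<and> c j ^ p = 1 \<and> (\<forall>i. \<rho> h (z j i) = c j * z j i)) \<and> (\<exists>j<r. c j \<noteq> 1)"
proof -
  have p0: "p > 0" using p(1) prime_gt_0_nat by blast
  have stab: "stable (system_field r z)" by (rule stable_system_field[OF z sc])
  \<comment> \<open>The kernel of the action of \<open>H\<close> on the systems. It is normal in
    \<open>G\<close> because the field that they generate is stable.\<close>
  define N where "N = {h \<in> H. \<forall>x\<in>system_field r z. \<rho> h x = x}"
  have N_iff: "h \<in> N \<longleftrightarrow> (\<forall>j<r. \<forall>i. \<rho> h (z j i) = z j i)" if h: "h \<in> H" for h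
  proof
    assume "\<forall>j<r. \<forall>i. \<rho> h (z j i) = z j i"
    then have "\<rho> h x = x" if "x \<in> system_field r z" for x
      using rho_adjoin_fixed[OF H_carrier[OF h], of K "\<Union>j<r. range (z j)" x] rho_K[OF H_carrier[OF h]] that
      by (auto simp: system_field_def)
    then show "h \<in> N" using h by (auto simp: N_def)
  qed (auto simp: N_def system_field_mem)
  have N_sub: "subgroup N G"
  proof (rule subgroupI)
    show "N \<subseteq> carrier G" using H_carrier by (auto simp: N_def)
    show "N \<noteq> {}" using subgroup.one_closed[OF H] rho_one by (auto simp: N_def)
    fix a assume a: "a \<in> N"
    then have aG: "a \<in> carrier G" using H_carrier by (auto simp: N_def)
    show "inv a \<in> N"
      using a subgroup.m_inv_closed[OF H] rho_inv(1)[OF aG] by (auto simp: N_def) metis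
    fix b assume b: "b \<in> N"
    then have bG: "b \<in> carrier G" using H_carrier by (auto simp: N_def)
    show "a \<otimes> b \<in> N"
      using a b subgroup.m_closed[OF H] by (auto simp: N_def rho_comp[OF aG bG])
  qed
  have NG: "n \<in> carrier G" if "n \<in> N" for n using that H_carrier by (auto simp: N_def)
  have N_conj: "g \<otimes> n \<otimes> inv g \<in> N" if g: "g \<in> carrier G" and n: "n \<in> N" for g n
  proof -
    have "\<rho> (g \<otimes> n \<otimes> inv g) x = x" if x: "x \<in> system_field r z" for x
    proof -
      have "\<rho> (inv g) x \<in> system_field r z" using stab x g by (auto simp: stable_def)
      then have "\<rho> n (\<rho> (inv g) x) = \<rho> (inv g) x" using n by (auto simp: N_def)
      then show ?thesis using g NG[OF n] by (simp add: rho_comp rho_inv(2))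
    qed
    then show ?thesis using n H_normal[OF g] by (auto simp: N_def)
  qed
  have NH: "N \<subseteq> H" by (auto simp: N_def)
  have "h0 \<notin> N" using nontriv N_iff[OF nontriv(1)] by auto
  \<comment> \<open>The cosets of \<open>N\<close> in \<open>H\<close>, on which \<open>G\<close>
    acts by conjugation. Their number is a power of \<open>p\<close> other than \<open>1\<close>,
    and the coset \<open>N\<close> is fixed.\<close>
  define \<Omega> where "\<Omega> = (\<lambda>h. N #> h) ` H"
  have finH: "finite H" using H_carrier finite_carrier by (meson finite_subset subsetI)
  have finOm: "finite \<Omega>" using finH by (simp add: \<Omega>_def)
  have cardOm: "card \<Omega> * card N = card H"
  proof -
    interpret GH: group "G\<lparr>carrier := H\<rparr>" using H by (rule subgroup_imp_group)
    have "subgroup N (G\<lparr>carrier := H\<rparr>)" using subgroup_incl[OF N_sub H NH] .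
    then have "card (rcosets\<^bsub>G\<lparr>carrier := H\<rparr>\<^esub> N) * card N = card H"
      using GH.lagrange by (simp add: Coset.order_def)
    moreover have "rcosets\<^bsub>G\<lparr>carrier := H\<rparr>\<^esub> N = \<Omega>"
      by (auto simp: RCOSETS_def \<Omega>_def r_coset_def)
    ultimately show ?thesis by simp
  qed
  have "card H dvd p ^ n" using card_H p(2) by (metis dvd_triv_left)
  moreover have "card \<Omega> dvd card H" using cardOm by (metis dvd_triv_left)
  ultimately have "card \<Omega> dvd p ^ n" by (rule dvd_trans[rotated])
  then obtain k where k: "card \<Omega> = p ^ k" using p(1) by (auto simp: divides_primepow_nat)
  have N1: "N #> \<one> = N" using NG by (auto simp: r_coset_def)
  have NOm: "N \<in> \<Omega>" using N1 subgroup.one_closed[OF H] unfolding \<Omega>_def by (metis image_eqI)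
  have mem: "h \<in> N #> h" if "h \<in> H" for h
    using rcos_self[OF H_carrier[OF that] N_sub] .
  have "card \<Omega> \<noteq> 1"
  proof
    assume "card \<Omega> = 1"
    then obtain C where "\<Omega> = {C}" by (auto simp: card_1_singleton_iff)
    then have "N #> h0 = N" using NOm nontriv(1) by (auto simp: \<Omega>_def)
    then show False using mem[OF nontriv(1)] \<open>h0 \<notin> N\<close> by simp
  qed
  then have pdvd: "p dvd card \<Omega>" using k by (cases k) auto
  define act where "act g C = (\<lambda>x. g \<otimes> x \<otimes> inv g) ` C" for g C
  have act_coset: "act g (N #> h) = N #> (g \<otimes> h \<otimes> inv g)" if g: "g \<in> carrier G" and h: "h \<in> H" for g h
  proof -
    have hG: "h \<in> carrier G" using H_carrier h by blast
    have eq: "g \<otimes> (n \<otimes> h) \<otimes> inv g = (g \<otimes> n \<otimes> inv g) \<otimes> (g \<otimes> h \<otimes> inv g)" if "n \<in> carrier G" for n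
    proof -
      have "(g \<otimes> n \<otimes> inv g) \<otimes> (g \<otimes> h \<otimes> inv g) = g \<otimes> n \<otimes> (inv g \<otimes> g) \<otimes> h \<otimes> inv g"
        using g hG that by (simp only: m_assoc m_closed inv_closed)
      then show ?thesis using g hG that by (simp add: m_assoc)
    qed
    show ?thesis
    proof
      show "act g (N #> h) \<subseteq> N #> (g \<otimes> h \<otimes> inv g)"
      proof
        fix y assume "y \<in> act g (N #> h)"
        then obtain n where n: "n \<in> N" "y = g \<otimes> (n \<otimes> h) \<otimes> inv g" by (auto simp: act_def r_coset_def)
        then have "y = (g \<otimes> n \<otimes> inv g) \<otimes> (g \<otimes> h \<otimes> inv g)" using eq[OF NG[OF n(1)]] by simp
        then show "y \<in> N #> (g \<otimes> h \<otimes> inv g)" using N_conj[OF g n(1)] unfolding r_coset_def by blast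
      qed
      show "N #> (g \<otimes> h \<otimes> inv g) \<subseteq> act g (N #> h)"
      proof
        fix y assume "y \<in> N #> (g \<otimes> h \<otimes> inv g)"
        then obtain n where n: "n \<in> N" "y = n \<otimes> (g \<otimes> h \<otimes> inv g)" by (auto simp: r_coset_def)
        define n' where "n' = inv g \<otimes> n \<otimes> g"
        have n': "n' \<in> N" using N_conj[of "inv g" n] g n(1) by (simp add: n'_def)
        have "g \<otimes> n' \<otimes> inv g = n" using g NG[OF n(1)] by (simp add: n'_def m_assoc) (simp add: m_assoc[symmetric])
        then have "y = g \<otimes> (n' \<otimes> h) \<otimes> inv g" using eq[OF NG[OF n']] n(2) by simp
        then show "y \<in> act g (N #> h)" using n' by (auto simp: act_def r_coset_def)
      qed
    qed
  qed
  have "\<exists>C\<in>\<Omega>. C \<noteq> N \<and> (\<forall>g\<in>carrier G. act g C = C)"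
  proof (rule p_group_second_fixed_point[OF p finOm pdvd _ _ _ NOm])
    show "act g C \<in> \<Omega>" if "g \<in> carrier G" "C \<in> \<Omega>" for g C
      using that act_coset H_normal by (auto simp: \<Omega>_def)
    show "act (g \<otimes> h) C = act g (act h C)" if gh: "g \<in> carrier G" "h \<in> carrier G" "C \<in> \<Omega>" for g h C
    proof -
      obtain a where a: "a \<in> H" "C = N #> a" using gh(3) by (auto simp: \<Omega>_def)
      have "g \<otimes> (h \<otimes> a \<otimes> inv h) \<otimes> inv g = g \<otimes> h \<otimes> a \<otimes> inv (g \<otimes> h)"
        using gh(1,2) H_carrier[OF a(1)] by (simp add: m_assoc inv_mult_group)
      then show ?thesis using gh(1,2) a act_coset H_normal by simp
    qed
    show "act \<one> C = C" if "C \<in> \<Omega>" for C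
      using that act_coset[of \<one>] H_carrier by (auto simp: \<Omega>_def)
    show "act g N = N" if g: "g \<in> carrier G" for g
      using act_coset[OF g subgroup.one_closed[OF H]] g by (simp add: N1)
  qed
  then obtain h where h: "h \<in> H" "N #> h \<noteq> N" "\<And>g. g \<in> carrier G \<Longrightarrow> act g (N #> h) = N #> h"
    by (auto simp: \<Omega>_def)
  have hG: "h \<in> carrier G" using H_carrier h by blast
  \<comment> \<open>\<open>h\<close> commutes with \<open>t\<close> up to the kernel
    \<open>N\<close>, so its eigenvalue does not change along a system.\<close>
  have "t \<otimes> h \<otimes> inv t \<in> act t (N #> h)" using mem[OF h(1)] unfolding act_def by blast
  then have "t \<otimes> h \<otimes> inv t \<in> N #> h" using h(3)[OF t] by simp
  then obtain n' where n': "n' \<in> N" "t \<otimes> h \<otimes> inv t = n' \<otimes> h" by (auto simp: r_coset_def)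
  have th: "t \<otimes> h = n' \<otimes> h \<otimes> t"
  proof -
    have "t \<otimes> h = (t \<otimes> h \<otimes> inv t) \<otimes> t" using t hG by (simp add: m_assoc)
    then show ?thesis using n'(2) by simp
  qed
  obtain d where d: "\<And>j i. j < r \<Longrightarrow> d j i \<in> K" "\<And>j i. j < r \<Longrightarrow> \<rho> h (z j i) = d j i * z j i"
    using sc[OF h(1)] by metis
  have nz: "z j i \<noteq> 0" if "j < r" for j i using cyclic_system_nonzero[OF z[OF that] p0] .
  have d_const: "d j i = d j 0" if j: "j < r" for j i
  proof (induction i)
    case (Suc i)
    have zS: "z j (Suc i) \<in> system_field r z" using system_field_mem[OF j] .
    have "\<rho> h (z j (Suc i)) \<in> system_field r z" using stab hG zS by (auto simp: stable_def)
    then have "\<rho> n' (\<rho> h (z j (Suc i))) = \<rho> h (z j (Suc i))" using n'(1) by (auto simp: N_def)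
    moreover have "\<rho> (t \<otimes> h) (z j i) = \<rho> (n' \<otimes> h \<otimes> t) (z j i)" using th by simp
    ultimately have "\<rho> t (\<rho> h (z j i)) = \<rho> h (z j (Suc i))"
      using t hG NG[OF n'(1)] cyclic_system_shift[OF z[OF j] p0] by (simp add: rho_comp)
    then have "d j i * z j (Suc i) = d j (Suc i) * z j (Suc i)"
      using d j t cyclic_system_shift[OF z[OF j] p0] by (simp add: rho_mult rho_K)
    then show ?case using nz[OF j] Suc by simp
  qed simp
  have h_pow: "\<rho> (h [^] k) (z j i) = d j 0 ^ k * z j i" if j: "j < r" for j i and k :: nat
  proof (induction k)
    case (Suc k)
    have "\<rho> (h [^] Suc k) (z j i) = \<rho> h (d j 0 ^ k * z j i)" by (simp only: rho_pow_Suc[OF hG] Suc)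
    also have "\<dots> = d j 0 ^ k * (d j 0 * z j i)"
      using d[OF j] d_const[OF j] hG by (simp add: rho_mult rho_power rho_K)
    finally show ?case by (simp add: ac_simps)
  qed (simp add: rho_one)
  have "h [^] (p ^ n) = \<one>" using pow_order_eq_1[OF hG] p(2) by simp
  then have pn: "d j 0 ^ (p ^ n) = 1" if "j < r" for j
    using h_pow[OF that, of "p ^ n" 0] nz[OF that, of 0] by (simp add: rho_one)
  \<comment> \<open>The smallest \<open>k\<close> for which all \<open>p ^ k\<close>-th powers of
    the eigenvalues are \<open>1\<close>. One step earlier these powers are \<open>p\<close>-th
    roots of unity, not all trivial.\<close>
  define k where "k = (LEAST k. \<forall>j<r. d j 0 ^ (p ^ k) = 1)"
  have kP: "\<forall>j<r. d j 0 ^ (p ^ k) = 1"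
    unfolding k_def by (rule LeastI[of _ n]) (use pn in blast)
  have "h \<notin> N"
  proof
    assume "h \<in> N"
    then have "N #> h = N" using coset_join2[OF hG N_sub] by simp
    then show False using h(2) by simp
  qed
  then have "\<not> (\<forall>j<r. d j 0 = 1)"
    using N_iff[OF h(1)] d(2) d_const by (metis mult_1)
  then have "k \<noteq> 0" using kP by (metis power_0 power_one_right)
  then obtain k' where k': "k = Suc k'" by (cases k) auto
  have "\<not> (\<forall>j<r. d j 0 ^ (p ^ k') = 1)" using not_less_Least[of k' "\<lambda>k. \<forall>j<r. d j 0 ^ (p ^ k) = 1"] k' k_def by simp
  moreover have "(d j 0 ^ (p ^ k')) ^ p = 1" if "j < r" for j
    using kP that k' by (simp add: power_mult[symmetric] mult.commute)
  moreover have "h [^] (p ^ k') \<in> H" using h(1) H by (simp add: subgroup_nat_pow_closed)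
  moreover have "d j 0 ^ (p ^ k') \<in> K" if "j < r" for j using d(1)[OF that] by (intro subfield_closed[OF K])
  ultimately show ?thesis using h_pow
    by (intro bexI[of _ "h [^] (p ^ k')"] exI[of _ "\<lambda>j. d j 0 ^ (p ^ k')"]) auto
qed

text \<open>Induction on the number of elements of \<open>H\<close> that act nontrivially. A Kummer
  step makes the chosen \<open>h\<close> act trivially; elements that acted trivially continue to do
  so, because the new systems lie in the field of the old ones.\<close>

lemma cyclic_systems_invariants:
  fixes z :: "nat \<Rightarrow> nat \<Rightarrow> 'l" and r :: nat
  assumes p: "Factorial_Ring.prime p" "Coset.order G = p ^ n" "of_nat p \<noteq> (0::'l)"
    and "\<And>j. j < r \<Longrightarrow> cyclic_system p t (z j)"
    and "\<And>h j i. h \<in> H \<Longrightarrow> j < r \<Longrightarrow> \<exists>c\<in>K. \<rho> h (z j i) = c * z j i"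
  shows "\<exists>z'. (\<forall>j<r. cyclic_system p t (z' j)) \<and> (\<forall>h\<in>H. \<forall>j<r. \<forall>i. \<rho> h (z' j i) = z' j i) \<and>
    system_field r z' \<subseteq> system_field r z \<and> fixed_by H (system_field r z) \<subseteq> system_field r z'"
  using assms(4,5)
proof (induction "card {h \<in> H. \<exists>j<r. \<exists>i. \<rho> h (z j i) \<noteq> z j i}" arbitrary: z rule: less_induct)
  case less
  show ?case
  proof (cases "\<forall>h\<in>H. \<forall>j<r. \<forall>i. \<rho> h (z j i) = z j i")
    case True
    then show ?thesis using less.prems fixed_by_subset[of H "system_field r z"] by (intro exI[of _ z]) auto
  next
    case False
    then obtain h0 j1 i1 where nt: "h0 \<in> H" "j1 < r" "\<rho> h0 (z j1 i1) \<noteq> z j1 i1" by blast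
    obtain h c where h: "h \<in> H" and c: "\<forall>j<r. c j \<in> K \<and> c j ^ p = 1 \<and> (\<forall>i. \<rho> h (z j i) = c j * z j i)"
      and "\<exists>j<r. c j \<noteq> 1"
      using cyclic_systems_central_scaling[where z = z and r = r and ?i1.0 = i1, OF p(1,2) less.prems nt] by blast
    then obtain j0 where j0: "j0 < r" "c j0 \<noteq> 1" by blast
    have hG: "h \<in> carrier G" using H_carrier h by blast
    have step: "\<exists>z'. (\<forall>j<r. cyclic_system p t (z' j)) \<and> system_field r z' \<subseteq> system_field r z \<and>
      (\<forall>j<r. \<forall>i. \<rho> h (z' j i) = z' j i) \<and>
      (\<forall>x\<in>system_field r z. \<rho> h x = x \<longrightarrow> x \<in> system_field r z') \<and>
      (\<forall>g\<in>carrier G. (\<forall>j<r. \<forall>i. \<exists>c\<in>K. \<rho> g (z j i) = c * z j i) \<longrightarrow>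
        (\<forall>j<r. \<forall>i. \<exists>c\<in>K. \<rho> g (z' j i) = c * z' j i))"
      using c by (intro cyclic_systems_kummer_step[where c = c and ?j0.0 = j0] p less.prems(1) t hG j0) auto
    obtain z' where z': "\<forall>j<r. cyclic_system p t (z' j)" "system_field r z' \<subseteq> system_field r z"
      "\<forall>j<r. \<forall>i. \<rho> h (z' j i) = z' j i"
      "\<forall>x\<in>system_field r z. \<rho> h x = x \<longrightarrow> x \<in> system_field r z'"
      "\<forall>g\<in>carrier G. (\<forall>j<r. \<forall>i. \<exists>c\<in>K. \<rho> g (z j i) = c * z j i) \<longrightarrow>
        (\<forall>j<r. \<forall>i. \<exists>c\<in>K. \<rho> g (z' j i) = c * z' j i)"
      using step by blast
    let ?A = "\<lambda>z. {h \<in> H. \<exists>j<r. \<exists>i. \<rho> h (z j i) \<noteq> z j i}"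
    have "?A z' \<subset> ?A z"
    proof
      show "?A z' \<subseteq> ?A z"
      proof (clarify, rule ccontr)
        fix g j i assume g: "g \<in> H" "j < r" "\<rho> g (z' j i) \<noteq> z' j i" "\<not> (\<exists>j<r. \<exists>i. \<rho> g (z j i) \<noteq> z j i)"
        have gG: "g \<in> carrier G" using H_carrier g by blast
        have "z' j i \<in> system_field r z" using system_field_mem[OF g(2)] z'(2) by blast
        then have "\<rho> g (z' j i) = z' j i"
          using rho_adjoin_fixed[OF gG, of K "\<Union>j<r. range (z j)" "z' j i"] rho_K[OF gG] g(4)
          by (auto simp: system_field_def)
        then show False using g(3) by simp
      qed
      have "h \<in> ?A z"
      proof -
        have "z j0 0 \<noteq> 0"
          using cyclic_system_nonzero[OF less.prems(1)[OF j0(1)]] p(1) prime_gt_0_nat by blast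
        then have "\<rho> h (z j0 0) \<noteq> z j0 0" using c j0 by simp
        then show ?thesis using h j0(1) by blast
      qed
      moreover have "h \<notin> ?A z'" using z'(3) by blast
      ultimately show "?A z' \<noteq> ?A z" by blast
    qed
    moreover have "finite (?A z)" using H_carrier finite_carrier by (auto intro: finite_subset[of _ "carrier G"])
    ultimately have lt: "card (?A z') < card (?A z)" by (rule psubset_card_mono[rotated])
    have sc: "\<exists>c\<in>K. \<rho> g (z' j i) = c * z' j i" if "g \<in> H" "j < r" for g j i
      using z'(5) H_carrier[OF that(1)] less.prems(2)[OF that(1)] that(2) by blast
    have sys: "cyclic_system p t (z' j)" if "j < r" for j using z'(1) that by blast
    obtain z'' where z'': "\<forall>j<r. cyclic_system p t (z'' j)" "\<forall>h\<in>H. \<forall>j<r. \<forall>i. \<rho> h (z'' j i) = z'' j i"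
      "system_field r z'' \<subseteq> system_field r z'" "fixed_by H (system_field r z') \<subseteq> system_field r z''"
      using less.hyps[OF lt sys sc] by blast
    have "fixed_by H (system_field r z) \<subseteq> system_field r z''"
    proof
      fix x assume x: "x \<in> fixed_by H (system_field r z)"
      then have "x \<in> system_field r z'" using z'(4) h by (auto simp: fixed_by_def)
      then have "x \<in> fixed_by H (system_field r z')" using x by (auto simp: fixed_by_def)
      then show "x \<in> system_field r z''" using z''(4) by blast
    qed
    then show ?thesis using z'' z'(2) by (intro exI[of _ z'']) blast
  qed
qed

lemma scalar_action:
  assumes triv: "\<And>h. h \<in> H \<Longrightarrow> \<rho> h u = u" and "\<exists>c\<in>K. \<rho> t u = c * u" and g: "g \<in> carrier G"
  shows "\<exists>c\<in>K. \<rho> g u = c * u"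
proof -
  obtain i :: nat and h where h: "h \<in> H" "g = t [^] i \<otimes> h" using cover[OF g] by blast
  obtain c where c: "c \<in> K" "\<rho> t u = c * u" using assms(2) by blast
  have "\<rho> (t [^] k) u = c ^ k * u" for k :: nat
  proof (induction k)
    case (Suc k)
    have "\<rho> (t [^] Suc k) u = \<rho> t (c ^ k * u)" by (simp only: rho_pow_Suc[OF t] Suc)
    also have "\<dots> = c ^ k * (c * u)" using c t by (simp add: rho_mult rho_power rho_K)
    finally show ?case by (simp add: ac_simps)
  qed (simp add: rho_one)
  then have "\<rho> g u = c ^ i * u" using h H_carrier[OF h(1)] t_power[of i] triv[OF h(1)] by (simp add: rho_comp)
  moreover have "c ^ i \<in> K" using c(1) by (intro subfield_closed[OF K])
  ultimately show ?thesis by blast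
qed

text \<open>Once \<open>H\<close> acts trivially, only \<open>t\<close> is left to be diagonalized,
  one system at a time. The lengths \<open>ms j\<close> may differ, since
  \<open>\<Phi>\<^sub>8\<close> combines a system of length \<open>p\<close> with systems of length
  \<open>p\<^sup>2\<close>.\<close>

lemma system_field_linearize:
  fixes z :: "nat \<Rightarrow> nat \<Rightarrow> 'l" and r :: nat
  assumes z: "\<And>j. j < r \<Longrightarrow> cyclic_system (ms j) t (z j)" "\<And>j. j < r \<Longrightarrow> ms j > 0"
    and triv: "\<And>h j i. h \<in> H \<Longrightarrow> j < r \<Longrightarrow> \<rho> h (z j i) = z j i"
    and \<omega>: "\<And>j. j < r \<Longrightarrow> \<exists>\<omega>\<in>K. primitive_root_of_unity (ms j) \<omega>"
    and ms: "\<And>j. j < r \<Longrightarrow> of_nat (ms j) \<noteq> (0::'l)"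
  shows "\<exists>U. finite U \<and> card U \<le> (\<Sum>j<r. ms j - 1) \<and> system_field r z = adjoin K U \<and>
    (\<forall>u\<in>U. \<forall>g\<in>carrier G. \<exists>c\<in>K. \<rho> g u = c * u)"
proof -
  have "\<forall>j\<in>{..<r}. \<exists>U. finite U \<and> card U \<le> ms j - 1 \<and> adjoin K (range (z j)) = adjoin K U \<and>
    (\<forall>u\<in>U. \<exists>c\<in>K. \<rho> t u = c * u)"
    using cyclic_system_linearize[OF z t _ _ ms] \<omega> by (metis lessThan_iff)
  then obtain U where U: "\<And>j. j < r \<Longrightarrow> finite (U j)" "\<And>j. j < r \<Longrightarrow> card (U j) \<le> ms j - 1"
    "\<And>j. j < r \<Longrightarrow> adjoin K (range (z j)) = adjoin K (U j)"
    "\<And>j u. j < r \<Longrightarrow> u \<in> U j \<Longrightarrow> \<exists>c\<in>K. \<rho> t u = c * u" by (metis lessThan_iff)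
  have "card (\<Union>j<r. U j) \<le> (\<Sum>j<r. card (U j))" by (rule card_UN_le) simp
  also have "\<dots> \<le> (\<Sum>j<r. ms j - 1)" using U(2) by (intro sum_mono) auto
  finally have cU: "card (\<Union>j<r. U j) \<le> (\<Sum>j<r. ms j - 1)" .
  have eq: "system_field r z = adjoin K (\<Union>j<r. U j)"
  proof
    show "system_field r z \<subseteq> adjoin K (\<Union>j<r. U j)"
    proof (intro system_field_least is_subfield_adjoin adjoin_base)
      fix j i assume j: "j < r"
      have "z j i \<in> adjoin K (U j)" using adjoin_gens[of "range (z j)" K] U(3)[OF j] by blast
      also have "\<dots> \<subseteq> adjoin K (\<Union>j<r. U j)" using j by (intro adjoin_mono) auto
      finally show "z j i \<in> adjoin K (\<Union>j<r. U j)" .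
    qed
    have "U j \<subseteq> system_field r z" if j: "j < r" for j
    proof -
      have "U j \<subseteq> adjoin K (range (z j))" using adjoin_gens[of "U j" K] U(3)[OF j] by blast
      also have "\<dots> \<subseteq> system_field r z" unfolding system_field_def using j by (intro adjoin_mono) auto
      finally show ?thesis .
    qed
    then show "adjoin K (\<Union>j<r. U j) \<subseteq> system_field r z"
      by (intro adjoin_least is_subfield_system_field system_field_base) auto
  qed
  have act: "\<exists>c\<in>K. \<rho> g u = c * u" if u: "u \<in> U j" "j < r" and g: "g \<in> carrier G" for u j g
  proof (rule scalar_action[OF _ U(4)[OF u(2,1)] g])
    fix h assume h: "h \<in> H"
    then have hG: "h \<in> carrier G" using H_carrier by blast
    have "u \<in> adjoin K (range (z j))" using adjoin_gens[of "U j" K] U(3)[OF u(2)] u(1) by blast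
    then show "\<rho> h u = u"
      using rho_adjoin_fixed[OF hG, of K "range (z j)" u] rho_K[OF hG] triv[OF h u(2)] by auto
  qed
  show ?thesis using cU eq act U(1) by (intro exI[of _ "\<Union>j<r. U j"]) auto
qed

end

section \<open>Invariants through a stable intermediate field\<close>

context regular_action
begin

text \<open>\<open>K(U)\<close> lies between the fixed field of \<open>E0\<close> and
  \<open>E0\<close>, so \<open>E0\<close> and \<open>K(U)\<close> have the same invariants and
  \<open>card U\<close> generators suffice for them; each \<open>xs i\<close> costs one more. Since
  \<open>E0\<close> is algebraic over \<open>K(U)\<close>, the joint count \<open>card U + r\<close>
  gives the transcendence needed in both towers.\<close>

lemma few_generators_if_reduced:
  assumes E0: "is_subfield E0" "stable E0" "K \<subseteq> E0"
    and L: "L = adjoin E0 (xs ` {..<r})"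
    and act: "\<And>i g. i < r \<Longrightarrow> g \<in> carrier G \<Longrightarrow> \<exists>a\<in>E0. \<rho> g (xs i) = a * xs i"
    and U: "finite U" "adjoin K U \<subseteq> E0" "fixed_by (carrier G) E0 \<subseteq> adjoin K U"
      "\<And>u g. u \<in> U \<Longrightarrow> g \<in> carrier G \<Longrightarrow> \<exists>c\<in>K. \<rho> g u = c * u"
    and card: "card U + r \<le> Coset.order G"
  shows few_generators
proof -
  let ?k = "card U"
  obtain us where us: "U = us ` {..<?k}"
    using ex_bij_betw_nat_finite[OF U(1)] by (auto simp: bij_betw_def atLeast0LessThan)
  \<comment> \<open>The elements of \<open>U\<close> precede the \<open>xs\<close>, so that one
    statement about transcendence over predecessors serves both towers.\<close>
  define ys where "ys i = (if i < ?k then us i else xs (i - ?k))" for i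
  have ys_img: "ys ` {..<i} = us ` {..<i}" if "i \<le> ?k" for i using that by (auto simp: ys_def image_iff)
  have ys_img2: "ys ` {..<?k + i} = U \<union> xs ` {..<i}" for i
  proof -
    have "{..<?k + i} = {..<?k} \<union> (\<lambda>j. ?k + j) ` {..<i}"
    proof (rule equalityI; rule subsetI)
      fix x assume "x \<in> {..<?k + i}"
      then show "x \<in> {..<?k} \<union> (\<lambda>j. ?k + j) ` {..<i}"
        by (cases "x < ?k") (auto intro!: image_eqI[of _ _ "x - ?k"])
    qed auto
    then have "ys ` {..<?k + i} = ys ` {..<?k} \<union> (\<lambda>j. ys (?k + j)) ` {..<i}"
      by (simp only: image_Un image_image)
    then show ?thesis using ys_img[of ?k] us by (simp add: ys_def)
  qed
  have E0_acl: "E0 \<subseteq> acl K S" if "U \<subseteq> S" for S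
  proof
    fix x assume "x \<in> E0"
    then have "alg_over (fixed_by (carrier G) E0) x" using alg_over_fixed E0 by blast
    then have "alg_over (adjoin K S) x"
      using alg_over_mono[OF subset_trans[OF U(3) adjoin_mono[OF order_refl that]]] by blast
    then show "x \<in> acl K S" by (simp add: acl_def alg_closure_in_def)
  qed
  have adj_acl: "adjoin E0 (xs ` {..<i}) \<subseteq> acl K (ys ` {..<?k + i})" for i
    using E0_acl[of "ys ` {..<?k + i}"] acl_gens[of "ys ` {..<?k + i}" K] unfolding ys_img2
    by (intro adjoin_least is_subfield_acl) auto
  have Lacl: "L \<subseteq> acl K ({} \<union> ys ` {..<?k + r})" using adj_acl[of r] L by simp
  have tr: "ys i \<notin> acl K (ys ` {..<i})" if "i < ?k + r" for i
    using generators_transcendental[OF _ Lacl _ that] card adjoin_empty[OF K]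
    by (simp add: acl_def alg_closure_in_def)
  have "\<exists>T. finite T \<and> card T \<le> r \<and>
    fixed_by (carrier G) (adjoin E0 (xs ` {..<r})) = adjoin (fixed_by (carrier G) E0) T"
  proof (rule fixed_by_triangular[OF E0(1,2)])
    fix i assume i: "i < r"
    show "\<not> alg_over (adjoin E0 (xs ` {..<i})) (xs i)"
    proof
      assume "alg_over (adjoin E0 (xs ` {..<i})) (xs i)"
      then have "alg_over (acl K (ys ` {..<?k + i})) (xs i)" using alg_over_mono[OF adj_acl] by blast
      then have "xs i \<in> acl K (ys ` {..<?k + i})"
        using alg_over_trans[OF is_subfield_adjoin] by (auto simp: acl_def alg_closure_in_def)
      then show False using tr[of "?k + i"] i by (simp add: ys_def)
    qed
    fix g assume "g \<in> carrier G"
    then obtain a where "a \<in> E0" "\<rho> g (xs i) = a * xs i" using act i by blast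
    then show "\<exists>a\<in>adjoin E0 (xs ` {..<i}). \<exists>b\<in>adjoin E0 (xs ` {..<i}). \<rho> g (xs i) = a * xs i + b"
      using adjoin_base[of E0 "xs ` {..<i}"] adjoin_closed(1) by (intro bexI[of _ a] bexI[of _ 0]) auto
  qed
  then obtain T where T: "finite T" "card T \<le> r" "fixed_by (carrier G) L = adjoin (fixed_by (carrier G) E0) T"
    using L by auto
  have "\<exists>T. finite T \<and> card T \<le> ?k \<and>
    fixed_by (carrier G) (adjoin K (us ` {..<?k})) = adjoin (fixed_by (carrier G) K) T"
  proof (rule fixed_by_triangular[OF K stable_K])
    fix i assume i: "i < ?k"
    show "\<not> alg_over (adjoin K (us ` {..<i})) (us i)"
      using tr[of i] i ys_img[of i] by (simp add: ys_def acl_def alg_closure_in_def)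
    fix g assume g: "g \<in> carrier G"
    have "us i \<in> U" using us i by blast
    then obtain c where "c \<in> K" "\<rho> g (us i) = c * us i" using U(4) g by blast
    then show "\<exists>a\<in>adjoin K (us ` {..<i}). \<exists>b\<in>adjoin K (us ` {..<i}). \<rho> g (us i) = a * us i + b"
      using adjoin_base[of K "us ` {..<i}"] adjoin_closed(1) by (intro bexI[of _ c] bexI[of _ 0]) auto
  qed
  then obtain T' where T': "finite T'" "card T' \<le> ?k" "fixed_by (carrier G) (adjoin K U) = adjoin K T'"
    using us fixed_by_K by auto
  have "fixed_by (carrier G) E0 = fixed_by (carrier G) (adjoin K U)"
    using U(2,3) by (auto simp: fixed_by_def)
  then have "fixed_by (carrier G) L = adjoin K (T' \<union> T)" using T(3) T'(3) by (simp add: adjoin_adjoin)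
  moreover have "card (T' \<union> T) \<le> Coset.order G"
    using card_Un_le[of T' T] T(2) T'(2) card by linarith
  ultimately show ?thesis using T(1) T'(1) unfolding few_generators_def by blast
qed

end

context regular_action
begin

text \<open>A zero could be dropped from the generators, leaving too few of them. In this way
  explicitly given eigenvectors are seen to be nonzero without evaluating them.\<close>

lemma nonzero_if_few_generators:
  assumes "finite B" "L \<subseteq> adjoin K B" "card B \<le> Coset.order G"
  shows "0 \<notin> B"
proof
  assume 0: "0 \<in> B"
  have "B \<subseteq> adjoin K (B - {0})" using adjoin_gens[of "B - {0}" K] adjoin_closed(1)[of K "B - {0}"] by auto
  then have "L \<subseteq> adjoin K (B - {0})" using assms(2) adjoin_subset by blast
  then have "var ` carrier G \<subseteq> acl K (B - {0})" using var_in_L adjoin_subset_acl by blast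
  then have "card (var ` carrier G) \<le> card (B - {0})"
    using assms(1) by (intro independent_card_le[OF _ card_var(1) independent_var]) auto
  moreover have "card (B - {0}) < card B" using 0 assms(1) by (rule card_Diff1_less[rotated])
  ultimately show False using assms(3) card_var(2) by linarith
qed

lemma few_generators_if_reduced_set:
  assumes E0: "is_subfield E0" "stable E0" "K \<subseteq> E0"
    and L: "L = adjoin E0 S" and S: "finite S"
    and act: "\<And>x g. x \<in> S \<Longrightarrow> g \<in> carrier G \<Longrightarrow> \<exists>a\<in>E0. \<rho> g x = a * x"
    and U: "finite U" "adjoin K U \<subseteq> E0" "fixed_by (carrier G) E0 \<subseteq> adjoin K U"
      "\<And>u g. u \<in> U \<Longrightarrow> g \<in> carrier G \<Longrightarrow> \<exists>c\<in>K. \<rho> g u = c * u"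
    and card: "card U + card S \<le> Coset.order G"
  shows few_generators
proof -
  obtain xs where xs: "S = xs ` {..<card S}"
    using ex_bij_betw_nat_finite[OF S] by (auto simp: bij_betw_def atLeast0LessThan)
  show ?thesis
  proof (rule few_generators_if_reduced[OF E0 _ _ U card])
    show "L = adjoin E0 (xs ` {..<card S})" using L xs by simp
    show "\<exists>a\<in>E0. \<rho> g (xs i) = a * xs i" if "i < card S" "g \<in> carrier G" for i g
      using act[of "xs i" g] that xs by blast
  qed
qed

end

section \<open>Orbits of eigenvectors and subgroups of prime index\<close>

context abelian_extension
begin

text \<open>Quotients of neighbours in the \<open>t\<close>-orbit of \<open>w\<close>, corrected by
  a constant \<open>d\<close>. If \<open>d ^ m\<close> is the eigenvalue of \<open>t [^] m\<close>
  on \<open>w\<close>, they have period \<open>m\<close> and product \<open>1\<close>.\<close>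

definition orbit_system :: "'l \<Rightarrow> 'l \<Rightarrow> nat \<Rightarrow> 'l" where
  "orbit_system d w i = \<rho> (t [^] Suc i) w / (d * \<rho> (t [^] i) w)"

text \<open>The eigenvalue \<open>c\<close> of \<open>t [^] m\<close> on \<open>w\<close> satisfies
  \<open>c ^ b = 1\<close> because \<open>t [^] (m * b) = \<one>\<close>, and such roots of unity
  have \<open>m\<close>-th roots among the powers of \<open>\<zeta>\<close>.\<close>

lemma normalizing_root:
  assumes w: "w \<noteq> 0" and eig: "\<And>h. h \<in> H \<Longrightarrow> \<exists>c\<in>K. \<rho> h w = c * w"
    and q: "primitive_root_of_unity q \<zeta>" "\<zeta> \<in> K" "q = m * b" "t [^] q = \<one>"
  shows "\<exists>d\<in>K. d \<noteq> 0 \<and> \<rho> (t [^] m) w = d ^ m * w"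
proof -
  obtain c where c: "c \<in> K" "\<rho> (t [^] m) w = c * w" using eig[OF t_pow] by blast
  have "\<rho> ((t [^] m) [^] k) w = c ^ k * w" for k :: nat
  proof (induction k)
    case (Suc k)
    have "\<rho> ((t [^] m) [^] Suc k) w = \<rho> (t [^] m) (c ^ k * w)"
      by (simp only: rho_pow_Suc[OF t_power] Suc)
    also have "\<dots> = c ^ k * (c * w)" using c t_power[of m] by (simp add: rho_mult rho_power rho_K)
    finally show ?case by (simp add: ac_simps)
  qed (simp add: rho_one)
  from this[of b] have "c ^ b * w = w" using q(3,4) t by (simp add: nat_pow_pow rho_one)
  then have "c ^ b = 1" using w by simp
  then obtain i where i: "c = (\<zeta> ^ i) ^ m" using root_of_root_of_unity q(1,3) m_pos by blast
  show ?thesis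
  proof (intro bexI conjI)
    show "\<zeta> ^ i \<in> K" using q(2) by (intro subfield_closed[OF K])
    show "\<zeta> ^ i \<noteq> 0" using primitive_root_nonzero[OF q(1)] by simp
    show "\<rho> (t [^] m) w = (\<zeta> ^ i) ^ m * w" using c i by simp
  qed
qed

context
  fixes w d
  assumes w: "w \<noteq> 0" and eig: "\<And>h. h \<in> H \<Longrightarrow> \<exists>c\<in>K. \<rho> h w = c * w"
    and d: "d \<in> K" "d \<noteq> 0" "\<rho> (t [^] m) w = d ^ m * w"
begin

lemma orbit_nonzero: "\<rho> (t [^] (i::nat)) w \<noteq> 0"
  using w t_power by (simp add: rho_eq_0)

lemma orbit_shift: "\<rho> (t [^] (i + m)) w = d ^ m * \<rho> (t [^] i) w"
proof -
  have "\<rho> (t [^] (i + m)) w = \<rho> (t [^] i) (\<rho> (t [^] m) w)"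
    using t t_power by (simp add: rho_comp[symmetric] nat_pow_mult)
  then show ?thesis using t_power[of i] d by (simp add: rho_mult rho_power rho_K)
qed

lemma orbit_product: "\<rho> (t [^] (i::nat)) w = w * (\<Prod>k<i. d * orbit_system d w k)"
proof (induction i)
  case (Suc i)
  have "w * (\<Prod>k<Suc i. d * orbit_system d w k) = \<rho> (t [^] i) w * (d * orbit_system d w i)"
    by (simp add: Suc mult.assoc)
  also have "\<dots> = \<rho> (t [^] Suc i) w"
    using orbit_nonzero[of i] d(2) by (simp add: orbit_system_def del: nat_pow_Suc)
  finally show ?case by simp
qed (simp add: rho_one)

lemma cyclic_system_orbit: "cyclic_system m t (orbit_system d w)"
  unfolding cyclic_system_def
proof (intro conjI allI)
  fix i
  show "orbit_system d w (i + m) = orbit_system d w i"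
    using orbit_shift[of i] orbit_shift[of "Suc i"] d(2) by (simp add: orbit_system_def del: nat_pow_Suc)
  show "\<rho> t (orbit_system d w i) = orbit_system d w (Suc i)"
    using t d(1) by (simp only: orbit_system_def rho_divide rho_mult rho_K rho_pow_Suc[OF t])
next
  have "w * (d ^ m * (\<Prod>k<m. orbit_system d w k)) = w * d ^ m"
    using orbit_product[of m] d(3) by (simp add: prod.distrib mult.commute)
  then show "(\<Prod>k<m. orbit_system d w k) = 1" using w d(2) by simp
qed

lemma orbit_eigen:
  assumes "h \<in> H" shows "\<exists>c\<in>K. \<rho> h (\<rho> (t [^] (i::nat)) w) = c * \<rho> (t [^] i) w"
proof -
  obtain c where "c \<in> K" "\<rho> (inv (t [^] i) \<otimes> h \<otimes> t [^] i) w = c * w"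
    using eig[OF H_conj[OF assms, of i]] by blast
  then have "c \<in> K \<and> \<rho> h (\<rho> (t [^] i) w) = c * \<rho> (t [^] i) w"
    using t_power[of i] by (simp add: rho_H_t_power[OF assms] rho_mult rho_K)
  then show ?thesis by blast
qed

lemma orbit_system_eigen:
  assumes h: "h \<in> H" shows "\<exists>c\<in>K. \<rho> h (orbit_system d w i) = c * orbit_system d w i"
proof -
  obtain c where c: "c \<in> K" "\<rho> h (\<rho> (t [^] i) w) = c * \<rho> (t [^] i) w" using orbit_eigen[OF h] by blast
  obtain c' where c': "c' \<in> K" "\<rho> h (\<rho> (t [^] Suc i) w) = c' * \<rho> (t [^] Suc i) w"
    using orbit_eigen[OF h] by blast
  have "\<rho> h (orbit_system d w i) = (c' / c) * orbit_system d w i"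
    using H_carrier[OF h] d(1) c(2) c'(2)
    by (simp add: orbit_system_def rho_divide rho_mult rho_K del: nat_pow_Suc)
  moreover have "c' / c \<in> K" using c c' by (intro subfield_closed[OF K])
  ultimately show ?thesis by blast
qed

lemma orbit_in:
  assumes "is_subfield E" "K \<subseteq> E" "w \<in> E" "\<And>k. orbit_system d w k \<in> E"
  shows "\<rho> (t [^] (i::nat)) w \<in> E"
  unfolding orbit_product using assms d(1)
  by (intro subfield_closed(5)[OF assms(1)] subfield_closed(9)[OF assms(1)]) auto

lemma orbit_act:
  assumes E: "is_subfield E" "K \<subseteq> E" "\<And>k. orbit_system d w k \<in> E" and g: "g \<in> carrier G"
  shows "\<exists>a\<in>E. \<rho> g w = a * w"
proof -
  obtain i :: nat and h where h: "h \<in> H" "g = t [^] i \<otimes> h" using cover[OF g] by blast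
  obtain c where c: "c \<in> K" "\<rho> h w = c * w" using eig[OF h(1)] by blast
  have "\<rho> g w = (c * (\<Prod>k<i. d * orbit_system d w k)) * w"
    using h c t_power[of i] H_carrier[OF h(1)] by (simp add: rho_comp rho_mult rho_K orbit_product ac_simps)
  moreover have "c * (\<Prod>k<i. d * orbit_system d w k) \<in> E"
    using E c(1) d(1) by (intro subfield_closed(5)[OF E(1)] subfield_closed(9)[OF E(1)]) auto
  ultimately show ?thesis by blast
qed

end

text \<open>The variable indexed by \<open>t [^] i \<otimes> h\<close> is the image of
  \<open>var h\<close> under \<open>t [^] i\<close>, so the orbits of generators for the variables
  of \<open>H\<close> generate everything.\<close>

lemma L_subset_orbits:
  assumes E: "is_subfield E" "K \<subseteq> E" and W: "var ` H \<subseteq> adjoin K W"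
    and orb: "\<And>w i. w \<in> W \<Longrightarrow> i < m \<Longrightarrow> \<rho> (t [^] i) w \<in> E"
  shows "L \<subseteq> E"
  unfolding L_def
proof (intro adjoin_least E subsetI)
  fix x assume "x \<in> var ` carrier G"
  then obtain g where g: "g \<in> carrier G" "x = var g" by blast
  obtain i h where i: "i < m" and h: "h \<in> H" "g = t [^] i \<otimes> h" using cover[OF g(1)] by blast
  have "x = \<rho> (t [^] i) (var h)" using h g t_power[of i] H_carrier[OF h(1)] by (simp add: rho_var)
  also have "\<dots> \<in> E"
  proof (rule rho_adjoin_subset[OF t_power _ _ E(1)])
    show "var h \<in> adjoin K W" using W h(1) by blast
    show "\<rho> (t [^] i) y \<in> E" if "y \<in> K" for y using that E(2) rho_K[OF t_power] by auto
  qed (rule orb[OF _ i])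
  finally show "x \<in> E" .
qed

text \<open>The intermediate field is generated by the orbit systems. Over it the group merely
  scales every eigenvector \<open>w j\<close>, while its own invariants lie in a field of
  \<open>H\<close>-fixed systems, which linearizes.\<close>

theorem few_generators_index_p:
  assumes p: "Factorial_Ring.prime m" "Coset.order G = m ^ n" "of_nat m \<noteq> (0::'l)"
    and q: "primitive_root_of_unity q \<zeta>" "\<zeta> \<in> K" "q = m * b" "of_nat q \<noteq> (0::'l)"
      "\<And>g. g \<in> carrier G \<Longrightarrow> g [^] q = \<one>"
  shows few_generators
proof -
  obtain W where W: "finite W" "card W \<le> card H" "0 \<notin> W" "W \<subseteq> L" "var ` H \<subseteq> adjoin K W"
    "\<forall>w\<in>W. \<forall>h\<in>H. \<exists>c\<in>K. \<rho> h w = c * w"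
    using eigenbasis[OF H H_comm q(5)[OF H_carrier] q(4,1,2)] by blast
  define r where "r = card W"
  obtain w where w: "W = w ` {..<r}"
    using ex_bij_betw_nat_finite[OF W(1)] by (auto simp: bij_betw_def atLeast0LessThan r_def)
  have wW: "w j \<in> W" if "j < r" for j using w that by blast
  have w0: "w j \<noteq> 0" if "j < r" for j using wW[OF that] W(3) by metis
  have eig: "\<exists>c\<in>K. \<rho> h (w j) = c * w j" if "j < r" "h \<in> H" for j h using wW[OF that(1)] that(2) W(6) by blast
  have "\<exists>d\<in>K. d \<noteq> 0 \<and> \<rho> (t [^] m) (w j) = d ^ m * w j" if "j < r" for j
    using normalizing_root[OF w0[OF that] eig[OF that] q(1-3) q(5)[OF t]] by blast
  then obtain d where d: "\<And>j. j < r \<Longrightarrow> d j \<in> K" "\<And>j. j < r \<Longrightarrow> d j \<noteq> 0"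
    "\<And>j. j < r \<Longrightarrow> \<rho> (t [^] m) (w j) = d j ^ m * w j" by metis
  define y where "y j = orbit_system (d j) (w j)" for j
  have ysys: "cyclic_system m t (y j)" if "j < r" for j
    unfolding y_def using cyclic_system_orbit[OF w0[OF that] eig[OF that] d(1,2,3)[OF that]] .
  have yeig: "\<exists>c\<in>K. \<rho> h (y j i) = c * y j i" if "h \<in> H" "j < r" for h j i
    unfolding y_def using orbit_system_eigen[OF w0[OF that(2)] eig[OF that(2)] d(1,2,3)[OF that(2)] that(1)] .
  let ?E = "system_field r y"
  have stE: "stable ?E" by (rule stable_system_field[OF ysys yeig])
  have yE: "orbit_system (d j) (w j) k \<in> ?E" if "j < r" for j k
    using system_field_mem[OF that, of y k] by (simp add: y_def)
  obtain z' where z': "\<forall>j<r. cyclic_system m t (z' j)" "\<forall>h\<in>H. \<forall>j<r. \<forall>i. \<rho> h (z' j i) = z' j i"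
    "system_field r z' \<subseteq> ?E" "fixed_by H ?E \<subseteq> system_field r z'"
    using cyclic_systems_invariants[where z = y and r = r, OF p ysys yeig] by blast
  have "\<exists>U. finite U \<and> card U \<le> (\<Sum>j<r. m - 1) \<and> system_field r z' = adjoin K U \<and>
    (\<forall>u\<in>U. \<forall>g\<in>carrier G. \<exists>c\<in>K. \<rho> g u = c * u)"
  proof (rule system_field_linearize)
    have "q > 0" using q(1) by (simp add: primitive_root_of_unity_def)
    then have "primitive_root_of_unity m (\<zeta> ^ b)"
      using primitive_root_power[of b m \<zeta>] q(1,3) by (simp add: mult.commute)
    moreover have "\<zeta> ^ b \<in> K" using q(2) by (intro subfield_closed[OF K])
    ultimately show "\<exists>\<omega>\<in>K. primitive_root_of_unity m \<omega>" by blast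
  qed (use z' p m_pos in auto)
  then obtain U where U: "finite U" "card U \<le> r * (m - 1)" "system_field r z' = adjoin K U"
    "\<forall>u\<in>U. \<forall>g\<in>carrier G. \<exists>c\<in>K. \<rho> g u = c * u" by auto
  show ?thesis
  proof (rule few_generators_if_reduced_set[OF is_subfield_system_field stE system_field_base _ W(1) _ U(1)])
    show "L = adjoin ?E W"
    proof
      have EE: "?E \<subseteq> adjoin ?E W" by (rule adjoin_base)
      show "L \<subseteq> adjoin ?E W"
      proof (rule L_subset_orbits[OF is_subfield_adjoin _ W(5)])
        show "K \<subseteq> adjoin ?E W" using system_field_base EE by blast
        fix v and i :: nat assume v: "v \<in> W"
        then obtain j where j: "j < r" "v = w j" using w by auto
        show "\<rho> (t [^] i) v \<in> adjoin ?E W"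
          unfolding j(2) using orbit_in[OF w0[OF j(1)] eig[OF j(1)] d(1,2,3)[OF j(1)] is_subfield_adjoin]
            system_field_base EE yE[OF j(1)] v j(2) adjoin_gens[of W ?E] by blast
      qed
      have "y j i \<in> L" if j: "j < r" for j i
      proof -
        have wL: "w j \<in> L" using wW[OF j] W(4) by blast
        have orbL: "\<rho> (t [^] k) (w j) \<in> L" for k :: nat using stable_L t_power wL by (auto simp: stable_def)
        then show ?thesis unfolding y_def orbit_system_def
          by (intro subfield_closed(12)[OF is_subfield_L] subfield_closed(5)[OF is_subfield_L] orbL
              subsetD[OF K_subset_L] d(1)[OF j])
      qed
      then have "?E \<subseteq> L" by (intro system_field_least is_subfield_L K_subset_L)
      then show "adjoin ?E W \<subseteq> L" using W(4) by (intro adjoin_least is_subfield_L)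
    qed
    fix v g assume v: "v \<in> W" and g: "g \<in> carrier G"
    then obtain j where j: "j < r" "v = w j" using w by auto
    show "\<exists>a\<in>?E. \<rho> g v = a * v"
      unfolding j(2)
      by (rule orbit_act[OF w0[OF j(1)] eig[OF j(1)] d(1,2,3)[OF j(1)] is_subfield_system_field system_field_base yE[OF j(1)] g])
  next
    show "adjoin K U \<subseteq> ?E" using U(3) z'(3) by simp
    show "fixed_by (carrier G) ?E \<subseteq> adjoin K U"
      using z'(4) U(3) H_carrier by (auto simp: fixed_by_def)
    show "\<exists>c\<in>K. \<rho> g u = c * u" if "u \<in> U" "g \<in> carrier G" for u g using U(4) that by blast
    have "card U + card W \<le> r * (m - 1) + r" using U(2) by (simp add: r_def)
    also have "\<dots> = r * m" using m_pos by (cases m) auto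
    also have "\<dots> \<le> card H * m" using W(2) by (simp add: r_def)
    finally show "card U + card W \<le> Coset.order G" using card_H by simp
  qed
qed

end

section \<open>The systems for the family \<open>\<Phi>\<^sub>8\<close>\<close>

text \<open>Congruence of nonzero elements modulo the multiplicative group of \<open>E\<close>. It
  serves to compute with entries of systems modulo the invariant field.\<close>

definition ratio_in :: "'l::field set \<Rightarrow> 'l \<Rightarrow> 'l \<Rightarrow> bool" where
  "ratio_in E a b \<longleftrightarrow> a \<noteq> 0 \<and> b \<noteq> 0 \<and> a / b \<in> E"

context
  fixes E :: "'l::field set"
  assumes E: "is_subfield E"
begin

lemma ratio_in_refl: "a \<noteq> 0 \<Longrightarrow> ratio_in E a a"
  by (simp add: ratio_in_def subfield_closed(2)[OF E])

lemma ratio_in_sym: "ratio_in E a b \<Longrightarrow> ratio_in E b a"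
  using subfield_inverse[OF E, of "a / b"] by (simp add: ratio_in_def)

lemma ratio_in_mult: "ratio_in E a b \<Longrightarrow> ratio_in E c d \<Longrightarrow> ratio_in E (a * c) (b * d)"
  using subfield_closed(5)[OF E, of "a / b" "c / d"] by (simp add: ratio_in_def)

lemma ratio_in_trans [trans]: "ratio_in E a b \<Longrightarrow> ratio_in E b c \<Longrightarrow> ratio_in E a c"
  using subfield_closed(5)[OF E, of "a / b" "b / c"] by (simp add: ratio_in_def)

lemma ratio_in_divide: "ratio_in E a b \<Longrightarrow> ratio_in E c d \<Longrightarrow> ratio_in E (a / c) (b / d)"
  using subfield_closed(12)[OF E, of "a / b" "c / d"] by (simp add: ratio_in_def mult.commute)

lemma ratio_in_power: "ratio_in E a b \<Longrightarrow> ratio_in E (a ^ n) (b ^ n)"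
  using subfield_closed(7)[OF E, of "a / b" n] by (simp add: ratio_in_def power_divide)

lemma ratio_in_prod: "(\<And>i. i \<in> I \<Longrightarrow> ratio_in E (f i) (g i)) \<Longrightarrow> ratio_in E (prod f I) (prod g I)"
  by (induction I rule: infinite_finite_induct) (auto intro: ratio_in_refl ratio_in_mult)

end

text \<open>Abel summation in multiplicative form. It evaluates the weighted product that occurs in
  the invariants \<open>V\<close> of \<open>phi8_systems_invariants\<close>.\<close>

lemma prod_telescoping_powers:
  fixes e :: "nat \<Rightarrow> 'l::field"
  assumes "\<And>i. e i \<noteq> 0"
  shows "(\<Prod>k<p. (e (Suc k) / e k) ^ (p - k)) * e 0 ^ p = (\<Prod>k<p. e (Suc k))"
proof (induction p)
  case (Suc p)
  have "(\<Prod>k<Suc p. (e (Suc k) / e k) ^ (Suc p - k)) =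
      (\<Prod>k<Suc p. (e (Suc k) / e k) ^ (p - k) * (e (Suc k) / e k))"
    by (intro prod.cong HOL.refl) (simp add: Suc_diff_le)
  also have "\<dots> = (\<Prod>k<p. (e (Suc k) / e k) ^ (p - k)) * (\<Prod>k<Suc p. e (Suc k) / e k)"
    by (subst prod.distrib) simp
  also have "(\<Prod>k<Suc p. e (Suc k) / e k) = e (Suc p) / e 0"
    using assms by (intro prod_lessThan_telescope) auto
  finally have "(\<Prod>k<Suc p. (e (Suc k) / e k) ^ (Suc p - k)) * e 0 ^ Suc p =
      ((\<Prod>k<p. (e (Suc k) / e k) ^ (p - k)) * e 0 ^ p) * (e (Suc p) / e 0 * e 0)"
    by (simp only: power_Suc ac_simps)
  then show ?case unfolding Suc using assms[of 0] by simp
qed simp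

lemma prod_lessThan_add:
  fixes f :: "nat \<Rightarrow> 'c::comm_monoid_mult"
  shows "(\<Prod>i<a + b. f i) = (\<Prod>i<a. f i) * (\<Prod>i<b. f (a + i))"
  by (induction b) (simp_all add: mult.assoc)

lemma prod_lessThan_mult:
  fixes f :: "nat \<Rightarrow> 'c::comm_monoid_mult"
  shows "(\<Prod>i<n * p. f i) = (\<Prod>k<n. \<Prod>i<p. f (i + p * k))"
proof (induction n)
  case (Suc n)
  have "(\<Prod>i<Suc n * p. f i) = (\<Prod>i<n * p + p. f i)" by (simp add: add.commute)
  also have "\<dots> = (\<Prod>i<n * p. f i) * (\<Prod>i<p. f (n * p + i))" by (rule prod_lessThan_add)
  finally show ?case using Suc by (simp add: ac_simps)
qed simp

lemma sum_lessThan_complement: "2 * (\<Sum>k<n. n - k) = n * Suc n"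
proof (induction n)
  case (Suc n)
  have "(\<Sum>k<Suc n. Suc n - k) = Suc n + (\<Sum>k<n. n - k)" by (simp add: sum.lessThan_Suc_shift del: sum.lessThan_Suc)
  then show ?case using Suc by simp
qed simp

lemma sum_lessThan_Suc_double: "2 * (\<Sum>k<n. Suc k) = n * Suc n"
  by (induction n) auto

context field_action
begin

text \<open>
  Additively, the \<open>e i\<close> generate \<open>\<int>[C\<^bsub>p\<^sup>2\<^esub>]\<close> modulo the norm element and the \<open>f i\<close> generate
  \<open>\<int>[C\<^sub>p]\<close> modulo the norm element. The kernel of the weight on the former alone need not be free,
  but on the direct sum it is: the generators \<open>V\<close> and \<open>Y\<close> below come from the factorization of \<open>p\<close> by
  \<open>1 - T\<close>, with cofactor \<open>- (\<Sum>k<p. k T\<^sup>k)\<close>, in \<open>\<int>[T]\<close> modulo \<open>\<Sum>k<p. T\<^sup>k\<close>.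
\<close>

lemma phi8_systems_invariants:
  fixes z :: "nat \<Rightarrow> nat \<Rightarrow> 'l" and r p :: nat
  assumes p: "Factorial_Ring.prime p" "odd p" "of_nat p \<noteq> (0::'l)"
    and t: "t \<in> carrier G" and g: "g \<in> carrier G" and r: "2 \<le> r"
    and sys: "\<And>j. j < r \<Longrightarrow> cyclic_system (if j = 0 then p else p\<^sup>2) t (z j)"
    and \<eta>: "primitive_root_of_unity (p\<^sup>2) \<eta>" "\<eta> \<in> K"
    and w0: "\<And>i. \<rho> g (z 0 i) = z 0 i"
    and wj: "\<And>j i. j < r \<Longrightarrow> 1 \<le> j \<Longrightarrow> \<rho> g (z j i) = (\<eta> * (\<eta> ^ p) ^ i) ^ j * z j i"
  shows "\<exists>z'. (\<forall>j<r. cyclic_system (if j = 0 then p else p\<^sup>2) t (z' j)) \<and>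
    (\<forall>j<r. \<forall>i. \<rho> g (z' j i) = z' j i) \<and> system_field r z' \<subseteq> system_field r z \<and>
    (\<forall>x\<in>system_field r z. \<rho> g x = x \<longrightarrow> x \<in> system_field r z')"
proof -
  have p0: "p > 0" using p(1) prime_gt_0_nat by blast
  have pp0: "p\<^sup>2 > 0" using p0 by simp
  \<comment> \<open>As \<open>p\<close> is odd, \<open>p (p + 1) / 2 = p * h\<close> is a multiple
    of \<open>p\<close>, so a \<open>p\<close>-th root of unity raised to this power is
    \<open>1\<close>.\<close>
  obtain h where h: "Suc p = 2 * h" using p(2) by (metis even_Suc evenE)
  define \<omega> where "\<omega> = \<eta> ^ p"
  have \<omega>p: "\<omega> ^ p = 1" using \<eta>(1) by (simp add: \<omega>_def primitive_root_of_unity_def power_mult[symmetric] power2_eq_square)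
  have \<eta>0: "\<eta> \<noteq> 0" using primitive_root_nonzero[OF \<eta>(1)] .
  have \<omega>0: "\<omega> \<noteq> 0" using \<eta>0 by (simp add: \<omega>_def)
  have KK: "\<rho> g \<eta> = \<eta>" "\<rho> g \<omega> = \<omega>" using \<eta>(2) g by (auto simp: \<omega>_def rho_K rho_power)
  define e where "e = z 1"
  have esys: "cyclic_system (p\<^sup>2) t e" using sys[of 1] r by (simp add: e_def)
  have f0sys: "cyclic_system p t (z 0)" using sys[of 0] r by simp
  note e_per = cyclic_system_period[OF esys pp0] and e_nz = cyclic_system_nonzero[OF esys pp0]
    and e_sh = cyclic_system_shift[OF esys pp0] and e_prod = cyclic_system_prod[OF esys pp0]
  note f0_per = cyclic_system_period[OF f0sys p0] and f0_nz = cyclic_system_nonzero[OF f0sys p0]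
    and f0_sh = cyclic_system_shift[OF f0sys p0] and f0_prod = cyclic_system_prod[OF f0sys p0]
  have e_w: "\<rho> g (e i) = \<eta> * \<omega> ^ i * e i" for i using wj[of 1 i] r by (simp add: e_def \<omega>_def)
  \<comment> \<open>Products over the residue classes modulo \<open>p\<close>. Each has weight
    \<open>(\<eta> * \<omega> ^ i) ^ p = \<omega>\<close>, whatever \<open>i\<close> is, so
    \<open>D\<close> is a system of length \<open>p\<close> with constant weight.\<close>
  define D where "D i = (\<Prod>k<p. e (i + p * k))" for i
  have D_nz: "D i \<noteq> 0" for i using e_nz by (simp add: D_def)
  have D_per: "D (i + p) = D i" for i
  proof -
    have "D (i + p) = (\<Prod>k<p. e (i + p * Suc k))" by (simp add: D_def algebra_simps)
    also have "\<dots> = D i"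
      unfolding D_def using e_per[of i] by (intro prod_lessThan_shift_cyclic) (simp add: power2_eq_square)
    finally show ?thesis .
  qed
  have D_sh: "\<rho> t (D i) = D (Suc i)" for i using t by (simp add: D_def rho_prod e_sh)
  have D_prod: "(\<Prod>i<p. D i) = 1"
  proof -
    have "(\<Prod>i<p. D i) = (\<Prod>k<p. \<Prod>i<p. e (i + p * k))" unfolding D_def by (rule prod.swap)
    then show ?thesis using e_prod by (simp add: prod_lessThan_mult[symmetric] power2_eq_square)
  qed
  have \<omega>mult: "\<omega> ^ (i + p * k) = \<omega> ^ i" for i k by (simp add: power_add power_mult \<omega>p)
  have \<eta>\<omega>p: "(\<eta> * \<omega> ^ i) ^ p = \<omega>" for i
  proof -
    have "(\<omega> ^ i) ^ p = (\<omega> ^ p) ^ i" by (simp add: power_mult[symmetric] mult.commute)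
    then have "(\<omega> ^ i) ^ p = 1" by (simp add: \<omega>p)
    then show ?thesis by (simp only: power_mult_distrib \<omega>_def[symmetric] mult_1_right)
  qed
  have D_w: "\<rho> g (D i) = \<omega> * D i" for i
  proof -
    have "\<rho> g (D i) = (\<Prod>k<p. \<eta> * \<omega> ^ i * e (i + p * k))"
      using g by (simp add: D_def rho_prod e_w \<omega>mult)
    then show ?thesis by (simp add: prod.distrib \<eta>\<omega>p D_def power_mult_distrib[symmetric])
  qed
  \<comment> \<open>Multiplication by \<open>D\<close> turns the fixed system \<open>z 0\<close>
    into one of weight \<open>\<omega>\<close>.\<close>
  define f where "f i = z 0 i * D i" for i
  have f_nz: "f i \<noteq> 0" for i by (simp add: f_def f0_nz D_nz)
  have f_per: "f (i + p) = f i" for i by (simp add: f_def f0_per D_per)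
  have fsys: "cyclic_system p t f"
    unfolding cyclic_system_def using f_per t
    by (simp add: f_def f0_sh D_sh rho_mult prod.distrib f0_prod D_prod)
  note f_sh = cyclic_system_shift[OF fsys p0] and f_prods = cyclic_system_prod_shift[OF fsys p0]
  have f_w: "\<rho> g (f i) = \<omega> * f i" for i using g by (simp add: f_def rho_mult w0 D_w)
  \<comment> \<open>\<open>e i / e (Suc i)\<close> has weight \<open>1 / \<omega>\<close>, which
    \<open>f i\<close> cancels. In \<open>V\<close> the weights of \<open>D i\<close> and
    \<open>f i\<close> cancel, and the exponents \<open>p - k\<close> of the remaining factors add
    up to \<open>p * h\<close>.\<close>
  define Y where "Y i = e i / e (Suc i) * f i" for i
  define V where "V i = D i * (\<Prod>k<p. f (i + k) ^ (p - k)) / f i" for i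
  \<comment> \<open>For \<open>j \<ge> 2\<close> the weight of \<open>z j\<close> is the
    \<open>j\<close>-th power of that of \<open>e\<close>, so division by \<open>e i ^ j\<close>
    makes the system invariant.\<close>
  define z' where "z' j = (if j = 0 then V else if j = 1 then Y else (\<lambda>i. z j i / e i ^ j))" for j
  have Vsys: "cyclic_system p t V"
    unfolding cyclic_system_def
  proof (intro conjI allI)
    show "V (i + p) = V i" for i
    proof -
      have "f (i + p + k) = f (i + k)" for k using f_per[of "i + k"] by (simp add: ac_simps)
      then show ?thesis by (simp add: V_def D_per f_per)
    qed
    show "\<rho> t (V i) = V (Suc i)" for i
      using t by (simp add: V_def rho_divide rho_mult rho_prod rho_power f_sh D_sh)
    have "(\<Prod>i<p. \<Prod>k<p. f (i + k) ^ (p - k)) = (\<Prod>k<p. (\<Prod>i<p. f (k + i)) ^ (p - k))"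
      by (subst prod.swap) (simp add: prod_power_distrib add.commute)
    also have "\<dots> = 1" by (simp add: f_prods)
    finally show "(\<Prod>i<p. V i) = 1"
      using cyclic_system_prod[OF fsys p0] by (simp add: V_def prod_dividef prod.distrib D_prod)
  qed
  have Ysys: "cyclic_system (p\<^sup>2) t Y"
    unfolding cyclic_system_def
  proof (intro conjI allI)
    have f_per': "f (i + p\<^sup>2) = f i" for i
      using cyclic_system_mod[OF fsys p0, of "i + p\<^sup>2"] cyclic_system_mod[OF fsys p0, of i]
      by (simp add: power2_eq_square)
    show "Y (i + p\<^sup>2) = Y i" for i
      using e_per[of i] e_per[of "Suc i"] by (simp add: Y_def f_per')
    show "\<rho> t (Y i) = Y (Suc i)" for i
      using t by (simp add: Y_def rho_mult rho_divide e_sh f_sh)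
    have "(\<Prod>i<p\<^sup>2. e (Suc i)) = (\<Prod>i<p\<^sup>2. e i)"
      by (rule prod_lessThan_shift_cyclic) (use e_per[of 0] in simp)
    moreover have "(\<Prod>i<p\<^sup>2. f i) = 1"
    proof -
      have "(\<Prod>i<p. f (i + p * k)) = 1" for k using f_prods[of "p * k"] by (simp add: add.commute)
      then show ?thesis by (simp add: power2_eq_square prod_lessThan_mult)
    qed
    ultimately show "(\<Prod>i<p\<^sup>2. Y i) = 1" by (simp add: Y_def prod.distrib prod_dividef e_prod)
  qed
  have z'sys: "cyclic_system (if j = 0 then p else p\<^sup>2) t (z' j)" if j: "j < r" for j
  proof -
    consider "j = 0" | "j = 1" | "j \<ge> 2" by linarith
    then show ?thesis
    proof cases
      case 3
      then have "cyclic_system (p\<^sup>2) t (z j)" using sys[OF j] by simp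
      then have "cyclic_system (p\<^sup>2) t (\<lambda>i. z j i / e i ^ j)"
        unfolding cyclic_system_def
        using t e_per e_sh e_prod by (simp add: rho_divide rho_power prod_dividef prod_power_distrib[symmetric])
      then show ?thesis using 3 by (simp add: z'_def)
    qed (use Vsys Ysys in \<open>simp_all add: z'_def\<close>)
  qed
  have sum_h: "(\<Sum>k<p. p - k) = p * h" "(\<Sum>k<p. Suc k) = p * h"
    using sum_lessThan_complement[of p] sum_lessThan_Suc_double[of p] h by (simp_all del: sum.lessThan_Suc)
  have inv: "\<rho> g (z' j i) = z' j i" if j: "j < r" for j i
  proof -
    consider "j = 0" | "j = 1" | "j \<ge> 2" by linarith
    then show ?thesis
    proof cases
      case 1
      have "(\<Prod>k<p. \<omega> ^ (p - k)) = \<omega> ^ (p * h)" by (simp add: power_sum[symmetric] sum_h)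
      also have "\<dots> = 1" by (simp add: power_mult \<omega>p)
      finally have "(\<Prod>k<p. (\<omega> * f (i + k)) ^ (p - k)) = (\<Prod>k<p. f (i + k) ^ (p - k))"
        by (simp add: power_mult_distrib prod.distrib)
      then have "\<rho> g (V i) = V i"
        using g \<omega>0 by (simp add: V_def rho_divide rho_mult rho_prod rho_power f_w D_w)
      then show ?thesis using 1 by (simp add: z'_def)
    next
      case 2
      have "\<rho> g (Y i) = Y i"
        using g \<omega>0 \<eta>0 by (simp add: Y_def rho_divide rho_mult f_w e_w)
      then show ?thesis using 2 by (simp add: z'_def)
    next
      case 3
      define c where "c = (\<eta> * \<omega> ^ i) ^ j"
      have "c \<noteq> 0" using \<eta>0 \<omega>0 by (simp add: c_def)
      moreover have "\<rho> g (e i ^ j) = c * e i ^ j"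
        by (simp only: rho_power[OF g] e_w power_mult_distrib[of _ "e i"] c_def)
      moreover have "\<rho> g (z j i) = c * z j i" using wj[OF j, of i] 3 by (simp add: c_def \<omega>_def)
      ultimately have "\<rho> g (z j i / e i ^ j) = z j i / e i ^ j" by (simp add: rho_divide[OF g])
      then show ?thesis using 3 by (simp add: z'_def)
    qed
  qed
  let ?E = "system_field r z'"
  note E = is_subfield_system_field[of r z']
  have VE: "V i \<in> ?E" for i using system_field_mem[of 0 r z' i] r by (simp add: z'_def)
  have YE: "Y i \<in> ?E" for i using system_field_mem[of 1 r z' i] r by (simp add: z'_def)
  have zF: "z j i \<in> system_field r z" if "j < r" for j i using system_field_mem[OF that] .
  have sub: "?E \<subseteq> system_field r z"
  proof (intro system_field_least is_subfield_system_field system_field_base)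
    fix j i assume j: "j < r"
    note F = is_subfield_system_field[of r z]
    have eF: "e i \<in> system_field r z" for i using zF[of 1] r by (simp add: e_def)
    have DF: "D i \<in> system_field r z" for i unfolding D_def using eF by (intro subfield_closed(9)[OF F])
    have fF: "f i \<in> system_field r z" for i
      unfolding f_def using DF zF[of 0] r by (intro subfield_closed(5)[OF F]) auto
    have YF: "Y i \<in> system_field r z" for i
      unfolding Y_def using eF fF by (intro subfield_closed(5)[OF F] subfield_closed(12)[OF F])
    have VF: "V i \<in> system_field r z" for i
      unfolding V_def using fF DF
      by (intro subfield_closed(5)[OF F] subfield_closed(12)[OF F] subfield_closed(9)[OF F] subfield_closed(7)[OF F])
    show "z' j i \<in> system_field r z"
      unfolding z'_def using YF VF eF zF[OF j]
      by (auto intro!: subfield_closed(12)[OF F] subfield_closed(7)[OF F])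
  qed
  \<comment> \<open>From here on entries are compared modulo the invariant field, where
    \<open>Y i\<close> and \<open>V i\<close> become trivial. The aim is that \<open>e 0\<close>
    generates all entries and that its \<open>p\<^sup>2\<close>-th power is invariant.\<close>
  let ?R = "ratio_in ?E"
  note rrefl = ratio_in_refl[OF E] and rsym = ratio_in_sym[OF E] and rmult = ratio_in_mult[OF E]
    and rtrans = ratio_in_trans[OF E] and rdiv = ratio_in_divide[OF E] and rpow = ratio_in_power[OF E]
    and rprod = ratio_in_prod[OF E]
  have r1: "?R (f i) (e (Suc i) / e i)" for i
    using YE[of i] e_nz f_nz by (simp add: ratio_in_def Y_def mult.commute)
  \<comment> \<open>A product of \<open>p\<close> consecutive \<open>f\<close>'s is
    \<open>1\<close>, while modulo the invariants it telescopes in the \<open>e\<close>'s; so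
    \<open>e\<close> has period \<open>p\<close> there.\<close>
  have r2: "?R (e (i + p)) (e i)" for i
  proof -
    have "?R (\<Prod>k<p. f (i + k)) (\<Prod>k<p. e (i + Suc k) / e (i + k))"
      using r1 by (intro rprod) simp
    moreover have "(\<Prod>k<p. e (i + Suc k) / e (i + k)) = e (i + p) / e i"
      by (subst prod_lessThan_telescope[of p "\<lambda>k. e (i + k)"]) (simp_all add: e_nz)
    ultimately have "?R 1 (e (i + p) / e i)" by (simp only: f_prods)
    from rmult[OF rrefl[OF e_nz[of i]] this] have "?R (e i) (e (i + p))" using e_nz[of i] by simp
    then show ?thesis by (rule rsym)
  qed
  have r2': "?R (e (i + p * k)) (e i)" for i k
  proof (induction k)
    case (Suc k)
    have "?R (e (i + p * k + p)) (e (i + p * k))" by (rule r2)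
    from rtrans[OF this Suc] show ?case by (simp add: algebra_simps)
  qed (simp add: rrefl e_nz)
  have rD: "?R (D i) (e i ^ p)" for i
  proof -
    have "?R (D i) (\<Prod>k<p. e i)" unfolding D_def by (intro rprod r2')
    then show ?thesis by simp
  qed
  define P where "P i = (\<Prod>k<p. e (i + Suc k))" for i
  have P_nz: "P i \<noteq> 0" for i by (simp add: P_def e_nz)
  \<comment> \<open>This is the triviality of \<open>V i\<close>: \<open>D i\<close> becomes
    \<open>e i ^ p\<close>, and the weighted product of the \<open>f\<close>'s telescopes against it
    to \<open>P i\<close>.\<close>
  have r3: "?R (P i) (e (Suc i) / e i)" for i
  proof -
    have "?R (V i) (e i ^ p * (\<Prod>k<p. (e (i + Suc k) / e (i + k)) ^ (p - k)) / (e (Suc i) / e i))"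
      unfolding V_def using r1 by (intro rdiv rmult rD rprod rpow) simp_all
    moreover have "(\<Prod>k<p. (e (i + Suc k) / e (i + k)) ^ (p - k)) * e i ^ p = P i"
      using prod_telescoping_powers[of "\<lambda>k. e (i + k)" p] e_nz by (simp add: P_def)
    ultimately have "?R (V i) (P i / (e (Suc i) / e i))" by (simp only: mult.commute)
    moreover have "?R (V i) 1" using VE[of i] D_nz f_nz by (simp add: ratio_in_def V_def)
    ultimately have "?R (P i / (e (Suc i) / e i)) 1" using rtrans[OF rsym] by blast
    from rmult[OF this rrefl[of "e (Suc i) / e i"]] show ?thesis using e_nz by simp
  qed
  have r4: "?R (P i) (P 0)" for i
  proof (induction i)
    case (Suc i)
    have "(\<Prod>k<n. e (Suc i + Suc k)) * e (Suc i) = (\<Prod>k<n. e (Suc i + k)) * e (Suc i + n)" for n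
      by (induction n) (simp_all add: ac_simps)
    from this[of p] have "P (Suc i) = P i * (e (Suc i + p) / e (Suc i))"
      using e_nz[of "Suc i"] by (simp add: P_def field_simps)
    moreover have "?R (P i * (e (Suc i + p) / e (Suc i))) (P i * (e (Suc i) / e (Suc i)))"
      by (intro rmult rdiv rrefl r2 P_nz e_nz)
    ultimately have "?R (P (Suc i)) (P i)" using e_nz by simp
    then show ?case using Suc rtrans by blast
  qed (simp add: rrefl P_nz)
  \<comment> \<open>Modulo the invariants the \<open>e i\<close> therefore form a geometric
    progression with ratio \<open>P 0\<close>.\<close>
  have r5: "?R (e (Suc i)) (e i * P 0)" for i
  proof -
    have "?R (e (Suc i) / e i) (P 0)" using rtrans[OF rsym[OF r3] r4] .
    from rmult[OF rrefl[OF e_nz[of i]] this] show ?thesis using e_nz by simp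
  qed
  have r6: "?R (e i) (e 0 * P 0 ^ i)" for i
  proof (induction i)
    case (Suc i)
    have "?R (e i * P 0) (e 0 * P 0 ^ i * P 0)" by (intro rmult Suc rrefl P_nz)
    from rtrans[OF r5 this] show ?case by (simp add: ac_simps)
  qed (simp add: rrefl e_nz)
  have r7: "?R (P 0 ^ p) 1"
  proof -
    have "?R (e 0 * P 0 ^ p) (e 0)" using rtrans[OF rsym[OF r6] r2[of 0]] by simp
    from rdiv[OF this rrefl[OF e_nz[of 0]]] show ?thesis using e_nz by simp
  qed
  \<comment> \<open>\<open>P 0\<close> is the product of the \<open>e i\<close> with
    \<open>i\<close> from \<open>1\<close> to \<open>p\<close>. Inserting the progression, the
    powers of \<open>P 0\<close> add up to \<open>p * h\<close> and drop out because
    \<open>P 0 ^ p\<close> is trivial.\<close>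
  have r8: "?R (P 0) (e 0 ^ p)"
  proof -
    have "?R (\<Prod>k<p. e (Suc k)) (\<Prod>k<p. e 0 * P 0 ^ Suc k)" by (intro rprod r6)
    moreover have "(\<Prod>k<p. e 0 * P 0 ^ Suc k) = e 0 ^ p * (P 0 ^ p) ^ h"
    proof -
      have "(\<Prod>k<p. e 0 * P 0 ^ Suc k) = e 0 ^ p * P 0 ^ (\<Sum>k<p. Suc k)"
        by (simp only: prod.distrib power_sum prod_constant card_lessThan)
      then show ?thesis by (simp only: sum_h power_mult)
    qed
    ultimately have 1: "?R (P 0) (e 0 ^ p * (P 0 ^ p) ^ h)" by (simp add: P_def)
    have "?R (e 0 ^ p * (P 0 ^ p) ^ h) (e 0 ^ p * 1 ^ h)" using e_nz by (intro rmult rpow r7 rrefl) simp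
    from rtrans[OF 1 this] show ?thesis by simp
  qed
  have r9: "?R (e i) (e 0 * (e 0 ^ p) ^ i)" for i
    by (rule rtrans[OF r6]) (intro rmult rpow r8 rrefl e_nz)
  have "?R ((e 0 ^ p) ^ p) 1" using rtrans[OF rpow[OF rsym[OF r8]] r7] .
  then have upE: "e 0 ^ p\<^sup>2 \<in> ?E" by (simp add: ratio_in_def power_mult[symmetric] power2_eq_square)
  let ?F = "adjoin ?E {e 0}"
  have EF: "x \<in> ?F" if "x \<in> ?E" for x using adjoin_base that by blast
  have e0F: "e 0 \<in> ?F" using adjoin_gens[of "{e 0}" ?E] by simp
  have eF: "e i \<in> ?F" for i
  proof -
    have "e i / (e 0 * (e 0 ^ p) ^ i) \<in> ?F" using r9[of i] EF by (simp add: ratio_in_def)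
    then have "e i / (e 0 * (e 0 ^ p) ^ i) * (e 0 * (e 0 ^ p) ^ i) \<in> ?F"
      using e0F by (intro adjoin_closed(5) adjoin_closed(7))
    then show ?thesis using e_nz by simp
  qed
  have gen: "system_field r z \<subseteq> ?F"
  proof (intro system_field_least is_subfield_adjoin)
    show "K \<subseteq> ?F" using system_field_base EF by blast
    fix j i assume j: "j < r"
    consider "j = 0" | "j = 1" | "j \<ge> 2" by linarith
    then show "z j i \<in> ?F"
    proof cases
      case 1
      have "z 0 i = Y i * e (Suc i) / e i / D i" using e_nz D_nz by (simp add: Y_def f_def)
      also have "\<dots> \<in> ?F" unfolding D_def using eF EF[OF YE]
        by (intro adjoin_closed(12) adjoin_closed(5) adjoin_closed(9))
      finally show ?thesis using 1 by simp
    next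
      case 2
      then show ?thesis using eF by (simp add: e_def)
    next
      case 3
      then have "z j i = z' j i * e i ^ j" using e_nz by (simp add: z'_def)
      also have "\<dots> \<in> ?F" using EF[OF system_field_mem[OF j]] eF by (intro adjoin_closed(5) adjoin_closed(7))
      finally show ?thesis .
    qed
  qed
  have fixE: "\<rho> g x = x" if "x \<in> ?E" for x
    using rho_adjoin_fixed[OF g, of K "\<Union>j<r. range (z' j)" x] inv rho_K[OF g] that
    by (auto simp: system_field_def)
  have "x \<in> ?E" if "x \<in> system_field r z" "\<rho> g x = x" for x
  proof (rule fixed_by_kummer[OF g E fixE _ upE \<eta>(1)])
    show "\<rho> g (e 0) = \<eta> * e 0" by (simp add: e_w)
    show "\<eta> \<in> ?E" using \<eta>(2) system_field_base by blast
    show "of_nat (p\<^sup>2) \<noteq> (0::'l)" using p(3) by (simp add: power2_eq_square)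
  qed (use that gen in auto)
  then show ?thesis using z'sys inv sub by (intro exI[of _ z']) blast
qed

end

section \<open>Groups with a cyclic normal subgroup of order \<open>p ^ 3\<close>\<close>

lemma primitive_root_inverse:
  "primitive_root_of_unity n (\<xi>::'l::field) \<Longrightarrow> primitive_root_of_unity n (inverse \<xi>)"
  by (simp add: primitive_root_of_unity_def power_inverse)

lemma primitive_root_coprime_power:
  assumes "primitive_root_of_unity n (\<xi>::'l::field)" "coprime n a"
  shows "primitive_root_of_unity n (\<xi> ^ a)"
proof -
  have "n > 0" using assms by (auto simp: primitive_root_of_unity_def)
  moreover have "(\<xi> ^ a) ^ i = 1 \<longleftrightarrow> n dvd i" for i
    using primitive_root_power_eq_1[OF assms(1), of "a * i"] assms(2)
    by (simp add: power_mult coprime_dvd_mult_right_iff)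
  ultimately show ?thesis unfolding primitive_root_of_unity_def by (auto dest: dvd_imp_le)
qed

lemma sum_lessThan_add:
  fixes f :: "nat \<Rightarrow> 'c::comm_monoid_add"
  shows "(\<Sum>i<a + b. f i) = (\<Sum>i<a. f i) + (\<Sum>i<b. f (a + i))"
  by (induction b) (simp_all add: add.assoc)

lemma sum_lessThan_mult:
  fixes f :: "nat \<Rightarrow> 'c::comm_monoid_add"
  shows "(\<Sum>i<n * p. f i) = (\<Sum>k<n. \<Sum>i<p. f (i + p * k))"
proof (induction n)
  case (Suc n)
  have "(\<Sum>i<Suc n * p. f i) = (\<Sum>i<n * p + p. f i)" by (simp add: add.commute)
  also have "\<dots> = (\<Sum>i<n * p. f i) + (\<Sum>i<p. f (n * p + i))" by (rule sum_lessThan_add)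
  finally show ?case using Suc by (simp add: ac_simps)
qed simp

lemma card_non_multiples:
  assumes "p > 0" shows "card {s \<in> {..<p\<^sup>2}. \<not> p dvd s} = p\<^sup>2 - p"
proof -
  have eq: "{s \<in> {..<p\<^sup>2}. \<not> p dvd s} = {..<p\<^sup>2} - (\<lambda>s. p * s) ` {..<p}"
    using assms by (auto simp: power2_eq_square)
  have "(\<lambda>s. p * s) ` {..<p} \<subseteq> {..<p\<^sup>2}" using assms by (auto simp: power2_eq_square)
  moreover have "card ((\<lambda>s. p * s) ` {..<p}) = p" using assms by (subst card_image) (auto simp: inj_on_def)
  ultimately show ?thesis unfolding eq by (subst card_Diff_subset) auto
qed

lemma (in group) conj_pow:
  assumes "a \<in> carrier G" "x \<in> carrier G"
  shows "(inv a \<otimes> x \<otimes> a) [^] (n::nat) = inv a \<otimes> x [^] n \<otimes> a"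
proof (induction n)
  case (Suc n)
  have "(inv a \<otimes> x \<otimes> a) [^] Suc n = inv a \<otimes> x [^] n \<otimes> a \<otimes> (inv a \<otimes> x \<otimes> a)" by (simp add: Suc)
  also have "\<dots> = inv a \<otimes> x [^] n \<otimes> (a \<otimes> inv a) \<otimes> x \<otimes> a"
    using assms by (simp only: m_assoc m_closed inv_closed nat_pow_closed)
  finally show ?case using assms by (simp add: m_assoc)
qed (use assms in simp)

context abelian_extension
begin

text \<open>The eigenvectors of \<open>H\<close> are written down explicitly because their
  eigenvalues matter: conjugation by \<open>t\<close> replaces \<open>g\<close> by a power, which
  makes the weights of \<open>g\<close> vary along an orbit system exactly as in
  \<open>phi8_systems_invariants\<close>. The orbit of the invariant eigenvector is treated
  separately and provides the system of length \<open>p\<close>.\<close>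

theorem few_generators_phi8:
  assumes p: "Factorial_Ring.prime p" "odd p" "of_nat p \<noteq> (0::'l)" and m: "m = p\<^sup>2"
    and g: "g \<in> H" "H = (\<lambda>k. g [^] k) ` {..<p ^ 3}" "card H = p ^ 3" "g [^] (p ^ 3) = \<one>"
    and conj: "inv t \<otimes> g \<otimes> t = g [^] (1 + p * (1 + p * l))"
    and q: "primitive_root_of_unity q \<zeta>" "\<zeta> \<in> K" "q = b * p ^ 3" "\<And>x. x \<in> carrier G \<Longrightarrow> x [^] q = \<one>"
  shows few_generators
proof -
  define N where "N = p ^ 3"
  have p0: "p > 0" using p(1) prime_gt_0_nat by blast
  have m0: "of_nat m \<noteq> (0::'l)" and N0: "of_nat N \<noteq> (0::'l)" "N > 0" using p(3) p0 by (simp_all add: m N_def)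
  have Np: "N = p * m" by (simp add: N_def m power2_eq_square power3_eq_cube)
  have N2: "2 \<le> N"
  proof -
    have "p \<ge> 2" using p(1) by (rule prime_ge_2_nat)
    also have "p \<le> p ^ 3" using p0 by (simp add: self_le_power)
    finally show ?thesis by (simp add: N_def)
  qed
  have mge: "p \<le> m" using p0 by (simp add: m power2_eq_square)
  have gG: "g \<in> carrier G" using g(1) by (rule H_carrier)
  have b0: "b > 0" using q(1,3) by (auto simp: primitive_root_of_unity_def)
  define \<xi> where "\<xi> = \<zeta> ^ b"
  have \<xi>: "primitive_root_of_unity N \<xi>" using primitive_root_power[of b N \<zeta>] q(1,3) b0 by (simp add: \<xi>_def N_def)
  have \<xi>K: "\<xi> \<in> K" using q(2) unfolding \<xi>_def by (intro subfield_closed[OF K])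
  have \<xi>0: "\<xi> \<noteq> 0" using primitive_root_nonzero[OF \<xi>] .
  define \<theta> where "\<theta> = \<xi> ^ p"
  have \<theta>: "primitive_root_of_unity m \<theta>" using primitive_root_power[of p m \<xi>] \<xi> p0 by (simp add: \<theta>_def Np)
  have \<theta>K: "\<theta> \<in> K" using \<xi>K unfolding \<theta>_def by (intro subfield_closed[OF K])
  have \<theta>p: "primitive_root_of_unity p (\<theta> ^ p)"
    using primitive_root_power[of p p \<theta>] \<theta> p0 by (simp add: m power2_eq_square)
  have \<theta>0: "\<theta> \<noteq> 0" using primitive_root_nonzero[OF \<theta>] .
  have powK: "(\<xi> ^ k) ^ j \<in> K" "(\<theta> ^ k) ^ j \<in> K" for k j using \<xi>K \<theta>K by (auto intro!: subfield_closed[OF K])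
  \<comment> \<open>The eigenvalue of \<open>g\<close> on \<open>v 1\<close>; on \<open>v k\<close>
    it is \<open>\<eta>0 ^ k\<close>.\<close>
  define \<eta>0 where "\<eta>0 = inverse \<xi>"
  have \<eta>0: "primitive_root_of_unity N \<eta>0" unfolding \<eta>0_def by (rule primitive_root_inverse[OF \<xi>])
  have \<eta>0K: "\<eta>0 \<in> K" using \<xi>K unfolding \<eta>0_def by (intro subfield_closed[OF K])
  \<comment> \<open>Conjugation by \<open>t\<close> raises \<open>g\<close> to the power
    \<open>1 + c\<close>. Since \<open>1 + p * l\<close> is prime to \<open>p\<close>, the element
    \<open>\<eta>0 ^ c\<close> has order exactly \<open>p\<^sup>2\<close>.\<close>
  define c where "c = p * (1 + p * l)"
  define \<eta> where "\<eta> = \<eta>0 ^ c"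
  have \<eta>: "primitive_root_of_unity (p\<^sup>2) \<eta>"
  proof -
    have "primitive_root_of_unity (p\<^sup>2) (\<eta>0 ^ p)" using primitive_root_power[of p m \<eta>0] \<eta>0 p0 by (simp add: Np m)
    moreover have "coprime p (1 + p * l)" by (metis coprime_Suc_right_nat coprime_commute coprime_mult_left_iff plus_1_eq_Suc)
    then have "coprime (p\<^sup>2) (1 + p * l)" by simp
    ultimately have "primitive_root_of_unity (p\<^sup>2) ((\<eta>0 ^ p) ^ (1 + p * l))" by (rule primitive_root_coprime_power)
    then show ?thesis by (simp only: \<eta>_def c_def power_mult)
  qed
  have \<eta>K: "\<eta> \<in> K" using \<eta>0K unfolding \<eta>_def by (intro subfield_closed[OF K])
  have gpow_eq: "g [^] (k::nat) \<in> H" for k using subgroup_nat_pow_closed[OF H g(1)] .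
  have gpowG: "g [^] (k::nat) \<in> carrier G" for k using gG by simp
  have fix_H: "\<rho> h x = x" if gx: "\<rho> g x = x" and h: "h \<in> H" for h x
  proof -
    have "\<rho> (g [^] k) x = x" for k :: nat
      by (induction k) (simp_all only: rho_pow_Suc[OF gG] nat_pow_0 rho_one gx)
    then show ?thesis using h g(2) by auto
  qed

  define v where "v k = (\<Sum>j<N. (\<xi> ^ k) ^ j * var (g [^] j))" for k
  have v_g: "\<rho> g (v k) = \<eta>0 ^ k * v k" for k
  proof -
    have "\<rho> g (v k) = (\<Sum>j<N. (\<xi> ^ k) ^ j * var (g [^] Suc j))"
    proof -
      have "\<rho> g (var (g [^] j)) = var (g [^] Suc j)" for j :: nat
        using gG nat_pow_Suc2[OF gG, of j] by (simp add: rho_var)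
      then show ?thesis by (simp only: v_def rho_sum[OF gG] rho_mult[OF gG] rho_K[OF gG powK(1)])
    qed
    then have "\<xi> ^ k * \<rho> g (v k) = (\<Sum>j<N. (\<xi> ^ k) ^ Suc j * var (g [^] Suc j))"
      by (simp only: sum_distrib_left power_Suc mult.assoc)
    also have "\<dots> = v k"
      unfolding v_def
    proof (rule sum_lessThan_shift_cyclic)
      have "(\<xi> ^ k) ^ N = 1" using primitive_root_power_eq_1[OF \<xi>, of "k * N"] by (simp add: power_mult)
      then show "(\<xi> ^ k) ^ N * var (g [^] N) = (\<xi> ^ k) ^ 0 * var (g [^] (0::nat))" using g(4) by (simp add: N_def)
    qed
    finally show ?thesis using \<xi>0 by (simp add: \<eta>0_def power_inverse field_simps)
  qed
  have v_gpow: "\<rho> (g [^] a) (v k) = (\<eta>0 ^ a) ^ k * v k" for a k :: nat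
  proof (induction a)
    case (Suc a)
    have "(\<eta>0 ^ a) ^ k \<in> K" using \<eta>0K by (intro subfield_closed[OF K])
    then have "\<rho> (g [^] Suc a) (v k) = (\<eta>0 ^ a) ^ k * (\<eta>0 ^ k * v k)"
      by (simp only: rho_pow_Suc[OF gG] Suc rho_mult[OF gG] rho_K[OF gG] v_g)
    then show ?case by (simp add: power_mult_distrib mult.assoc mult.left_commute)
  qed (simp add: rho_one)
  have eig: "\<exists>c\<in>K. \<rho> h (v k) = c * v k" if h: "h \<in> H" for h k
  proof -
    obtain a :: nat where "h = g [^] a" using h g(2) by blast
    moreover have "(\<eta>0 ^ a) ^ k \<in> K" using \<eta>0K by (intro subfield_closed[OF K])
    ultimately show ?thesis using v_gpow by blast
  qed
  have var_v: "var ` H \<subseteq> adjoin K (v ` {..<N})"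
  proof
    fix x assume "x \<in> var ` H"
    then obtain i where i: "i < N" "x = var (g [^] i)" using g(2) by (auto simp: N_def)
    have "v k \<in> adjoin K (v ` {..<N})" if "k < N" for k using adjoin_gens[of "v ` {..<N}" K] that by auto
    moreover have "(\<xi> ^ k) ^ j \<in> adjoin K (v ` {..<N})" for k j using powK(1) adjoin_base by blast
    ultimately have "(\<Sum>k<N. (\<xi> ^ k) ^ (N - i) * v k) \<in> adjoin K (v ` {..<N})"
      by (intro adjoin_closed(8) adjoin_closed(5)) auto
    then have "of_nat N * var (g [^] i) \<in> adjoin K (v ` {..<N})"
      using fourier_inversion[OF \<xi> i(1), of "\<lambda>j. var (g [^] j)"] by (simp add: v_def)
    then have "of_nat N * var (g [^] i) / of_nat N \<in> adjoin K (v ` {..<N})"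
      by (rule adjoin_closed(12)[OF _ adjoin_closed(10)])
    then show "x \<in> adjoin K (v ` {..<N})" using N0 i(2) by simp
  qed
  define vt where "vt k i = \<rho> (t [^] i) (v k)" for k and i :: nat
  have v_in_L: "vt k i \<in> L" for k i
  proof -
    have "(\<xi> ^ k) ^ j \<in> L" for j using powK(1) K_subset_L by blast
    then have "v k \<in> L" unfolding v_def using var_in_L[OF gpowG]
      by (intro subfield_closed(8)[OF is_subfield_L] subfield_closed(5)[OF is_subfield_L])
    then show ?thesis using stable_L t_power by (auto simp: vt_def stable_def)
  qed
  \<comment> \<open>The conjugates of the \<open>v k\<close> by powers of \<open>t\<close> generate
    \<open>L\<close>, and there are at most \<open>N * m = |G|\<close> of them.\<close>
  have v_nz: "v k \<noteq> 0" if "k < N" for k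
  proof -
    let ?B = "(\<lambda>(k, i). vt k i) ` ({..<N} \<times> {..<m})"
    have "L \<subseteq> adjoin K ?B"
    proof (rule L_subset_orbits[OF is_subfield_adjoin adjoin_base var_v])
      fix w i assume "w \<in> v ` {..<N}" "i < m"
      then have "\<rho> (t [^] i) w \<in> ?B" by (auto simp: vt_def)
      then show "\<rho> (t [^] i) w \<in> adjoin K ?B" by (rule subsetD[OF adjoin_gens])
    qed
    moreover have "card ?B \<le> card ({..<N} \<times> {..<m})" by (rule card_image_le) simp
    then have "card ?B \<le> Coset.order G" using card_H g(3) by (simp add: N_def card_cartesian_product)
    ultimately have "0 \<notin> ?B" by (intro nonzero_if_few_generators) auto
    moreover have "v k \<in> ?B" using that m_pos
      by (intro image_eqI[of _ _ "(k, 0)"]) (auto simp: vt_def rho_one)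
    ultimately show ?thesis by metis
  qed
  have "\<exists>d\<in>K. d \<noteq> 0 \<and> \<rho> (t [^] m) (v k) = d ^ m * v k" if "k < N" for k
  proof (rule normalizing_root[OF v_nz[OF that] eig q(1,2) _ q(4)[OF t]])
    show "q = m * (p * b)" using q(3) by (simp add: m power2_eq_square power3_eq_cube)
  qed
  then obtain d where d: "\<And>k. k < N \<Longrightarrow> d k \<in> K" "\<And>k. k < N \<Longrightarrow> d k \<noteq> 0"
    "\<And>k. k < N \<Longrightarrow> \<rho> (t [^] m) (v k) = d k ^ m * v k" by metis
  define y where "y k = orbit_system (d k) (v k)" for k
  have ysys: "cyclic_system m t (y k)" if "k < N" for k
    unfolding y_def using cyclic_system_orbit[OF v_nz[OF that] eig d(1,2,3)[OF that]] .
  have gconj: "inv (t [^] i) \<otimes> g \<otimes> t [^] i = g [^] ((1 + c) ^ i)" for i :: nat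
  proof (induction i)
    case (Suc i)
    have "inv (t [^] Suc i) \<otimes> g \<otimes> t [^] Suc i = inv t \<otimes> (inv (t [^] i) \<otimes> g \<otimes> t [^] i) \<otimes> t"
      using t gG by (simp add: inv_mult_group m_assoc)
    also have "\<dots> = (inv t \<otimes> g \<otimes> t) [^] ((1 + c) ^ i)" unfolding Suc using conj_pow[OF t gG] by simp
    also have "\<dots> = g [^] ((1 + c) ^ Suc i)" unfolding conj c_def[symmetric] by (simp only: nat_pow_pow[OF gG] power_Suc)
    finally show ?case .
  qed (use gG in simp)
  \<comment> \<open>The eigenvalue of \<open>g\<close> on \<open>vt 1 i\<close>; on
    \<open>vt k i\<close> it is the \<open>k\<close>-th power.\<close>
  define \<tau> where "\<tau> i = \<eta>0 ^ ((1 + c) ^ i)" for i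
  have \<tau>0: "\<tau> i \<noteq> 0" for i using primitive_root_nonzero[OF \<eta>0] by (simp add: \<tau>_def)
  have \<tau>K: "\<tau> i ^ k \<in> K" for i k using \<eta>0K unfolding \<tau>_def by (intro subfield_closed[OF K])
  have vt_g: "\<rho> g (vt k i) = \<tau> i ^ k * vt k i" for k i
    unfolding vt_def rho_H_t_power[OF g(1)] gconj v_gpow \<tau>_def[symmetric]
    using rho_K[OF t_power \<tau>K] t_power by (simp add: rho_mult)
  have \<tau>_Suc: "\<tau> (Suc i) = \<tau> i * \<tau> i ^ c" for i
  proof -
    have "\<tau> (Suc i) = \<tau> i ^ (1 + c)" by (simp only: \<tau>_def power_Suc2 power_mult)
    then show ?thesis by simp
  qed
  have \<eta>pp: "\<eta> ^ (p\<^sup>2) = 1" using \<eta> by (simp add: primitive_root_of_unity_def)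
  \<comment> \<open>As \<open>c\<close> is \<open>p\<close> modulo \<open>p\<^sup>2\<close>, raising
    a \<open>p\<^sup>2\<close>-th root of unity to the power \<open>c\<close> is raising it to the
    power \<open>p\<close>. Hence each step multiplies \<open>\<tau> i ^ c\<close> by the same
    factor \<open>\<eta> ^ p\<close>.\<close>
  have \<tau>_c: "\<tau> i ^ c = \<eta> * (\<eta> ^ p) ^ i" for i
  proof (induction i)
    case (Suc i)
    let ?x = "\<eta> * (\<eta> ^ p) ^ i"
    have "?x ^ p = \<eta> ^ p * (\<eta> ^ (p\<^sup>2)) ^ i"
      by (simp add: power_mult_distrib power_mult[symmetric] power2_eq_square ac_simps)
    then have xp: "?x ^ p = \<eta> ^ p" by (simp add: \<eta>pp)
    have "?x ^ c = ?x ^ p * (?x ^ p) ^ (p * l)" by (simp add: c_def power_add[symmetric] power_mult[symmetric] algebra_simps)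
    also have "(?x ^ p) ^ (p * l) = (\<eta> ^ (p\<^sup>2)) ^ l" unfolding xp by (simp add: power_mult[symmetric] power2_eq_square ac_simps)
    finally have xc: "?x ^ c = \<eta> ^ p" by (simp add: \<eta>pp xp)
    have "\<tau> (Suc i) ^ c = ?x * ?x ^ c" by (simp only: \<tau>_Suc power_mult_distrib Suc)
    then show ?case by (simp add: xc)
  qed (simp add: \<tau>_def \<eta>_def)
  have y_vt: "y k i = vt k (Suc i) / (d k * vt k i)" for k i
    by (simp only: y_def orbit_system_def vt_def)
  have y_g: "\<rho> g (y k i) = (\<eta> * (\<eta> ^ p) ^ i) ^ k * y k i" if "k < N" for k i
  proof -
    have "\<rho> g (y k i) = \<tau> (Suc i) ^ k * vt k (Suc i) / (d k * (\<tau> i ^ k * vt k i))"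
      by (simp only: y_vt rho_divide[OF gG] rho_mult[OF gG] rho_K[OF gG d(1)[OF that]] vt_g)
    also have "\<dots> = (\<tau> i ^ c) ^ k * y k i"
      using \<tau>0[of i] by (simp add: y_vt \<tau>_Suc power_mult_distrib)
    finally show ?thesis by (simp only: \<tau>_c)
  qed

  \<comment> \<open>\<open>v 0\<close> is fixed by \<open>H\<close>, in particular by
    \<open>t [^] m\<close>, so its \<open>t\<close>-orbit has period \<open>m\<close> as it
    stands.\<close>
  define x where "x i = vt 0 i" for i
  have x_g: "\<rho> g (x i) = x i" for i using vt_g[of 0 i] by (simp add: x_def)
  have x_t: "\<rho> t (x i) = x (Suc i)" for i by (simp only: x_def vt_def rho_pow_Suc[OF t])
  have x_per: "x (i + m) = x i" for i
  proof -
    have "x (i + m) = \<rho> (t [^] i) (\<rho> (t [^] m) (v 0))"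
      using t t_power by (simp add: x_def vt_def rho_comp[symmetric] nat_pow_mult)
    moreover have "\<rho> (t [^] m) (v 0) = v 0"
      using fix_H[OF _ t_pow] v_g[of 0] by simp
    ultimately show ?thesis by (simp add: x_def vt_def)
  qed
  \<comment> \<open>Partial sums of the orbit over the residue classes modulo \<open>p\<close>;
    \<open>t\<close> permutes them with period \<open>p\<close>.\<close>
  define a where "a i = (\<Sum>k<p. x (i + p * k))" for i
  have a_g: "\<rho> g (a i) = a i" for i by (simp add: a_def rho_sum[OF gG] x_g)
  have a_t: "\<rho> t (a i) = a (Suc i)" for i by (simp add: a_def rho_sum[OF t] x_t)
  have a_per: "a (i + p) = a i" for i
  proof -
    have "a (i + p) = (\<Sum>k<p. x (i + p * Suc k))" by (simp add: a_def algebra_simps)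
    also have "\<dots> = a i"
      unfolding a_def using x_per[of i] by (intro sum_lessThan_shift_cyclic) (simp add: m power2_eq_square)
    finally show ?thesis .
  qed
  define u where "u s = (\<Sum>i<m. (\<theta> ^ s) ^ i * x i)" for s
  have u_g: "\<rho> g (u s) = u s" for s
    by (simp only: u_def rho_sum[OF gG] rho_mult[OF gG] rho_K[OF gG powK(2)] x_g)
  have u_t: "\<exists>c\<in>K. \<rho> t (u s) = c * u s" for s
  proof -
    have "\<rho> t (u s) = (\<Sum>i<m. (\<theta> ^ s) ^ i * x (Suc i))"
      by (simp only: u_def rho_sum[OF t] rho_mult[OF t] rho_K[OF t powK(2)] x_t)
    then have "\<theta> ^ s * \<rho> t (u s) = (\<Sum>i<m. (\<theta> ^ s) ^ Suc i * x (Suc i))"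
      by (simp only: sum_distrib_left power_Suc mult.assoc)
    also have "\<dots> = u s"
      unfolding u_def
    proof (rule sum_lessThan_shift_cyclic)
      have "(\<theta> ^ s) ^ m = 1" using primitive_root_power_eq_1[OF \<theta>, of "s * m"] by (simp add: power_mult)
      then show "(\<theta> ^ s) ^ m * x m = (\<theta> ^ s) ^ 0 * x 0" using x_per[of 0] by simp
    qed
    finally have "\<rho> t (u s) = inverse (\<theta> ^ s) * u s" using \<theta>0 by (simp add: field_simps)
    moreover have "inverse (\<theta> ^ s) \<in> K" using \<theta>K by (intro subfield_closed[OF K])
    ultimately show ?thesis by blast
  qed
  let ?M = "{s \<in> {..<m}. \<not> p dvd s}"
  \<comment> \<open>The Fourier coefficients at multiples of \<open>p\<close> are combinations of
    the partial sums \<open>a i\<close>. So \<open>p\<close> partial sums and the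
    \<open>m - p\<close> remaining coefficients replace the \<open>m\<close> elements of the
    orbit.\<close>
  have x_recover: "x i \<in> F"
    if F: "is_subfield F" "K \<subseteq> F" and aF: "\<And>i. i < p \<Longrightarrow> a i \<in> F" and uF: "\<And>s. s \<in> ?M \<Longrightarrow> u s \<in> F" and i: "i < m" for F i
  proof -
    have powF: "(\<theta> ^ s) ^ j \<in> F" for s j using powK(2) F(2) by blast
    have us: "u s \<in> F" if s: "s < m" for s
    proof (cases "p dvd s")
      case True
      then obtain s' where s': "s = p * s'" by blast
      have per: "(\<theta> ^ s) ^ (i + p * k) = (\<theta> ^ s) ^ i" for i k
      proof -
        have "(\<theta> ^ s) ^ (p * k) = (\<theta> ^ m) ^ (s' * k)"
          by (simp add: s' m power_mult[symmetric] power2_eq_square ac_simps)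
        also have "\<dots> = 1" using \<theta> by (simp add: primitive_root_of_unity_def)
        finally show ?thesis by (simp add: power_add)
      qed
      have "u s = (\<Sum>k<p. \<Sum>i<p. (\<theta> ^ s) ^ (i + p * k) * x (i + p * k))"
        unfolding u_def m power2_eq_square by (rule sum_lessThan_mult)
      also have "\<dots> = (\<Sum>i<p. (\<theta> ^ s) ^ i * a i)"
        unfolding per by (subst sum.swap) (simp add: a_def sum_distrib_left)
      also have "\<dots> \<in> F" using powF aF by (intro subfield_closed(8)[OF F(1)] subfield_closed(5)[OF F(1)]) auto
      finally show ?thesis .
    qed (use uF s in simp)
    have "of_nat m * x i = (\<Sum>s<m. (\<theta> ^ s) ^ (m - i) * u s)"
      unfolding u_def by (rule fourier_inversion[OF \<theta> i])
    also have "\<dots> \<in> F" using powF us by (intro subfield_closed(8)[OF F(1)] subfield_closed(5)[OF F(1)]) auto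
    finally have "of_nat m * x i / of_nat m \<in> F"
      by (rule subfield_closed(12)[OF F(1) _ subfield_closed(10)[OF F(1)]])
    then show ?thesis using m0 by simp
  qed
  have a_L: "a i \<in> L" for i unfolding a_def x_def using v_in_L by (intro subfield_closed(8)[OF is_subfield_L])
  have u_L: "u s \<in> L" for s unfolding u_def x_def using v_in_L powK(2) K_subset_L
    by (intro subfield_closed(8)[OF is_subfield_L] subfield_closed(5)[OF is_subfield_L]) auto
  have cM: "card ?M = m - p" unfolding m by (rule card_non_multiples[OF p0])
  \<comment> \<open>After this replacement the generators of \<open>L\<close> still number at most
    \<open>N * m\<close>, so none of them is zero.\<close>
  have a_nz: "a i \<noteq> 0" for i
  proof -
    let ?B1 = "(\<lambda>(k, i). vt k i) ` ({1..<N} \<times> {..<m})"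
    let ?B = "?B1 \<union> a ` {..<p} \<union> u ` ?M"
    have "L \<subseteq> adjoin K ?B"
    proof (rule L_subset_orbits[OF is_subfield_adjoin adjoin_base var_v])
      fix w i assume w: "w \<in> v ` {..<N}" and i: "i < m"
      then obtain k where k: "k < N" "w = v k" by blast
      show "\<rho> (t [^] i) w \<in> adjoin K ?B"
      proof (cases "k = 0")
        case True
        have "x i \<in> adjoin K ?B"
        proof (rule x_recover[OF is_subfield_adjoin adjoin_base _ _ i])
          show "a j \<in> adjoin K ?B" if "j < p" for j by (rule subsetD[OF adjoin_gens]) (use that in auto)
          show "u s \<in> adjoin K ?B" if "s \<in> ?M" for s by (rule subsetD[OF adjoin_gens]) (use that in blast)
        qed
        then show ?thesis using True k by (simp add: x_def vt_def)
      next
        case False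
        then have "\<rho> (t [^] i) w \<in> ?B1" using k i by (auto simp: vt_def image_iff)
        then show ?thesis by (intro subsetD[OF adjoin_gens] UnI1)
      qed
    qed
    moreover have "card ?B \<le> Coset.order G"
    proof -
      have c1: "card ?B1 \<le> (N - 1) * m"
        using card_image_le[of "{1..<N} \<times> {..<m}" "\<lambda>(k, i). vt k i"] by (simp add: card_cartesian_product)
      have c2: "card (a ` {..<p}) \<le> p" using card_image_le[of "{..<p}" a] by simp
      have c3: "card (u ` ?M) \<le> m - p" using card_image_le[of ?M u] cM by simp
      have "card ?B \<le> card ?B1 + card (a ` {..<p}) + card (u ` ?M)"
        by (meson card_Un_le add_le_mono1 order_trans)
      also have "\<dots> \<le> (N - 1) * m + p + (m - p)" using c1 c2 c3 by linarith
      also have "\<dots> = N * m" using mge N0(2) by (cases N) auto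
      finally show ?thesis using card_H g(3) by (simp add: N_def)
    qed
    ultimately have "0 \<notin> ?B" by (intro nonzero_if_few_generators) auto
    moreover have "a 0 \<in> ?B" using p0 by blast
    ultimately have "a 0 \<noteq> 0" by metis
    then show "a i \<noteq> 0" by (induction i) (use rho_eq_0[OF t] a_t in metis)+
  qed
  \<comment> \<open>The product telescopes to \<open>a p / a 0 = 1\<close>, so these quotients form
    a system without a correcting constant.\<close>
  define f0 where "f0 i = a (Suc i) / a i" for i
  have f0sys: "cyclic_system p t f0"
    unfolding cyclic_system_def
  proof (intro conjI allI)
    show "f0 (i + p) = f0 i" for i using a_per[of i] a_per[of "Suc i"] by (simp add: f0_def)
    show "\<rho> t (f0 i) = f0 (Suc i)" for i by (simp add: f0_def rho_divide[OF t] a_t)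
    have "(\<Prod>i<p. f0 i) = a p / a 0" unfolding f0_def using a_nz by (intro prod_lessThan_telescope)
    then show "(\<Prod>i<p. f0 i) = 1" using a_per[of 0] a_nz by simp
  qed
  have f0_g: "\<rho> g (f0 i) = f0 i" for i by (simp add: f0_def rho_divide[OF gG] a_g)
  have a_prod: "a i = a 0 * (\<Prod>k<i. f0 k)" for i
    by (induction i) (use a_nz in \<open>simp_all add: f0_def\<close>)

  define z where "z k = (if k = 0 then f0 else y k)" for k
  let ?ms = "\<lambda>k::nat. if k = 0 then p else p\<^sup>2"
  have zsys: "cyclic_system (?ms k) t (z k)" if "k < N" for k
    using ysys[OF that] f0sys by (simp add: z_def m)
  have "z 0 i = f0 i" for i by (simp add: z_def)
  have z_g0: "\<rho> g (z 0 i) = z 0 i" for i by (simp add: z_def f0_g)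
  have z_g1: "\<rho> g (z k i) = (\<eta> * (\<eta> ^ p) ^ i) ^ k * z k i" if "k < N" "1 \<le> k" for k i
    using y_g[OF that(1)] that(2) by (simp add: z_def)
  have z_eig: "\<exists>c\<in>K. \<rho> h (z k i) = c * z k i" if "h \<in> H" "k < N" for h k i
  proof (cases "k = 0")
    case True
    then show ?thesis using fix_H[OF z_g0 that(1)] subfield_closed(2)[OF K] by (intro bexI[of _ 1]) auto
  next
    case False
    then show ?thesis
      using orbit_system_eigen[OF v_nz[OF that(2)] eig d(1,2,3)[OF that(2)] that(1)] by (simp add: z_def y_def)
  qed
  let ?E = "system_field N z"
  have stE: "stable ?E" by (rule stable_system_field[OF zsys z_eig])
  obtain z' where z': "\<forall>k<N. cyclic_system (?ms k) t (z' k)" "\<forall>k<N. \<forall>i. \<rho> g (z' k i) = z' k i"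
    "system_field N z' \<subseteq> ?E" "\<forall>x\<in>?E. \<rho> g x = x \<longrightarrow> x \<in> system_field N z'"
    using phi8_systems_invariants[where z = z and r = N, OF p t gG N2 zsys \<eta> \<eta>K z_g0 z_g1] by blast
  have "\<exists>U. finite U \<and> card U \<le> (\<Sum>k<N. ?ms k - 1) \<and> system_field N z' = adjoin K U \<and>
    (\<forall>u\<in>U. \<forall>g\<in>carrier G. \<exists>c\<in>K. \<rho> g u = c * u)"
  proof (rule system_field_linearize)
    show "\<rho> h (z' k i) = z' k i" if "h \<in> H" "k < N" for h k i using z'(2) that fix_H by blast
    have "\<theta> ^ p \<in> K" using \<theta>K by (intro subfield_closed[OF K])
    then show "\<exists>\<omega>\<in>K. primitive_root_of_unity (?ms k) \<omega>" for k using \<theta> \<theta>p \<theta>K by (auto simp: m)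
  qed (use z' p0 m0 p(3) m in auto)
  then obtain U where U: "finite U" "card U \<le> (\<Sum>k<N. ?ms k - 1)" "system_field N z' = adjoin K U"
    "\<forall>u\<in>U. \<forall>g\<in>carrier G. \<exists>c\<in>K. \<rho> g u = c * u" by auto
  \<comment> \<open>Over the field of the systems, \<open>L\<close> is generated by one partial sum,
    the eigenvectors \<open>v k\<close> with \<open>k \<noteq> 0\<close>, and the Fourier
    coefficients at indices prime to \<open>p\<close>.\<close>
  define S where "S = insert (a 0) (v ` {1..<N} \<union> u ` ?M)"
  have finS: "finite S" by (simp add: S_def)
  have cardS: "card S \<le> 1 + (N - 1) + (m - p)"
  proof -
    have "card (v ` {1..<N}) \<le> N - 1" using card_image_le[of "{1..<N}" v] by simp
    moreover have "card (u ` ?M) \<le> m - p" using card_image_le[of ?M u] cM by simp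
    ultimately have "card (v ` {1..<N} \<union> u ` ?M) \<le> (N - 1) + (m - p)"
      using card_Un_le[of "v ` {1..<N}" "u ` ?M"] by linarith
    then show ?thesis unfolding S_def by (metis (no_types, lifting) Suc_eq_plus1 Suc_le_mono add.assoc card_insert_le_m1
      card.infinite card_insert_if finite_insert le_Suc_eq plus_1_eq_Suc)
  qed
  have cardU: "(\<Sum>k<N. ?ms k - 1) = (p - 1) + (N - 1) * (m - 1)"
  proof -
    obtain n where n: "N = Suc n" using N0(2) by (cases N) auto
    show ?thesis unfolding n sum.lessThan_Suc_shift by (simp add: m)
  qed
  have fE: "f0 i \<in> ?E" for i using system_field_mem[of 0 N z i] N0(2) by (simp add: z_def)
  have yE: "orbit_system (d k) (v k) i \<in> ?E" if "k < N" "k \<noteq> 0" for k i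
    using system_field_mem[OF that(1), of z i] that(2) by (simp add: z_def y_def)
  show ?thesis
  proof (rule few_generators_if_reduced_set[OF is_subfield_system_field stE system_field_base _ finS _ U(1)])
    show "L = adjoin ?E S"
    proof
      let ?F = "adjoin ?E S"
      have EF: "?E \<subseteq> ?F" by (rule adjoin_base)
      have KF: "K \<subseteq> ?F" using EF system_field_base by blast
      have SF: "S \<subseteq> ?F" by (rule adjoin_gens)
      show "L \<subseteq> ?F"
      proof (rule L_subset_orbits[OF is_subfield_adjoin KF var_v])
        fix w i assume "w \<in> v ` {..<N}" and i: "i < m"
        then obtain k where k: "k < N" "w = v k" by blast
        show "\<rho> (t [^] i) w \<in> ?F"
        proof (cases "k = 0")
          case True
          have "x i \<in> ?F"
          proof (rule x_recover[OF is_subfield_adjoin KF _ _ i])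
            show "a j \<in> ?F" for j
            proof -
              have "a 0 \<in> ?F" using SF by (auto simp: S_def)
              then show ?thesis unfolding a_prod[of j] using fE EF
                by (intro adjoin_closed(5) adjoin_closed(9)) auto
            qed
            show "u s \<in> ?F" if "s \<in> ?M" for s using SF that unfolding S_def by blast
          qed
          then show ?thesis using True k by (simp add: x_def vt_def)
        next
          case False
          have "v k \<in> ?F" using SF False k(1) by (auto simp: S_def)
          then show ?thesis unfolding k(2)
            using orbit_in[OF v_nz[OF k(1)] eig d(1,2,3)[OF k(1)] is_subfield_adjoin KF] yE[OF k(1) False] EF by blast
        qed
      qed
      have "z k i \<in> L" if "k < N" for k i
      proof (cases "k = 0")
        case True
        then show ?thesis unfolding z_def f0_def using a_L by (auto intro: subfield_closed(12)[OF is_subfield_L])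
      next
        case False
        have "vt k (Suc i) / (d k * vt k i) \<in> L"
          by (intro subfield_closed(12)[OF is_subfield_L] subfield_closed(5)[OF is_subfield_L] v_in_L
              subsetD[OF K_subset_L] d(1)[OF that])
        then show ?thesis using False by (simp only: z_def y_vt if_False)
      qed
      then have "?E \<subseteq> L" by (intro system_field_least is_subfield_L K_subset_L)
      moreover have "v k \<in> L" for k using v_in_L[of k 0] by (simp add: vt_def rho_one)
      then have "S \<subseteq> L" using a_L u_L by (auto simp: S_def)
      ultimately show "?F \<subseteq> L" by (intro adjoin_least is_subfield_L)
    qed
  next
    fix w h assume w: "w \<in> S" and h: "h \<in> carrier G"
    consider "w = a 0" | k where "w = v k" "k < N" "k \<noteq> 0" | s where "w = u s" using w by (auto simp: S_def)
    then show "\<exists>a\<in>?E. \<rho> h w = a * w"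
    proof cases
      case 1
      obtain i :: nat and h' where h': "h' \<in> H" "h = t [^] i \<otimes> h'" using cover[OF h] by blast
      have "\<rho> (t [^] i) (a 0) = a i"
        by (induction i) (simp_all only: rho_pow_Suc[OF t] nat_pow_0 rho_one a_t)
      then have "\<rho> h w = (\<Prod>k<i. f0 k) * w"
        using h' t_power[of i] H_carrier[OF h'(1)] fix_H[OF a_g h'(1)] 1 a_prod[of i]
        by (simp add: rho_comp mult.commute)
      moreover have "(\<Prod>k<i. f0 k) \<in> ?E" using fE by (intro subfield_closed(9)[OF is_subfield_system_field])
      ultimately show ?thesis by blast
    next
      case 2
      show ?thesis unfolding 2(1)
        by (rule orbit_act[OF v_nz[OF 2(2)] eig d(1,2,3)[OF 2(2)] is_subfield_system_field system_field_base yE[OF 2(2,3)] h])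
    next
      case 3
      have "\<exists>c\<in>K. \<rho> h (u s) = c * u s" by (rule scalar_action[OF fix_H[OF u_g] u_t h])
      then show ?thesis using 3 system_field_base by blast
    qed
  next
    show "adjoin K U \<subseteq> ?E" using U(3) z'(3) by simp
    show "fixed_by (carrier G) ?E \<subseteq> adjoin K U"
      using z'(4) U(3) gG by (auto simp: fixed_by_def)
    show "\<exists>c\<in>K. \<rho> g u = c * u" if "u \<in> U" "g \<in> carrier G" for u g using U(4) that by blast
    have "card U + card S \<le> (p - 1) + (N - 1) * (m - 1) + (1 + (N - 1) + (m - p))"
      using U(2) cardU cardS by linarith
    \<comment> \<open>The invariant orbit accounts for \<open>(p - 1) + 1 + (m - p) = m\<close>
      generators, and each of the other \<open>N - 1\<close> eigenvectors for
      \<open>(m - 1) + 1\<close>.\<close>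
    also have "\<dots> = N * m"
    proof -
      obtain n where n: "N = Suc n" using N0(2) by (cases N) auto
      obtain m' where m': "m = Suc m'" using m_pos by (cases m) auto
      show ?thesis using mge p0 by (simp add: n m' algebra_simps)
    qed
    finally show "card U + card S \<le> Coset.order G" using card_H g(3) by (simp add: N_def)
  qed
qed

end

section \<open>Abelian-by-cyclic groups\<close>

text \<open>For prime \<open>p\<close> the quotient by \<open>A\<close> is cyclic of order
  \<open>1\<close> or \<open>p\<close>. Admitting the trivial quotient lets the property pass
  through isoclinism without keeping track of orders.\<close>

definition abelian_by_cyclic :: "('a, 'b) monoid_scheme \<Rightarrow> nat \<Rightarrow> bool" where
  "abelian_by_cyclic G p \<longleftrightarrow> (\<exists>A t. subgroup A G \<and> (\<forall>x\<in>A. \<forall>y\<in>A. x \<otimes>\<^bsub>G\<^esub> y = y \<otimes>\<^bsub>G\<^esub> x) \<and>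
     (\<forall>g\<in>carrier G. \<forall>x\<in>A. g \<otimes>\<^bsub>G\<^esub> x \<otimes>\<^bsub>G\<^esub> inv\<^bsub>G\<^esub> g \<in> A) \<and> t \<in> carrier G \<and> t [^]\<^bsub>G\<^esub> p \<in> A \<and>
     (\<forall>g\<in>carrier G. \<exists>i::nat. \<exists>x\<in>A. g = t [^]\<^bsub>G\<^esub> i \<otimes>\<^bsub>G\<^esub> x))"

context group
begin

lemma subgroup_centralizer:
  assumes x: "x \<in> carrier G" shows "subgroup {g \<in> carrier G. g \<otimes> x = x \<otimes> g} G"
proof (rule subgroupI)
  fix a assume "a \<in> {g \<in> carrier G. g \<otimes> x = x \<otimes> g}"
  then have a: "a \<in> carrier G" "a \<otimes> x = x \<otimes> a" by auto
  have "inv a \<otimes> x = inv a \<otimes> (x \<otimes> a) \<otimes> inv a" using a x by (simp add: m_assoc)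
  also have "\<dots> = inv a \<otimes> (a \<otimes> x) \<otimes> inv a" by (simp only: a(2))
  also have "\<dots> = x \<otimes> inv a" using a(1) x by (simp add: m_assoc[symmetric])
  finally show "inv a \<in> {g \<in> carrier G. g \<otimes> x = x \<otimes> g}" using a by simp
next
  fix a b assume "a \<in> {g \<in> carrier G. g \<otimes> x = x \<otimes> g}" "b \<in> {g \<in> carrier G. g \<otimes> x = x \<otimes> g}"
  then have ab: "a \<in> carrier G" "a \<otimes> x = x \<otimes> a" "b \<in> carrier G" "b \<otimes> x = x \<otimes> b" by auto
  have "a \<otimes> b \<otimes> x = a \<otimes> x \<otimes> b" using ab(1,3,4) x by (simp add: m_assoc)
  also have "\<dots> = x \<otimes> (a \<otimes> b)" unfolding ab(2) using ab(1,3) x by (simp add: m_assoc)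
  finally show "a \<otimes> b \<in> {g \<in> carrier G. g \<otimes> x = x \<otimes> g}" using ab by simp
qed (use x in auto)

text \<open>Centralizers are subgroups; this is applied to the centralizer of each generator and
  then to that of \<open>g\<close>.\<close>

lemma generate_commute:
  assumes S: "S \<subseteq> carrier G" and c: "\<And>x y. x \<in> S \<Longrightarrow> y \<in> S \<Longrightarrow> x \<otimes> y = y \<otimes> x"
    and gh: "g \<in> generate G S" "h \<in> generate G S"
  shows "g \<otimes> h = h \<otimes> g"
proof -
  have 1: "g \<otimes> x = x \<otimes> g" if "x \<in> S" for x
  proof -
    have "generate G S \<subseteq> {g \<in> carrier G. g \<otimes> x = x \<otimes> g}"
      using S c that by (intro generate_subgroup_incl subgroup_centralizer) auto
    then show ?thesis using gh(1) by blast
  qed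
  have gG: "g \<in> carrier G" using generate_in_carrier[OF S gh(1)] .
  have "S \<subseteq> {h \<in> carrier G. h \<otimes> g = g \<otimes> h}" using 1 S by auto
  then have "generate G S \<subseteq> {h \<in> carrier G. h \<otimes> g = g \<otimes> h}"
    by (rule generate_subgroup_incl[OF _ subgroup_centralizer[OF gG]])
  then show ?thesis using gh(2) by auto
qed

lemma subgroup_conj_preimage:
  assumes B: "subgroup B G" and a: "a \<in> carrier G"
  shows "subgroup {x \<in> carrier G. inv a \<otimes> x \<otimes> a \<in> B} G"
proof (rule subgroupI)
  show "{x \<in> carrier G. inv a \<otimes> x \<otimes> a \<in> B} \<noteq> {}" using subgroup.one_closed[OF B] a by (auto intro!: exI[of _ \<one>])
  fix x assume x: "x \<in> {x \<in> carrier G. inv a \<otimes> x \<otimes> a \<in> B}"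
  then have "inv (inv a \<otimes> x \<otimes> a) \<in> B" using subgroup.m_inv_closed[OF B] by auto
  then show "inv x \<in> {x \<in> carrier G. inv a \<otimes> x \<otimes> a \<in> B}" using x a by (simp add: inv_mult_group m_assoc)
  fix y assume y: "y \<in> {x \<in> carrier G. inv a \<otimes> x \<otimes> a \<in> B}"
  have "inv a \<otimes> (x \<otimes> y) \<otimes> a = inv a \<otimes> x \<otimes> (a \<otimes> inv a) \<otimes> y \<otimes> a" using x y a by (simp add: m_assoc)
  also have "\<dots> = (inv a \<otimes> x \<otimes> a) \<otimes> (inv a \<otimes> y \<otimes> a)" using x y a by (simp only: m_assoc m_closed inv_closed mem_Collect_eq)
  finally show "x \<otimes> y \<in> {x \<in> carrier G. inv a \<otimes> x \<otimes> a \<in> B}"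
    using x y subgroup.m_closed[OF B] by auto
qed auto

text \<open>\<open>B\<close> is only assumed to be mapped into itself by conjugation with
  \<open>a\<close>. As \<open>a\<close> has finite order, its inverse is a natural power of it,
  which yields closure under inverses and the normality of \<open>B\<close>.\<close>

lemma cyclic_cover:
  assumes B: "subgroup B G" and a: "a \<in> carrier G" "0 < (n::nat)" "a [^] n = \<one>"
    and cl: "\<And>b. b \<in> B \<Longrightarrow> inv a \<otimes> b \<otimes> a \<in> B" and gen: "carrier G \<subseteq> generate G (B \<union> {a})"
  shows "\<And>g. g \<in> carrier G \<Longrightarrow> \<exists>i::nat. \<exists>b\<in>B. g = a [^] i \<otimes> b"
    and "\<And>g b. g \<in> carrier G \<Longrightarrow> b \<in> B \<Longrightarrow> g \<otimes> b \<otimes> inv g \<in> B"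
proof -
  have BG: "b \<in> carrier G" if "b \<in> B" for b using that B by (auto dest: subgroup.subset)
  have pG: "a [^] i \<in> carrier G" for i :: nat using a by simp
  have cli: "inv (a [^] i) \<otimes> b \<otimes> a [^] i \<in> B" if b: "b \<in> B" for b and i :: nat
  proof (induction i)
    case (Suc i)
    have "inv (a [^] Suc i) \<otimes> b \<otimes> a [^] Suc i = inv a \<otimes> (inv (a [^] i) \<otimes> b \<otimes> a [^] i) \<otimes> a"
      using a BG[OF b] by (simp add: inv_mult_group m_assoc)
    then show ?case using cl[OF Suc] by simp
  qed (use b BG in simp)
  have inva: "inv (a [^] i) = a [^] ((n - 1) * i)" for i :: nat
  proof -
    have "a [^] ((n - 1) * i) \<otimes> a [^] i = a [^] ((n - 1) * i + i)" using a by (simp add: nat_pow_mult)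
    also have "(n - 1) * i + i = n * i" using a(2) by (cases n) auto
    also have "a [^] (n * i) = \<one>" using a by (simp add: nat_pow_pow[symmetric])
    finally show ?thesis by (rule inv_equality) (use a in auto)
  qed
  have swap: "b \<otimes> a [^] i = a [^] i \<otimes> (inv (a [^] i) \<otimes> b \<otimes> a [^] i)" if "b \<in> B" for b and i :: nat
    using BG[OF that] pG[of i] by (simp add: m_assoc[symmetric])
  have "subgroup {g \<in> carrier G. \<exists>i::nat. \<exists>b\<in>B. g = a [^] i \<otimes> b} G" (is "subgroup ?T G")
  proof (rule subgroupI)
    show "?T \<noteq> {}" using subgroup.one_closed[OF B] a by (auto intro!: exI[of _ \<one>] exI[of _ "0::nat"] bexI[of _ \<one>])
    fix x assume x: "x \<in> ?T"
    then obtain i :: nat and b where b: "b \<in> B" "x = a [^] i \<otimes> b" by auto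
    let ?k = "(n - 1) * i"
    have ib: "inv b \<in> B" using subgroup.m_inv_closed[OF B b(1)] .
    have "inv x = inv b \<otimes> a [^] ?k" using b BG[OF b(1)] pG[of i] inva[of i] by (simp add: inv_mult_group)
    also have "\<dots> = a [^] ?k \<otimes> (inv (a [^] ?k) \<otimes> inv b \<otimes> a [^] ?k)" by (rule swap[OF ib])
    finally show "inv x \<in> ?T" using x cli[OF ib, of ?k] by blast
    fix y assume y: "y \<in> ?T"
    then obtain j :: nat and c where c: "c \<in> B" "y = a [^] j \<otimes> c" by auto
    have "x \<otimes> y = a [^] i \<otimes> (b \<otimes> a [^] j) \<otimes> c"
      using b c BG[OF b(1)] BG[OF c(1)] pG by (simp add: m_assoc)
    also have "\<dots> = a [^] i \<otimes> a [^] j \<otimes> ((inv (a [^] j) \<otimes> b \<otimes> a [^] j) \<otimes> c)"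
      unfolding swap[OF b(1)] using BG[OF cli[OF b(1), of j]] BG[OF c(1)] pG by (simp add: m_assoc)
    also have "\<dots> = a [^] (i + j) \<otimes> ((inv (a [^] j) \<otimes> b \<otimes> a [^] j) \<otimes> c)" using a by (simp add: nat_pow_mult)
    finally have "x \<otimes> y = a [^] (i + j) \<otimes> ((inv (a [^] j) \<otimes> b \<otimes> a [^] j) \<otimes> c)" .
    moreover have "(inv (a [^] j) \<otimes> b \<otimes> a [^] j) \<otimes> c \<in> B" using subgroup.m_closed[OF B cli[OF b(1)] c(1)] .
    ultimately show "x \<otimes> y \<in> ?T" using x y by blast
  qed auto
  moreover have "B \<union> {a} \<subseteq> ?T"
  proof -
    have "b \<in> ?T" if "b \<in> B" for b using that BG by (auto intro!: exI[of _ "0::nat"] bexI[of _ b])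
    moreover have "a \<in> ?T" using a subgroup.one_closed[OF B] by (auto intro!: exI[of _ "1::nat"] bexI[of _ \<one>])
    ultimately show ?thesis by blast
  qed
  ultimately have "generate G (B \<union> {a}) \<subseteq> ?T" by (rule generate_subgroup_incl[rotated])
  then show cov: "\<exists>i::nat. \<exists>b\<in>B. g = a [^] i \<otimes> b" if "g \<in> carrier G" for g using gen that by blast
  fix g b assume g: "g \<in> carrier G" and b: "b \<in> B"
  obtain i :: nat and c where c: "c \<in> B" "g = a [^] i \<otimes> c" using cov[OF g] by blast
  have cb: "c \<otimes> b \<otimes> inv c \<in> B" using subgroup.m_closed[OF B] subgroup.m_inv_closed[OF B] b c(1) by blast
  have "inv (a [^] ((n - 1) * i)) = a [^] i" using inva[of i] pG[of i] by (metis inv_inv)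
  then have "a [^] i \<otimes> (c \<otimes> b \<otimes> inv c) \<otimes> inv (a [^] i) \<in> B"
    using cli[OF cb, of "(n - 1) * i"] inva[of i] by simp
  moreover have "g \<otimes> b \<otimes> inv g = a [^] i \<otimes> (c \<otimes> b \<otimes> inv c) \<otimes> inv (a [^] i)"
    using c BG[OF c(1)] BG[OF b] pG[of i] by (simp add: inv_mult_group m_assoc)
  ultimately show "g \<otimes> b \<otimes> inv g \<in> B" by simp
qed

text \<open>A criterion on generators, in the form in which presentations supply the data.\<close>

lemma abelian_by_cyclicI:
  assumes S: "S \<subseteq> carrier G" "\<And>x y. x \<in> S \<Longrightarrow> y \<in> S \<Longrightarrow> x \<otimes> y = y \<otimes> x"
    and a: "a \<in> carrier G" "0 < (n::nat)" "a [^] n = \<one>" "a [^] p \<in> generate G S"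
    and cl: "\<And>x. x \<in> S \<Longrightarrow> inv a \<otimes> x \<otimes> a \<in> generate G S"
    and gen: "carrier G \<subseteq> generate G (S \<union> {a})"
  shows "abelian_by_cyclic G p"
proof -
  let ?B = "generate G S"
  have B: "subgroup ?B G" by (rule generate_is_subgroup[OF S(1)])
  have "?B \<subseteq> {x \<in> carrier G. inv a \<otimes> x \<otimes> a \<in> ?B}"
    using S(1) cl by (intro generate_subgroup_incl subgroup_conj_preimage B a) auto
  then have cl': "inv a \<otimes> b \<otimes> a \<in> ?B" if "b \<in> ?B" for b using that by blast
  have "S \<union> {a} \<subseteq> ?B \<union> {a}" using generate.incl[of _ S G] by blast
  then have gen': "carrier G \<subseteq> generate G (?B \<union> {a})" using gen mono_generate by blast
  show ?thesis unfolding abelian_by_cyclic_def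
    using B generate_commute[OF S] a(1,4) cyclic_cover[OF B a(1-3) cl' gen']
    by (intro exI[of _ ?B] exI[of _ a]) blast
qed

section \<open>Centre and commutators\<close>

lemma group_center_carrier: "z \<in> group_center G \<Longrightarrow> z \<in> carrier G"
  by (simp add: group_center_def)

lemma normal_group_center: "group_center G \<lhd> G"
proof -
  have "subgroup (group_center G) G"
  proof (rule subgroupI)
    show "group_center G \<noteq> {}" by (auto simp: group_center_def intro!: exI[of _ \<one>])
    fix a assume a: "a \<in> group_center G"
    show "inv a \<in> group_center G"
      unfolding group_center_def
    proof (intro CollectI conjI ballI)
      fix g assume g: "g \<in> carrier G"
      have "a \<in> {h \<in> carrier G. h \<otimes> g = g \<otimes> h}" using a g by (auto simp: group_center_def)
      then show "inv a \<otimes> g = g \<otimes> inv a"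
        using subgroup.m_inv_closed[OF subgroup_centralizer[OF g]] by blast
    qed (simp add: group_center_carrier[OF a])
    fix b assume b: "b \<in> group_center G"
    show "a \<otimes> b \<in> group_center G"
      unfolding group_center_def
    proof (intro CollectI conjI ballI)
      fix g assume g: "g \<in> carrier G"
      have "a \<in> {h \<in> carrier G. h \<otimes> g = g \<otimes> h}" "b \<in> {h \<in> carrier G. h \<otimes> g = g \<otimes> h}"
        using a b g by (auto simp: group_center_def)
      then show "a \<otimes> b \<otimes> g = g \<otimes> (a \<otimes> b)"
        using subgroup.m_closed[OF subgroup_centralizer[OF g]] by blast
    qed (simp add: group_center_carrier[OF a] group_center_carrier[OF b])
  qed (auto dest: group_center_carrier)
  moreover have "x \<otimes> h \<otimes> inv x \<in> group_center G" if "x \<in> carrier G" "h \<in> group_center G" for x h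
  proof -
    have "x \<otimes> h = h \<otimes> x" "h \<in> carrier G" using that by (auto simp: group_center_def)
    then have "x \<otimes> h \<otimes> inv x = h" using that(1) by (simp add: m_assoc)
    then show ?thesis using that(2) by simp
  qed
  ultimately show ?thesis unfolding normal_inv_iff by blast
qed

lemma commutator_eq_one_iff:
  assumes "x \<in> carrier G" "y \<in> carrier G"
  shows "commutator G x y = \<one> \<longleftrightarrow> x \<otimes> y = y \<otimes> x"
proof -
  have eq: "x \<otimes> y = y \<otimes> x \<otimes> commutator G x y"
    using assms by (simp add: commutator_def m_assoc) (simp add: m_assoc[symmetric])
  show ?thesis
  proof
    assume "commutator G x y = \<one>"
    then show "x \<otimes> y = y \<otimes> x" using eq assms by simp
  next
    assume "x \<otimes> y = y \<otimes> x"
    then have "y \<otimes> x \<otimes> commutator G x y = y \<otimes> x \<otimes> \<one>" using eq assms by simp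
    then show "commutator G x y = \<one>" using assms by (simp add: commutator_def)
  qed
qed

lemma conj_eq_commutator:
  "x \<in> carrier G \<Longrightarrow> y \<in> carrier G \<Longrightarrow> inv y \<otimes> x \<otimes> y = x \<otimes> commutator G x y"
  by (simp add: commutator_def m_assoc[symmetric])

text \<open>The derived subgroup is generated with the opposite commutator convention; inverting
  both arguments matches the two.\<close>

lemma commutator_in_derived:
  assumes "x \<in> carrier G" "y \<in> carrier G" shows "commutator G x y \<in> derived G (carrier G)"
proof -
  have "commutator G x y = inv x \<otimes> inv y \<otimes> inv (inv x) \<otimes> inv (inv y)" using assms by (simp add: commutator_def)
  also have "\<dots> \<in> derived_set G (carrier G)" using assms by (intro UN_I[of "inv x"] UN_I[of "inv y"]) auto
  finally show ?thesis unfolding derived_def by (rule generate.incl)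
qed

end

section \<open>Isoclinism as a relation\<close>

locale isoclinism = G: group G + P: group P
  for G :: "('a, 'b) monoid_scheme" (structure) and P :: "('c, 'd) monoid_scheme" +
  fixes \<theta> \<phi>
  assumes \<theta>: "\<theta> \<in> iso (G Mod group_center G) (P Mod group_center P)"
    and \<phi>: "\<phi> \<in> iso (G\<lparr>carrier := derived G (carrier G)\<rparr>) (P\<lparr>carrier := derived P (carrier P)\<rparr>)"
    and comp: "\<And>g h g' h'. g \<in> carrier G \<Longrightarrow> h \<in> carrier G \<Longrightarrow> g' \<in> carrier P \<Longrightarrow> h' \<in> carrier P \<Longrightarrow>
      \<theta> (group_center G #> g) = group_center P #>\<^bsub>P\<^esub> g' \<Longrightarrow>
      \<theta> (group_center G #> h) = group_center P #>\<^bsub>P\<^esub> h' \<Longrightarrow>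
      \<phi> (commutator G g h) = commutator P g' h'"
begin

text \<open>\<open>\<theta>\<close> on the level of representatives. It is a relation and not a map,
  because representatives modulo the centre cannot in general be chosen multiplicatively. It is
  total on both sides and compatible with the group operations.\<close>

definition rel :: "'a \<Rightarrow> 'c \<Rightarrow> bool" where
  "rel x y \<longleftrightarrow> x \<in> carrier G \<and> y \<in> carrier P \<and> \<theta> (group_center G #> x) = group_center P #>\<^bsub>P\<^esub> y"

lemma rel_carrier: "rel x y \<Longrightarrow> x \<in> carrier G" "rel x y \<Longrightarrow> y \<in> carrier P"
  by (simp_all add: rel_def)

lemma rel_left_total: "x \<in> carrier G \<Longrightarrow> \<exists>y. rel x y"
proof -
  assume x: "x \<in> carrier G"
  have "\<theta> (group_center G #> x) \<in> carrier (P Mod group_center P)"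
  proof -
    have "group_center G #> x \<in> carrier (G Mod group_center G)" using x by (auto simp: FactGroup_def RCOSETS_def)
    then show ?thesis using \<theta> unfolding iso_def hom_def by blast
  qed
  then show ?thesis using x by (auto simp: rel_def FactGroup_def RCOSETS_def)
qed

lemma rel_right_total: "y \<in> carrier P \<Longrightarrow> \<exists>x. rel x y"
proof -
  assume y: "y \<in> carrier P"
  have "group_center P #>\<^bsub>P\<^esub> y \<in> \<theta> ` carrier (G Mod group_center G)"
    using \<theta> y unfolding iso_def bij_betw_def by (auto simp: FactGroup_def RCOSETS_def)
  then show ?thesis using y by (auto simp: rel_def FactGroup_def RCOSETS_def)
qed

lemma rel_mult: "rel x y \<Longrightarrow> rel x' y' \<Longrightarrow> rel (x \<otimes> x') (y \<otimes>\<^bsub>P\<^esub> y')"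
proof -
  assume xy: "rel x y" "rel x' y'"
  interpret ZG: normal "group_center G" G by (rule G.normal_group_center)
  interpret ZP: normal "group_center P" P by (rule P.normal_group_center)
  have "\<theta> ((group_center G #> x) <#> (group_center G #> x')) =
      \<theta> (group_center G #> x) <#>\<^bsub>P\<^esub> \<theta> (group_center G #> x')"
    using \<theta> xy unfolding iso_def hom_def by (auto simp: FactGroup_def RCOSETS_def rel_def)
  then show ?thesis using xy by (simp add: rel_def ZG.rcos_sum ZP.rcos_sum)
qed

lemma phi_mult:
  "a \<in> derived G (carrier G) \<Longrightarrow> b \<in> derived G (carrier G) \<Longrightarrow> \<phi> (a \<otimes> b) = \<phi> a \<otimes>\<^bsub>P\<^esub> \<phi> b"
  using \<phi> unfolding iso_def hom_def by auto

lemma phi_inj: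
  "a \<in> derived G (carrier G) \<Longrightarrow> b \<in> derived G (carrier G) \<Longrightarrow> \<phi> a = \<phi> b \<Longrightarrow> a = b"
  using \<phi> unfolding iso_def bij_betw_def inj_on_def by auto

lemma one_in_derived: "\<one> \<in> derived G (carrier G)"
  unfolding derived_def by (rule generate.one)

lemma phi_one: "\<phi> \<one> = \<one>\<^bsub>P\<^esub>"
proof -
  have "\<phi> \<one> \<in> derived P (carrier P)" using \<phi> one_in_derived unfolding iso_def hom_def by auto
  then have "\<phi> \<one> \<in> carrier P" using P.derived_in_carrier[of "carrier P"] by blast
  moreover have "\<phi> \<one> \<otimes>\<^bsub>P\<^esub> \<phi> \<one> = \<phi> \<one>" using phi_mult[OF one_in_derived one_in_derived] by simp
  ultimately show ?thesis by (metis P.l_cancel_one)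
qed

lemma phi_pow: "a \<in> derived G (carrier G) \<Longrightarrow> \<phi> (a [^] (n::nat)) = \<phi> a [^]\<^bsub>P\<^esub> n"
proof (induction n)
  case (Suc n)
  have "a [^] n \<in> derived G (carrier G)"
    using G.subgroup_nat_pow_closed[OF G.derived_is_subgroup Suc.prems] by simp
  then show ?case using Suc phi_mult by simp
qed (simp add: phi_one)

lemma rel_commutator: "rel x y \<Longrightarrow> rel x' y' \<Longrightarrow> \<phi> (commutator G x x') = commutator P y y'"
  using comp by (simp add: rel_def)

text \<open>Commuting is triviality of the commutator, and \<open>\<phi>\<close> carries commutators
  to commutators injectively.\<close>

lemma rel_commute: "rel x y \<Longrightarrow> rel x' y' \<Longrightarrow> x \<otimes> x' = x' \<otimes> x \<longleftrightarrow> y \<otimes>\<^bsub>P\<^esub> y' = y' \<otimes>\<^bsub>P\<^esub> y"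
proof -
  assume xy: "rel x y" "rel x' y'"
  have c: "\<phi> (commutator G x x') = commutator P y y'" using rel_commutator xy by blast
  have "commutator G x x' = \<one> \<longleftrightarrow> commutator P y y' = \<one>\<^bsub>P\<^esub>"
  proof -
    have one: "\<phi> \<one> = \<one>\<^bsub>P\<^esub>" using phi_one .
    show ?thesis using c one phi_inj[of "commutator G x x'" \<one>] xy
      by (auto simp: rel_def G.commutator_in_derived one_in_derived)
  qed
  then show ?thesis using xy by (simp add: rel_def G.commutator_eq_one_iff P.commutator_eq_one_iff)
qed


text \<open>The coset of a partner of \<open>\<one>\<close> is idempotent, so the partner is
  central.\<close>

lemma rel_one: "rel \<one> \<one>\<^bsub>P\<^esub>"
proof -
  obtain y where y: "rel \<one> y" using rel_left_total by blast
  obtain x where x: "rel x \<one>\<^bsub>P\<^esub>" using rel_right_total by blast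
  from rel_mult[OF y y] y have "group_center P #>\<^bsub>P\<^esub> (y \<otimes>\<^bsub>P\<^esub> y) = group_center P #>\<^bsub>P\<^esub> y"
    by (simp add: rel_def)
  interpret ZP: normal "group_center P" P by (rule P.normal_group_center)
  have yP: "y \<in> carrier P" using y by (simp add: rel_def)
  have "y \<otimes>\<^bsub>P\<^esub> y \<in> group_center P #>\<^bsub>P\<^esub> y"
    using P.rcos_self[of "y \<otimes>\<^bsub>P\<^esub> y" "group_center P"] yP ZP.subgroup_axioms
      \<open>group_center P #>\<^bsub>P\<^esub> (y \<otimes>\<^bsub>P\<^esub> y) = group_center P #>\<^bsub>P\<^esub> y\<close> by simp
  then obtain z where "z \<in> group_center P" "y \<otimes>\<^bsub>P\<^esub> y = z \<otimes>\<^bsub>P\<^esub> y" by (auto simp: r_coset_def)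
  then have "y \<in> group_center P" using yP P.group_center_carrier by (metis P.r_cancel)
  then have "group_center P #>\<^bsub>P\<^esub> y = group_center P #>\<^bsub>P\<^esub> \<one>\<^bsub>P\<^esub>"
    using P.coset_join2[OF yP ZP.subgroup_axioms] P.coset_mult_one[OF ZP.subset] by simp
  then show ?thesis using y by (simp add: rel_def)
qed

lemma rel_inv: "rel x y \<Longrightarrow> rel (inv x) (inv\<^bsub>P\<^esub> y)"
proof -
  assume xy: "rel x y"
  have xG: "x \<in> carrier G" and yP: "y \<in> carrier P" using rel_carrier[OF xy] .
  obtain y' where y': "rel (inv x) y'" using rel_left_total[of "inv x"] xG by auto
  have y'P: "y' \<in> carrier P" using rel_carrier[OF y'] by simp
  interpret ZP: normal "group_center P" P by (rule P.normal_group_center)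
  have "rel \<one> (y' \<otimes>\<^bsub>P\<^esub> y)" using rel_mult[OF y' xy] xG by simp
  then have 1: "group_center P #>\<^bsub>P\<^esub> (y' \<otimes>\<^bsub>P\<^esub> y) = group_center P #>\<^bsub>P\<^esub> \<one>\<^bsub>P\<^esub>"
    using rel_one by (simp add: rel_def)
  have "group_center P #>\<^bsub>P\<^esub> y' = (group_center P #>\<^bsub>P\<^esub> (y' \<otimes>\<^bsub>P\<^esub> y)) #>\<^bsub>P\<^esub> inv\<^bsub>P\<^esub> y"
    using yP y'P ZP.subset by (simp add: P.coset_mult_assoc P.m_assoc)
  also have "\<dots> = group_center P #>\<^bsub>P\<^esub> inv\<^bsub>P\<^esub> y"
    unfolding 1 using yP ZP.subset by (simp add: P.coset_mult_assoc)
  finally show ?thesis using y' xG yP by (simp add: rel_def)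
qed

lemma rel_pow: "rel x y \<Longrightarrow> rel (x [^] (n::nat)) (y [^]\<^bsub>P\<^esub> n)"
  by (induction n) (auto intro: rel_one rel_mult)

lemma rel_center: "rel x y \<Longrightarrow> x \<in> group_center G \<longleftrightarrow> y \<in> group_center P"
proof -
  assume xy: "rel x y"
  have "(\<forall>g\<in>carrier G. x \<otimes> g = g \<otimes> x) \<longleftrightarrow> (\<forall>g\<in>carrier P. y \<otimes>\<^bsub>P\<^esub> g = g \<otimes>\<^bsub>P\<^esub> y)"
    using rel_commute[OF xy] rel_left_total rel_right_total rel_carrier by metis
  then show ?thesis using rel_carrier[OF xy] by (simp add: group_center_def)
qed

text \<open>The preimage of the abelian normal subgroup under \<open>rel\<close> is again abelian
  and normal, because \<open>rel\<close> reflects commuting and respects conjugation.\<close>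

lemma abelian_by_cyclic_transfer:
  assumes "abelian_by_cyclic P p" shows "abelian_by_cyclic G p"
proof -
  obtain B a where B: "subgroup B P" "\<forall>x\<in>B. \<forall>y\<in>B. x \<otimes>\<^bsub>P\<^esub> y = y \<otimes>\<^bsub>P\<^esub> x"
    "\<forall>g\<in>carrier P. \<forall>x\<in>B. g \<otimes>\<^bsub>P\<^esub> x \<otimes>\<^bsub>P\<^esub> inv\<^bsub>P\<^esub> g \<in> B" "a \<in> carrier P" "a [^]\<^bsub>P\<^esub> p \<in> B"
    "\<forall>g\<in>carrier P. \<exists>i::nat. \<exists>x\<in>B. g = a [^]\<^bsub>P\<^esub> i \<otimes>\<^bsub>P\<^esub> x"
    using assms unfolding abelian_by_cyclic_def by blast
  define A where "A = {x \<in> carrier G. \<exists>b\<in>B. rel x b}"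
  have A: "subgroup A G"
  proof (rule G.subgroupI)
    show "A \<noteq> {}" using rel_one subgroup.one_closed[OF B(1)] by (auto simp: A_def)
    fix x assume "x \<in> A"
    then obtain b where b: "b \<in> B" "rel x b" by (auto simp: A_def)
    show "inv x \<in> A" using rel_inv[OF b(2)] subgroup.m_inv_closed[OF B(1) b(1)] rel_carrier by (auto simp: A_def)
    fix y assume "y \<in> A"
    then obtain c where c: "c \<in> B" "rel y c" by (auto simp: A_def)
    show "x \<otimes> y \<in> A" using rel_mult[OF b(2) c(2)] subgroup.m_closed[OF B(1) b(1) c(1)] rel_carrier by (auto simp: A_def)
  qed (auto simp: A_def)
  have comm: "x \<otimes> y = y \<otimes> x" if "x \<in> A" "y \<in> A" for x y
    using that B(2) rel_commute by (auto simp: A_def)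
  have norm: "g \<otimes> x \<otimes> inv g \<in> A" if g: "g \<in> carrier G" and x: "x \<in> A" for g x
  proof -
    obtain h where h: "rel g h" using rel_left_total[OF g] by blast
    obtain b where b: "b \<in> B" "rel x b" using x by (auto simp: A_def)
    have "rel (g \<otimes> x \<otimes> inv g) (h \<otimes>\<^bsub>P\<^esub> b \<otimes>\<^bsub>P\<^esub> inv\<^bsub>P\<^esub> h)" by (intro rel_mult rel_inv h b)
    moreover have "h \<otimes>\<^bsub>P\<^esub> b \<otimes>\<^bsub>P\<^esub> inv\<^bsub>P\<^esub> h \<in> B" using B(3) rel_carrier[OF h] b(1) by blast
    ultimately show ?thesis using rel_carrier by (auto simp: A_def)
  qed
  obtain t where t: "rel t a" using rel_right_total[OF B(4)] by blast
  have tG: "t \<in> carrier G" using rel_carrier[OF t] by simp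
  have tp: "t [^] p \<in> A" using rel_pow[OF t, of p] B(5) tG by (auto simp: A_def)
  have cov: "\<exists>i::nat. \<exists>x\<in>A. g = t [^] i \<otimes> x" if g: "g \<in> carrier G" for g
  proof -
    obtain h where h: "rel g h" using rel_left_total[OF g] by blast
    obtain i :: nat and b where b: "b \<in> B" "h = a [^]\<^bsub>P\<^esub> i \<otimes>\<^bsub>P\<^esub> b" using B(6) rel_carrier[OF h] by blast
    have bP: "b \<in> carrier P" using b(1) B(1) by (auto dest: subgroup.subset)
    have "rel (inv (t [^] i) \<otimes> g) (inv\<^bsub>P\<^esub> (a [^]\<^bsub>P\<^esub> i) \<otimes>\<^bsub>P\<^esub> h)" by (intro rel_mult rel_inv rel_pow t h)
    moreover have "inv\<^bsub>P\<^esub> (a [^]\<^bsub>P\<^esub> i) \<otimes>\<^bsub>P\<^esub> h = b" using b(2) bP B(4) by (simp add: P.m_assoc[symmetric])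
    ultimately have "inv (t [^] i) \<otimes> g \<in> A" using b(1) rel_carrier by (auto simp: A_def)
    moreover have "g = t [^] i \<otimes> (inv (t [^] i) \<otimes> g)" using tG g by (simp add: G.m_assoc[symmetric])
    ultimately show ?thesis by blast
  qed
  show ?thesis unfolding abelian_by_cyclic_def
    using A comm norm tG tp cov by (intro exI[of _ A] exI[of _ t]) blast
qed

end

lemma isoclinic_imp_isoclinism:
  assumes "group G" "group P" "isoclinic G P"
  shows "\<exists>\<theta> \<phi>. isoclinism G P \<theta> \<phi>"
  using assms unfolding isoclinic_def isoclinism_def isoclinism_axioms_def by blast

section \<open>Presented groups\<close>

lemma words_closed:
  "[] \<in> words S" "u \<in> words S \<Longrightarrow> v \<in> words S \<Longrightarrow> u @ v \<in> words S"
  "u \<in> words S \<Longrightarrow> word_inv u \<in> words S" "x \<in> S \<Longrightarrow> letter x \<in> words S"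
  by (auto simp: words_def word_inv_def letter_def image_image case_prod_beta)

lemma words_pow: "u \<in> words S \<Longrightarrow> word_pow u n \<in> words S"
  by (fastforce simp: words_def word_pow_def)

context
  fixes S :: "'x set" and R :: "('x gword \<times> 'x gword) set"
begin

interpretation P: group "presented_group S R"
  by (rule group_presented_group)

lemma presented_one: "\<one>\<^bsub>presented_group S R\<^esub> = word_rel S R `` {[]}"
  by (simp add: presented_group_def)

lemma presented_carrier: "w \<in> words S \<Longrightarrow> word_rel S R `` {w} \<in> carrier (presented_group S R)"
  by (simp add: presented_group_def quotientI)

lemma presented_rel:
  "(u, v) \<in> R \<Longrightarrow> u \<in> words S \<Longrightarrow> v \<in> words S \<Longrightarrow> word_rel S R `` {u} = word_rel S R `` {v}"
  by (intro equiv_class_eq[OF equiv_word_rel]) (simp add: word_rel_def word_cong.rel)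

lemma presented_inv:
  assumes w: "w \<in> words S"
  shows "inv\<^bsub>presented_group S R\<^esub> (word_rel S R `` {w}) = word_rel S R `` {word_inv w}"
proof (rule P.inv_equality)
  have "word_rel S R `` {word_inv w @ w} = word_rel S R `` {[]}"
    using word_cong_inv[OF w] by (intro equiv_class_eq[OF equiv_word_rel]) (simp add: word_rel_def)
  then show "word_rel S R `` {word_inv w} \<otimes>\<^bsub>presented_group S R\<^esub> word_rel S R `` {w} = \<one>\<^bsub>presented_group S R\<^esub>"
    by (simp add: presented_group_mult words_closed w presented_one)
qed (intro presented_carrier words_closed(3) w)+

lemma presented_pow:
  assumes w: "w \<in> words S"
  shows "word_rel S R `` {word_pow w n} = (word_rel S R `` {w}) [^]\<^bsub>presented_group S R\<^esub> n"
proof (induction n)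
  case (Suc n)
  have "word_pow w (Suc n) = w @ word_pow w n" by (simp add: word_pow_def)
  then have "word_rel S R `` {word_pow w (Suc n)} =
      word_rel S R `` {w} \<otimes>\<^bsub>presented_group S R\<^esub> word_rel S R `` {word_pow w n}"
    by (simp add: presented_group_mult w words_pow)
  also have "\<dots> = (word_rel S R `` {w}) [^]\<^bsub>presented_group S R\<^esub> Suc n"
    unfolding Suc by (rule P.nat_pow_Suc2[OF presented_carrier[OF w], symmetric])
  finally show ?case .
qed (simp add: word_pow_def presented_one)

lemma presented_commutator:
  assumes "u \<in> words S" "v \<in> words S"
  shows "word_rel S R `` {word_commutator u v} =
    commutator (presented_group S R) (word_rel S R `` {u}) (word_rel S R `` {v})"
  using assms unfolding word_commutator_def commutator_def
  by (simp add: presented_inv presented_group_mult words_closed)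

lemma presented_generate:
  "carrier (presented_group S R) \<subseteq> generate (presented_group S R) ((\<lambda>x. word_rel S R `` {letter x}) ` S)"
  (is "_ \<subseteq> generate ?P ?X")
proof
  fix c assume "c \<in> carrier ?P"
  then obtain w where w: "w \<in> words S" "c = word_rel S R `` {w}"
    by (auto simp: presented_group_def quotient_def)
  have "word_rel S R `` {w} \<in> generate ?P ?X" using w(1)
  proof (induction w)
    case Nil
    show ?case using generate.one[of ?P ?X] by (simp add: presented_one)
  next
    case (Cons l w)
    obtain x b where l: "l = (x, b)" by force
    have x: "x \<in> S" and ws: "w \<in> words S" "[l] \<in> words S" using Cons.prems by (auto simp: l words_def)
    have in_X: "word_rel S R `` {letter x} \<in> ?X" using x by blast
    have "word_rel S R `` {[l]} \<in> generate ?P ?X"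
    proof (cases b)
      case True
      then show ?thesis using generate.incl[OF in_X] by (simp add: l letter_def)
    next
      case False
      then have "word_rel S R `` {[l]} = inv\<^bsub>?P\<^esub> (word_rel S R `` {letter x})"
        using presented_inv[of "letter x"] x by (simp add: words_closed) (simp add: l letter_def word_inv_def)
      then show ?thesis using generate.inv[OF in_X] by simp
    qed
    moreover have "word_rel S R `` {w} \<in> generate ?P ?X" using Cons.IH ws by blast
    ultimately have "word_rel S R `` {[l]} \<otimes>\<^bsub>?P\<^esub> word_rel S R `` {w} \<in> generate ?P ?X" by (rule generate.eng)
    then show ?case using ws by (simp add: presented_group_mult)
  qed
  then show "c \<in> generate ?P ?X" using w(2) by simp
qed

end

text \<open>In the presentations of \<open>\<Phi>\<^sub>2\<close>, \<open>\<Phi>\<^sub>3\<close>,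
  \<open>\<Phi>\<^sub>4\<close> and \<open>\<Phi>\<^sub>9\<close> every listed commutator has
  \<open>Alpha 0\<close> as second entry and a generator other than \<open>Alpha 0\<close> as value.
  The other generators therefore commute and generate a subgroup normalized by
  \<open>Alpha 0\<close>, independently of the order of the presented group.\<close>

lemma abelian_by_cyclic_commutator_presentation:
  assumes S: "Alpha 0 \<in> S" and p: "p > 0"
    and C: "\<And>x y w. ((x, y), w) \<in> C \<Longrightarrow> y = Alpha 0 \<and> x \<in> S - {Alpha 0} \<and> (\<exists>z\<in>S - {Alpha 0}. w = letter z)"
    and R: "(gpow (Alpha 0) p, []) \<in> R"
  shows "group (commutator_presentation S C R)" "abelian_by_cyclic (commutator_presentation S C R) p"
proof -
  define R' where "R' = {(gcomm x y, w) | x y w. ((x, y), w) \<in> C} \<union>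
        {(gcomm x y, []) | x y. x \<in> S \<and> y \<in> S \<and> (x, y) \<notin> fst ` C \<and> (y, x) \<notin> fst ` C} \<union> R"
  have P_eq: "commutator_presentation S C R = presented_group S R'"
    by (simp add: commutator_presentation_def R'_def)
  let ?P = "presented_group S R'"
  let ?g = "\<lambda>x. word_rel S R' `` {letter x}"
  interpret P: group ?P by (rule group_presented_group)
  have gP: "?g x \<in> carrier ?P" if "x \<in> S" for x using that by (intro presented_carrier words_closed)
  have comm: "commutator ?P (?g x) (?g y) = word_rel S R' `` {w}"
    if "(gcomm x y, w) \<in> R'" "x \<in> S" "y \<in> S" "w \<in> words S" for x y w
  proof -
    have "gcomm x y \<in> words S" using that by (simp add: gcomm_def word_commutator_def words_closed)
    then have "word_rel S R' `` {gcomm x y} = word_rel S R' `` {w}" using that by (intro presented_rel)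
    then show ?thesis using that by (simp add: gcomm_def presented_commutator words_closed)
  qed
  let ?X = "?g ` (S - {Alpha 0})"
  have "abelian_by_cyclic ?P p"
  proof (rule P.abelian_by_cyclicI[of ?X "?g (Alpha 0)" p])
    show "?X \<subseteq> carrier ?P" using gP by blast
    show "a \<otimes>\<^bsub>?P\<^esub> b = b \<otimes>\<^bsub>?P\<^esub> a" if "a \<in> ?X" "b \<in> ?X" for a b
    proof -
      obtain x y where xy: "x \<in> S - {Alpha 0}" "y \<in> S - {Alpha 0}" "a = ?g x" "b = ?g y" using \<open>a \<in> ?X\<close> \<open>b \<in> ?X\<close> by blast
      then have "(x, y) \<notin> fst ` C" "(y, x) \<notin> fst ` C" using C by fastforce+
      then have "(gcomm x y, []) \<in> R'" using xy by (auto simp: R'_def)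
      then have "commutator ?P (?g x) (?g y) = \<one>\<^bsub>?P\<^esub>"
        using comm[of x y "[]"] xy words_closed(1)[of S] by (simp add: presented_one)
      then show ?thesis using P.commutator_eq_one_iff gP xy by auto
    qed
    show "?g (Alpha 0) \<in> carrier ?P" using gP S by blast
    show "0 < p" by (rule p)
    show ap: "?g (Alpha 0) [^]\<^bsub>?P\<^esub> p = \<one>\<^bsub>?P\<^esub>"
    proof -
      have "gpow (Alpha 0) p \<in> words S" using S by (simp add: gpow_def words_pow words_closed)
      then have "word_rel S R' `` {gpow (Alpha 0) p} = word_rel S R' `` {[]}"
        using R by (intro presented_rel) (auto simp: R'_def words_closed)
      then show ?thesis using S by (simp add: gpow_def presented_pow words_closed presented_one)
    qed
    show "?g (Alpha 0) [^]\<^bsub>?P\<^esub> p \<in> generate ?P ?X" unfolding ap by (rule generate.one)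
    show "inv\<^bsub>?P\<^esub> ?g (Alpha 0) \<otimes>\<^bsub>?P\<^esub> a \<otimes>\<^bsub>?P\<^esub> ?g (Alpha 0) \<in> generate ?P ?X" if "a \<in> ?X" for a
    proof -
      obtain x where x: "x \<in> S - {Alpha 0}" "a = ?g x" using \<open>a \<in> ?X\<close> by blast
      have conj: "inv\<^bsub>?P\<^esub> ?g (Alpha 0) \<otimes>\<^bsub>?P\<^esub> a \<otimes>\<^bsub>?P\<^esub> ?g (Alpha 0) = a \<otimes>\<^bsub>?P\<^esub> commutator ?P a (?g (Alpha 0))"
        using gP x S by (intro P.conj_eq_commutator) auto
      have "commutator ?P (?g x) (?g (Alpha 0)) \<in> generate ?P ?X"
      proof (cases "(x, Alpha 0) \<in> fst ` C")
        case True
        then obtain w where w: "((x, Alpha 0), w) \<in> C" by force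
        then obtain z where z: "z \<in> S - {Alpha 0}" "w = letter z" using C by blast
        have "(gcomm x (Alpha 0), w) \<in> R'" using w by (auto simp: R'_def)
        then have "commutator ?P (?g x) (?g (Alpha 0)) = ?g z" using comm[of x "Alpha 0" "letter z"] x S z words_closed(4)[of z S] by simp
        then show ?thesis using z by (auto intro: generate.incl)
      next
        case False
        moreover have "(Alpha 0, x) \<notin> fst ` C" using C x(1) by fastforce
        ultimately have "(gcomm x (Alpha 0), []) \<in> R'" using x S by (auto simp: R'_def)
        then have "commutator ?P (?g x) (?g (Alpha 0)) = \<one>\<^bsub>?P\<^esub>"
          using comm[of x "Alpha 0" "[]"] x S words_closed(1)[of S] by (simp add: presented_one)
        then show ?thesis by (simp add: generate.one)
      qed
      moreover have "a \<in> generate ?P ?X" using \<open>a \<in> ?X\<close> by (rule generate.incl)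
      ultimately show ?thesis unfolding conj unfolding x(2) by (intro generate.eng)
    qed
    have "?X \<union> {?g (Alpha 0)} = ?g ` S" using S by auto
    then show "carrier ?P \<subseteq> generate ?P (?X \<union> {?g (Alpha 0)})" using presented_generate by simp
  qed
  then show "abelian_by_cyclic (commutator_presentation S C R) p" by (simp add: P_eq)
  show "group (commutator_presentation S C R)" unfolding P_eq by (rule group_presented_group)
qed

lemma abelian_by_cyclic_phi2: "p > 0 \<Longrightarrow> group (phi2_group p) \<and> abelian_by_cyclic (phi2_group p) p"
  unfolding phi2_group_def by (intro conjI abelian_by_cyclic_commutator_presentation) auto

lemma abelian_by_cyclic_phi3: "p > 0 \<Longrightarrow> group (phi3_group p) \<and> abelian_by_cyclic (phi3_group p) p"
  unfolding phi3_group_def by (intro conjI abelian_by_cyclic_commutator_presentation) auto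

lemma abelian_by_cyclic_phi4: "p > 0 \<Longrightarrow> group (phi4_group p) \<and> abelian_by_cyclic (phi4_group p) p"
  unfolding phi4_group_def by (intro conjI abelian_by_cyclic_commutator_presentation) auto

lemma abelian_by_cyclic_phi9: "p > 0 \<Longrightarrow> group (phi9_group p) \<and> abelian_by_cyclic (phi9_group p) p"
  unfolding phi9_group_def by (intro conjI abelian_by_cyclic_commutator_presentation) auto

text \<open>\<open>Beta 0\<close> is eliminated as the \<open>p\<close>-th power of
  \<open>Alpha 1\<close>, which leaves two generators.\<close>

lemma phi8_group_generators:
  "\<exists>a\<in>carrier (phi8_group p). \<exists>b\<in>carrier (phi8_group p).
     commutator (phi8_group p) a b = a [^]\<^bsub>phi8_group p\<^esub> p \<and> a [^]\<^bsub>phi8_group p\<^esub> (p ^ 3) = \<one>\<^bsub>phi8_group p\<^esub> \<and>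
     b [^]\<^bsub>phi8_group p\<^esub> (p\<^sup>2) = \<one>\<^bsub>phi8_group p\<^esub> \<and> carrier (phi8_group p) \<subseteq> generate (phi8_group p) {a, b}"
proof -
  define S where "S = {Alpha 1, Alpha 2, Beta 0}"
  define R where "R = {(gcomm (Alpha 1) (Alpha 2), letter (Beta 0)), (letter (Beta 0), gpow (Alpha 1) p),
      (gpow (Beta 0) (p ^ 2), []), (gpow (Alpha 2) (p ^ 2), [])}"
  have P_eq: "phi8_group p = presented_group S R" by (simp add: phi8_group_def S_def R_def)
  let ?P = "presented_group S R"
  interpret P: group ?P by (rule group_presented_group)
  let ?g = "\<lambda>x. word_rel S R `` {letter x}"
  let ?a = "?g (Alpha 1)" and ?b = "?g (Alpha 2)" and ?c = "?g (Beta 0)"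
  have S: "Alpha 1 \<in> S" "Alpha 2 \<in> S" "Beta 0 \<in> S" by (simp_all add: S_def)
  have gP: "?a \<in> carrier ?P" "?b \<in> carrier ?P" "?c \<in> carrier ?P" using S by (auto intro: presented_carrier words_closed)
  have w: "letter x \<in> words S" "gpow x n \<in> words S" "gcomm x y \<in> words S" if "x \<in> S" "y \<in> S" for x y n
    using that by (simp_all add: gpow_def gcomm_def word_commutator_def words_closed words_pow)
  have gpow: "word_rel S R `` {gpow x n} = ?g x [^]\<^bsub>?P\<^esub> n" if "x \<in> S" for x n
    using that by (simp add: gpow_def presented_pow words_closed)
  have "word_rel S R `` {gcomm (Alpha 1) (Alpha 2)} = ?c"
    by (rule presented_rel) (use w S in \<open>auto simp: R_def\<close>)
  then have ab: "commutator ?P ?a ?b = ?c" using S by (simp add: gcomm_def presented_commutator words_closed)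
  have "?c = word_rel S R `` {gpow (Alpha 1) p}" by (rule presented_rel) (use w S in \<open>auto simp: R_def\<close>)
  then have c: "?c = ?a [^]\<^bsub>?P\<^esub> p" using gpow S by simp
  have "word_rel S R `` {gpow (Beta 0) (p\<^sup>2)} = word_rel S R `` {[]}"
    by (rule presented_rel) (use w S words_closed in \<open>auto simp: R_def\<close>)
  then have cp: "?c [^]\<^bsub>?P\<^esub> (p\<^sup>2) = \<one>\<^bsub>?P\<^esub>" using gpow[OF S(3)] by (simp add: presented_one)
  have "word_rel S R `` {gpow (Alpha 2) (p\<^sup>2)} = word_rel S R `` {[]}"
    by (rule presented_rel) (use w S words_closed in \<open>auto simp: R_def\<close>)
  then have bp: "?b [^]\<^bsub>?P\<^esub> (p\<^sup>2) = \<one>\<^bsub>?P\<^esub>" using gpow[OF S(2)] by (simp add: presented_one)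
  have ap: "?a [^]\<^bsub>?P\<^esub> (p ^ 3) = \<one>\<^bsub>?P\<^esub>"
    using cp gP(1) unfolding c by (simp add: P.nat_pow_pow power2_eq_square power3_eq_cube mult.assoc)
  have "?c \<in> generate ?P {?a, ?b}"
    unfolding c by (rule P.subgroup_nat_pow_closed[OF P.generate_is_subgroup]) (use gP in \<open>auto intro: generate.incl\<close>)
  then have "?g ` S \<subseteq> generate ?P {?a, ?b}" by (auto simp: S_def intro: generate.incl)
  then have "generate ?P (?g ` S) \<subseteq> generate ?P {?a, ?b}"
    using gP by (intro P.generate_subgroup_incl P.generate_is_subgroup) auto
  then have "carrier ?P \<subseteq> generate ?P {?a, ?b}" using presented_generate by blast
  then show ?thesis unfolding P_eq using gP ab c ap bp by (intro bexI[of _ ?a] bexI[of _ ?b]) auto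
qed

section \<open>Groups isoclinic to the family \<open>\<Phi>\<^sub>8\<close>\<close>

text \<open>The binomial expansion modulo \<open>p\<^sup>2\<close>, with a cofactor because
  exponents of group elements are kept as natural numbers.\<close>

lemma one_plus_power_expansion: "\<exists>e. (1 + p) ^ k = 1 + k * p + e * p\<^sup>2" for p k :: nat
proof (induction k)
  case (Suc k)
  then obtain e where "(1 + p) ^ k = 1 + k * p + e * p\<^sup>2" by blast
  then have "(1 + p) ^ Suc k = 1 + Suc k * p + (k + e * (1 + p)) * p\<^sup>2"
    by (simp add: power2_eq_square algebra_simps)
  then show ?case by blast
qed simp

context group
begin

lemma conj_pow_power:
  assumes a: "a \<in> carrier G" and x: "x \<in> carrier G" "inv a \<otimes> x \<otimes> a = x [^] (n::nat)"
  shows "inv (a [^] (k::nat)) \<otimes> x \<otimes> a [^] k = x [^] (n ^ k)"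
proof (induction k)
  case (Suc k)
  have "inv (a [^] Suc k) \<otimes> x \<otimes> a [^] Suc k = inv a \<otimes> (inv (a [^] k) \<otimes> x \<otimes> a [^] k) \<otimes> a"
    using a x(1) by (simp add: inv_mult_group m_assoc)
  also have "\<dots> = (inv a \<otimes> x \<otimes> a) [^] (n ^ k)" unfolding Suc using conj_pow[OF a x(1)] by simp
  also have "\<dots> = x [^] (n ^ Suc k)" unfolding x(2) by (simp only: nat_pow_pow[OF x(1)] power_Suc)
  finally show ?case .
qed (use x in simp)

lemma conj_eq_iff_commute:
  assumes "x \<in> carrier G" "y \<in> carrier G"
  shows "inv y \<otimes> x \<otimes> y = x \<longleftrightarrow> x \<otimes> y = y \<otimes> x"
proof
  assume "inv y \<otimes> x \<otimes> y = x"
  then have "y \<otimes> (inv y \<otimes> x \<otimes> y) = y \<otimes> x" by simp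
  then show "x \<otimes> y = y \<otimes> x" using assms by (simp add: m_assoc[symmetric])
next
  assume "x \<otimes> y = y \<otimes> x"
  then have "inv y \<otimes> x \<otimes> y = inv y \<otimes> (y \<otimes> x)" using assms by (simp add: m_assoc)
  then show "inv y \<otimes> x \<otimes> y = x" using assms by (simp add: m_assoc[symmetric])
qed

lemma subgroup_nat_powers:
  assumes a: "a \<in> carrier G" "0 < (n::nat)" "a [^] n = \<one>"
  shows "subgroup ((\<lambda>i::nat. a [^] i) ` {..<n}) G"
proof -
  have eq: "(\<lambda>i::nat. a [^] i) ` {..<n} = range (\<lambda>i::nat. a [^] i)"
  proof -
    have "a [^] i = a [^] (i mod n)" for i :: nat
    proof -
      have "a [^] i = a [^] (n * (i div n) + i mod n)" by simp
      also have "\<dots> = (a [^] n) [^] (i div n) \<otimes> a [^] (i mod n)"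
        unfolding nat_pow_mult[OF a(1), symmetric] nat_pow_pow[OF a(1)] ..
      finally show ?thesis using a by simp
    qed
    moreover have "i mod n \<in> {..<n}" for i using a(2) by simp
    ultimately show ?thesis by blast
  qed
  show ?thesis unfolding eq
  proof (rule subgroupI)
    fix x assume "x \<in> range (\<lambda>i::nat. a [^] i)"
    then obtain i :: nat where i: "x = a [^] i" by blast
    have "a [^] ((n - 1) * i) \<otimes> a [^] i = a [^] ((n - 1) * i + i)" using a by (simp add: nat_pow_mult)
    also have "(n - 1) * i + i = n * i" using a(2) by (cases n) auto
    also have "a [^] (n * i) = \<one>" using a by (simp add: nat_pow_pow[symmetric])
    finally have "inv x = a [^] ((n - 1) * i)" unfolding i by (rule inv_equality) (use a in auto)
    then show "inv x \<in> range (\<lambda>i::nat. a [^] i)" by blast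
    fix y assume "y \<in> range (\<lambda>i::nat. a [^] i)"
    then obtain j :: nat where "y = a [^] j" by blast
    then have "x \<otimes> y = a [^] (i + j)" using i a by (simp add: nat_pow_mult)
    then show "x \<otimes> y \<in> range (\<lambda>i::nat. a [^] i)" by blast
  qed (use a in auto)
qed

text \<open>If the order of \<open>a\<close> divides \<open>p\<^sup>2\<close>, then
  \<open>b [^] p\<close> centralizes \<open>a\<close>, because \<open>(1 + p) ^ p\<close> is
  \<open>1\<close> modulo \<open>p\<^sup>2\<close>. The abelian normal subgroup is generated by
  \<open>a\<close> and \<open>b [^] p\<close>.\<close>

lemma phi8_abelian_by_cyclic:
  assumes ab: "a \<in> carrier G" "b \<in> carrier G" and comm: "commutator G a b = a [^] p"
    and p: "0 < p" "a [^] (p\<^sup>2) = \<one>" "b [^] (p\<^sup>2) = \<one>" and gen: "carrier G \<subseteq> generate G {a, b}"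
  shows "abelian_by_cyclic G p"
proof (rule abelian_by_cyclicI[of "{a, b [^] p}" b "p\<^sup>2"])
  have conj: "inv b \<otimes> a \<otimes> b = a [^] (1 + p)"
    using conj_eq_commutator[OF ab] comm ab(1) nat_pow_Suc2[OF ab(1), of p] by simp
  obtain e where e: "(1 + p) ^ p = 1 + p * p + e * p\<^sup>2" using one_plus_power_expansion by blast
  have "inv (b [^] p) \<otimes> a \<otimes> b [^] p = a [^] (1 + (p\<^sup>2) * (1 + e))"
    unfolding conj_pow_power[OF ab(2,1) conj] e by (simp add: power2_eq_square algebra_simps)
  also have "\<dots> = a \<otimes> (a [^] (p\<^sup>2)) [^] (1 + e)"
    using ab(1) nat_pow_mult[OF ab(1), of 1 "(p\<^sup>2) * (1 + e)"] by (simp only: nat_pow_pow nat_pow_eone)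
  also have "\<dots> = a" using ab(1) unfolding p(2) by simp
  finally have c: "a \<otimes> b [^] p = b [^] p \<otimes> a" using conj_eq_iff_commute[OF ab(1), of "b [^] p"] ab(2) by simp
  show "x \<otimes> y = y \<otimes> x" if "x \<in> {a, b [^] p}" "y \<in> {a, b [^] p}" for x y using that c by auto
  show "inv b \<otimes> x \<otimes> b \<in> generate G {a, b [^] p}" if "x \<in> {a, b [^] p}" for x
  proof -
    have sub: "subgroup (generate G {a, b [^] p}) G" using ab by (intro generate_is_subgroup) auto
    have "a [^] (1 + p) \<in> generate G {a, b [^] p}"
      by (rule subgroup_nat_pow_closed[OF sub]) (simp add: generate.incl)
    moreover have "b [^] p \<otimes> b = b \<otimes> b [^] p" using ab(2) nat_pow_Suc2[OF ab(2), of p] by simp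
    then have "inv b \<otimes> b [^] p \<otimes> b = b [^] p" using conj_eq_iff_commute[of "b [^] p" b] ab(2) by simp
    moreover have "b [^] p \<in> generate G {a, b [^] p}" by (simp add: generate.incl)
    ultimately show ?thesis using that conj by auto
  qed
  show "b [^] p \<in> generate G {a, b [^] p}" by (simp add: generate.incl)
  have "{a, b} \<subseteq> {a, b [^] p} \<union> {b}" by auto
  then show "carrier G \<subseteq> generate G ({a, b [^] p} \<union> {b})" using gen mono_generate by blast
qed (use ab p in auto)

lemma reduce_cyclic_cover:
  assumes H: "subgroup H G" and t: "t \<in> carrier G" "t [^] m \<in> H" "0 < (m::nat)"
    and cover: "\<exists>i::nat. \<exists>h\<in>H. g = t [^] i \<otimes> h"
  shows "\<exists>i<m. \<exists>h\<in>H. g = t [^] i \<otimes> h"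
proof -
  obtain i :: nat and h where h: "h \<in> H" "g = t [^] i \<otimes> h" using cover by blast
  have HG: "x \<in> carrier G" if "x \<in> H" for x using that H by (auto dest: subgroup.subset)
  have "t [^] i = t [^] (i mod m + m * (i div m))" by simp
  also have "\<dots> = t [^] (i mod m) \<otimes> (t [^] m) [^] (i div m)"
    unfolding nat_pow_mult[OF t(1), symmetric] nat_pow_pow[OF t(1)] ..
  finally have "g = t [^] (i mod m) \<otimes> ((t [^] m) [^] (i div m) \<otimes> h)"
    using h HG[OF h(1)] t(1) by (simp add: m_assoc)
  moreover have "(t [^] m) [^] (i div m) \<otimes> h \<in> H"
    using subgroup.m_closed[OF H subgroup_nat_pow_closed[OF H t(2)] h(1)] .
  moreover have "i mod m < m" using t(3) by simp
  ultimately show ?thesis by blast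
qed

end

context isoclinism
begin

text \<open>Lifts \<open>g\<close>, \<open>h\<close> of \<open>a\<close>, \<open>b\<close> with
  commutator \<open>c\<close> inherit what isoclinism preserves: \<open>c\<close> has order
  \<open>p\<^sup>2\<close>, and conjugation by \<open>h\<close> acts on \<open>c\<close> as in the
  presentation. The order \<open>p ^ 5\<close> leaves room for at most \<open>p\<close> central
  elements, so the centre consists of the powers of \<open>c [^] p\<close>. Hence
  \<open>g [^] p\<close> is \<open>c\<close> up to such a power, which forces \<open>g\<close> to
  have order \<open>p ^ 3\<close> and \<open>c\<close> to be a power of \<open>g\<close>.\<close>

lemma phi8_structure:
  assumes p: "Factorial_Ring.prime p" "odd p" and order: "Coset.order G = p ^ 5"
    and ab: "a \<in> carrier P" "b \<in> carrier P" "commutator P a b = a [^]\<^bsub>P\<^esub> p"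
    and pw: "a [^]\<^bsub>P\<^esub> (p ^ 3) = \<one>\<^bsub>P\<^esub>" "b [^]\<^bsub>P\<^esub> (p\<^sup>2) = \<one>\<^bsub>P\<^esub>" "a [^]\<^bsub>P\<^esub> (p\<^sup>2) \<noteq> \<one>\<^bsub>P\<^esub>"
    and gen: "carrier P \<subseteq> generate P {a, b}"
  shows "\<exists>g\<in>carrier G. \<exists>t\<in>carrier G. \<exists>l. g [^] (p ^ 3) = \<one> \<and> card ((\<lambda>k. g [^] k) ` {..<p ^ 3}) = p ^ 3 \<and>
    inv t \<otimes> g \<otimes> t = g [^] (1 + p * (1 + p * l)) \<and> t [^] (p\<^sup>2) \<in> (\<lambda>k. g [^] k) ` {..<p ^ 3} \<and>
    (\<forall>x\<in>carrier G. \<exists>i<p\<^sup>2. \<exists>h\<in>(\<lambda>k. g [^] k) ` {..<p ^ 3}. x = t [^] i \<otimes> h) \<and>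
    (\<forall>x\<in>carrier G. \<forall>h\<in>(\<lambda>k. g [^] k) ` {..<p ^ 3}. x \<otimes> h \<otimes> inv x \<in> (\<lambda>k. g [^] k) ` {..<p ^ 3})"
proof -
  have p0: "p > 0" using p(1) prime_gt_0_nat by blast
  have finG: "finite (carrier G)" using order p0 G.order_gt_0_iff_finite by simp
  have orda: "P.ord a = p ^ 3"
  proof -
    have "P.ord a dvd p ^ 3" using pw(1) P.pow_eq_id[OF ab(1)] by blast
    then obtain i where i: "i \<le> 3" "P.ord a = p ^ i" using p(1) by (auto simp: divides_primepow_nat)
    have "\<not> P.ord a dvd p\<^sup>2" using pw(3) P.pow_eq_id[OF ab(1)] by blast
    then have "\<not> i \<le> 2" using i(2) by (auto simp: le_imp_power_dvd)
    then show ?thesis using i by (simp add: le_antisym not_less_eq_eq numeral_3_eq_3)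
  qed
  have conjP: "inv\<^bsub>P\<^esub> b \<otimes>\<^bsub>P\<^esub> a \<otimes>\<^bsub>P\<^esub> b = a [^]\<^bsub>P\<^esub> (1 + p)"
    using P.conj_eq_commutator[OF ab(1,2)] ab(3) P.nat_pow_Suc2[OF ab(1), of p] by simp
  have conjPk: "inv\<^bsub>P\<^esub> b \<otimes>\<^bsub>P\<^esub> (a [^]\<^bsub>P\<^esub> k) \<otimes>\<^bsub>P\<^esub> b = a [^]\<^bsub>P\<^esub> k \<otimes>\<^bsub>P\<^esub> a [^]\<^bsub>P\<^esub> (p * k)" for k :: nat
  proof -
    have "inv\<^bsub>P\<^esub> b \<otimes>\<^bsub>P\<^esub> (a [^]\<^bsub>P\<^esub> k) \<otimes>\<^bsub>P\<^esub> b = a [^]\<^bsub>P\<^esub> ((1 + p) * k)"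
      unfolding P.conj_pow[OF ab(2,1), symmetric] conjP using ab(1) by (simp only: P.nat_pow_pow)
    then show ?thesis using ab(1) by (simp add: P.nat_pow_mult)
  qed
  have cover_P: "\<exists>(j::nat) (i::nat). y = b [^]\<^bsub>P\<^esub> j \<otimes>\<^bsub>P\<^esub> a [^]\<^bsub>P\<^esub> i" if "y \<in> carrier P" for y
  proof -
    let ?B = "(\<lambda>i::nat. a [^]\<^bsub>P\<^esub> i) ` {..<p ^ 3}"
    have B: "subgroup ?B P" using P.subgroup_nat_powers[OF ab(1) _ pw(1)] p0 by simp
    have aB: "a \<in> ?B"
    proof (rule image_eqI[of _ _ 1])
      have "1 < p" using p(1) by (rule prime_gt_1_nat)
      then show "1 \<in> {..<p ^ 3}" using one_less_power[of p 3] by simp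
    qed (use ab in simp)
    have "\<exists>i::nat. \<exists>x\<in>?B. y = b [^]\<^bsub>P\<^esub> i \<otimes>\<^bsub>P\<^esub> x"
    proof (rule P.cyclic_cover(1)[OF B ab(2) _ pw(2) _ _ that])
      show "0 < p\<^sup>2" using p0 by simp
      show "inv\<^bsub>P\<^esub> b \<otimes>\<^bsub>P\<^esub> x \<otimes>\<^bsub>P\<^esub> b \<in> ?B" if x: "x \<in> ?B" for x
      proof -
        obtain k :: nat where "x = a [^]\<^bsub>P\<^esub> k" using x by blast
        then show ?thesis using conjPk[of k] subgroup.m_closed[OF B] P.subgroup_nat_pow_closed[OF B aB] by simp
      qed
      have "{a, b} \<subseteq> ?B \<union> {b}" using aB by blast
      then show "carrier P \<subseteq> generate P (?B \<union> {b})" using gen P.mono_generate by blast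
    qed
    then obtain j :: nat and x where x: "x \<in> ?B" "y = b [^]\<^bsub>P\<^esub> j \<otimes>\<^bsub>P\<^esub> x" by metis
    from x(1) obtain i :: nat where "x = a [^]\<^bsub>P\<^esub> i" by auto
    then show ?thesis using x(2) by metis
  qed
  obtain g where g: "rel g a" using rel_right_total[OF ab(1)] by blast
  obtain h where h: "rel h b" using rel_right_total[OF ab(2)] by blast
  have gG: "g \<in> carrier G" and hG: "h \<in> carrier G" using rel_carrier g h by blast+
  define c where "c = commutator G g h"
  have cG: "c \<in> carrier G" using gG hG by (simp add: c_def commutator_def)
  have cD: "c \<in> derived G (carrier G)" unfolding c_def by (rule G.commutator_in_derived[OF gG hG])
  have \<phi>c: "\<phi> c = a [^]\<^bsub>P\<^esub> p" unfolding c_def using rel_commutator[OF g h] ab(3) by simp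
  have rc: "rel c (a [^]\<^bsub>P\<^esub> p)"
  proof -
    have "rel (commutator G g h) (commutator P a b)" unfolding commutator_def by (intro rel_mult rel_inv g h)
    then show ?thesis using ab(3) by (simp add: c_def)
  qed
  \<comment> \<open>The order of \<open>c\<close> is seen through the injective
    \<open>\<phi>\<close>, which sends \<open>c\<close> to the \<open>p\<close>-th power of
    \<open>a\<close>.\<close>
  have c_pow: "c [^] k = \<one> \<longleftrightarrow> p\<^sup>2 dvd k" for k :: nat
  proof -
    have ck: "c [^] k \<in> derived G (carrier G)"
      using G.subgroup_nat_pow_closed[OF G.derived_is_subgroup cD] by simp
    have "c [^] k = \<one> \<longleftrightarrow> \<phi> (c [^] k) = \<one>\<^bsub>P\<^esub>" using phi_inj[OF ck one_in_derived] phi_one by auto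
    also have "\<phi> (c [^] k) = a [^]\<^bsub>P\<^esub> (p * k)" using phi_pow[OF cD, of k] ab(1) by (simp add: \<phi>c P.nat_pow_pow)
    also have "\<dots> = \<one>\<^bsub>P\<^esub> \<longleftrightarrow> p * p\<^sup>2 dvd p * k"
      unfolding P.pow_eq_id[OF ab(1)] orda by (simp add: power2_eq_square power3_eq_cube)
    finally show ?thesis using p0 by simp
  qed
  have c_mult: "c [^] (i + p\<^sup>2 * j) = c [^] i" for i j :: nat
  proof -
    have "c [^] (i + p\<^sup>2 * j) = c [^] i \<otimes> c [^] (p\<^sup>2 * j)" using cG by (simp add: G.nat_pow_mult)
    then show ?thesis using c_pow[of "p\<^sup>2 * j"] cG by simp
  qed
  have cg: "c \<otimes> g = g \<otimes> c"
  proof -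
    have "a [^]\<^bsub>P\<^esub> p \<otimes>\<^bsub>P\<^esub> a = a \<otimes>\<^bsub>P\<^esub> a [^]\<^bsub>P\<^esub> p" using P.nat_pow_Suc2[OF ab(1), of p] by simp
    then show ?thesis using rel_commute[OF rc g] by simp
  qed
  have conj_g: "inv h \<otimes> g \<otimes> h = g \<otimes> c" unfolding c_def by (rule G.conj_eq_commutator[OF gG hG])
  have conj_c: "inv h \<otimes> c \<otimes> h = c [^] (1 + p)"
  proof -
    have "commutator P (a [^]\<^bsub>P\<^esub> p) b = inv\<^bsub>P\<^esub> (a [^]\<^bsub>P\<^esub> p) \<otimes>\<^bsub>P\<^esub> (inv\<^bsub>P\<^esub> b \<otimes>\<^bsub>P\<^esub> (a [^]\<^bsub>P\<^esub> p) \<otimes>\<^bsub>P\<^esub> b)"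
      using ab by (simp add: commutator_def P.m_assoc)
    also have "\<dots> = a [^]\<^bsub>P\<^esub> (p * p)" unfolding conjPk using ab by (simp add: P.m_assoc[symmetric])
    also have "\<dots> = \<phi> (c [^] p)" using phi_pow[OF cD, of p] ab(1) by (simp add: \<phi>c P.nat_pow_pow)
    finally have "\<phi> (commutator G c h) = \<phi> (c [^] p)" using rel_commutator[OF rc h] by simp
    moreover have "c [^] p \<in> derived G (carrier G)"
      using G.subgroup_nat_pow_closed[OF G.derived_is_subgroup cD] by simp
    ultimately have "commutator G c h = c [^] p" using phi_inj G.commutator_in_derived[OF cG hG] by blast
    then show ?thesis using G.conj_eq_commutator[OF cG hG] G.nat_pow_Suc2[OF cG, of p] by simp
  qed
  let ?Z = "group_center G"
  interpret Z: normal ?Z G by (rule G.normal_group_center)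
  have cover_G: "\<exists>(j::nat) (i::nat). \<exists>z\<in>?Z. x = h [^] j \<otimes> g [^] i \<otimes> z" if x: "x \<in> carrier G" for x
  proof -
    obtain y where y: "rel x y" using rel_left_total[OF x] by blast
    obtain j i :: nat where ji: "y = b [^]\<^bsub>P\<^esub> j \<otimes>\<^bsub>P\<^esub> a [^]\<^bsub>P\<^esub> i" using cover_P rel_carrier[OF y] by blast
    let ?u = "h [^] j \<otimes> g [^] i"
    have uG: "?u \<in> carrier G" using gG hG by simp
    have "rel ?u y" unfolding ji by (intro rel_mult rel_pow g h)
    then have "rel (inv ?u \<otimes> x) (inv\<^bsub>P\<^esub> y \<otimes>\<^bsub>P\<^esub> y)" by (intro rel_mult rel_inv y)
    then have "rel (inv ?u \<otimes> x) \<one>\<^bsub>P\<^esub>" using rel_carrier[OF y] by simp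
    moreover have "\<one>\<^bsub>P\<^esub> \<in> group_center P" by (simp add: group_center_def)
    ultimately have "inv ?u \<otimes> x \<in> ?Z" using rel_center by blast
    moreover have "x = ?u \<otimes> (inv ?u \<otimes> x)" using uG x by (simp add: G.m_assoc[symmetric])
    ultimately show ?thesis by blast
  qed
  have cp_center: "c [^] p \<in> ?Z"
  proof -
    have "a [^]\<^bsub>P\<^esub> (p\<^sup>2) \<in> group_center P"
    proof -
      let ?s = "a [^]\<^bsub>P\<^esub> (p\<^sup>2)"
      have sP: "?s \<in> carrier P" using ab by simp
      have "a [^]\<^bsub>P\<^esub> (p * p\<^sup>2) = \<one>\<^bsub>P\<^esub>" using pw(1) by (simp add: power2_eq_square power3_eq_cube mult.assoc)
      then have "inv\<^bsub>P\<^esub> b \<otimes>\<^bsub>P\<^esub> ?s \<otimes>\<^bsub>P\<^esub> b = ?s" using conjPk[of "p\<^sup>2"] ab by simp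
      then have "?s \<otimes>\<^bsub>P\<^esub> b = b \<otimes>\<^bsub>P\<^esub> ?s" using P.conj_eq_iff_commute[OF sP ab(2)] by simp
      moreover have "?s \<otimes>\<^bsub>P\<^esub> a = a \<otimes>\<^bsub>P\<^esub> ?s" using P.nat_pow_Suc2[OF ab(1), of "p\<^sup>2"] by simp
      ultimately have "{a, b} \<subseteq> {x \<in> carrier P. x \<otimes>\<^bsub>P\<^esub> ?s = ?s \<otimes>\<^bsub>P\<^esub> x}" using ab by auto
      then have "generate P {a, b} \<subseteq> {x \<in> carrier P. x \<otimes>\<^bsub>P\<^esub> ?s = ?s \<otimes>\<^bsub>P\<^esub> x}"
        by (rule P.generate_subgroup_incl[OF _ P.subgroup_centralizer[OF sP]])
      then have "?s \<otimes>\<^bsub>P\<^esub> x = x \<otimes>\<^bsub>P\<^esub> ?s" if "x \<in> carrier P" for x using gen that by force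
      then show ?thesis using sP by (simp add: group_center_def)
    qed
    moreover have "rel (c [^] p) (a [^]\<^bsub>P\<^esub> (p\<^sup>2))"
      using rel_pow[OF rc, of p] ab(1) by (simp add: P.nat_pow_pow power2_eq_square)
    ultimately show ?thesis using rel_center by blast
  qed
  \<comment> \<open>The exponent is the sum of \<open>(1 + p) ^ l\<close> over \<open>l < k\<close>,
    reduced modulo \<open>p\<^sup>2\<close>.\<close>
  have conj_gk: "inv (h [^] k) \<otimes> g \<otimes> h [^] k = g \<otimes> c [^] (k + p * (\<Sum>l<k. l))" for k :: nat
  proof (induction k)
    case (Suc k)
    let ?n = "k + p * (\<Sum>l<k. l)"
    have "inv (h [^] Suc k) \<otimes> g \<otimes> h [^] Suc k = inv h \<otimes> (inv (h [^] k) \<otimes> g \<otimes> h [^] k) \<otimes> h"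
      using hG gG by (simp add: G.inv_mult_group G.m_assoc)
    also have "\<dots> = inv h \<otimes> (g \<otimes> c [^] ?n) \<otimes> h" by (simp only: Suc)
    also have "\<dots> = (inv h \<otimes> g \<otimes> h) \<otimes> (inv h \<otimes> c [^] ?n \<otimes> h)"
    proof -
      have "(inv h \<otimes> g \<otimes> h) \<otimes> (inv h \<otimes> c [^] ?n \<otimes> h) = inv h \<otimes> g \<otimes> (h \<otimes> inv h) \<otimes> c [^] ?n \<otimes> h"
        using hG gG cG by (simp only: G.m_assoc G.m_closed G.inv_closed G.nat_pow_closed)
      then show ?thesis using hG gG cG by (simp add: G.m_assoc)
    qed
    also have "inv h \<otimes> c [^] ?n \<otimes> h = c [^] ((1 + p) * ?n)"
      unfolding G.conj_pow[OF hG cG, symmetric] conj_c by (rule G.nat_pow_pow[OF cG])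
    also have "(inv h \<otimes> g \<otimes> h) \<otimes> c [^] ((1 + p) * ?n) = g \<otimes> (c [^] (1::nat) \<otimes> c [^] ((1 + p) * ?n))"
      unfolding conj_g using gG cG by (simp add: G.m_assoc)
    also have "c [^] (1::nat) \<otimes> c [^] ((1 + p) * ?n) = c [^] (1 + (1 + p) * ?n)" by (rule G.nat_pow_mult[OF cG])
    also have "1 + (1 + p) * ?n = (Suc k + p * (\<Sum>l<Suc k. l)) + p\<^sup>2 * (\<Sum>l<k. l)"
      by (simp add: power2_eq_square algebra_simps)
    finally show ?case by (simp only: c_mult)
  qed (use gG in simp)
  \<comment> \<open>The action of \<open>h [^] k\<close> on \<open>c\<close> shows that
    \<open>p\<close> divides \<open>k\<close>. As \<open>p\<close> is odd, it then also divides
    \<open>k (k - 1) / 2\<close>, and the action on \<open>g\<close> gives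
    \<open>p\<^sup>2 dvd k\<close>.\<close>
  have h_comm: "k = 0" if k: "k < p\<^sup>2" and comm: "h [^] k \<otimes> g = g \<otimes> h [^] k" for k :: nat
  proof -
    let ?h = "h [^] k"
    have hkG: "?h \<in> carrier G" using hG by simp
    have sub: "subgroup {x \<in> carrier G. x \<otimes> ?h = ?h \<otimes> x} G" by (rule G.subgroup_centralizer[OF hkG])
    have g1: "g \<in> {x \<in> carrier G. x \<otimes> ?h = ?h \<otimes> x}" using gG comm by simp
    have h1: "h \<in> {x \<in> carrier G. x \<otimes> ?h = ?h \<otimes> x}" using hG G.nat_pow_Suc2[OF hG, of k] by simp
    have "c \<in> {x \<in> carrier G. x \<otimes> ?h = ?h \<otimes> x}"
      unfolding c_def commutator_def by (intro subgroup.m_closed[OF sub] subgroup.m_inv_closed[OF sub] g1 h1)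
    then have "inv ?h \<otimes> c \<otimes> ?h = c" using G.conj_eq_iff_commute[OF cG hkG] by simp
    then have c1: "c [^] ((1 + p) ^ k) = c" using G.conj_pow_power[OF hG cG conj_c] by simp
    obtain e where e: "(1 + p) ^ k = 1 + k * p + e * p\<^sup>2" using one_plus_power_expansion by blast
    have "c [^] ((1 + p) ^ k) = c [^] (1 + k * p)" unfolding e using c_mult[of "1 + k * p" e] by (simp add: mult.commute)
    also have "\<dots> = c \<otimes> c [^] (k * p)" using G.nat_pow_mult[OF cG, of 1 "k * p"] cG by simp
    finally have "c \<otimes> c [^] (k * p) = c \<otimes> \<one>" using c1 cG by simp
    then have "c [^] (k * p) = \<one>" using cG by simp
    then have pk: "p dvd k" using c_pow[of "k * p"] p0 by (simp add: power2_eq_square)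
    have "p dvd (\<Sum>l<k. l)"
    proof -
      have "2 * (\<Sum>l<k. l) = k * (k - 1)" by (induction k) (auto simp: algebra_simps diff_mult_distrib2)
      then have "p dvd 2 * (\<Sum>l<k. l)" using pk by simp
      moreover have "coprime p 2" using p(2) by simp
      ultimately show ?thesis by (simp add: coprime_dvd_mult_right_iff)
    qed
    then obtain s where s: "(\<Sum>l<k. l) = p * s" by blast
    have "g \<otimes> c [^] k = g \<otimes> c [^] (k + p * (\<Sum>l<k. l))"
      unfolding s using c_mult[of k s] by (simp add: power2_eq_square mult.assoc)
    also have "\<dots> = g" unfolding conj_gk[symmetric] using G.conj_eq_iff_commute[OF gG hkG] comm by simp
    finally have "g \<otimes> c [^] k = g \<otimes> \<one>" using gG by simp
    then have "c [^] k = \<one>" using gG cG by simp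
    then have "p\<^sup>2 dvd k" using c_pow by blast
    then show "k = 0" using k by (auto dest: dvd_imp_le)
  qed
  have g_comm: "l = 0" if l: "l < p\<^sup>2" and comm: "g [^] l \<otimes> h = h \<otimes> g [^] l" for l :: nat
  proof -
    have glG: "g [^] l \<in> carrier G" using gG by simp
    have "inv h \<otimes> g [^] l \<otimes> h = g [^] l" using G.conj_eq_iff_commute[OF glG hG] comm by simp
    moreover have "inv h \<otimes> g [^] l \<otimes> h = (g \<otimes> c) [^] l" unfolding G.conj_pow[OF hG gG, symmetric] conj_g ..
    moreover have "(g \<otimes> c) [^] l = g [^] l \<otimes> c [^] l" using G.pow_mult_distrib[OF cg[symmetric] gG cG] .
    ultimately have "g [^] l \<otimes> c [^] l = g [^] l \<otimes> \<one>" using glG by simp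
    then have "c [^] l = \<one>" using glG cG by simp
    then have "p\<^sup>2 dvd l" using c_pow by blast
    then show "l = 0" using l by (auto dest: dvd_imp_le)
  qed
  have Zcomm: "z \<otimes> x = x \<otimes> z" if "z \<in> ?Z" "x \<in> carrier G" for z x using that unfolding group_center_def by blast
  have ZG: "z \<in> carrier G" if "z \<in> ?Z" for z using G.group_center_carrier[OF that] .
  have g_part: "i = i' \<and> z = z'"
    if le: "i \<le> i'" and lt: "i' < p\<^sup>2" and z: "z \<in> ?Z" "z' \<in> ?Z" and eq: "g [^] i \<otimes> z = g [^] i' \<otimes> z'" for i i' :: nat and z z'
  proof -
    have "g [^] i' = g [^] i \<otimes> g [^] (i' - i)" using gG le by (simp add: G.nat_pow_mult)
    then have "g [^] i \<otimes> z = g [^] i \<otimes> (g [^] (i' - i) \<otimes> z')" using eq gG ZG z by (simp add: G.m_assoc)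
    then have zz: "z = g [^] (i' - i) \<otimes> z'" using gG ZG z by simp
    then have "g [^] (i' - i) = z \<otimes> inv z'" using gG ZG[OF z(2)] by (simp add: G.m_assoc)
    then have "g [^] (i' - i) \<in> ?Z" using z Z.m_closed Z.m_inv_closed by simp
    then have "i' - i = 0" using Zcomm[OF _ hG] lt by (intro g_comm) auto
    then show ?thesis using le zz ZG[OF z(2)] by simp
  qed
  have h_part: "j = j'"
    if le: "j \<le> j'" and lt: "j' < p\<^sup>2" and z: "z \<in> ?Z" "z' \<in> ?Z"
      and eq: "h [^] j \<otimes> (g [^] i \<otimes> z) = h [^] j' \<otimes> (g [^] i' \<otimes> z')" for i i' j j' :: nat and z z'
  proof -
    have sub: "subgroup {x \<in> carrier G. x \<otimes> g = g \<otimes> x} G" by (rule G.subgroup_centralizer[OF gG])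
    have gz: "g [^] i \<otimes> z \<in> {x \<in> carrier G. x \<otimes> g = g \<otimes> x}" if "z \<in> ?Z" for z and i :: nat
    proof (rule subgroup.m_closed[OF sub])
      show "g [^] i \<in> {x \<in> carrier G. x \<otimes> g = g \<otimes> x}" using gG by (intro G.subgroup_nat_pow_closed[OF sub]) simp
      show "z \<in> {x \<in> carrier G. x \<otimes> g = g \<otimes> x}" using that Zcomm[OF that gG] ZG by simp
    qed
    have gzG: "g [^] i \<otimes> z \<in> carrier G" "g [^] i' \<otimes> z' \<in> carrier G" using gz z by blast+
    have "h [^] j' = h [^] j \<otimes> h [^] (j' - j)" using hG le by (simp add: G.nat_pow_mult)
    then have "h [^] j \<otimes> (g [^] i \<otimes> z) = h [^] j \<otimes> (h [^] (j' - j) \<otimes> (g [^] i' \<otimes> z'))"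
      using eq hG gzG by (simp add: G.m_assoc)
    then have "g [^] i \<otimes> z = h [^] (j' - j) \<otimes> (g [^] i' \<otimes> z')" using hG gzG by simp
    then have "h [^] (j' - j) = (g [^] i \<otimes> z) \<otimes> inv (g [^] i' \<otimes> z')" using hG gzG by (simp add: G.m_assoc)
    also have "\<dots> \<in> {x \<in> carrier G. x \<otimes> g = g \<otimes> x}"
      by (intro subgroup.m_closed[OF sub] subgroup.m_inv_closed[OF sub] gz z)
    finally have "j' - j = 0" using lt by (intro h_comm) auto
    then show ?thesis using le by simp
  qed
  \<comment> \<open>Products of \<open>h [^] j\<close>, \<open>g [^] i\<close> and a central
    \<open>z\<close> with \<open>i\<close> and \<open>j\<close> below \<open>p\<^sup>2\<close> are
    distinct, so \<open>p ^ 4\<close> times the order of the centre is at most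
    \<open>p ^ 5\<close>.\<close>
  let ?f = "\<lambda>(j, i, z). h [^] j \<otimes> (g [^] i \<otimes> z)"
  have inj: "inj_on ?f ({..<p\<^sup>2} \<times> {..<p\<^sup>2} \<times> ?Z)"
  proof (rule inj_onI)
    fix x y assume x: "x \<in> {..<p\<^sup>2} \<times> {..<p\<^sup>2} \<times> ?Z" and y: "y \<in> {..<p\<^sup>2} \<times> {..<p\<^sup>2} \<times> ?Z" and "?f x = ?f y"
    obtain j i z where xe: "x = (j, i, z)" by (metis prod_cases3)
    obtain j' i' z' where ye: "y = (j', i', z')" by (metis prod_cases3)
    have lt: "j < p\<^sup>2" "i < p\<^sup>2" "z \<in> ?Z" "j' < p\<^sup>2" "i' < p\<^sup>2" "z' \<in> ?Z" using x y by (auto simp: xe ye)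
    have eq: "h [^] j \<otimes> (g [^] i \<otimes> z) = h [^] j' \<otimes> (g [^] i' \<otimes> z')" using \<open>?f x = ?f y\<close> by (simp add: xe ye)
    have jj: "j = j'"
      using h_part[OF _ lt(4,3,6) eq] h_part[OF _ lt(1,6,3) eq[symmetric]] by (cases "j \<le> j'") auto
    have eq2: "g [^] i \<otimes> z = g [^] i' \<otimes> z'" using eq hG gG ZG lt by (simp add: jj)
    have "i = i' \<and> z = z'"
      using g_part[OF _ lt(5,3,6) eq2] g_part[OF _ lt(2,6,3) eq2[symmetric]] by (cases "i \<le> i'") auto
    then show "x = y" using jj by (simp add: xe ye)
  qed
  have finZ: "finite ?Z" using finG ZG by (meson finite_subset subsetI)
  have "?f ` ({..<p\<^sup>2} \<times> {..<p\<^sup>2} \<times> ?Z) \<subseteq> carrier G" using hG gG ZG by auto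
  then have "card ({..<p\<^sup>2} \<times> {..<p\<^sup>2} \<times> ?Z) \<le> p ^ 5"
    using card_inj_on_le[OF inj _ finG] order by (simp add: Coset.order_def)
  moreover have "card ({..<p\<^sup>2} \<times> {..<p\<^sup>2} \<times> ?Z) = p ^ 4 * card ?Z"
    by (simp add: card_cartesian_product power2_eq_square power4_eq_xxxx mult.assoc)
  moreover have "p ^ 5 = p ^ 4 * p" by (simp add: eval_nat_numeral)
  ultimately have cardZ: "card ?Z \<le> p" using p0 by simp
  let ?C = "(\<lambda>k. c [^] (p * k)) ` {..<p}"
  have "?C \<subseteq> ?Z"
  proof
    fix x assume "x \<in> ?C"
    then obtain k :: nat where "x = (c [^] p) [^] k" using cG by (auto simp: G.nat_pow_pow)
    then show "x \<in> ?Z" using G.subgroup_nat_pow_closed[OF Z.subgroup_axioms cp_center] by simp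
  qed
  moreover have "card ?C = p"
  proof -
    have "inj_on (\<lambda>k. c [^] (p * k)) {..<p}"
    proof (rule linorder_inj_onI)
      fix i j :: nat assume ij: "i < j" "j \<in> {..<p}"
      show "c [^] (p * i) \<noteq> c [^] (p * j)"
      proof
        assume eq: "c [^] (p * i) = c [^] (p * j)"
        have "p * j = p * i + p * (j - i)" using ij by (simp add: add_mult_distrib2[symmetric])
        then have "c [^] (p * j) = c [^] (p * i) \<otimes> c [^] (p * (j - i))" using cG by (simp add: G.nat_pow_mult)
        then have "c [^] (p * i) \<otimes> c [^] (p * (j - i)) = c [^] (p * i) \<otimes> \<one>" using eq cG by simp
        then have "c [^] (p * (j - i)) = \<one>" using cG by simp
        then have "p dvd j - i" using c_pow[of "p * (j - i)"] p0 by (simp add: power2_eq_square)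
        then show False using ij by (auto dest: dvd_imp_le)
      qed
    qed auto
    then show ?thesis by (simp add: card_image)
  qed
  ultimately have ZC: "?Z = ?C" using cardZ finZ by (metis card_seteq)
  \<comment> \<open>Both \<open>g [^] p\<close> and \<open>c\<close> are related to the
    \<open>p\<close>-th power of \<open>a\<close>, so they differ by a central element, which is a
    power of \<open>c [^] p\<close>.\<close>
  obtain k where k: "k < p" "g [^] p = c [^] (1 + p * k)"
  proof -
    have "rel (inv c \<otimes> g [^] p) (inv\<^bsub>P\<^esub> (a [^]\<^bsub>P\<^esub> p) \<otimes>\<^bsub>P\<^esub> a [^]\<^bsub>P\<^esub> p)" by (intro rel_mult rel_inv rel_pow rc g)
    then have "rel (inv c \<otimes> g [^] p) \<one>\<^bsub>P\<^esub>" using ab by simp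
    moreover have "\<one>\<^bsub>P\<^esub> \<in> group_center P" by (simp add: group_center_def)
    ultimately have "inv c \<otimes> g [^] p \<in> ?Z" using rel_center by blast
    then obtain k where k: "k < p" "inv c \<otimes> g [^] p = c [^] (p * k)" unfolding ZC by auto
    have "g [^] p = c \<otimes> (inv c \<otimes> g [^] p)" using cG gG by (simp add: G.m_assoc[symmetric])
    also have "\<dots> = c [^] (1 + p * k)" unfolding k(2) using G.nat_pow_mult[OF cG, of 1 "p * k"] cG by simp
    finally show ?thesis using that k(1) by blast
  qed
  have gpp: "g [^] (p\<^sup>2) = c [^] p"
  proof -
    have "g [^] (p\<^sup>2) = (g [^] p) [^] p" using gG by (simp add: G.nat_pow_pow power2_eq_square)
    also have "\<dots> = c [^] (p + p\<^sup>2 * k)" unfolding k(2) G.nat_pow_pow[OF cG] by (simp only: power2_eq_square) (simp add: algebra_simps)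
    finally show ?thesis by (simp only: c_mult)
  qed
  have gppp: "g [^] (p ^ 3) = \<one>"
  proof -
    have "g [^] (p ^ 3) = (g [^] (p\<^sup>2)) [^] p" using gG by (simp add: G.nat_pow_pow power2_eq_square power3_eq_cube)
    also have "\<dots> = c [^] (p\<^sup>2)" unfolding gpp using cG by (simp add: G.nat_pow_pow power2_eq_square)
    finally show ?thesis using c_pow[of "p\<^sup>2"] by simp
  qed
  have ordg: "G.ord g = p ^ 3"
  proof -
    have "G.ord g dvd p ^ 3" using gppp G.pow_eq_id[OF gG] by blast
    then obtain i where i: "i \<le> 3" "G.ord g = p ^ i" using p(1) by (auto simp: divides_primepow_nat)
    have "c [^] p \<noteq> \<one>"
    proof
      assume "c [^] p = \<one>"
      then have "p * p dvd p * 1" using c_pow[of p] by (simp add: power2_eq_square)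
      then have "p dvd 1" using p0 by (simp only: nat_mult_dvd_cancel_disj) simp
      then show False using p(1) by simp
    qed
    then have "\<not> G.ord g dvd p\<^sup>2" using gpp G.pow_eq_id[OF gG] by metis
    then have "\<not> i \<le> 2" using i(2) by (auto simp: le_imp_power_dvd)
    then show ?thesis using i by (simp add: le_antisym not_less_eq_eq numeral_3_eq_3)
  qed
  let ?H = "(\<lambda>k::nat. g [^] k) ` {..<p ^ 3}"
  have ppp0: "0 < p ^ 3" using p0 by simp
  have H: "subgroup ?H G" using G.subgroup_nat_powers[OF gG ppp0 gppp] .
  have gH: "g \<in> ?H"
  proof (rule image_eqI[of _ _ 1])
    have "1 < p" using p(1) by (rule prime_gt_1_nat)
    then show "1 \<in> {..<p ^ 3}" using one_less_power[of p 3] by simp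
  qed (use gG in simp)
  have cardH: "card ?H = p ^ 3"
  proof -
    have "{0..G.ord g - 1} = {..<p ^ 3}" unfolding ordg using ppp0 by (cases "p ^ 3") auto
    then have "inj_on (\<lambda>k::nat. g [^] k) {..<p ^ 3}" using G.ord_inj[OF gG] by simp
    then show ?thesis by (simp add: card_image)
  qed
  \<comment> \<open>Modulo \<open>p\<^sup>2\<close> the inverse of \<open>1 + p * k\<close> is
    \<open>1 + p * (p - k)\<close>.\<close>
  have c_eq: "c = g [^] (p * (1 + p * (p - k)))"
  proof -
    have "g [^] (p * (1 + p * (p - k))) = c [^] ((1 + p * k) * (1 + p * (p - k)))"
      using gG cG k(2) by (simp only: G.nat_pow_pow[symmetric])
    also have "(1 + p * k) * (1 + p * (p - k)) = 1 + p\<^sup>2 * (1 + k * (p - k))"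
    proof -
      have "p * k + p * (p - k) = p * p" using k(1) by (simp add: add_mult_distrib2[symmetric])
      moreover have "(1 + p * k) * (1 + p * d) = 1 + (p * k + p * d) + p * p * (k * d)" for d by (simp add: algebra_simps)
      ultimately show ?thesis by (simp add: power2_eq_square add_mult_distrib2)
    qed
    finally show ?thesis using cG by (simp only: c_mult G.nat_pow_eone)
  qed
  have conj_h: "inv h \<otimes> g \<otimes> h = g [^] (1 + p * (1 + p * (p - k)))"
  proof -
    have "g \<otimes> c = g [^] (1::nat) \<otimes> g [^] (p * (1 + p * (p - k)))" by (simp only: c_eq[symmetric] G.nat_pow_eone[OF gG])
    then show ?thesis unfolding conj_g by (simp only: G.nat_pow_mult[OF gG])
  qed
  have cH: "c \<in> ?H" unfolding c_eq by (rule G.subgroup_nat_pow_closed[OF H gH])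
  have ZH: "z \<in> ?H" if "z \<in> ?Z" for z using that G.subgroup_nat_pow_closed[OF H cH] unfolding ZC by auto
  have cl: "inv h \<otimes> x \<otimes> h \<in> ?H" if "x \<in> ?H" for x
  proof -
    obtain i :: nat where "x = g [^] i" using \<open>x \<in> ?H\<close> by blast
    then have "inv h \<otimes> x \<otimes> h = (inv h \<otimes> g \<otimes> h) [^] i" using G.conj_pow[OF hG gG] by simp
    then show ?thesis unfolding conj_h by (simp only: G.subgroup_nat_pow_closed[OF H] gH)
  qed
  have genG: "carrier G \<subseteq> generate G (?H \<union> {h})"
  proof
    fix x assume "x \<in> carrier G"
    then obtain j i :: nat and z where z: "z \<in> ?Z" "x = h [^] j \<otimes> g [^] i \<otimes> z" using cover_G by blast
    have HG: "?H \<union> {h} \<subseteq> carrier G" using gG hG by auto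
    have sub: "subgroup (generate G (?H \<union> {h})) G" by (rule G.generate_is_subgroup[OF HG])
    have "h [^] j \<in> generate G (?H \<union> {h})" by (rule G.subgroup_nat_pow_closed[OF sub]) (simp add: generate.incl)
    moreover have "g [^] i \<in> generate G (?H \<union> {h})"
      by (rule G.subgroup_nat_pow_closed[OF sub]) (use gH in \<open>auto intro: generate.incl\<close>)
    moreover have "z \<in> generate G (?H \<union> {h})" using ZH[OF z(1)] by (auto intro: generate.incl)
    ultimately show "x \<in> generate G (?H \<union> {h})" unfolding z(2) by (intro generate.eng)
  qed
  have ho: "h [^] (p ^ 5) = \<one>" using G.pow_order_eq_1[OF hG] order by simp
  have p50: "0 < p ^ 5" using p0 by simp
  note cc = G.cyclic_cover[OF H hG p50 ho cl genG]
  have hpp: "h [^] (p\<^sup>2) \<in> ?H"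
  proof (rule ZH)
    have "rel (h [^] (p\<^sup>2)) \<one>\<^bsub>P\<^esub>" using rel_pow[OF h, of "p\<^sup>2"] pw(2) by simp
    moreover have "\<one>\<^bsub>P\<^esub> \<in> group_center P" by (simp add: group_center_def)
    ultimately show "h [^] (p\<^sup>2) \<in> ?Z" using rel_center by blast
  qed
  have pp0: "0 < p\<^sup>2" using p0 by simp
  have cover: "\<forall>x\<in>carrier G. \<exists>i<p\<^sup>2. \<exists>y\<in>?H. x = h [^] i \<otimes> y"
    by (intro ballI G.reduce_cyclic_cover[OF H hG hpp pp0] cc(1))
  have normal: "\<forall>x\<in>carrier G. \<forall>y\<in>?H. x \<otimes> y \<otimes> inv x \<in> ?H"
    by (intro ballI cc(2))
  show ?thesis
    by (rule bexI[OF bexI[OF exI[of _ "p - k"] hG] gG]) (intro conjI gppp cardH conj_h hpp cover normal)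
qed

end

section \<open>Purely transcendental fixed fields\<close>

context regular_action
begin

lemma rational_if_few_generators:
  assumes few_generators
  shows "\<exists>B. algebraically_independent K B \<and> fixed_by (carrier G) L = adjoin K B"
proof -
  obtain B where B: "finite B" "card B \<le> Coset.order G" "fixed_by (carrier G) L = adjoin K B"
    using assms unfolding few_generators_def by blast
  have "var ` carrier G \<subseteq> acl K B"
    using alg_over_fixed[OF is_subfield_L stable_L var_in_L]
    by (auto simp: B(3) acl_def alg_closure_in_def)
  then have "independent_over K B"
    using independent_if_card_le[OF B(1) card_var(1) independent_var] B(2) card_var(2) by simp
  then have "algebraically_independent K B" by (rule algebraically_independent_if_independent_over[OF K B(1)])
  then show ?thesis using B(3) by blast
qed

text \<open>If \<open>t\<close> lies in \<open>A\<close>, the group is abelian. Otherwise primality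
  of \<open>p\<close> makes the products \<open>t [^] i \<otimes> x\<close> with
  \<open>i < p\<close> distinct, so \<open>A\<close> has index exactly \<open>p\<close>.\<close>

lemma few_generators_abelian_by_cyclic:
  assumes G: "abelian_by_cyclic G p" and p: "Factorial_Ring.prime p" "Coset.order G = p ^ n" "of_nat p \<noteq> (0::'l)"
    and q: "primitive_root_of_unity (p ^ e) \<zeta>" "\<zeta> \<in> K" "\<And>g. g \<in> carrier G \<Longrightarrow> g [^] (p ^ e) = \<one>"
  shows few_generators
proof -
  have p0: "p > 0" using p(1) prime_gt_0_nat by blast
  have q0: "of_nat (p ^ e) \<noteq> (0::'l)" using p(3) by (simp add: of_nat_power)
  obtain A t where A: "subgroup A G" "\<forall>x\<in>A. \<forall>y\<in>A. x \<otimes> y = y \<otimes> x"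
    "\<forall>g\<in>carrier G. \<forall>x\<in>A. g \<otimes> x \<otimes> inv g \<in> A" and t: "t \<in> carrier G" "t [^] p \<in> A"
    and cover: "\<forall>g\<in>carrier G. \<exists>i::nat. \<exists>x\<in>A. g = t [^] i \<otimes> x"
    using G unfolding abelian_by_cyclic_def by blast
  interpret A: subgroup A G by (rule A(1))
  have tA_abelian: few_generators if tA: "t \<in> A"
  proof (rule few_generators_abelian[OF _ q(3) q0 q(1,2)])
    have "g \<in> A" if g: "g \<in> carrier G" for g
    proof -
      obtain i :: nat and x where "x \<in> A" "g = t [^] i \<otimes> x" using cover g by blast
      then show ?thesis using A.m_closed[OF subgroup_nat_pow_closed[OF A(1) tA]] by simp
    qed
    then show "g \<otimes> h = h \<otimes> g" if "g \<in> carrier G" "h \<in> carrier G" for g h using A(2) that by blast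
  qed
  show ?thesis
  proof (cases "t \<in> A")
    case tA: False
    have e0: "e \<noteq> 0"
    proof
      assume "e = 0"
      then have "t = \<one>" using q(3)[OF t(1)] t(1) by simp
      then show False using tA A.one_closed by simp
    qed
    have pow_notin: "i = 0" if i: "i < p" "t [^] i \<in> A" for i :: nat
    proof (rule ccontr)
      assume "i \<noteq> 0"
      then have "\<not> p dvd i" using i(1) by (auto dest: dvd_imp_le)
      then have "coprime i p" using prime_imp_coprime[OF p(1)] by (simp add: coprime_commute)
      then obtain x y where xy: "i * x = p * y + 1" using bezout_nat[of i p] \<open>i \<noteq> 0\<close> by auto
      have "t [^] (p * y) \<otimes> t = (t [^] i) [^] x"
        using t(1) by (simp only: nat_pow_pow xy) (simp add: nat_pow_mult[symmetric])
      also have "\<dots> \<in> A" by (rule subgroup_nat_pow_closed[OF A(1) i(2)])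
      finally have ty: "t [^] (p * y) \<otimes> t \<in> A" .
      have py: "t [^] (p * y) \<in> A" unfolding nat_pow_pow[OF t(1), symmetric] by (rule subgroup_nat_pow_closed[OF A(1) t(2)])
      have "t = inv (t [^] (p * y)) \<otimes> (t [^] (p * y) \<otimes> t)" using t(1) by (simp add: m_assoc[symmetric])
      also have "\<dots> \<in> A" by (rule A.m_closed[OF A.m_inv_closed[OF py] ty])
      finally show False using tA by simp
    qed
    have small: "\<exists>i<p. \<exists>h\<in>A. g = t [^] i \<otimes> h" if "g \<in> carrier G" for g
      using reduce_cyclic_cover[OF A(1) t p0] cover that by blast
    have le: "i = j" if ij: "i \<le> j" "j < p" "x \<in> A" "y \<in> A" "t [^] i \<otimes> x = t [^] j \<otimes> y" for i j :: nat and x y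
    proof -
      have xyG: "x \<in> carrier G" "y \<in> carrier G" using ij A.mem_carrier by auto
      have "t [^] j = t [^] i \<otimes> t [^] (j - i)" using t(1) ij(1) by (simp add: nat_pow_mult)
      then have "t [^] i \<otimes> x = t [^] i \<otimes> (t [^] (j - i) \<otimes> y)" using ij(5) t(1) xyG by (simp add: m_assoc)
      then have "x = t [^] (j - i) \<otimes> y" using t(1) xyG by simp
      then have "t [^] (j - i) = x \<otimes> inv y" using t(1) xyG by (simp add: m_assoc)
      also have "\<dots> \<in> A" using ij(3,4) by simp
      finally have "j - i = 0" using ij(2) by (intro pow_notin) auto
      then show ?thesis using ij(1) by simp
    qed
    have "inj_on (\<lambda>(i, x). t [^] i \<otimes> x) ({..<p} \<times> A)"
    proof (rule inj_onI)
      fix u v assume u: "u \<in> {..<p} \<times> A" and v: "v \<in> {..<p} \<times> A"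
        and eq: "(\<lambda>(i, x). t [^] i \<otimes> x) u = (\<lambda>(i, x). t [^] i \<otimes> x) v"
      obtain i x j y where uv: "u = (i, x)" "v = (j, y)" by (meson surj_pair)
      have ij: "i < p" "j < p" "x \<in> A" "y \<in> A" "t [^] i \<otimes> x = t [^] j \<otimes> y" using u v eq by (auto simp: uv)
      have "i = j" using le[OF _ ij(2,3,4,5)] le[OF _ ij(1,4,3) ij(5)[symmetric]] by (cases "i \<le> j") auto
      then show "u = v" using ij A.mem_carrier t(1) by (simp add: uv)
    qed
    moreover have "(\<lambda>(i, x). t [^] i \<otimes> x) ` ({..<p} \<times> A) = carrier G"
    proof (intro equalityI subsetI)
      fix g assume "g \<in> (\<lambda>(i, x). t [^] i \<otimes> x) ` ({..<p} \<times> A)"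
      then show "g \<in> carrier G" using t(1) A.mem_carrier by auto
    next
      fix g assume "g \<in> carrier G"
      then obtain i x where "i < p" "x \<in> A" "g = t [^] i \<otimes> x" using small by blast
      then show "g \<in> (\<lambda>(i, x). t [^] i \<otimes> x) ` ({..<p} \<times> A)" by (intro image_eqI[of _ _ "(i, x)"]) auto
    qed
    ultimately have "Coset.order G = card ({..<p} \<times> A)" unfolding Coset.order_def by (metis card_image)
    then have card: "card A * p = Coset.order G" by (simp add: card_cartesian_product mult.commute)
    interpret E: abelian_extension G \<rho> K var A t p
      by (intro abelian_extension.intro abelian_extension_axioms.intro regular_action_axioms)
        (use A t small card in blast)+
    have "p ^ e = p * p ^ (e - 1)" using e0 by (simp add: power_eq_if)
    then show ?thesis by (rule E.few_generators_index_p[OF p q(1,2) _ q0 q(3)])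
  qed (rule tA_abelian)
qed

end

section \<open>The Noether action\<close>

lemma permute_mpoly_comp:
  assumes "bij \<pi>" "bij \<sigma>"
  shows "permute_mpoly (\<pi> \<circ> \<sigma>) P = permute_mpoly \<pi> (permute_mpoly \<sigma> P)"
proof (rule poly_mapping_eqI)
  fix m :: "'a monom"
  have "Poly_Mapping.map_key (\<pi> \<circ> \<sigma>) m = Poly_Mapping.map_key \<sigma> (Poly_Mapping.map_key \<pi> m)"
    using assms by (intro poly_mapping_eqI) (simp add: map_key.rep_eq bij_is_inj bij_comp)
  then show "Poly_Mapping.lookup (permute_mpoly (\<pi> \<circ> \<sigma>) P) m =
      Poly_Mapping.lookup (permute_mpoly \<pi> (permute_mpoly \<sigma> P)) m"
    using assms by (simp add: lookup_permute_mpoly bij_comp)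
qed

lemma permute_mpoly_id: "permute_mpoly id P = (P :: ('a, 'k::zero) mpoly)"
proof (rule poly_mapping_eqI)
  fix m :: "'a monom"
  have "Poly_Mapping.map_key id m = m" by (rule poly_mapping_eqI) (simp add: map_key.rep_eq)
  then show "Poly_Mapping.lookup (permute_mpoly id P) m = Poly_Mapping.lookup P m"
    by (simp add: lookup_permute_mpoly)
qed

lemma permute_ratfun_comp:
  assumes "bij \<pi>" "bij \<sigma>"
  shows "permute_ratfun (\<pi> \<circ> \<sigma>) f = permute_ratfun \<pi> (permute_ratfun \<sigma> f)"
proof (cases f)
  case (Fract a b)
  have "map_var (\<pi> \<circ> \<sigma>) = map_var \<pi> \<circ> map_var \<sigma>" by (simp add: fun_eq_iff var.map_comp)
  then show ?thesis using Fract assms by (simp add: permute_ratfun_Fract permute_mpoly_comp bij_comp)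
qed

lemma permute_ratfun_id: "permute_ratfun id f = (f :: ('v, 'k::field) ratfun)"
proof (cases f)
  case (Fract a b)
  have "map_var id = (id :: 'v var \<Rightarrow> 'v var)" by (simp add: fun_eq_iff var.map_id)
  then show ?thesis using Fract by (simp add: permute_ratfun_Fract permute_mpoly_id)
qed

text \<open>\<open>left_mult\<close> is the identity off the carrier, so left translations are
  permutations of the whole index type and their composition law passes to rational
  functions.\<close>

lemma (in group) regular_action_noether:
  assumes "finite (carrier G)"
  shows "regular_action G (noether_act G) (base_field :: ('a, 'k::field) ratfun set) ratfun_var"
proof
  show "finite (carrier G)" by (rule assms)
  show "is_subfield (base_field :: ('a, 'k) ratfun set)" by (rule is_subfield_base_field)
  fix g assume g: "g \<in> carrier G"
  note bg = bij_left_mult[OF g]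
  fix x y :: "('a, 'k) ratfun"
  show "noether_act G g (x + y) = noether_act G g x + noether_act G g y"
    by (simp add: noether_act_def permute_ratfun_add[OF bg])
  show "noether_act G g (x * y) = noether_act G g x * noether_act G g y"
    by (simp add: noether_act_def permute_ratfun_mult[OF bg])
  show "noether_act G g k = k" if "k \<in> base_field" for k :: "('a, 'k) ratfun"
    using that by (auto simp: noether_act_def permute_ratfun_const[OF bg])
  fix h assume h: "h \<in> carrier G"
  have "left_mult G (g \<otimes> h) = left_mult G g \<circ> left_mult G h"
    using g h by (auto simp: left_mult_def fun_eq_iff m_assoc)
  then show "noether_act G (g \<otimes> h) x = noether_act G g (noether_act G h x)"
    unfolding noether_act_def by (simp add: permute_ratfun_comp[OF bg bij_left_mult[OF h]])
  show "noether_act G g (ratfun_var h :: ('a, 'k) ratfun) = ratfun_var (g \<otimes> h)"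
    by (rule noether_act_var[OF g h])
next
  fix x :: "('a, 'k) ratfun"
  have "left_mult G \<one> = id" by (simp add: left_mult_def fun_eq_iff)
  then show "noether_act G \<one> x = x" by (simp add: noether_act_def permute_ratfun_id)
next
  show "inj_on (ratfun_var :: 'a \<Rightarrow> ('a, 'k) ratfun) (carrier G)" using inj_ratfun_var by (rule inj_on_subset) simp
  show "independent_over (base_field :: ('a, 'k) ratfun set) (ratfun_var ` carrier G)"
    by (rule independent_over_if_algebraically_independent[OF is_subfield_base_field algebraically_independent_ratfun_var])
qed

lemma (in group) pow_group_exponent:
  assumes "finite (carrier G)" "x \<in> carrier G"
  shows "x [^] group_exponent G = \<one>"
proof -
  have "0 < Coset.order G \<and> (\<forall>x\<in>carrier G. x [^] Coset.order G = \<one>)"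
    using assms(1) by (simp add: order_gt_0_iff_finite pow_order_eq_1)
  from LeastI[where P = "\<lambda>n. 0 < n \<and> (\<forall>x\<in>carrier G. x [^] n = \<one>)", OF this]
  show ?thesis using assms(2) unfolding group_exponent_def by blast
qed

lemma primitive_root_of_unity_ratfun_const:
  assumes "primitive_root_of_unity n \<zeta>"
  shows "primitive_root_of_unity n (ratfun_const \<zeta> :: ('v, 'k::field) ratfun)"
proof -
  have "ratfun_const \<zeta> ^ m = (1 :: ('v, 'k) ratfun) \<longleftrightarrow> \<zeta> ^ m = 1" for m
    using ratfun_const_eq_0[of "\<zeta> ^ m - 1", where 'v = 'v] by (simp add: ratfun_const_diff ratfun_const_power ratfun_const_hom(4))
  then show ?thesis using assms by (simp add: primitive_root_of_unity_def)
qed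

theorem (in group) noether_field_rational:
  assumes p: "Factorial_Ring.prime p" "odd p" and order: "Coset.order G = p ^ 5"
    and family: "in_Phi1 G \<or> in_Phi2 p G \<or> in_Phi3 p G \<or> in_Phi4 p G \<or> in_Phi8 p G \<or> in_Phi9 p G"
    and exp: "group_exponent G = p ^ e"
    and field: "CHAR('k::field) = p \<or>
      (CHAR('k) \<noteq> p \<and> (\<exists>\<zeta>::'k. primitive_root_of_unity (p ^ e) \<zeta>))"
  shows "rational_over base_field (noether_field G :: ('a, 'k) ratfun set)"
proof -
  have p0: "p > 0" using p(1) prime_gt_0_nat by blast
  have fin: "finite (carrier G)" using order p0 order_gt_0_iff_finite by simp
  interpret R: regular_action G "noether_act G" "base_field :: ('a, 'k) ratfun set" ratfun_var
    by (rule regular_action_noether[OF fin])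
  have fixed: "noether_field G = R.fixed_by (carrier G) R.L"
    by (auto simp: noether_field_def R.fixed_by_def R.L_def)
  have exponent: "g [^] (p ^ e) = \<one>" if "g \<in> carrier G" for g
    using pow_group_exponent[OF fin that] exp by simp
  have "R.few_generators"
  proof (cases "CHAR('k) = p")
    case True
    then have "of_nat p = (0::'k)" by (metis of_nat_CHAR)
    then have "of_nat p = (0 :: ('a, 'k) ratfun)" by (metis ratfun_const_of_nat ratfun_const_hom(3))
    then show ?thesis by (rule R.few_generators_char_p[OF p(1) _ order])
  next
    case False
    obtain \<zeta>' :: 'k where "primitive_root_of_unity (p ^ e) \<zeta>'" using field False by blast
    define \<zeta> :: "('a, 'k) ratfun" where "\<zeta> = ratfun_const \<zeta>'"
    have \<zeta>: "primitive_root_of_unity (p ^ e) \<zeta>" "\<zeta> \<in> base_field"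
      using primitive_root_of_unity_ratfun_const \<open>primitive_root_of_unity (p ^ e) \<zeta>'\<close> by (auto simp: \<zeta>_def)
    \<comment> \<open>A characteristic is never \<open>1\<close>, so one that divides the prime
      \<open>p\<close> would have to be \<open>p\<close>.\<close>
    have "\<not> CHAR('k) dvd p" using False p(1) CHAR_not_1[where 'a = 'k] by (auto simp: prime_nat_iff)
    then have "of_nat p \<noteq> (0::'k)" by (simp add: of_nat_eq_0_iff_char_dvd)
    then have np: "of_nat p \<noteq> (0 :: ('a, 'k) ratfun)" by (metis ratfun_const_of_nat ratfun_const_eq_0)
    then have npe: "of_nat (p ^ e) \<noteq> (0 :: ('a, 'k) ratfun)" by (simp add: of_nat_power)
    have by_cyclic: R.few_generators if "abelian_by_cyclic G p"
      by (rule R.few_generators_abelian_by_cyclic[OF that p(1) order np \<zeta> exponent])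
    have transfer: "abelian_by_cyclic G p"
      if P: "group P \<and> abelian_by_cyclic P p" "isoclinic G P" for P :: "gen gword set monoid"
    proof -
      obtain \<theta> \<phi> where "isoclinism G P \<theta> \<phi>" using isoclinic_imp_isoclinism[OF group_axioms] P by blast
      then show ?thesis using isoclinism.abelian_by_cyclic_transfer P by blast
    qed
    consider (1) "in_Phi1 G" | (2) "in_Phi2 p G" | (3) "in_Phi3 p G" | (4) "in_Phi4 p G"
      | (8) "in_Phi8 p G" | (9) "in_Phi9 p G" using family by blast
    then show ?thesis
    proof cases
      case 1
      then interpret comm_group G by (simp add: in_Phi1_def)
      show ?thesis by (rule R.few_generators_abelian[OF m_comm exponent npe \<zeta>])
    next
      case 2
      then show ?thesis using by_cyclic[OF transfer[OF abelian_by_cyclic_phi2[OF p0]]] by (simp add: in_Phi2_def)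
    next
      case 3
      then show ?thesis using by_cyclic[OF transfer[OF abelian_by_cyclic_phi3[OF p0]]] by (simp add: in_Phi3_def)
    next
      case 4
      then show ?thesis using by_cyclic[OF transfer[OF abelian_by_cyclic_phi4[OF p0]]] by (simp add: in_Phi4_def)
    next
      case 9
      then show ?thesis using by_cyclic[OF transfer[OF abelian_by_cyclic_phi9[OF p0]]] by (simp add: in_Phi9_def)
    next
      case 8
      let ?P = "phi8_group p"
      have gP: "group ?P" unfolding phi8_group_def by (rule group_presented_group)
      obtain a b where ab: "a \<in> carrier ?P" "b \<in> carrier ?P" "commutator ?P a b = a [^]\<^bsub>?P\<^esub> p"
        "a [^]\<^bsub>?P\<^esub> (p ^ 3) = \<one>\<^bsub>?P\<^esub>" "b [^]\<^bsub>?P\<^esub> (p\<^sup>2) = \<one>\<^bsub>?P\<^esub>" "carrier ?P \<subseteq> generate ?P {a, b}"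
        using phi8_group_generators by blast
      have iso: "isoclinic G ?P" using 8 by (simp add: in_Phi8_def)
      show ?thesis
      \<comment> \<open>Whether \<open>a\<close> has order \<open>p ^ 3\<close> in the presented
        group is left open: a smaller order would make that group abelian-by-cyclic, which is
        covered already.\<close>
      proof (cases "a [^]\<^bsub>?P\<^esub> (p\<^sup>2) = \<one>\<^bsub>?P\<^esub>")
        case True
        have "abelian_by_cyclic ?P p"
          by (rule group.phi8_abelian_by_cyclic[OF gP ab(1,2,3) p0 True ab(5,6)])
        then show ?thesis using by_cyclic transfer gP iso by blast
      next
        case False
        obtain \<theta> \<phi> where "isoclinism G ?P \<theta> \<phi>" using isoclinic_imp_isoclinism[OF group_axioms gP iso] by blast
        from isoclinism.phi8_structure[OF this p order ab(1-5) False ab(6)]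
        obtain g t l where g: "g \<in> carrier G" and t: "t \<in> carrier G" and gp: "g [^] (p ^ 3) = \<one>"
          and card: "card ((\<lambda>k. g [^] k) ` {..<p ^ 3}) = p ^ 3"
          and conj: "inv t \<otimes> g \<otimes> t = g [^] (1 + p * (1 + p * l))"
          and tp: "t [^] (p\<^sup>2) \<in> (\<lambda>k. g [^] k) ` {..<p ^ 3}"
          and cover: "\<forall>x\<in>carrier G. \<exists>i<p\<^sup>2. \<exists>h\<in>(\<lambda>k. g [^] k) ` {..<p ^ 3}. x = t [^] i \<otimes> h"
          and normal: "\<forall>x\<in>carrier G. \<forall>h\<in>(\<lambda>k. g [^] k) ` {..<p ^ 3}. x \<otimes> h \<otimes> inv x \<in> (\<lambda>k. g [^] k) ` {..<p ^ 3}"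
          by blast
        define H where "H = (\<lambda>k::nat. g [^] k) ` {..<p ^ 3}"
        have ppp0: "0 < p ^ 3" using p0 by simp
        have H: "subgroup H G" unfolding H_def by (rule subgroup_nat_powers[OF g ppp0 gp])
        have H_comm: "x \<otimes> y = y \<otimes> x" if "x \<in> H" "y \<in> H" for x y
          using that g by (auto simp: H_def nat_pow_mult add.commute)
        have card_H: "card H * p\<^sup>2 = Coset.order G" using card order by (simp add: H_def flip: power_add)
        interpret E: abelian_extension G "noether_act G" "base_field :: ('a, 'k) ratfun set" ratfun_var H t "p\<^sup>2"
          by (intro abelian_extension.intro abelian_extension_axioms.intro R.regular_action_axioms)
            (use H H_comm card_H t tp cover normal in \<open>unfold H_def, blast+\<close>)
        have gH: "g \<in> H"
        proof -
          have "1 < p ^ 3" using one_less_power[of p 3] prime_gt_1_nat[OF p(1)] by simp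
          then show ?thesis unfolding H_def using g by (intro image_eqI[of _ _ 1]) auto
        qed
        \<comment> \<open>\<open>g\<close> has \<open>p ^ 3\<close> distinct powers, so the exponent
          is at least \<open>p ^ 3\<close> and the base field contains the roots of unity of that
          order.\<close>
        have "3 \<le> e"
        proof (rule ccontr)
          assume "\<not> 3 \<le> e"
          then have "p ^ e < p ^ 3" using prime_gt_1_nat[OF p(1)] by simp
          moreover have "inj_on (\<lambda>k::nat. g [^] k) {..<p ^ 3}" using card by (intro eq_card_imp_inj_on) auto
          moreover have "g [^] (p ^ e) = g [^] (0::nat)" using exponent[OF g] by simp
          ultimately have "p ^ e = 0" using ppp0 by (metis inj_onD lessThan_iff)
          then show False using p0 by simp
        qed
        then have pe: "p ^ e = p ^ (e - 3) * p ^ 3" by (simp flip: power_add)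
        have "card H = p ^ 3" using card by (simp add: H_def)
        then show ?thesis by (rule E.few_generators_phi8[OF p np HOL.refl gH H_def _ gp conj \<zeta> pe exponent])
      qed
    qed
  qed
  from R.rational_if_few_generators[OF this] show ?thesis
    unfolding rational_over_def fixed by blast
qed

theorem theorem1p10:
  fixes G :: "('a, 'b) monoid_scheme" and p e :: nat
  assumes "Factorial_Ring.prime p" and "odd p"
    and "group G" and "Coset.order G = p ^ 5"
    and "in_Phi1 G \<or> in_Phi2 p G \<or> in_Phi3 p G \<or> in_Phi4 p G \<or> in_Phi8 p G \<or> in_Phi9 p G"
    and "group_exponent G = p ^ e"
    and "CHAR('k::field) = p \<or>
      (CHAR('k) \<noteq> p \<and> (\<exists>\<zeta>::'k. primitive_root_of_unity (p ^ e) \<zeta>))"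
  shows "rational_over base_field (noether_field G :: ('a, 'k) ratfun set)"
  using group.noether_field_rational[OF assms(3,1,2,4-7)] .

end
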